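(* Let $M$ and $N$ be atomic JBW-algebras with units $e_M$ and $e_N$, and let $f\colon [0,e_M]\to[0,e_N]$ be an order isomorphism. For $x\in[0,e_M]$ write $x=(x_p)_{p\in\mathcal{D}_M}\times x_E$ according to the decomposition $[0,e_M]=[0,1]^{\mathcal{D}_M}\times[0,e_{M_E}]$, and similarly for $N$. (i) There exists an index set $I$ such that $M_E$ decomposes as a direct sum of factors $\bigoplus_{i\in I}M_i$ and $N_E$ decomposes as a direct sum of factors $\bigoplus_{i\in I}N_i$, and, writing $x_E=(x_i)_{i\in I}$, $$f(x)=(f_p(x_p))_{\sigma(p)\in\mathcal{D}_N}\times\prod_{i\in I}\varphi_{t_i}\left(U_{(z_i^2+e_{N_i})^{1/2}}\left(e_{N_i}-(e_{N_i}+U_{z_i^{-1}}J_ix_i)^{-1}\right)\right)\qquad (x\in[0,e_M])$$ for some $t_i<1$, $z_i\in(N_i)_+^\circ$ and Jordan isomorphisms $J_i\colon M_i\to N_i$ ($i\in I$), a bijection $\sigma\colon\mathcal{D}_M\to\mathcal{D}_N$, and order isomorphisms $f_p\colon[0,1]\to[0,1]$ ($p\in\mathcal{D}_M$). (ii) If $M_E$ is a finite direct sum of factors, then $$f(x)=(f_p(x_p))_{\sigma(p)\in\mathcal{D}_N}\times\varphi_t\left(U_{(z^2+e_{N_E})^{1/2}}\left(e_{N_E}-(e_{N_E}+U_{z^{-1}}Jx_E)^{-1}\right)\right)\qquad (x\in[0,e_M])$$ for some $t<1$, $z\in(N_E)_+^\circ$, a bijection $\sigma\colon\mathcal{D}_M\to\mathcal{D}_N$,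 order isomorphisms $f_p\colon[0,1]\to[0,1]$ ($p\in\mathcal{D}_M$), and some Jordan isomorphism $J\colon M_E\to N_E$. (iii) If $M_E$ is a finite direct sum of factors and $M_D=\{0\}$, then $$f(x)=\varphi_t\left(U_{(z^2+e_N)^{1/2}}\left(e_N-(e_N+U_{z^{-1}}Jx)^{-1}\right)\right)\qquad (x\in[0,e_M])$$ for some $t<1$, $z\in N_+^\circ$, and some Jordan isomorphism $J\colon M\to N$.
   Context: A JB-algebra is a real Banach space $A$ with a commutative bilinear product $\circ$ satisfying $x\circ(y\circ x^2)=(x\circ y)\circ x^2$, $\|x\circ y\|\le\|x\|\|y\|$, $\|x^2\|=\|x\|^2$ and $\|x^2\|\le\|x^2+y^2\|$ for all $x,y\in A$. A JBW-algebra is a JB-algebra that is a dual Banach space; it has a unit, denoted $e$ (with a subscript indicating the algebra). $A_+$ denotes the cone of squares (equivalently, the elements with non-negative spectrum), and $x\le y$ means $y-x\in A_+$; $A_+^\circ$ is the interior of $A_+$ (the elements with strictly positive spectrum). $[x,y]=\{w: x\le w\le y\}$. In a unital JB-algebra, an element $x$ is invertible if it is invertible in the JB-subalgebra generated by $x$ and $e$, which is isomorphic to $C(\sigma(x))$; $x^{-1}$, $x^{1/2}$ etc. are defined by the continuous functional calculus there. The quadratic representation of $x$ is $U_xy=2x\circ(x\circ y)-x^2\circ y$. An order isomorphism is a bijection $f$ with $x\le y\iff f(x)\le f(y)$. A Jordan isomorphism is a linear bijection preserving $\circ$. Elements $x,y$ operator commute if $x\circ(y\circ w)=y\circ(x\circ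 w)$ for all $w$; the centre $Z(M)$ is the set of elements operator commuting with all elements of $M$, and a factor is a JBW-algebra with trivial centre $\mathbb{R}e$. A projection is an element $p$ with $p^2=p$; an atom is a minimal non-zero projection; $M$ is atomic if every non-zero projection dominates an atom. Direct sums are $\ell^\infty$-direct sums with coordinatewise operations. $\mathcal{D}_M$ denotes the set of central atoms of $M$ (atoms lying in $Z(M)$). Let $p_0$ be the supremum of $\mathcal{D}_M$ in the lattice of projections; it is a central projection. The disengaged part of $M$ is $M_D=U_{p_0}(M)$ and the engaged part is $M_E=U_{e-p_0}(M)$, so $M=M_D\oplus M_E$, $M_D=\bigoplus_{p\in\mathcal{D}_M}\mathbb{R}p\cong\ell_\infty(\mathcal{D}_M,\mathbb{R})$, and $M_E$ has no central atoms. This identifies $[0,e_M]$ with $[0,1]^{\mathcal{D}_M}\times[0,e_{M_E}]$, where $[0,1]\subseteq\mathbb{R}$. The notation $(f_p(x_p))_{\sigma(p)\in\mathcal{D}_N}$ means the element of $[0,1]^{\mathcal{D}_N}$ whose $\sigma(p)$-coordinate is $f_p(x_p)$. For $t<1$ and a unital JB-algebra $A$ with unit $e$, $\varphi_t\colon[0,e]\to[0,e]$ is defined by $\varphi_t(x)=x\circ(tx+(1-t)e)^{-1}$; in the formulas $\varphi_{t_i}$ acts on $[0,e_{N_i}]$, and $\varphi_t$ acts on $[0,e_{N_E}]$ in (ii) and on $[0,e_N]$ in (iii). *)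

theory Defs
  imports "HOL-Analysis.Analysis"
begin

class jb_algebra = banach +
  fixes jprod :: "'a \<Rightarrow> 'a \<Rightarrow> 'a"  (infixl "\<circ>\<^sub>J" 70)
  assumes jprod_commute: "x \<circ>\<^sub>J y = y \<circ>\<^sub>J x"
    and jprod_add_left: "(x + y) \<circ>\<^sub>J w = x \<circ>\<^sub>J w + y \<circ>\<^sub>J w"
    and jprod_scaleR_left: "(r *\<^sub>R x) \<circ>\<^sub>J y = r *\<^sub>R (x \<circ>\<^sub>J y)"
    and jordan_identity: "x \<circ>\<^sub>J (y \<circ>\<^sub>J (x \<circ>\<^sub>J x)) = (x \<circ>\<^sub>J y) \<circ>\<^sub>J (x \<circ>\<^sub>J x)"
    and norm_jprod_le: "norm (x \<circ>\<^sub>J y) \<le> norm x * norm y"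
    and norm_jsquare: "norm (x \<circ>\<^sub>J x) = (norm x)\<^sup>2"
    and norm_jsquare_le: "norm (x \<circ>\<^sub>J x) \<le> norm (x \<circ>\<^sub>J x + y \<circ>\<^sub>J y)"

text \<open>
  The algebras occurring below are carrier sets: norm-closed subalgebras \<open>S\<close> of a type
  of class \<open>jb_algebra\<close> (possibly the whole type). Each of them is a JB-algebra in its own right,
  and all notions are relative to \<open>S\<close>; in particular its unit, if any, need not be
  a unit of the surrounding type.
\<close>

definition jb_subalgebra :: "'a::jb_algebra set \<Rightarrow> bool" where
  "jb_subalgebra S \<longleftrightarrow> subspace S \<and> closed S \<and> (\<forall>x\<in>S. \<forall>y\<in>S. x \<circ>\<^sub>J y \<in> S)"

definition is_jb_unit :: "'a::jb_algebra set \<Rightarrow> 'a \<Rightarrow> bool" where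
  "is_jb_unit S u \<longleftrightarrow> u \<in> S \<and> (\<forall>x\<in>S. u \<circ>\<^sub>J x = x)"

definition jb_unit :: "'a::jb_algebra set \<Rightarrow> 'a" where
  "jb_unit S = (THE u. is_jb_unit S u)"

subsection \<open>Dual Banach spaces\<close>

definition banach_function_space :: "('b \<Rightarrow> real) set \<Rightarrow> (('b \<Rightarrow> real) \<Rightarrow> real) \<Rightarrow> bool" where
  "banach_function_space V n \<longleftrightarrow>
     (\<lambda>b. 0) \<in> V \<and>
     (\<forall>g\<in>V. \<forall>h\<in>V. (\<lambda>b. g b + h b) \<in> V) \<and>
     (\<forall>r. \<forall>g\<in>V. (\<lambda>b. r * g b) \<in> V) \<and>
     (\<forall>g\<in>V. 0 \<le> n g \<and> (n g = 0 \<longleftrightarrow> g = (\<lambda>b. 0))) \<and>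
     (\<forall>r. \<forall>g\<in>V. n (\<lambda>b. r * g b) = \<bar>r\<bar> * n g) \<and>
     (\<forall>g\<in>V. \<forall>h\<in>V. n (\<lambda>b. g b + h b) \<le> n g + n h) \<and>
     (\<forall>X :: nat \<Rightarrow> 'b \<Rightarrow> real.
        (\<forall>k. X k \<in> V) \<and> (\<forall>\<epsilon>>0. \<exists>K. \<forall>k\<ge>K. \<forall>l\<ge>K. n (\<lambda>b. X k b - X l b) < \<epsilon>) \<longrightarrow>
        (\<exists>g\<in>V. (\<lambda>k. n (\<lambda>b. X k b - g b)) \<longlonglongrightarrow> 0))"

definition dual_functionals ::
    "('b \<Rightarrow> real) set \<Rightarrow> (('b \<Rightarrow> real) \<Rightarrow> real) \<Rightarrow> (('b \<Rightarrow> real) \<Rightarrow> real) set" where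
  "dual_functionals V n =
     {\<Lambda> \<in> extensional V.
        (\<forall>g\<in>V. \<forall>h\<in>V. \<Lambda> (\<lambda>b. g b + h b) = \<Lambda> g + \<Lambda> h) \<and>
        (\<forall>r. \<forall>g\<in>V. \<Lambda> (\<lambda>b. r * g b) = r * \<Lambda> g) \<and>
        (\<exists>C. \<forall>g\<in>V. \<bar>\<Lambda> g\<bar> \<le> C * n g)}"

definition dual_norm ::
    "('b \<Rightarrow> real) set \<Rightarrow> (('b \<Rightarrow> real) \<Rightarrow> real) \<Rightarrow> (('b \<Rightarrow> real) \<Rightarrow> real) \<Rightarrow> real" where
  "dual_norm V n \<Lambda> = (SUP g\<in>{g\<in>V. n g \<le> 1}. \<bar>\<Lambda> g\<bar>)"

text \<open>
  \<open>S\<close> is isometrically isomorphic to the dual of some Banach space \<open>(V, n)\<close>. Letting \<open>V\<close> range over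
  spaces of real functions on \<open>'a\<close> with pointwise operations and an arbitrary complete norm is no
  restriction: a predual of \<open>S\<close> embeds in the dual of \<open>S\<close>, whose elements become functions
  on \<open>'a\<close> when extended by 0.
\<close>

definition dual_banach_space :: "'a::real_normed_vector set \<Rightarrow> bool" where
  "dual_banach_space S \<longleftrightarrow>
     (\<exists>(V :: ('a \<Rightarrow> real) set) n \<Phi>.
        banach_function_space V n \<and>
        bij_betw \<Phi> S (dual_functionals V n) \<and>
        (\<forall>x\<in>S. \<forall>y\<in>S. \<forall>g\<in>V. \<Phi> (x + y) g = \<Phi> x g + \<Phi> y g) \<and>
        (\<forall>r. \<forall>x\<in>S. \<forall>g\<in>V. \<Phi> (r *\<^sub>R x) g = r * \<Phi> x g) \<and>
        (\<forall>x\<in>S. dual_norm V n (\<Phi> x) = norm x))"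

definition jbw_algebra :: "'a::jb_algebra set \<Rightarrow> bool" where
  "jbw_algebra S \<longleftrightarrow> jb_subalgebra S \<and> dual_banach_space S"

subsection \<open>Order\<close>

definition jb_cone :: "'a::jb_algebra set \<Rightarrow> 'a set" where
  "jb_cone S = {x \<circ>\<^sub>J x | x. x \<in> S}"

definition jb_le :: "'a::jb_algebra set \<Rightarrow> 'a \<Rightarrow> 'a \<Rightarrow> bool" where
  "jb_le S x y \<longleftrightarrow> y - x \<in> jb_cone S"

definition jb_cone_interior :: "'a::jb_algebra set \<Rightarrow> 'a set" where
  "jb_cone_interior S = (top_of_set S) interior_of (jb_cone S)"

definition jb_interval :: "'a::jb_algebra set \<Rightarrow> 'a \<Rightarrow> 'a \<Rightarrow> 'a set" where
  "jb_interval S x y = {w \<in> S. jb_le S x w \<and> jb_le S w y}"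

definition order_isomorphism ::
    "'a set \<Rightarrow> ('a \<Rightarrow> 'a \<Rightarrow> bool) \<Rightarrow> 'b set \<Rightarrow> ('b \<Rightarrow> 'b \<Rightarrow> bool) \<Rightarrow> ('a \<Rightarrow> 'b) \<Rightarrow> bool" where
  "order_isomorphism A le B le' f \<longleftrightarrow>
     bij_betw f A B \<and> (\<forall>x\<in>A. \<forall>y\<in>A. le x y \<longleftrightarrow> le' (f x) (f y))"

definition jordan_isomorphism ::
    "'a::jb_algebra set \<Rightarrow> 'b::jb_algebra set \<Rightarrow> ('a \<Rightarrow> 'b) \<Rightarrow> bool" where
  "jordan_isomorphism S T J \<longleftrightarrow>
     bij_betw J S T \<and>
     (\<forall>x\<in>S. \<forall>y\<in>S. J (x + y) = J x + J y) \<and>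
     (\<forall>r. \<forall>x\<in>S. J (r *\<^sub>R x) = r *\<^sub>R J x) \<and>
     (\<forall>x\<in>S. \<forall>y\<in>S. J (x \<circ>\<^sub>J y) = J x \<circ>\<^sub>J J y)"

subsection \<open>Functional calculus\<close>

text \<open>Here \<open>u\<close> is the unit of the algebra under consideration and \<open>x\<close> one of its elements.\<close>

definition jb_generated :: "'a::jb_algebra \<Rightarrow> 'a \<Rightarrow> 'a set" where
  "jb_generated u x = \<Inter>{T. jb_subalgebra T \<and> u \<in> T \<and> x \<in> T}"

definition jb_invertible :: "'a::jb_algebra \<Rightarrow> 'a \<Rightarrow> bool" where
  "jb_invertible u x \<longleftrightarrow> (\<exists>y\<in>jb_generated u x. x \<circ>\<^sub>J y = u)"

definition jb_spectrum :: "'a::jb_algebra \<Rightarrow> 'a \<Rightarrow> real set" where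
  "jb_spectrum u x = {s. \<not> jb_invertible u (x - s *\<^sub>R u)}"

text \<open>
  \<open>\<Phi>\<close> induces the isometric isomorphism of \<open>C(\<sigma>(x))\<close> onto the algebra generated by \<open>x\<close> and \<open>u\<close>
  that maps the identity function to \<open>x\<close>. The supremum norm is described by its upper bounds, so that
  the empty spectrum of the zero algebra is covered.
\<close>

definition is_functional_calculus :: "'a::jb_algebra \<Rightarrow> 'a \<Rightarrow> ((real \<Rightarrow> real) \<Rightarrow> 'a) \<Rightarrow> bool" where
  "is_functional_calculus u x \<Phi> \<longleftrightarrow>
     (let K = jb_spectrum u x; C = {g. continuous_on K g} in
        \<Phi> ` C = jb_generated u x \<and>
        \<Phi> (\<lambda>s. 1) = u \<and> \<Phi> (\<lambda>s. s) = x \<and>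
        (\<forall>g\<in>C. \<forall>h\<in>C. \<Phi> (\<lambda>s. g s + h s) = \<Phi> g + \<Phi> h) \<and>
        (\<forall>r. \<forall>g\<in>C. \<Phi> (\<lambda>s. r * g s) = r *\<^sub>R \<Phi> g) \<and>
        (\<forall>g\<in>C. \<forall>h\<in>C. \<Phi> (\<lambda>s. g s * h s) = \<Phi> g \<circ>\<^sub>J \<Phi> h) \<and>
        (\<forall>g\<in>C. \<forall>B\<ge>0. norm (\<Phi> g) \<le> B \<longleftrightarrow> (\<forall>s\<in>K. \<bar>g s\<bar> \<le> B)))"

text \<open>Meaningful when \<open>g\<close> is continuous on the spectrum of \<open>x\<close>.\<close>

definition jb_fun_calc :: "'a::jb_algebra \<Rightarrow> (real \<Rightarrow> real) \<Rightarrow> 'a \<Rightarrow> 'a" where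
  "jb_fun_calc u g x = (THE y. \<exists>\<Phi>. is_functional_calculus u x \<Phi> \<and> y = \<Phi> g)"

definition jb_inverse :: "'a::jb_algebra \<Rightarrow> 'a \<Rightarrow> 'a" where
  "jb_inverse u x = jb_fun_calc u inverse x"

definition jb_sqrt :: "'a::jb_algebra \<Rightarrow> 'a \<Rightarrow> 'a" where
  "jb_sqrt u x = jb_fun_calc u sqrt x"

definition quad_rep :: "'a::jb_algebra \<Rightarrow> 'a \<Rightarrow> 'a" where
  "quad_rep x y = 2 *\<^sub>R (x \<circ>\<^sub>J (x \<circ>\<^sub>J y)) - (x \<circ>\<^sub>J x) \<circ>\<^sub>J y"

definition jb_phi :: "'a::jb_algebra \<Rightarrow> real \<Rightarrow> 'a \<Rightarrow> 'a" where
  "jb_phi u t x = x \<circ>\<^sub>J jb_inverse u (t *\<^sub>R x + (1 - t) *\<^sub>R u)"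

text \<open>
  The map \<open>w \<mapsto> \<phi>\<^sub>t(U\<^sub>v(u - (u + U\<^sub>y w)\<inverse>))\<close> on \<open>[0,u]\<close>, where \<open>v\<close> is the square root
  of \<open>z\<^sup>2 + u\<close> and \<open>y\<close> the inverse of \<open>z\<close>.
\<close>

definition interval_map :: "'a::jb_algebra \<Rightarrow> real \<Rightarrow> 'a \<Rightarrow> 'a \<Rightarrow> 'a" where
  "interval_map u t z w =
     jb_phi u t (quad_rep (jb_sqrt u (z \<circ>\<^sub>J z + u))
       (u - jb_inverse u (u + quad_rep (jb_inverse u z) w)))"

subsection \<open>Centre, factors, atoms\<close>

definition jb_centre :: "'a::jb_algebra set \<Rightarrow> 'a set" where
  "jb_centre S = {x \<in> S. \<forall>y\<in>S. \<forall>w\<in>S. x \<circ>\<^sub>J (y \<circ>\<^sub>J w) = y \<circ>\<^sub>J (x \<circ>\<^sub>J w)}"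

definition jbw_factor :: "'a::jb_algebra set \<Rightarrow> bool" where
  "jbw_factor S \<longleftrightarrow>
     jbw_algebra S \<and> S \<noteq> {0} \<and> jb_centre S = range (\<lambda>r. r *\<^sub>R jb_unit S)"

definition jb_projection :: "'a::jb_algebra set \<Rightarrow> 'a \<Rightarrow> bool" where
  "jb_projection S p \<longleftrightarrow> p \<in> S \<and> p \<circ>\<^sub>J p = p"

definition jb_atom :: "'a::jb_algebra set \<Rightarrow> 'a \<Rightarrow> bool" where
  "jb_atom S p \<longleftrightarrow>
     jb_projection S p \<and> p \<noteq> 0 \<and>
     (\<forall>q. jb_projection S q \<and> q \<noteq> 0 \<and> jb_le S q p \<longrightarrow> q = p)"

definition jb_atomic :: "'a::jb_algebra set \<Rightarrow> bool" where
  "jb_atomic S \<longleftrightarrow>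
     (\<forall>q. jb_projection S q \<and> q \<noteq> 0 \<longrightarrow> (\<exists>p. jb_atom S p \<and> jb_le S p q))"

definition central_atoms :: "'a::jb_algebra set \<Rightarrow> 'a set" where
  "central_atoms S = {p \<in> jb_centre S. jb_atom S p}"

subsection \<open>Disengaged and engaged part\<close>

text \<open>The supremum of the central atoms in the lattice of projections.\<close>

definition disengaged_projection :: "'a::jb_algebra set \<Rightarrow> 'a" where
  "disengaged_projection S =
     (THE p. jb_projection S p \<and> (\<forall>q\<in>central_atoms S. jb_le S q p) \<and>
        (\<forall>r. jb_projection S r \<and> (\<forall>q\<in>central_atoms S. jb_le S q r) \<longrightarrow> jb_le S p r))"

definition engaged_component :: "'a::jb_algebra set \<Rightarrow> 'a \<Rightarrow> 'a" where
  "engaged_component S x = quad_rep (jb_unit S - disengaged_projection S) x"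

definition disengaged_part :: "'a::jb_algebra set \<Rightarrow> 'a set" where
  "disengaged_part S = quad_rep (disengaged_projection S) ` S"

definition engaged_part :: "'a::jb_algebra set \<Rightarrow> 'a set" where
  "engaged_part S = engaged_component S ` S"

text \<open>The coordinate of \<open>x\<close> in the one-dimensional summand spanned by the central atom \<open>p\<close>.\<close>

definition atom_coord :: "'a::jb_algebra \<Rightarrow> 'a \<Rightarrow> real" where
  "atom_coord p x = (THE r. quad_rep p x = r *\<^sub>R p)"

subsection \<open>Direct sums\<close>

text \<open>
  \<open>S\<close> is the internal \<open>\<ell>\<^sup>\<infinity>\<close>-direct sum of the subalgebras \<open>F i\<close>, with coordinate maps \<open>\<pi> i\<close>.
  As above, the supremum norm is described by its upper bounds because the index set may be empty.
\<close>

definition is_direct_sum ::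
    "'a::jb_algebra set \<Rightarrow> 'i set \<Rightarrow> ('i \<Rightarrow> 'a set) \<Rightarrow> ('i \<Rightarrow> 'a \<Rightarrow> 'a) \<Rightarrow> bool" where
  "is_direct_sum S I F \<pi> \<longleftrightarrow>
     (\<forall>i\<in>I. jb_subalgebra (F i) \<and> F i \<subseteq> S) \<and>
     (\<forall>i\<in>I. \<forall>x\<in>F i. \<forall>j\<in>I. \<pi> j x = (if j = i then x else 0)) \<and>
     bij_betw (\<lambda>x. \<lambda>i\<in>I. \<pi> i x) S {y \<in> Pi\<^sub>E I F. bounded (y ` I)} \<and>
     (\<forall>i\<in>I. \<forall>x\<in>S. \<forall>y\<in>S. \<pi> i (x + y) = \<pi> i x + \<pi> i y) \<and>
     (\<forall>i\<in>I. \<forall>r. \<forall>x\<in>S. \<pi> i (r *\<^sub>R x) = r *\<^sub>R \<pi> i x) \<and>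
     (\<forall>i\<in>I. \<forall>x\<in>S. \<forall>y\<in>S. \<pi> i (x \<circ>\<^sub>J y) = \<pi> i x \<circ>\<^sub>J \<pi> i y) \<and>
     (\<forall>x\<in>S. \<forall>B\<ge>0. norm x \<le> B \<longleftrightarrow> (\<forall>i\<in>I. norm (\<pi> i x) \<le> B))"

definition direct_sum_of_factors ::
    "'a::jb_algebra set \<Rightarrow> 'i set \<Rightarrow> ('i \<Rightarrow> 'a set) \<Rightarrow> ('i \<Rightarrow> 'a \<Rightarrow> 'a) \<Rightarrow> bool" where
  "direct_sum_of_factors S I F \<pi> \<longleftrightarrow> is_direct_sum S I F \<pi> \<and> (\<forall>i\<in>I. jbw_factor (F i))"

definition finite_direct_sum_of_factors :: "'a::jb_algebra set \<Rightarrow> bool" where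
  "finite_direct_sum_of_factors S \<longleftrightarrow> (\<exists>(n::nat) F \<pi>. direct_sum_of_factors S {..<n} F \<pi>)"

end

theory Submission
  imports Defs "HOL-Computational_Algebra.Fundamental_Theorem_Algebra"
begin

text \<open>
  An order isomorphism \<open>f\<close> maps atoms to atoms and \<open>l p\<close> to \<open>f\<^sub>p(l) f(p)\<close> for atoms \<open>p\<close> and
  \<open>l \<in> [0,1]\<close>. An atom is central iff it is orthogonal to all others. Non-orthogonality generates an
  equivalence relation on the atoms, preserved by \<open>f\<close>, and the suprema of the classes with more
  than one element are the units of the factors of the engaged part.

  On such a factor let \<open>g(y) = f(y\<inverse>)\<inverse>\<close>, an order isomorphism between the sets of elements above
  the units, and let \<open>\<tau>\<^sub>p(x)\<close> be the coefficient in \<open>U\<^sub>p x = \<tau>\<^sub>p(x) p\<close>. Since \<open>l p \<le> x\<close> iff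
  \<open>l \<tau>\<^sub>p(x\<inverse>) \<le> 1\<close>, one has \<open>\<tau>\<^bsub>f(p)\<^esub>(g(y)) = h\<^sub>p(\<tau>\<^sub>p(y))\<close> with \<open>h\<^sub>p(s) = 1/f\<^sub>p(1/s)\<close>. Comparing
  \<open>h\<^sub>p\<close> and \<open>h\<^sub>q\<close> along the lines \<open>y + s p\<close> and \<open>y + s q\<close> for non-orthogonal atoms \<open>p \<noteq> q\<close> gives a
  functional equation that forces \<open>h\<^sub>p\<close> to be affine. Hence \<open>g(e + v) = e + L v\<close> with a linear order
  isomorphism \<open>L = U\<^sub>w J\<close>, where \<open>w\<^sup>2 = L e\<close>. The unital order isomorphism \<open>J\<close> preserves inverses and
  therefore squares. Rewriting \<open>f(x) = (e + U\<^sub>w((J x)\<inverse> - e))\<inverse>\<close> by means of \<open>t\<close> and \<open>z\<close> gives the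
  formula on invertible \<open>x\<close>, and monotone approximation the general case.
\<close>

text \<open>Inversion turns the invertible part of \<open>[0,e]\<close> into the unbounded set of
  elements above \<open>e\<close>, where half-lines in the direction of an atom never stop; only
  there can values along two lines be compared for all parameters. All such comparisons are between
  real functions, because the coefficients at the atoms determine an element and its order. A
  central atom has no partner to be compared with, so its \<open>f_p\<close> stays arbitrary. The
  obstacle is that \<open>g\<close> exists only if \<open>f\<close> preserves invertibility, which
  has to be read off the order. An invertible element dominates a positive multiple of every atom,
  but the converse requires constants that are uniform over the atoms. A Baire category argument
  supplies them within one class, hence for finitely many classes together. Infinitely many classes
  have to be treated one at a time, each with its own \<open>t\<close> and \<open>z\<close>; this is
  the difference between (i) and (ii). The parameters are not determined by \<open>f\<close>: every
  sufficiently negative \<open>t\<close> is possible, and \<open>z\<close> then depends on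
  \<open>t\<close> and \<open>w\<close>.\<close>

notation jprod (infixl "\<cdot>" 70)

abbreviation "U \<equiv> quad_rep"

section \<open>Jordan identities\<close>

interpretation jprod: bounded_bilinear "jprod :: 'a::jb_algebra \<Rightarrow> 'a \<Rightarrow> 'a"
proof
  fix a a' b b' :: 'a and r :: real
  show "(a + a') \<cdot> b = a \<cdot> b + a' \<cdot> b" by (rule jprod_add_left)
  show "a \<cdot> (b + b') = a \<cdot> b + a \<cdot> b'" by (metis jprod_add_left jprod_commute)
  show "(r *\<^sub>R a) \<cdot> b = r *\<^sub>R (a \<cdot> b)" by (rule jprod_scaleR_left)
  show "a \<cdot> (r *\<^sub>R b) = r *\<^sub>R (a \<cdot> b)" by (metis jprod_scaleR_left jprod_commute)
  show "\<exists>K. \<forall>a b::'a. norm (a \<cdot> b) \<le> norm a * norm b * K" by (intro exI[of _ 1]) (simp add: norm_jprod_le)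
qed

lemmas jbilin = jprod.add_left jprod.add_right jprod.diff_left jprod.diff_right
  jprod.minus_left jprod.minus_right jprod.scaleR_left jprod.scaleR_right

text \<open>Polarisation: the defect \<open>P\<close> of the Jordan identity is cubic in
  \<open>x\<close>, and the alternating sum over partial sums of \<open>a\<close>, \<open>b\<close>,
  \<open>c\<close> keeps its trilinear part, in which commutativity makes every term occur
  twice.\<close>

lemma jordan_linearized:
  fixes a b c z :: "'a::jb_algebra"
  shows "(a \<cdot> b) \<cdot> (c \<cdot> z) + (b \<cdot> c) \<cdot> (a \<cdot> z) + (c \<cdot> a) \<cdot> (b \<cdot> z)
    = c \<cdot> ((a \<cdot> b) \<cdot> z) + a \<cdot> ((b \<cdot> c) \<cdot> z) + b \<cdot> ((c \<cdot> a) \<cdot> z)"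
proof -
  define P where "P x = (x \<cdot> x) \<cdot> (x \<cdot> z) - x \<cdot> ((x \<cdot> x) \<cdot> z)" for x
  have P0: "P x = 0" for x using jordan_identity[of x z] by (simp add: P_def jprod_commute)
  define D where "D = ((a \<cdot> b) \<cdot> (c \<cdot> z) + (b \<cdot> c) \<cdot> (a \<cdot> z) + (c \<cdot> a) \<cdot> (b \<cdot> z))
    - (c \<cdot> ((a \<cdot> b) \<cdot> z) + a \<cdot> ((b \<cdot> c) \<cdot> z) + b \<cdot> ((c \<cdot> a) \<cdot> z))"
  have "P (a + b + c) - P (a + b) - P (b + c) - P (a + c) + P a + P b + P c = D + D"
    unfolding P_def D_def by (simp add: jbilin algebra_simps jprod_commute)
  hence "D + D = 0" by (simp add: P0)
  hence "2 *\<^sub>R D = 0" by (simp add: scaleR_2)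
  thus ?thesis by (simp add: D_def)
qed

section \<open>The Jordan triple product and the fundamental formula\<close>

definition jtriple :: "'a::jb_algebra \<Rightarrow> 'a \<Rightarrow> 'a \<Rightarrow> 'a" where
  "jtriple a b c = (a \<cdot> b) \<cdot> c + a \<cdot> (b \<cdot> c) - b \<cdot> (a \<cdot> c)"

lemma jtriple_commute: "jtriple a b c = jtriple c b a" by (simp add: jtriple_def jprod_commute algebra_simps)

lemma quad_rep_jtriple: "U a b = jtriple a b a" by (simp add: jtriple_def quad_rep_def jprod_commute scaleR_2)

text \<open>Two instances of the polarised identity have the same left side. Equating the right
  sides shows that the commutator of two multiplication operators is a derivation.\<close>

lemma jordan_derivation:
  fixes a b c d :: "'a::jb_algebra"
  shows "a \<cdot> (b \<cdot> (c \<cdot> d)) - b \<cdot> (a \<cdot> (c \<cdot> d))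
    = (a \<cdot> (b \<cdot> c) - b \<cdot> (a \<cdot> c)) \<cdot> d + c \<cdot> (a \<cdot> (b \<cdot> d) - b \<cdot> (a \<cdot> d))"
  using jordan_linearized[of a c d b] jordan_linearized[of b c d a] by (simp add: jbilin jprod_commute algebra_simps)

text \<open>Multiplication operators act on triples with the opposite sign in the middle slot.
  Together with the derivations of \<open>jordan_triple_derivation\<close> they account for all
  operators \<open>{a b .}\<close>.\<close>

lemma jordan_triple_mult:
  fixes x c d f :: "'a::jb_algebra"
  shows "x \<cdot> jtriple c d f = jtriple (x \<cdot> c) d f - jtriple c (x \<cdot> d) f + jtriple c d (x \<cdot> f)"
  using jordan_derivation[of d c x f] jordan_linearized[of x c d f]
  unfolding jtriple_def by (simp add: jbilin jprod_commute algebra_simps)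

lemma jordan_triple_derivation:
  fixes a b c d f :: "'a::jb_algebra"
  defines "D \<equiv> \<lambda>w. a \<cdot> (b \<cdot> w) - b \<cdot> (a \<cdot> w)"
  shows "D (jtriple c d f) = jtriple (D c) d f + jtriple c (D d) f + jtriple c d (D f)"
proof -
  have D: "D (v \<cdot> w) = D v \<cdot> w + v \<cdot> D w" for v w unfolding D_def by (rule jordan_derivation)
  have add: "D (v + w) = D v + D w" "D (v - w) = D v - D w" for v w by (simp_all add: D_def jbilin algebra_simps)
  show ?thesis unfolding jtriple_def by (simp add: D add jbilin algebra_simps)
qed

text \<open>The operator \<open>{a b .}\<close> is multiplication by \<open>a \<cdot> b\<close> plus
  the commutator of the multiplications by \<open>a\<close> and \<open>b\<close>. The first summand
  changes sign in the middle slot, the second acts as a derivation, and \<open>{a b .}\<close> with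
  the sign of its first summand reversed is minus \<open>{b a .}\<close>.\<close>

lemma jordan_triple_identity:
  "jtriple a b (jtriple c d f)
    = jtriple (jtriple a b c) d f - jtriple c (jtriple b a d) f + jtriple c d (jtriple a b f)"
proof -
  have V: "jtriple v w u = (v \<cdot> w) \<cdot> u + (v \<cdot> (w \<cdot> u) - w \<cdot> (v \<cdot> u))" for u v w :: 'a
    by (simp add: jtriple_def algebra_simps)
  have lin: "jtriple (u + u') v w = jtriple u v w + jtriple u' v w"
    "jtriple v (u + u') w = jtriple v u w + jtriple v u' w"
    "jtriple v w (u + u') = jtriple v w u + jtriple v w u'"
    "jtriple v (u - u') w = jtriple v u w - jtriple v u' w" for u u' v w :: 'a
    by (simp_all add: jtriple_def jbilin algebra_simps)
  have ba: "jtriple b a d = (a \<cdot> b) \<cdot> d - (a \<cdot> (b \<cdot> d) - b \<cdot> (a \<cdot> d))" by (simp add: V jprod_commute algebra_simps)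
  show ?thesis unfolding V[of a b] ba lin
      jordan_triple_mult[of "a \<cdot> b"] jordan_triple_derivation[of a b] by simp
qed

text \<open>Derived from the five-linear triple identity alone, by specialising its arguments and by
  exchanging \<open>y\<close> and \<open>z\<close>.\<close>

theorem fundamental_formula:
  "U (U x y) z = U x (U y (U x z))"
proof -
  let ?T = jtriple
  have lin: "?T a (b - c) d = ?T a b d - ?T a c d" "?T a (b + c) d = ?T a b d + ?T a c d"
    for a b c d :: 'a by (simp_all add: jtriple_def jbilin algebra_simps)
  have 1: "?T x y (?T x z x) = 2 *\<^sub>R ?T (?T x y x) z x - ?T x (?T y x z) x" for y z
    using jordan_triple_identity[of x y x z x] jtriple_commute[of x z "?T x y x"] by (simp add: scaleR_2)
  \<comment> \<open>Identity \<open>1\<close> for both orders of \<open>y\<close> and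
    \<open>z\<close> reads \<open>A = 2B - C\<close> and \<open>B = 2A - C\<close>.\<close>
  have "3 *\<^sub>R ?T x y (?T x z x) = 3 *\<^sub>R ?T x z (?T x y x)" for y z
  proof -
    define A B C where "A = ?T x y (?T x z x)" and "B = ?T x z (?T x y x)" and "C = ?T x (?T y x z) x"
    have "A = 2 *\<^sub>R B - C" "B = 2 *\<^sub>R A - C" using 1[of y z] 1[of z y] jtriple_commute[of y x z]
        jtriple_commute[of "?T x y x" z x] jtriple_commute[of "?T x z x" y x] by (simp_all add: A_def B_def C_def)
    hence "A - B = 2 *\<^sub>R B - 2 *\<^sub>R A" by (metis add_diff_cancel_right diff_add_cancel add.commute diff_diff_eq2)
    moreover have "3 *\<^sub>R (u::'a) = u + 2 *\<^sub>R u" for u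
      by (metis scaleR_left_distrib scaleR_one one_plus_numeral numeral_plus_one semiring_norm(3))
    ultimately show ?thesis unfolding A_def B_def by (simp add: algebra_simps)
  qed
  hence 3: "?T x y (?T x z x) = ?T x z (?T x y x)" for y z by simp
  have 4: "?T x (?T y x z) x = ?T x z (?T x y x)" for y z
    using 1[of y z] 3[of y z] jtriple_commute[of "?T x y x" z x] by (simp add: scaleR_2)
  have 5: "?T (?T y x y) x z = ?T y (?T x y x) z" for z using jordan_triple_identity[of y x y x z] by simp
  have 6: "?T y (?T x z x) y = 2 *\<^sub>R ?T y x (?T y x z) - ?T z (?T x y x) y"
    using jordan_triple_identity[of z x y x y] 5[of z]
      jtriple_commute[of z x y] jtriple_commute[of z x "?T y x y"]
      jtriple_commute[of y "?T x y x" z] jtriple_commute[of "?T z x y" x y] by (simp add: scaleR_2 algebra_simps)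
  have "?T (?T x y x) z (?T x y x) = 2 *\<^sub>R ?T (?T (?T x y x) z x) y x - ?T x (?T z (?T x y x) y) x"
    using jordan_triple_identity[of "?T x y x" z x y x]
      jtriple_commute[of x y "?T (?T x y x) z x"] by (simp add: scaleR_2)
  also have "?T (?T (?T x y x) z x) y x = ?T x (?T y x (?T y x z)) x"
    using 4[of y z] 4[of y "?T y x z"] 3[of y "?T y x z"]
      jtriple_commute[of "?T x y x" z x] jtriple_commute[of x y "?T x z (?T x y x)"] by simp
  also have "2 *\<^sub>R ?T x (?T y x (?T y x z)) x - ?T x (?T z (?T x y x) y) x = ?T x (?T y (?T x z x) y) x"
    unfolding 6 lin scaleR_2 by simp
  finally show ?thesis by (simp add: quad_rep_jtriple)
qed

lemma quad_rep_add: "U x (y + z) = U x y + U x z" by (simp add: quad_rep_def jbilin algebra_simps)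

lemma quad_rep_diff: "U x (y - z) = U x y - U x z" by (simp add: quad_rep_def jbilin algebra_simps)

lemma quad_rep_scaleR: "U x (r *\<^sub>R y) = r *\<^sub>R U x y" by (simp add: quad_rep_def jbilin algebra_simps)

lemma quad_rep_zero [simp]: "U x 0 = 0" "U 0 y = 0" by (simp_all add: quad_rep_def jprod.zero_left jprod.zero_right)

lemma quad_rep_scaleR_left: "U (r *\<^sub>R x) y = r\<^sup>2 *\<^sub>R U x y"
  by (simp add: quad_rep_def jbilin algebra_simps power2_eq_square)

lemma quad_rep_minus_left: "U (- x) y = U x y" by (simp add: quad_rep_def jbilin)

lemma quad_rep_add_left:
  "U (x + w) y = U x y + 2 *\<^sub>R jtriple x y w + U w y"
  by (simp add: quad_rep_def jtriple_def jbilin algebra_simps jprod_commute scaleR_2)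

lemma norm_quad_rep: "norm (U x y) \<le> 3 * (norm x)\<^sup>2 * norm y"
proof -
  have "norm (U x y) \<le> 2 * norm (x \<cdot> (x \<cdot> y)) + norm ((x \<cdot> x) \<cdot> y)"
    unfolding quad_rep_def by (rule order_trans[OF norm_triangle_ineq4]) simp
  also have "norm (x \<cdot> (x \<cdot> y)) \<le> norm x * (norm x * norm y)"
    by (rule order_trans[OF norm_jprod_le]) (simp add: mult_left_mono norm_jprod_le)
  also have "norm ((x \<cdot> x) \<cdot> y) \<le> (norm x)\<^sup>2 * norm y" using norm_jprod_le[of "x \<cdot> x" y] by (simp add: norm_jsquare)
  finally show ?thesis by (simp add: power2_eq_square algebra_simps)
qed

lemma bounded_linear_quad_rep: "bounded_linear (U x)" by (rule bounded_linear_intro[where K = "3 * (norm x)\<^sup>2"])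
    (simp_all add: quad_rep_add quad_rep_scaleR norm_quad_rep mult.commute[of "norm _" "3 * _"])

lemma continuous_on_quad_rep [continuous_intros]:
  "continuous_on A f \<Longrightarrow> continuous_on A g \<Longrightarrow> continuous_on A (\<lambda>t. U (f t) (g t))"
  unfolding quad_rep_def by (intro continuous_intros jprod.continuous_on)

lemma tendsto_quad_rep [tendsto_intros]:
  "(f \<longlongrightarrow> a) F \<Longrightarrow> (g \<longlongrightarrow> b) F \<Longrightarrow> ((\<lambda>t. U (f t) (g t)) \<longlongrightarrow> U a b) F"
  unfolding quad_rep_def by (intro tendsto_intros jprod.tendsto)

text \<open>Horner evaluation, with the unit as a parameter because it belongs to the carrier and
  not to the type. Every step multiplies by \<open>x\<close> once, so no choice of powers is made;
  power associativity reappears as \<open>peval_mult\<close>.\<close>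

definition peval :: "'a::jb_algebra \<Rightarrow> real poly \<Rightarrow> 'a \<Rightarrow> 'a" where
  "peval e p x = fold_coeffs (\<lambda>a y. a *\<^sub>R e + x \<cdot> y) p 0"

lemma peval_0 [simp]: "peval e 0 x = 0" by (simp add: peval_def)

lemma peval_pCons [simp]: "peval e (pCons a p) x = a *\<^sub>R e + x \<cdot> peval e p x"
  by (cases "p = 0 \<and> a = 0") (auto simp: peval_def jprod.zero_right)

lemma peval_add: "peval e (p + q) x = peval e p x + peval e q x"
proof (induction p arbitrary: q)
  case (pCons a p)
  obtain b r where q: "q = pCons b r" by (cases q)
  show ?case unfolding q by (simp add: pCons.IH[of r] algebra_simps jbilin)
qed simp

lemma peval_smult: "peval e (smult c p) x = c *\<^sub>R peval e p x" by (induction p) (simp_all add: algebra_simps jbilin)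

lemma peval_minus: "peval e (- p) x = - peval e p x" using peval_smult[of e "-1" p x] by simp

lemma peval_diff: "peval e (p - q) x = peval e p x - peval e q x"
  using peval_add[of e p "- q" x] by (simp add: peval_minus)

lemma peval_const: "peval e [:c:] x = c *\<^sub>R e" by (simp add: jprod.zero_right)

lemma subspace_closure:
  fixes T :: "'a::real_normed_vector set"
  assumes "subspace T"
  shows "subspace (closure T)"
proof (rule subspaceI)
  show "0 \<in> closure T" using subspace_0[OF assms] closure_subset by auto
next
  fix x y assume "x \<in> closure T" "y \<in> closure T"
  then obtain f g where "\<forall>n. f n \<in> T" "f \<longlonglongrightarrow> x" "\<forall>n. g n \<in> T" "g \<longlonglongrightarrow> y" unfolding closure_sequential by blast
  thus "x + y \<in> closure T" unfolding closure_sequential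
    by (intro exI[of _ "\<lambda>n. f n + g n"]) (auto intro: tendsto_add subspace_add[OF assms])
next
  fix c x assume "x \<in> closure T"
  then obtain f where "\<forall>n. f n \<in> T" "f \<longlonglongrightarrow> x" unfolding closure_sequential by blast
  thus "c *\<^sub>R x \<in> closure T" unfolding closure_sequential
    by (intro exI[of _ "\<lambda>n. c *\<^sub>R f n"]) (auto intro: tendsto_intros subspace_scale[OF assms])
qed

section \<open>Unital carriers and the algebra generated by one element\<close>

locale jb_unital =
  fixes S :: "'a::jb_algebra set" and e :: 'a
  assumes subalgebra: "jb_subalgebra S" and unit: "is_jb_unit S e"
begin

abbreviation "sp \<equiv> jb_spectrum e"

lemma closed_carrier: "closed S"
  and subspace_carrier: "subspace S"
  and jprod_in [intro, simp]: "x \<in> S \<Longrightarrow> y \<in> S \<Longrightarrow> x \<cdot> y \<in> S" using subalgebra by (auto simp: jb_subalgebra_def)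

lemma unit_in [intro, simp]: "e \<in> S"
  and unit_left [simp]: "x \<in> S \<Longrightarrow> e \<cdot> x = x"
  and unit_right [simp]: "x \<in> S \<Longrightarrow> x \<cdot> e = x" using unit by (auto simp: is_jb_unit_def jprod_commute[of _ e])

lemma zero_in [intro, simp]: "0 \<in> S"
  and add_in [intro, simp]: "x \<in> S \<Longrightarrow> y \<in> S \<Longrightarrow> x + y \<in> S"
  and diff_in [intro, simp]: "x \<in> S \<Longrightarrow> y \<in> S \<Longrightarrow> x - y \<in> S"
  and minus_in [intro, simp]: "x \<in> S \<Longrightarrow> - x \<in> S"
  and scaleR_in [intro, simp]: "x \<in> S \<Longrightarrow> r *\<^sub>R x \<in> S" using subspace_carrier
  by (auto simp: subspace_0 subspace_add subspace_diff subspace_scale subspace_neg)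

lemma sum_in [intro, simp]: "(\<And>i. i \<in> A \<Longrightarrow> f i \<in> S) \<Longrightarrow> sum f A \<in> S" using subspace_carrier by (rule subspace_sum)

lemma quad_rep_in [intro, simp]: "x \<in> S \<Longrightarrow> y \<in> S \<Longrightarrow> U x y \<in> S" unfolding quad_rep_def by auto

lemma jtriple_in [intro, simp]: "x \<in> S \<Longrightarrow> y \<in> S \<Longrightarrow> z \<in> S \<Longrightarrow> jtriple x y z \<in> S" unfolding jtriple_def by auto

lemma quad_rep_unit [simp]: "x \<in> S \<Longrightarrow> U x e = x \<cdot> x" "x \<in> S \<Longrightarrow> U e x = x" by (simp_all add: quad_rep_def scaleR_2)

lemma quad_rep_unit_add:
  "y \<in> S \<Longrightarrow> h \<in> S \<Longrightarrow> U (e + h) y = y + 2 *\<^sub>R (h \<cdot> y) + U h y" by (simp add: quad_rep_add_left jtriple_def jprod_commute)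

lemma jb_unit_eq: "jb_unit S = e" unfolding jb_unit_def
  using unit by (rule the_equality[where P = "is_jb_unit S"]) (metis is_jb_unit_def unit_right unit_in)

lemma norm_unit_le: "norm e \<le> 1"
proof -
  have "(norm e)\<^sup>2 = norm e * 1" using norm_jsquare[of e] by simp
  hence "norm e = 0 \<or> norm e = 1" unfolding power2_eq_square by (auto simp only: mult_cancel_left)
  thus ?thesis by auto
qed

lemma carrier_trivial: "e = 0 \<Longrightarrow> x \<in> S \<Longrightarrow> x = 0" by (metis unit_left jprod.zero_left)

definition opcomm :: "'a \<Rightarrow> 'a \<Rightarrow> bool" where
  "opcomm a b \<longleftrightarrow> (\<forall>z\<in>S. a \<cdot> (b \<cdot> z) = b \<cdot> (a \<cdot> z))"

lemma opcomm_sym: "opcomm a b \<Longrightarrow> opcomm b a" by (simp add: opcomm_def)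

lemma opcomm_unit: "a \<in> S \<Longrightarrow> opcomm a e" by (auto simp: opcomm_def)

lemma opcomm_linear:
  "opcomm w a \<Longrightarrow> opcomm w b \<Longrightarrow> opcomm w (r *\<^sub>R a + s *\<^sub>R b)" by (simp add: opcomm_def jbilin)

lemma opcomm_square: "x \<in> S \<Longrightarrow> opcomm x (x \<cdot> x)" unfolding opcomm_def by (metis jordan_identity jprod_commute)

text \<open>As operators, \<open>L_{x(xb)} = 2 L_{xb} L_x + L_{xx} L_b - L_x L_x L_b - L_b L_x
  L_x\<close>, and multiplication by \<open>w\<close> commutes with every factor on the
  right.\<close>

lemma opcomm_jprod_step:
  assumes S: "x \<in> S" "b \<in> S" "w \<in> S"
    and w: "opcomm w x" "opcomm w (x \<cdot> x)" "opcomm w b" "opcomm w (x \<cdot> b)"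
  shows "opcomm w (x \<cdot> (x \<cdot> b))"
proof -
  have eq: "(x \<cdot> (x \<cdot> b)) \<cdot> c = 2 *\<^sub>R ((x \<cdot> b) \<cdot> (x \<cdot> c)) + (x \<cdot> x) \<cdot> (b \<cdot> c)
      - x \<cdot> (x \<cdot> (b \<cdot> c)) - b \<cdot> (x \<cdot> (x \<cdot> c))" for c using jordan_linearized[of x b c x]
    by (simp add: jprod_commute algebra_simps scaleR_2)
  have c: "w \<cdot> (x \<cdot> z) = x \<cdot> (w \<cdot> z)" "w \<cdot> (b \<cdot> z) = b \<cdot> (w \<cdot> z)"
    "w \<cdot> ((x \<cdot> x) \<cdot> z) = (x \<cdot> x) \<cdot> (w \<cdot> z)"
    "w \<cdot> ((x \<cdot> b) \<cdot> z) = (x \<cdot> b) \<cdot> (w \<cdot> z)" if "z \<in> S" for z using w that by (auto simp: opcomm_def)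
  show ?thesis unfolding opcomm_def using S by (simp add: eq jbilin c)
qed

lemma peval_in [intro, simp]: "x \<in> S \<Longrightarrow> peval e p x \<in> S" by (induction p) auto

lemma opcomm_peval:
  assumes x: "x \<in> S" and w: "w \<in> S" "opcomm w x" "opcomm w (x \<cdot> x)"
  shows "opcomm w (peval e p x)"
proof -
  \<comment> \<open>The product of \<open>x\<close> with the polynomial has to be carried along,
    since \<open>opcomm_jprod_step\<close> asks for it.\<close>
  have "opcomm w (peval e p x) \<and> opcomm w (x \<cdot> peval e p x)"
  proof (induction p)
    case 0
    show ?case by (simp add: opcomm_def jprod.zero_left jprod.zero_right)
  next
    case (pCons a p)
    have "opcomm w (a *\<^sub>R e + 1 *\<^sub>R (x \<cdot> peval e p x))" using pCons.IH w opcomm_unit by (intro opcomm_linear) auto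
    moreover have "opcomm w (a *\<^sub>R x + 1 *\<^sub>R (x \<cdot> (x \<cdot> peval e p x)))"
      using pCons.IH w x by (intro opcomm_linear opcomm_jprod_step) auto
    ultimately show ?case using x by (simp add: jbilin)
  qed
  thus ?thesis ..
qed

text \<open>Three passes through \<open>opcomm_peval\<close>: the Jordan identity makes
  \<open>x\<close> and \<open>x \<cdot> x\<close> commute with each other, so both commute with all
  polynomials in \<open>x\<close>, and then a polynomial can take the role of
  \<open>w\<close>.\<close>

lemma opcomm_peval_peval: "x \<in> S \<Longrightarrow> opcomm (peval e p x) (peval e q x)"
proof -
  assume x: "x \<in> S"
  have 1: "opcomm x (peval e p x)" for p by (rule opcomm_peval) (use x opcomm_square in \<open>auto simp: opcomm_def\<close>)
  have 2: "opcomm (x \<cdot> x) (peval e p x)" for p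
    by (rule opcomm_peval) (use x opcomm_square opcomm_sym in \<open>auto simp: opcomm_def\<close>)
  show "opcomm (peval e p x) (peval e q x)" by (rule opcomm_peval) (use x 1 2 opcomm_sym in auto)
qed

lemma peval_id: "x \<in> S \<Longrightarrow> peval e [:0, 1:] x = x" by (simp add: jprod.zero_right)

text \<open>This is power associativity. The induction step only moves \<open>x\<close> past the
  value of \<open>q\<close>, which is operator commutation.\<close>

lemma peval_mult: "x \<in> S \<Longrightarrow> peval e (p * q) x = peval e p x \<cdot> peval e q x"
proof (induction p)
  case (pCons a p)
  have "x \<cdot> (peval e p x \<cdot> peval e q x) = (x \<cdot> peval e p x) \<cdot> peval e q x"
    using opcomm_peval_peval[OF pCons.prems, of "[:0,1:]" q] pCons.prems
    unfolding peval_id[OF pCons.prems] opcomm_def by (metis jprod_commute peval_in)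
  thus ?case using pCons by (simp add: peval_add peval_smult jbilin)
qed (simp add: jprod.zero_left)

text \<open>The algebra \<open>jb_generated e x\<close> of the definitions
  (\<open>jb_generated_eq\<close>), in a form where every element is visibly a limit of polynomials
  in \<open>x\<close>.\<close>

definition gen :: "'a \<Rightarrow> 'a set" where
  "gen x = closure (range (\<lambda>p. peval e p x))"

lemma gen_subset: "x \<in> S \<Longrightarrow> gen x \<subseteq> S" unfolding gen_def by (intro closure_minimal closed_carrier) auto

lemma gen_in: "x \<in> S \<Longrightarrow> a \<in> gen x \<Longrightarrow> a \<in> S" using gen_subset by blast

lemma peval_in_gen: "peval e p x \<in> gen x" unfolding gen_def by (rule subsetD[OF closure_subset]) simp

lemma gen_self: "x \<in> S \<Longrightarrow> x \<in> gen x" using peval_in_gen[of "[:0,1:]" x] by (simp only: peval_id)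

lemma gen_unit: "e \<in> gen x" using peval_in_gen[of "1" x] by (simp add: one_pCons jprod.zero_right)

lemma genE:
  assumes "a \<in> gen x"
  obtains p where "(\<lambda>n. peval e (p n) x) \<longlonglongrightarrow> a"
proof - from assms obtain f where f: "\<forall>n. f n \<in> range (\<lambda>p. peval e p x)" "f \<longlonglongrightarrow> a"
    unfolding gen_def closure_sequential by blast
  hence "\<forall>n. \<exists>p. f n = peval e p x" by auto
  then obtain p where "\<And>n. f n = peval e (p n) x" by metis
  hence "f = (\<lambda>n. peval e (p n) x)" by auto
  with f(2) have "(\<lambda>n. peval e (p n) x) \<longlonglongrightarrow> a" by simp
  thus thesis by (rule that)
qed

lemma genI: "(\<And>n. f n \<in> gen x) \<Longrightarrow> f \<longlonglongrightarrow> a \<Longrightarrow> a \<in> gen x" using closed_sequentially[of "gen x" f a] unfolding gen_def by simp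

lemma gen_subalgebra:
  assumes x: "x \<in> S"
  shows "jb_subalgebra (gen x)" unfolding jb_subalgebra_def
proof (intro conjI ballI)
  show "closed (gen x)" by (simp add: gen_def)
  show "subspace (gen x)" unfolding gen_def
  proof (rule subspace_closure, rule subspaceI)
    show "0 \<in> range (\<lambda>p. peval e p x)" by (metis peval_0 rangeI)
    show "\<And>a b. a \<in> range (\<lambda>p. peval e p x) \<Longrightarrow> b \<in> range (\<lambda>p. peval e p x) \<Longrightarrow> a + b \<in> range (\<lambda>p. peval e p x)"
      by (auto simp: peval_add[symmetric])
    show "\<And>c a. a \<in> range (\<lambda>p. peval e p x) \<Longrightarrow> c *\<^sub>R a \<in> range (\<lambda>p. peval e p x)" by (auto simp: peval_smult[symmetric])
  qed
  fix a b assume a: "a \<in> gen x" and b: "b \<in> gen x"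
  obtain p where p: "(\<lambda>n. peval e (p n) x) \<longlonglongrightarrow> a" using a by (rule genE)
  obtain q where q: "(\<lambda>n. peval e (q n) x) \<longlonglongrightarrow> b" using b by (rule genE)
  have "(\<lambda>n. peval e (p n * q n) x) \<longlonglongrightarrow> a \<cdot> b" using jprod.tendsto[OF p q] by (simp add: peval_mult x)
  thus "a \<cdot> b \<in> gen x" by (rule genI[rotated]) (rule peval_in_gen)
qed

lemma gen_unital: "x \<in> S \<Longrightarrow> jb_unital (gen x) e"
  by unfold_locales (auto simp: gen_subalgebra is_jb_unit_def gen_unit gen_in)

lemma gen_opcomm:
  assumes x: "x \<in> S" and a: "a \<in> gen x" and b: "b \<in> gen x"
  shows "opcomm a b" unfolding opcomm_def
proof
  fix z assume z: "z \<in> S"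
  obtain p where p: "(\<lambda>n. peval e (p n) x) \<longlonglongrightarrow> a" using a by (rule genE)
  obtain q where q: "(\<lambda>n. peval e (q n) x) \<longlonglongrightarrow> b" using b by (rule genE)
  have "(\<lambda>n. peval e (p n) x \<cdot> (peval e (q n) x \<cdot> z)) \<longlonglongrightarrow> a \<cdot> (b \<cdot> z)" by (intro jprod.tendsto p q tendsto_const)
  moreover have "(\<lambda>n. peval e (p n) x \<cdot> (peval e (q n) x \<cdot> z)) \<longlonglongrightarrow> b \<cdot> (a \<cdot> z)"
  proof -
    have "(\<lambda>n. peval e (q n) x \<cdot> (peval e (p n) x \<cdot> z)) \<longlonglongrightarrow> b \<cdot> (a \<cdot> z)" by (intro jprod.tendsto p q tendsto_const)
    thus ?thesis using opcomm_peval_peval[OF x] z by (simp add: opcomm_def)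
  qed
  ultimately show "a \<cdot> (b \<cdot> z) = b \<cdot> (a \<cdot> z)" by (rule LIMSEQ_unique)
qed

lemma gen_assoc:
  assumes "x \<in> S" "a \<in> gen x" "b \<in> gen x" "c \<in> S"
  shows "a \<cdot> (b \<cdot> c) = b \<cdot> (a \<cdot> c)" using gen_opcomm assms by (auto simp: opcomm_def)

lemma gen_minimal:
  assumes "a \<in> gen x" "jb_subalgebra T" "e \<in> T" "x \<in> T"
  shows "a \<in> T"
proof -
  have sub: "subspace T" and cl: "closed T" and mul: "\<And>u v. u \<in> T \<Longrightarrow> v \<in> T \<Longrightarrow> u \<cdot> v \<in> T"
    using assms(2) by (auto simp: jb_subalgebra_def)
  have "peval e p x \<in> T" for p
    by (induction p) (auto simp: subspace_0[OF sub] assms intro!: subspace_add[OF sub] subspace_scale[OF sub] mul)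
  hence "gen x \<subseteq> T" unfolding gen_def by (intro closure_minimal cl) auto
  with assms show ?thesis by auto
qed

lemma jb_generated_eq: "x \<in> S \<Longrightarrow> jb_generated e x = gen x" unfolding jb_generated_def
  by (auto intro: gen_minimal gen_subalgebra gen_unit gen_self)

lemma gen_mono: "x \<in> S \<Longrightarrow> y \<in> gen x \<Longrightarrow> a \<in> gen y \<Longrightarrow> a \<in> gen x" using gen_minimal gen_subalgebra gen_unit by blast


end

section \<open>The cone of squares\<close>

definition nonneg_coeffs :: "real poly \<Rightarrow> bool" where
  "nonneg_coeffs p \<longleftrightarrow> (\<forall>i. 0 \<le> coeff p i)"

lemma nonneg_coeffs_add: "nonneg_coeffs p \<Longrightarrow> nonneg_coeffs q \<Longrightarrow> nonneg_coeffs (p + q)" by (simp add: nonneg_coeffs_def)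

lemma nonneg_coeffs_mult: "nonneg_coeffs p \<Longrightarrow> nonneg_coeffs q \<Longrightarrow> nonneg_coeffs (p * q)"
  by (simp add: nonneg_coeffs_def coeff_mult sum_nonneg)

lemma nonneg_coeffs_smult: "nonneg_coeffs p \<Longrightarrow> 0 \<le> c \<Longrightarrow> nonneg_coeffs (smult c p)" by (simp add: nonneg_coeffs_def)

text \<open>The iterates converge to \<open>1 - sqrt (1 - t)\<close>; since they increase coefficientwise and
  \<open>1\<close> bounds their values at \<open>t = 1\<close>, they may be evaluated at elements of norm at most \<open>1\<close>.\<close>

fun sqrt_iter :: "nat \<Rightarrow> real poly" where
  "sqrt_iter 0 = 0"
| "sqrt_iter (Suc n) = smult (1/2) ([:0, 1:] + sqrt_iter n * sqrt_iter n)"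

lemma sqrt_iter_nonneg: "nonneg_coeffs (sqrt_iter n)"
proof (induction n)
  case (Suc n)
  have "nonneg_coeffs [:0, 1:]" by (simp add: nonneg_coeffs_def coeff_pCons split: nat.split)
  with Suc show ?case by (auto intro!: nonneg_coeffs_smult nonneg_coeffs_add nonneg_coeffs_mult)
qed (simp add: nonneg_coeffs_def)

text \<open>The quadratic terms of consecutive iterates differ by a product
  \<open>(p - q)(p + q)\<close> of polynomials with nonnegative coefficients.\<close>

lemma sqrt_iter_step: "nonneg_coeffs (sqrt_iter (Suc n) - sqrt_iter n)"
proof (induction n)
  case 0
  show ?case by (simp add: nonneg_coeffs_def coeff_pCons split: nat.split)
next
  case (Suc n)
  have "sqrt_iter (Suc (Suc n)) - sqrt_iter (Suc n)
      = smult (1/2) (sqrt_iter (Suc n) * sqrt_iter (Suc n) - sqrt_iter n * sqrt_iter n)"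
    by (simp add: smult_diff_right[symmetric] del: smult_diff_right)
  also have "sqrt_iter (Suc n) * sqrt_iter (Suc n) - sqrt_iter n * sqrt_iter n
      = (sqrt_iter (Suc n) - sqrt_iter n) * (sqrt_iter (Suc n) + sqrt_iter n)" by (simp only: algebra_simps)
  finally show ?case using Suc.IH sqrt_iter_nonneg
    by (metis nonneg_coeffs_smult nonneg_coeffs_mult nonneg_coeffs_add zero_le_divide_1_iff zero_le_numeral)
qed

lemma sqrt_iter_mono: "m \<le> n \<Longrightarrow> nonneg_coeffs (sqrt_iter n - sqrt_iter m)"
proof (induction n rule: dec_induct)
  case base
  show ?case by (simp add: nonneg_coeffs_def)
next
  case (step n)
  have "sqrt_iter (Suc n) - sqrt_iter m = (sqrt_iter (Suc n) - sqrt_iter n) + (sqrt_iter n - sqrt_iter m)" by simp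
  thus ?case by (metis nonneg_coeffs_add sqrt_iter_step step.IH)
qed

lemma sqrt_iter_at_1: "0 \<le> poly (sqrt_iter n) 1 \<and> poly (sqrt_iter n) 1 \<le> 1"
proof (induction n)
  case (Suc n)
  hence "poly (sqrt_iter n) 1 * poly (sqrt_iter n) 1 \<le> 1 * 1" by (intro mult_mono) auto
  with Suc show ?case by simp
qed simp

lemma nonneg_coeffs_poly_1: "nonneg_coeffs p \<Longrightarrow> 0 \<le> poly p 1"
  by (auto simp: poly_altdef nonneg_coeffs_def intro!: sum_nonneg)

lemma sqrt_iter_Cauchy: "Cauchy (\<lambda>n. poly (sqrt_iter n) 1)"
proof -
  have "incseq (\<lambda>n. poly (sqrt_iter n) 1)" using nonneg_coeffs_poly_1[OF sqrt_iter_mono] by (auto simp: incseq_def)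
  moreover have "\<forall>n. poly (sqrt_iter n) 1 \<le> 1" using sqrt_iter_at_1 by auto
  ultimately obtain L where "(\<lambda>n. poly (sqrt_iter n) 1) \<longlonglongrightarrow> L" by (meson incseq_convergent)
  thus ?thesis by (rule LIMSEQ_imp_Cauchy)
qed

context jb_unital
begin

text \<open>With nonnegative coefficients the triangle inequality amounts to evaluation at
  \<open>1\<close>. In this way the scalar convergence of the iterates at \<open>1\<close> is
  transferred to the algebra.\<close>

lemma norm_peval_le:
  "nonneg_coeffs p \<Longrightarrow> w \<in> S \<Longrightarrow> norm w \<le> 1 \<Longrightarrow> norm (peval e p w) \<le> poly p 1"
proof (induction p)
  case (pCons a p)
  have a: "0 \<le> a" "nonneg_coeffs p" using pCons.prems(1) unfolding nonneg_coeffs_def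
    by (metis coeff_pCons_0, metis coeff_pCons_Suc)
  have "norm (peval e (pCons a p) w) \<le> norm (a *\<^sub>R e) + norm (w \<cdot> peval e p w)"
    unfolding peval_pCons by (rule norm_triangle_ineq)
  also have "norm (a *\<^sub>R e) \<le> a" using a norm_unit_le by (simp add: mult_left_le)
  also have "norm (w \<cdot> peval e p w) \<le> 1 * poly p 1"
    using pCons a by (intro order_trans[OF norm_jprod_le] mult_mono) auto
  finally show ?case by simp
qed simp

text \<open>The limit \<open>l\<close> of the iterates satisfies \<open>2 l = w + l l\<close>, which
  says that \<open>e - l\<close> is a square root of \<open>e - w\<close>.\<close>

lemma sqrt_exists_aux:
  assumes w: "w \<in> S" "norm w \<le> 1"
  shows "\<exists>b\<in>gen w. b \<cdot> b = e - w"
proof -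
  define s where "s n = peval e (sqrt_iter n) w" for n
  have dist: "norm (s n - s m) \<le> \<bar>poly (sqrt_iter n) 1 - poly (sqrt_iter m) 1\<bar>" if "m \<le> n" for m n
    using norm_peval_le[OF sqrt_iter_mono[OF that] w] unfolding s_def by (simp add: peval_diff)
  have "Cauchy s"
  proof (rule CauchyI)
    fix r :: real assume "0 < r"
    then obtain N where N: "\<And>m n. m \<ge> N \<Longrightarrow> n \<ge> N \<Longrightarrow> \<bar>poly (sqrt_iter n) 1 - poly (sqrt_iter m) 1\<bar> < r"
      using sqrt_iter_Cauchy unfolding Cauchy_def dist_real_def by metis
    have "norm (s m - s n) < r" if "m \<ge> N" "n \<ge> N" for m n
    proof (cases "m \<le> n")
      case True
      thus ?thesis using dist[OF True] N[OF that] by (simp add: norm_minus_commute)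
    next
      case False
      thus ?thesis using dist[of n m] N[OF that(2,1)] by simp
    qed
    thus "\<exists>M. \<forall>m\<ge>M. \<forall>n\<ge>M. norm (s m - s n) < r" by blast
  qed
  then obtain l where l: "s \<longlonglongrightarrow> l" by (auto simp: Cauchy_convergent_iff convergent_def)
  have lg: "l \<in> gen w" using l by (rule genI[rotated]) (simp add: s_def peval_in_gen)
  have "(\<lambda>n. s (Suc n)) \<longlonglongrightarrow> l" using l by (rule LIMSEQ_Suc)
  moreover have "(\<lambda>n. s (Suc n)) \<longlonglongrightarrow> (1/2) *\<^sub>R (w + l \<cdot> l)"
  proof -
    have "s (Suc n) = (1/2) *\<^sub>R (w + s n \<cdot> s n)" for n
      unfolding s_def sqrt_iter.simps(2) peval_smult peval_add peval_mult[OF w(1)] peval_id[OF w(1)] ..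
    thus ?thesis using l by (auto intro!: tendsto_intros jprod.tendsto)
  qed
  ultimately have eq: "l = (1/2) *\<^sub>R (w + l \<cdot> l)" by (rule LIMSEQ_unique)
  have lS: "l \<in> S" using lg w gen_in by blast
  have "2 *\<^sub>R l = w + l \<cdot> l" by (subst eq) simp
  hence "(e - l) \<cdot> (e - l) = e - w" using lS by (simp add: jbilin scaleR_2 algebra_simps)
  moreover have "e - l \<in> gen w" using jb_unital.diff_in[OF gen_unital[OF w(1)] gen_unit lg] .
  ultimately show ?thesis by blast
qed

section \<open>The cone of squares, its order and the norm\<close>

abbreviation K :: "'a set" where "K \<equiv> jb_cone S"

abbreviation le :: "'a \<Rightarrow> 'a \<Rightarrow> bool" (infix "\<preceq>" 50) where "x \<preceq> y \<equiv> jb_le S x y"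

lemma K_subset: "a \<in> K \<Longrightarrow> a \<in> S" by (auto simp: jb_cone_def)

lemma square_in_K [intro, simp]: "x \<in> S \<Longrightarrow> x \<cdot> x \<in> K" by (auto simp: jb_cone_def)

lemma unit_in_K [intro, simp]: "e \<in> K" using square_in_K[of e] by simp

lemma zero_in_K [intro, simp]: "0 \<in> K" using square_in_K[of 0] by (simp add: jprod.zero_left)

lemma K_scaleR [intro]: "a \<in> K \<Longrightarrow> 0 \<le> r \<Longrightarrow> r *\<^sub>R a \<in> K"
proof -
  assume "a \<in> K" "0 \<le> r"
  then obtain b where b: "b \<in> S" "a = b \<cdot> b" by (auto simp: jb_cone_def)
  hence "r *\<^sub>R a = (sqrt r *\<^sub>R b) \<cdot> (sqrt r *\<^sub>R b)" using \<open>0 \<le> r\<close> by (simp add: jbilin)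
  thus ?thesis using b by simp
qed

lemma norm_le_1_square:
  assumes "a \<in> S" "norm (e - a) \<le> 1"
  shows "\<exists>b\<in>gen a. b \<cdot> b = a"
proof -
  have g: "e - a \<in> gen a" by (rule jb_unital.diff_in[OF gen_unital[OF assms(1)] gen_unit gen_self[OF assms(1)]])
  obtain b where "b \<in> gen (e - a)" "b \<cdot> b = e - (e - a)" using sqrt_exists_aux[of "e - a"] assms by auto
  thus ?thesis using gen_mono[OF assms(1) g, of b] by auto
qed

text \<open>Both \<open>a = c c\<close> and \<open>e - a = b b\<close> are squares, and their sum is
  \<open>e\<close>. Here the axiom \<open>norm_jsquare_le\<close> enters.\<close>

lemma square_norm_le_1:
  assumes "a \<in> K" "norm a \<le> 1"
  shows "norm (e - a) \<le> 1"
proof -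
  obtain c where c: "c \<in> S" "a = c \<cdot> c" using assms by (auto simp: jb_cone_def)
  have aS: "a \<in> S" using c by simp
  obtain b where b: "b \<in> gen a" "b \<cdot> b = e - a" using sqrt_exists_aux[of a] aS assms by auto
  have "norm (b \<cdot> b) \<le> norm (b \<cdot> b + c \<cdot> c)" by (rule norm_jsquare_le)
  thus ?thesis using b c norm_unit_le by simp
qed

text \<open>Positivity becomes membership in a ball. Neither convexity nor closedness of the set of
  squares is visible from its definition; both follow from this form (\<open>K_add\<close>,
  \<open>K_closed\<close>).\<close>

lemma K_iff_norm:
  assumes "a \<in> S" "norm a \<le> r" "0 < r"
  shows "a \<in> K \<longleftrightarrow> norm (r *\<^sub>R e - a) \<le> r"
proof -
  let ?a = "(1/r) *\<^sub>R a"
  have n: "norm ?a \<le> 1" using assms by simp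
  have "a \<in> K \<longleftrightarrow> ?a \<in> K" using K_scaleR[of a "1/r"] K_scaleR[of ?a r] assms by auto
  also have "\<dots> \<longleftrightarrow> norm (e - ?a) \<le> 1"
  proof
    assume "norm (e - ?a) \<le> 1"
    then obtain b where b: "b \<in> gen ?a" "b \<cdot> b = ?a" using norm_le_1_square[of ?a] assms by auto
    thus "?a \<in> K" using gen_in[of ?a b] assms square_in_K[of b] by simp
  qed (rule square_norm_le_1[OF _ n])
  also have "e - ?a = (1/r) *\<^sub>R (r *\<^sub>R e - a)" using assms by (simp add: algebra_simps)
  also have "norm \<dots> \<le> 1 \<longleftrightarrow> norm (r *\<^sub>R e - a) \<le> r" using assms by simp
  finally show ?thesis .
qed

lemma K_sqrt: "a \<in> K \<Longrightarrow> \<exists>b\<in>gen a. b \<cdot> b = a"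
proof -
  assume aK: "a \<in> K"
  define r where "r = norm a + 1"
  have r: "r > 0" "norm a \<le> r" by (simp_all add: r_def add_nonneg_pos)
  let ?a = "(1/r) *\<^sub>R a"
  have "norm ?a \<le> 1" using r by simp
  have aS: "a \<in> S" using aK K_subset by blast
  interpret G: jb_unital "gen a" e using aS by (rule gen_unital)
  obtain b where b: "b \<in> gen ?a" "b \<cdot> b = ?a"
    using norm_le_1_square[of ?a] square_norm_le_1[of ?a] aK r K_scaleR[of a "1/r"] K_subset \<open>norm ?a \<le> 1\<close> by auto
  have "?a \<in> gen a" by (rule G.scaleR_in[OF gen_self[OF aS]]) from gen_mono[OF aS this b(1)] have "b \<in> gen a" .
  moreover have "(sqrt r *\<^sub>R b) \<cdot> (sqrt r *\<^sub>R b) = a" using b r by (simp add: jbilin)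
  ultimately show ?thesis using G.scaleR_in by blast
qed

lemma K_add [intro]: "a \<in> K \<Longrightarrow> b \<in> K \<Longrightarrow> a + b \<in> K"
proof -
  assume K: "a \<in> K" "b \<in> K"
  define r where "r = norm a + norm b + 1"
  have r: "norm a \<le> r" "norm b \<le> r" "r > 0" "norm (a + b) \<le> r + r"
    using norm_triangle_ineq[of a b] norm_ge_zero[of a] norm_ge_zero[of b] unfolding r_def by linarith+
  have "norm (r *\<^sub>R e - a) \<le> r" "norm (r *\<^sub>R e - b) \<le> r" using K r K_iff_norm K_subset by blast+
  hence "norm ((r *\<^sub>R e - a) + (r *\<^sub>R e - b)) \<le> r + r" by (rule norm_triangle_mono)
  moreover have "(r *\<^sub>R e - a) + (r *\<^sub>R e - b) = (r + r) *\<^sub>R e - (a + b)" unfolding scaleR_left_distrib by simp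
  ultimately have "norm ((r + r) *\<^sub>R e - (a + b)) \<le> r + r" by simp
  thus ?thesis using r K K_subset K_iff_norm[of "a + b" "r + r"] by auto
qed

lemma K_sum [intro]: "(\<And>i. i \<in> A \<Longrightarrow> f i \<in> K) \<Longrightarrow> sum f A \<in> K" by (induction A rule: infinite_finite_induct) auto

lemma K_pointed: "a \<in> K \<Longrightarrow> - a \<in> K \<Longrightarrow> a = 0"
proof -
  assume "a \<in> K" "- a \<in> K"
  then obtain c d where cd: "a = c \<cdot> c" "- a = d \<cdot> d" by (auto simp: jb_cone_def)
  have "norm (c \<cdot> c) \<le> norm (c \<cdot> c + d \<cdot> d)" by (rule norm_jsquare_le)
  also have "c \<cdot> c + d \<cdot> d = 0" using cd by (metis add.right_inverse)
  finally show "a = 0" using cd by simp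
qed

lemma K_closed: "(\<And>n. f n \<in> K) \<Longrightarrow> f \<longlonglongrightarrow> a \<Longrightarrow> a \<in> K"
proof -
  assume f: "\<And>n. f n \<in> K" and lim: "f \<longlonglongrightarrow> a"
  have "Bseq f" using lim by (intro convergent_imp_Bseq) (auto simp: convergent_def)
  then obtain r where r: "0 < r" "\<And>n. norm (f n) \<le> r" unfolding Bseq_def by auto
  have aS: "a \<in> S" using closed_sequentially[OF closed_carrier _ lim] f K_subset by blast
  have "norm (r *\<^sub>R e - f n) \<le> r" for n using f r K_iff_norm K_subset by blast
  moreover have "(\<lambda>n. norm (r *\<^sub>R e - f n)) \<longlonglongrightarrow> norm (r *\<^sub>R e - a)" by (intro tendsto_intros lim)
  ultimately have "norm (r *\<^sub>R e - a) \<le> r" by (meson LIMSEQ_le_const2)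
  moreover have "norm a \<le> r" using tendsto_norm[OF lim] r(2) by (meson LIMSEQ_le_const2)
  ultimately show "a \<in> K" using aS r K_iff_norm by blast
qed

lemma closed_K: "closed K" unfolding closed_sequential_limits using K_closed by blast

lemma le_iff: "x \<preceq> y \<longleftrightarrow> y - x \<in> K" by (simp add: jb_le_def)

lemma zero_le_iff [simp]: "0 \<preceq> y \<longleftrightarrow> y \<in> K" by (simp add: jb_le_def)

lemma le_refl [intro, simp]: "x \<preceq> x" by (simp add: le_iff)

lemma le_trans [trans]: "x \<preceq> y \<Longrightarrow> y \<preceq> z \<Longrightarrow> x \<preceq> z" using K_add[of "z - y" "y - x"] by (simp add: le_iff)

lemma le_antisym: "x \<preceq> y \<Longrightarrow> y \<preceq> x \<Longrightarrow> x = y" using K_pointed[of "y - x"] by (simp add: le_iff)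

lemma le_add_mono: "x \<preceq> y \<Longrightarrow> u \<preceq> v \<Longrightarrow> x + u \<preceq> y + v" using K_add[of "y - x" "v - u"] by (simp add: le_iff algebra_simps)

lemma le_scaleR_mono: "x \<preceq> y \<Longrightarrow> 0 \<le> r \<Longrightarrow> r *\<^sub>R x \<preceq> r *\<^sub>R y"
  using K_scaleR[of "y - x" r] by (simp add: le_iff algebra_simps)

lemma le_scaleR_left: "x \<in> K \<Longrightarrow> r \<le> s \<Longrightarrow> r *\<^sub>R x \<preceq> s *\<^sub>R x"
  using K_scaleR[of x "s - r"] by (simp add: le_iff algebra_simps)

lemma le_limit:
  "(\<And>n. f n \<preceq> g n) \<Longrightarrow> f \<longlonglongrightarrow> x \<Longrightarrow> g \<longlonglongrightarrow> y \<Longrightarrow> x \<preceq> y"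
  unfolding le_iff by (rule K_closed[of "\<lambda>n. g n - f n"]) (auto intro: tendsto_diff)

lemma le_norm: "a \<in> S \<Longrightarrow> norm a \<le> r \<Longrightarrow> a \<preceq> r *\<^sub>R e"
proof (cases "r = 0")
  case False
  assume a: "a \<in> S" "norm a \<le> r"
  hence r: "0 < r" using False norm_ge_zero[of a] by linarith
  have "norm (r *\<^sub>R e) \<le> r" using r norm_unit_le by simp
  hence "norm (r *\<^sub>R e - a) \<le> r + r" using norm_triangle_le_diff[of "r *\<^sub>R e" a "r + r"] a by simp
  moreover have "norm ((r + r) *\<^sub>R e - (r *\<^sub>R e - a)) \<le> r + r"
  proof -
    have "(r + r) *\<^sub>R e - (r *\<^sub>R e - a) = r *\<^sub>R e + a" unfolding scaleR_left_distrib by simp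
    moreover have "norm (r *\<^sub>R e + a) \<le> r + r"
      using \<open>norm (r *\<^sub>R e) \<le> r\<close> a norm_triangle_ineq[of "r *\<^sub>R e" a] by linarith
    ultimately show ?thesis by (simp only:)
  qed
  ultimately show ?thesis using K_iff_norm[of "r *\<^sub>R e - a" "r + r"] r a by (simp add: le_iff)
qed simp

lemma le_norm': "a \<in> S \<Longrightarrow> norm a \<le> r \<Longrightarrow> - (r *\<^sub>R e) \<preceq> a" using le_norm[of "- a" r] by (simp add: le_iff add.commute)

text \<open>Take roots \<open>c\<close> of \<open>e - a\<close> and \<open>d\<close> of
  \<open>e + a\<close> in the associative algebra \<open>gen a\<close>. Then
  \<open>(c d)^2 = e - a^2\<close>, so \<open>a^2\<close> and \<open>(c d)^2\<close> are squares
  with sum \<open>e\<close>.\<close>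

lemma norm_le_1_aux:
  assumes a: "a \<in> S" "- e \<preceq> a" "a \<preceq> e"
  shows "norm a \<le> 1"
proof -
  interpret G: jb_unital "gen a" e using a(1) by (rule gen_unital)
  have ag: "a \<in> gen a" using a gen_self by blast
  obtain c where c: "c \<in> gen (e - a)" "c \<cdot> c = e - a" using K_sqrt[of "e - a"] a by (auto simp: le_iff)
  obtain d where d: "d \<in> gen (e + a)" "d \<cdot> d = e + a" using K_sqrt[of "e + a"] a by (auto simp: le_iff add.commute)
  have "c \<in> gen a" by (rule gen_mono[OF a(1) _ c(1)]) (use ag gen_unit in auto)
  moreover have "d \<in> gen a" by (rule gen_mono[OF a(1) _ d(1)]) (use ag gen_unit in auto)
  ultimately have cd: "c \<in> gen a" "d \<in> gen a" by auto
  have S: "c \<in> S" "d \<in> S" using cd gen_in a by auto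
  have "(c \<cdot> d) \<cdot> (c \<cdot> d) = c \<cdot> (d \<cdot> (c \<cdot> d))"
    using gen_assoc[OF a(1), of "c \<cdot> d" c d] cd S by (simp add: jprod_commute)
  also have "d \<cdot> (c \<cdot> d) = c \<cdot> (d \<cdot> d)" using gen_assoc[OF a(1), of d c d] cd S by simp
  also have "c \<cdot> (c \<cdot> (d \<cdot> d)) = (d \<cdot> d) \<cdot> (c \<cdot> c)"
    using gen_assoc[OF a(1), of c "d \<cdot> d" c] cd S by (simp add: jprod_commute)
  also have "\<dots> = (e + a) \<cdot> (e - a)" unfolding c(2) d(2) ..
  also have "\<dots> = e - a \<cdot> a" using a by (simp add: jbilin)
  finally have *: "a \<cdot> a + (c \<cdot> d) \<cdot> (c \<cdot> d) = e" by simp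
  have "(norm a)\<^sup>2 \<le> 1" using norm_jsquare_le[of a "c \<cdot> d"] norm_unit_le unfolding * by (simp add: norm_jsquare)
  thus ?thesis by (metis norm_ge_zero one_power2 power2_le_imp_le zero_le_one)
qed

lemma norm_le_iff:
  assumes a: "a \<in> S" "0 \<le> r"
  shows "norm a \<le> r \<longleftrightarrow> - (r *\<^sub>R e) \<preceq> a \<and> a \<preceq> r *\<^sub>R e"
proof
  assume "norm a \<le> r"
  thus "- (r *\<^sub>R e) \<preceq> a \<and> a \<preceq> r *\<^sub>R e" using le_norm le_norm' a by blast
next
  assume le: "- (r *\<^sub>R e) \<preceq> a \<and> a \<preceq> r *\<^sub>R e"
  show "norm a \<le> r"
  proof (cases "r = 0")
    case True
    thus ?thesis using le le_antisym[of a 0] by simp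
  next
    case False
    have "- e \<preceq> (1/r) *\<^sub>R a" "(1/r) *\<^sub>R a \<preceq> e"
      using le le_scaleR_mono[of "- (r *\<^sub>R e)" a "1/r"] le_scaleR_mono[of a "r *\<^sub>R e" "1/r"] False a by auto
    hence "norm ((1/r) *\<^sub>R a) \<le> 1" by (rule norm_le_1_aux[rotated]) (simp add: a)
    thus ?thesis using False a by (simp add: divide_le_eq)
  qed
qed

lemma norm_mono:
  assumes "a \<in> K" "a \<preceq> b" "b \<in> S"
  shows "norm a \<le> norm b"
proof -
  have "a \<preceq> norm b *\<^sub>R e" using le_trans[OF assms(2) le_norm[of b "norm b"]] assms by simp
  moreover have "- (norm b *\<^sub>R e) \<preceq> a" using assms K_add[OF assms(1) K_scaleR[OF unit_in_K]] by (simp add: le_iff)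
  ultimately show ?thesis using norm_le_iff[of a "norm b"] assms K_subset by auto
qed

lemma le_eps:
  assumes "\<And>\<delta>. 0 < \<delta> \<Longrightarrow> x \<preceq> y + \<delta> *\<^sub>R z"
  shows "x \<preceq> y"
proof (rule le_limit)
  show "x \<preceq> y + (1 / real (Suc n)) *\<^sub>R z" for n by (rule assms) simp
  have "(\<lambda>n. y + (1 / real (Suc n)) *\<^sub>R z) \<longlonglongrightarrow> y + 0 *\<^sub>R z"
    by (intro tendsto_intros LIMSEQ_inverse_real_of_nat[unfolded inverse_eq_divide])
  thus "(\<lambda>n. y + (1 / real (Suc n)) *\<^sub>R z) \<longlonglongrightarrow> y" by simp
qed simp

text \<open>Positivity does not depend on where a root is sought, because \<open>K_sqrt\<close>
  finds one in \<open>gen a\<close>.\<close>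

lemma gen_K: "x \<in> S \<Longrightarrow> a \<in> gen x \<Longrightarrow> a \<in> K \<longleftrightarrow> a \<in> jb_cone (gen x)"
proof
  assume x: "x \<in> S" "a \<in> gen x" "a \<in> K"
  obtain b where "b \<in> gen a" "b \<cdot> b = a" using K_sqrt[OF x(3)] by auto
  thus "a \<in> jb_cone (gen x)" using gen_mono[OF x(1,2), of b] unfolding jb_cone_def by auto
next
  assume x: "x \<in> S" "a \<in> jb_cone (gen x)"
  then obtain b where "b \<in> gen x" "a = b \<cdot> b" by (auto simp: jb_cone_def)
  thus "a \<in> K" using gen_in[OF x(1), of b] by simp
qed

lemma gen_K_mult:
  assumes x: "x \<in> S" and ab: "a \<in> gen x" "b \<in> gen x" "a \<in> K" "b \<in> K"
  shows "a \<cdot> b \<in> K"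
proof -
  interpret G: jb_unital "gen x" e using x by (rule gen_unital)
  have "a \<in> jb_cone (gen x)" "b \<in> jb_cone (gen x)" using ab gen_K[OF x] by auto
  then obtain c d where c: "c \<in> gen x" "a = c \<cdot> c" and d: "d \<in> gen x" "b = d \<cdot> d" unfolding jb_cone_def by auto
  have S: "c \<in> S" "d \<in> S" using c d gen_in x by auto
  have "(c \<cdot> c) \<cdot> (d \<cdot> d) = d \<cdot> ((c \<cdot> c) \<cdot> d)" using gen_assoc[OF x, of "c \<cdot> c" d d] c d S by simp
  also have "(c \<cdot> c) \<cdot> d = c \<cdot> (c \<cdot> d)" using gen_assoc[OF x, of d c c] c d S by (simp add: jprod_commute)
  also have "d \<cdot> (c \<cdot> (c \<cdot> d)) = (c \<cdot> d) \<cdot> (c \<cdot> d)"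
    using gen_assoc[OF x, of d "c \<cdot> d" c] c d S by (simp add: jprod_commute)
  finally show ?thesis using c d S by simp
qed

end

section \<open>Spectrum and functional calculus\<close>

text \<open>The spectrum is a set of reals, so polynomials have to be factored over the reals. A
  complex zero \<open>a + i b\<close> yields the factor \<open>(x - a)^2 + b^2\<close>, whose value
  at an element dominates \<open>b^2 e\<close> and is therefore invertible.\<close>

lemma real_poly_quadratic_factor:
  fixes p :: "real poly"
  assumes "degree p > 0" and "\<And>s. poly p s \<noteq> 0"
  shows "\<exists>a b q. b \<noteq> 0 \<and> p = ([:- a, 1:] * [:- a, 1:] + [:b\<^sup>2:]) * q"
proof -
  let ?C = "map_poly complex_of_real"
  have hom: "poly (?C (u * v)) w = poly (?C u) w * poly (?C v) w"
    "poly (?C (u + v)) w = poly (?C u) w + poly (?C v) w" for u v w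
  proof -
    have "?C (u * v) = ?C u * ?C v" "?C (u + v) = ?C u + ?C v" by (rule poly_eqI; simp add: coeff_mult coeff_map_poly)+
    thus "poly (?C (u * v)) w = poly (?C u) w * poly (?C v) w"
      "poly (?C (u + v)) w = poly (?C u) w + poly (?C v) w" by simp_all
  qed
  have real: "poly (?C u) (of_real t) = of_real (poly u t)" for u t by (induction u) (simp_all add: map_poly_pCons)
  have "degree (?C p) = degree p" by (intro degree_map_poly) auto
  then obtain z where z: "poly (?C p) z = 0" using assms(1) alg_closed_imp_poly_has_root[of "?C p"] by auto
  define a b where "a = Re z" and "b = Im z"
  have zz: "z = Complex a b" by (simp add: a_def b_def)
  have b: "b \<noteq> 0"
  proof
    assume "b = 0"
    hence "z = of_real a" by (simp add: zz complex_of_real_def)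
    hence "poly p a = 0" using z real[of p a] by simp
    with assms(2) show False by blast
  qed
  define d where "d = [:- a, 1:] * [:- a, 1:] + [:b\<^sup>2:]"
  have d: "d = [:a\<^sup>2 + b\<^sup>2, - 2 * a, 1:]" by (simp add: d_def power2_eq_square)
  have d0: "d \<noteq> 0" by (simp add: d)
  have deg: "degree d = 2" by (simp add: d)
  have eq: "p = d * (p div d) + p mod d" by simp
  define r where "r = p mod d"
  have "r = 0 \<or> degree r < 2" unfolding r_def using degree_mod_less[OF d0, of p] deg by simp
  hence "degree r \<le> 1" by auto
  hence r: "r = [:coeff r 0, coeff r 1:]" by (intro poly_eqI) (auto simp: coeff_pCons coeff_eq_0 split: nat.split)
  have "poly (?C d) z = 0" by (simp add: d map_poly_pCons zz complex_eq_iff power2_eq_square algebra_simps)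
  moreover have "poly (?C p) z = poly (?C d) z * poly (?C (p div d)) z + poly (?C r) z"
    using hom eq unfolding r_def by metis
  ultimately have "poly (?C r) z = 0" using z by simp
  \<comment> \<open>The remainder has real coefficients and degree at most one, so vanishing at a
    point off the real line makes it zero.\<close>
  hence "of_real (coeff r 0) + z * of_real (coeff r 1) = 0" by (subst (asm) r) (simp add: map_poly_pCons)
  hence "coeff r 0 = 0" "coeff r 1 = 0" using b by (auto simp: zz complex_eq_iff)
  hence "r = 0" using r by simp
  hence "p = d * (p div d)" using eq unfolding r_def by simp
  thus ?thesis using b d_def by blast
qed

context jb_unital
begin

lemma gen_assoc3:
  assumes "x \<in> S" "a \<in> gen x" "b \<in> gen x" "c \<in> gen x"
  shows "(a \<cdot> b) \<cdot> c = a \<cdot> (b \<cdot> c)"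
  using gen_assoc[of x a c b] gen_in[of x c] gen_in[of x b] assms by (simp add: jprod_commute)

lemma gen_closed:
  assumes "x \<in> S"
  shows "a \<in> gen x \<Longrightarrow> b \<in> gen x \<Longrightarrow> a \<cdot> b \<in> gen x"
    and "a \<in> gen x \<Longrightarrow> b \<in> gen x \<Longrightarrow> a + b \<in> gen x"
    and "a \<in> gen x \<Longrightarrow> b \<in> gen x \<Longrightarrow> a - b \<in> gen x"
    and "a \<in> gen x \<Longrightarrow> - a \<in> gen x"
    and "a \<in> gen x \<Longrightarrow> r *\<^sub>R a \<in> gen x"
  using jb_unital.jprod_in[OF gen_unital[OF assms]] jb_unital.add_in[OF gen_unital[OF assms]]
    jb_unital.diff_in[OF gen_unital[OF assms]] jb_unital.minus_in[OF gen_unital[OF assms]]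
    jb_unital.scaleR_in[OF gen_unital[OF assms]] by auto

text \<open>Invertibility inside one fixed associative algebra, which allows products and factors to
  be compared. The notion \<open>jb_invertible\<close> looks into the algebra generated by the
  element itself; for \<open>x - s e\<close> the two agree (\<open>spectrum_iff\<close>).\<close>

definition ginv :: "'a \<Rightarrow> 'a \<Rightarrow> bool" where
  "ginv x a \<longleftrightarrow> a \<in> gen x \<and> (\<exists>y\<in>gen x. a \<cdot> y = e)"

lemma ginv_mult:
  assumes x: "x \<in> S" and ab: "ginv x a" "ginv x b"
  shows "ginv x (a \<cdot> b)"
proof -
  obtain y z where y: "a \<in> gen x" "y \<in> gen x" "a \<cdot> y = e" and z: "b \<in> gen x" "z \<in> gen x" "b \<cdot> z = e"
    using ab by (auto simp: ginv_def)
  have "(a \<cdot> b) \<cdot> (y \<cdot> z) = a \<cdot> (b \<cdot> (y \<cdot> z))" by (rule gen_assoc3) (auto intro: x y z gen_closed)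
  also have "b \<cdot> (y \<cdot> z) = y \<cdot> (b \<cdot> z)" by (rule gen_assoc) (use x y z gen_in in auto)
  also have "a \<cdot> (y \<cdot> (b \<cdot> z)) = e" using y z x gen_in by simp
  finally show ?thesis using gen_closed(1)[OF x y(1) z(1)] gen_closed(1)[OF x y(2) z(2)] unfolding ginv_def by blast
qed

lemma ginv_factor:
  assumes x: "x \<in> S" and ab: "a \<in> gen x" "b \<in> gen x" "ginv x (a \<cdot> b)"
  shows "ginv x a"
proof -
  obtain y where y: "y \<in> gen x" "(a \<cdot> b) \<cdot> y = e" using ab by (auto simp: ginv_def)
  hence "a \<cdot> (b \<cdot> y) = e" using gen_assoc3[OF x ab(1,2) y(1)] by simp
  moreover have "b \<cdot> y \<in> gen x" using gen_closed(1)[OF x ab(2) y(1)] .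
  ultimately show ?thesis using ab unfolding ginv_def by blast
qed

lemma ginv_uminus: "x \<in> S \<Longrightarrow> ginv x a \<Longrightarrow> ginv x (- a)"
proof -
  assume x: "x \<in> S" "ginv x a"
  then obtain y where y: "a \<in> gen x" "y \<in> gen x" "a \<cdot> y = e" by (auto simp: ginv_def)
  hence "(- a) \<cdot> (- y) = e" by (simp add: jbilin)
  thus ?thesis using gen_closed(4)[OF x(1)] y unfolding ginv_def by blast
qed

lemma ginv_scaleR: "x \<in> S \<Longrightarrow> ginv x a \<Longrightarrow> c \<noteq> 0 \<Longrightarrow> ginv x (c *\<^sub>R a)"
proof -
  assume x: "x \<in> S" "ginv x a" "c \<noteq> 0"
  then obtain y where y: "a \<in> gen x" "y \<in> gen x" "a \<cdot> y = e" by (auto simp: ginv_def)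
  hence "(c *\<^sub>R a) \<cdot> ((1/c) *\<^sub>R y) = e" using x by (simp add: jbilin)
  thus ?thesis using gen_closed(5)[OF x(1)] y unfolding ginv_def by blast
qed

text \<open>Neumann series; its partial sums lie in \<open>gen x\<close>, which is closed.\<close>

lemma ginv_near_unit:
  assumes x: "x \<in> S" and w: "w \<in> gen x" "norm w < 1"
  shows "ginv x (e - w)"
proof -
  define v where "v n = ((\<lambda>u. w \<cdot> u) ^^ n) e" for n
  have v: "v 0 = e" "v (Suc n) = w \<cdot> v n" for n by (simp_all add: v_def)
  have vg: "v n \<in> gen x" for n by (induction n) (use v w gen_unit gen_closed(1)[OF x] in auto)
  have nv: "norm (v n) \<le> norm w ^ n" for n
  proof (induction n)
    case (Suc n)
    thus ?case using order_trans[OF norm_jprod_le[of w "v n"] mult_left_mono[OF Suc]] by (simp add: v)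
  qed (simp add: v norm_unit_le)
  have sum: "summable v" by (rule summable_comparison_test'[OF summable_geometric[of "norm w"] nv]) (use w in simp)
  have "w \<cdot> suminf v = (\<Sum>n. w \<cdot> v n)" by (rule bounded_linear.suminf[OF jprod.bounded_linear_right sum])
  also have "\<dots> = suminf v - v 0" using suminf_split_head[OF sum] by (simp add: v)
  finally have ws: "w \<cdot> suminf v = suminf v - e" by (simp add: v)
  have sg: "suminf v \<in> gen x"
  proof (rule genI[where f = "\<lambda>n. sum v {..<n}"])
    show "(\<lambda>n. sum v {..<n}) \<longlonglongrightarrow> suminf v" using sum by (rule summable_LIMSEQ)
    show "sum v {..<n} \<in> gen x" for n by (rule jb_unital.sum_in[OF gen_unital[OF x]]) (rule vg)
  qed
  have "(e - w) \<cdot> suminf v = e" using gen_in[OF x sg] by (simp add: jbilin ws)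
  thus ?thesis unfolding ginv_def using sg gen_closed(3)[OF x gen_unit w(1)] by blast
qed

text \<open>Divided by \<open>r = norm a + \<epsilon>\<close>, the element differs from
  \<open>e\<close> by some \<open>w\<close> between \<open>0\<close> and
  \<open>(1 - \<epsilon>/r) e\<close>, so the norm of \<open>w\<close> is below \<open>1\<close> and
  the Neumann series applies.\<close>

lemma ginv_positive:
  assumes x: "x \<in> S" and a: "a \<in> gen x" "\<epsilon> > 0" "\<epsilon> *\<^sub>R e \<preceq> a"
  shows "ginv x a"
proof (cases "e = 0")
  case True
  have "a \<cdot> e = e" using carrier_trivial[OF True gen_in[OF x a(1)]] True by (simp add: jprod.zero_right)
  thus ?thesis using a gen_unit[of x] unfolding ginv_def by blast
next
  case False
  define r where "r = norm a + \<epsilon>"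
  have r: "r > 0" "\<epsilon> \<le> r" using a norm_ge_zero[of a] unfolding r_def by linarith+
  have aS: "a \<in> S" using gen_in[OF x a(1)] .
  define w where "w = e - (1/r) *\<^sub>R a"
  have wg: "w \<in> gen x" unfolding w_def by (intro gen_closed[OF x] gen_unit a)
  have wS: "w \<in> S" using gen_in[OF x wg] .
  have "w \<preceq> (1 - \<epsilon> / r) *\<^sub>R e" using le_scaleR_mono[OF a(3), of "1/r"] r by (simp add: le_iff w_def algebra_simps)
  moreover have "- ((1 - \<epsilon> / r) *\<^sub>R e) \<preceq> w"
  proof -
    have "a \<preceq> r *\<^sub>R e" using aS a(2) by (intro le_norm) (auto simp: r_def)
    hence "w \<in> K" using le_scaleR_mono[of a "r *\<^sub>R e" "1/r"] r by (simp add: le_iff w_def)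
    moreover have "(1 - \<epsilon> / r) *\<^sub>R e \<in> K" using r by (intro K_scaleR) auto
    ultimately show ?thesis using K_add by (simp add: le_iff)
  qed
  ultimately have "norm w \<le> 1 - \<epsilon> / r" using norm_le_iff[OF wS, of "1 - \<epsilon> / r"] r by auto
  also have "\<dots> < 1" using r a by simp
  finally have "ginv x (e - w)" by (rule ginv_near_unit[OF x wg])
  hence "ginv x ((1/r) *\<^sub>R a)" by (simp add: w_def) from ginv_scaleR[OF x this, of r] show ?thesis using r by simp
qed

text \<open>The inverse \<open>y = (y y) a\<close> is positive as a product of positive elements of
  \<open>gen x\<close>. Multiplying \<open>r e - y\<close>, which is positive for large
  \<open>r\<close>, by \<open>a\<close> gives \<open>e \<preceq> r a\<close>.\<close>

lemma ginv_bounded_below: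
  assumes x: "x \<in> S" and a: "ginv x a" "a \<in> K"
  shows "\<exists>\<epsilon>>0. \<epsilon> *\<^sub>R e \<preceq> a"
proof -
  obtain y where y: "a \<in> gen x" "y \<in> gen x" "a \<cdot> y = e" using a by (auto simp: ginv_def)
  have S: "y \<in> S" "a \<in> S" using y gen_in x by auto
  have "(y \<cdot> y) \<cdot> a = y" using gen_assoc3[OF x y(2) y(2) y(1)] y S by (simp add: jprod_commute)
  moreover have "(y \<cdot> y) \<cdot> a \<in> K" by (rule gen_K_mult[OF x]) (auto intro: y S a gen_closed(1)[OF x])
  ultimately have yK: "y \<in> K" by simp
  define r where "r = norm y + 1"
  have r: "r > 0" using norm_ge_zero[of y] unfolding r_def by linarith
  have "r *\<^sub>R e - y \<in> K" using le_norm[OF S(1), of r] by (simp add: le_iff r_def)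
  hence "a \<cdot> (r *\<^sub>R e - y) \<in> K" by (intro gen_K_mult[OF x]) (auto intro: y a gen_closed[OF x] gen_unit)
  hence "e \<preceq> r *\<^sub>R a" using y S by (simp add: jbilin le_iff)
  hence "(1/r) *\<^sub>R e \<preceq> a" using le_scaleR_mono[of e "r *\<^sub>R a" "1/r"] r by simp
  thus ?thesis using r by (intro exI[of _ "1/r"]) auto
qed

lemma e_scale_le: "e \<noteq> 0 \<Longrightarrow> r *\<^sub>R e \<preceq> s *\<^sub>R e \<longleftrightarrow> r \<le> s"
proof
  assume e: "e \<noteq> 0" and le: "r *\<^sub>R e \<preceq> s *\<^sub>R e"
  show "r \<le> s"
  proof (rule ccontr)
    assume "\<not> r \<le> s"
    hence "s *\<^sub>R e \<preceq> r *\<^sub>R e" by (intro le_scaleR_left) auto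
    hence "r *\<^sub>R e = s *\<^sub>R e" using le le_antisym by blast
    thus False using e \<open>\<not> r \<le> s\<close> by simp
  qed
qed (rule le_scaleR_left, auto)

text \<open>If \<open>norm a e - a\<close> and \<open>norm a e + a\<close> were both invertible,
  they would be bounded below by some \<open>\<epsilon> e\<close>, and then the order bounds on
  \<open>a\<close> would give it a norm of at most \<open>norm a - \<epsilon>\<close>.\<close>

lemma norm_in_gen_spectrum:
  assumes e: "e \<noteq> 0" and x: "x \<in> S" and a: "a \<in> gen x"
  shows "\<exists>s. \<bar>s\<bar> = norm a \<and> \<not> ginv x (a - s *\<^sub>R e)"
proof (rule ccontr)
  assume "\<not> ?thesis"
  hence g: "ginv x (a - norm a *\<^sub>R e)" "ginv x (a - (- norm a) *\<^sub>R e)"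
    using abs_norm_cancel[of a] abs_minus_cancel[of "norm a"] by metis+
  have aS: "a \<in> S" using gen_in[OF x a] .
  have "ginv x (norm a *\<^sub>R e - a)" using ginv_uminus[OF x g(1)] by simp
  moreover have "norm a *\<^sub>R e - a \<in> K" using le_norm[OF aS, of "norm a"] by (simp add: le_iff)
  ultimately obtain \<delta> where \<delta>: "\<delta> > 0" "\<delta> *\<^sub>R e \<preceq> norm a *\<^sub>R e - a" using ginv_bounded_below[OF x] by blast
  have "norm a *\<^sub>R e + a \<in> K" using le_norm'[OF aS, of "norm a"] by (simp add: le_iff add.commute)
  moreover have "ginv x (norm a *\<^sub>R e + a)" using g(2) by (simp add: add.commute)
  ultimately obtain \<eta> where \<eta>: "\<eta> > 0" "\<eta> *\<^sub>R e \<preceq> norm a *\<^sub>R e + a" using ginv_bounded_below[OF x] by blast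
  define \<epsilon> where "\<epsilon> = min \<delta> \<eta>"
  have \<epsilon>: "\<epsilon> > 0" using \<delta> \<eta> by (simp add: \<epsilon>_def)
  have 1: "\<epsilon> *\<^sub>R e \<preceq> norm a *\<^sub>R e - a" "\<epsilon> *\<^sub>R e \<preceq> norm a *\<^sub>R e + a"
    using le_trans[OF le_scaleR_left[OF unit_in_K] \<delta>(2), of \<epsilon>]
      le_trans[OF le_scaleR_left[OF unit_in_K] \<eta>(2), of \<epsilon>] by (auto simp: \<epsilon>_def)
  have "a \<preceq> (norm a - \<epsilon>) *\<^sub>R e" "- ((norm a - \<epsilon>) *\<^sub>R e) \<preceq> a" using 1 by (simp_all add: le_iff algebra_simps)
  moreover from this have "- ((norm a - \<epsilon>) *\<^sub>R e) \<preceq> (norm a - \<epsilon>) *\<^sub>R e" by (meson le_trans)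
  hence "- (norm a - \<epsilon>) \<le> norm a - \<epsilon>"
    using e_scale_le[OF e, of "- (norm a - \<epsilon>)" "norm a - \<epsilon>"] unfolding scaleR_minus_left by blast
  hence "norm a - \<epsilon> \<ge> 0" by simp
  ultimately have "norm a \<le> norm a - \<epsilon>" using norm_le_iff[OF aS] by blast
  with \<epsilon> show False by simp
qed

lemma gen_shift: "x \<in> S \<Longrightarrow> gen (x - s *\<^sub>R e) = gen x"
proof (intro equalityI subsetI)
  fix a assume x: "x \<in> S"
  { assume "a \<in> gen (x - s *\<^sub>R e)"
    with gen_mono[OF x, of "x - s *\<^sub>R e" a] show "a \<in> gen x"
      by (blast intro: gen_closed[OF x] gen_self[OF x] gen_unit) }
  { assume a: "a \<in> gen x"
    have x': "x - s *\<^sub>R e \<in> S" using x by auto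
    have "(x - s *\<^sub>R e) + s *\<^sub>R e \<in> gen (x - s *\<^sub>R e)" by (intro gen_closed[OF x'] gen_self[OF x'] gen_unit)
    hence "x \<in> gen (x - s *\<^sub>R e)" by simp from gen_mono[OF x' this a] show "a \<in> gen (x - s *\<^sub>R e)" . }
qed

lemma spectrum_iff: "x \<in> S \<Longrightarrow> s \<in> sp x \<longleftrightarrow> \<not> ginv x (x - s *\<^sub>R e)" unfolding jb_spectrum_def jb_invertible_def ginv_def
  using jb_generated_eq[of "x - s *\<^sub>R e"] gen_shift[of x s] gen_self[of "x - s *\<^sub>R e"] by auto

text \<open>Factorisation over the reals: linear factors belong to zeros off the spectrum, quadratic
  ones without real zeros are bounded below by a positive multiple of \<open>e\<close>.\<close>

lemma ginv_peval:
  assumes x: "x \<in> S"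
  shows "p \<noteq> 0 \<Longrightarrow> (\<And>s. s \<in> sp x \<Longrightarrow> poly p s \<noteq> 0) \<Longrightarrow> ginv x (peval e p x)"
proof (induction "degree p" arbitrary: p rule: less_induct)
  case less
  consider "degree p = 0" | s where "poly p s = 0" "degree p > 0" | "degree p > 0" "\<And>s. poly p s \<noteq> 0" by blast
  thus ?case
  proof cases
    case 1
    then obtain c where c: "p = [:c:]" by (rule degree_eq_zeroE)
    have "ginv x e" unfolding ginv_def using gen_unit[of x] unit_left[OF unit_in] by blast
    from ginv_scaleR[OF x this, of c] show ?thesis using less.prems(1) by (simp add: c jprod.zero_right)
  next
    case 2
    then obtain q where q: "p = [:- s, 1:] * q" by (metis dvdE poly_eq_0_iff_dvd)
    have q0: "q \<noteq> 0" using less.prems(1) q by auto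
    have "degree q < degree p" using degree_mult_eq[of "[:- s, 1:]" q] q q0 by simp
    moreover have "poly q t \<noteq> 0" if "t \<in> sp x" for t using less.prems(2)[OF that] q by simp
    ultimately have "ginv x (peval e q x)" using less.hyps q0 by blast
    moreover have "ginv x (x - s *\<^sub>R e)" using spectrum_iff[OF x] less.prems(2) 2 by blast
    moreover have "peval e p x = (x - s *\<^sub>R e) \<cdot> peval e q x"
      unfolding q peval_mult[OF x] using x by (simp add: jprod.zero_right)
    ultimately show ?thesis using ginv_mult[OF x] by presburger
  next
    case 3
    then obtain a b q where q: "b \<noteq> 0" "p = ([:- a, 1:] * [:- a, 1:] + [:b\<^sup>2:]) * q"
      using real_poly_quadratic_factor by blast
    let ?d = "[:- a, 1:] * [:- a, 1:] + [:b\<^sup>2:]"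
    have d: "degree ?d = 2" by simp
    have q0: "q \<noteq> 0" using less.prems(1) q by auto
    have "degree p = 2 + degree q"
      unfolding q(2) using degree_mult_eq[of ?d q] q0 d by (metis degree_0 zero_neq_numeral)
    hence "degree q < degree p" by linarith
    moreover have "poly q t \<noteq> 0" if "t \<in> sp x" for t
      using less.prems(2)[OF that] unfolding q(2) poly_mult by (metis mult_zero_right)
    ultimately have "ginv x (peval e q x)" using less.hyps q0 by blast
    moreover have "ginv x (peval e ?d x)"
    proof (rule ginv_positive[OF x peval_in_gen])
      show "b\<^sup>2 > 0" using q by simp
      show "b\<^sup>2 *\<^sub>R e \<preceq> peval e ?d x" unfolding peval_add peval_mult[OF x] peval_const using x by (simp add: le_iff)
    qed
    moreover have "peval e p x = peval e ?d x \<cdot> peval e q x" unfolding q(2) peval_mult[OF x] ..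
    ultimately show ?thesis using ginv_mult[OF x] by presburger
  qed
qed

lemma spectrum_nonempty: "e \<noteq> 0 \<Longrightarrow> x \<in> S \<Longrightarrow> \<exists>s. s \<in> sp x"
  using norm_in_gen_spectrum[of x x] gen_self spectrum_iff by blast

text \<open>Upper bound: the norm is the modulus of some \<open>s\<close> for which
  \<open>p(x) - s e\<close> is singular, and by \<open>ginv_peval\<close> such an \<open>s\<close>
  is a value of \<open>p\<close> on the spectrum. Lower bound: if a value \<open>p(s)\<close>
  exceeded \<open>B\<close> in modulus, \<open>p(x) - p(s) e\<close> would be invertible by order,
  and so would its factor \<open>x - s e\<close>.\<close>

lemma norm_peval_iff:
  assumes x: "x \<in> S" and B: "0 \<le> B"
  shows "norm (peval e p x) \<le> B \<longleftrightarrow> (\<forall>s\<in>sp x. \<bar>poly p s\<bar> \<le> B)"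
proof
  assume R: "\<forall>s\<in>sp x. \<bar>poly p s\<bar> \<le> B"
  show "norm (peval e p x) \<le> B"
  proof (cases "e = 0")
    case True
    have "peval e p x = 0" by (rule carrier_trivial[OF True]) (use x in auto)
    thus ?thesis using B by simp
  next
    case False
    then obtain s where s: "\<bar>s\<bar> = norm (peval e p x)" "\<not> ginv x (peval e p x - s *\<^sub>R e)"
      using norm_in_gen_spectrum[OF False x peval_in_gen] by blast
    have "peval e p x - s *\<^sub>R e = peval e (p - [:s:]) x" by (simp add: peval_diff peval_const jprod.zero_right)
    with s(2) have ng: "\<not> ginv x (peval e (p - [:s:]) x)" by metis
    show ?thesis
    proof (cases "p - [:s:] = 0")
      case True
      obtain t where "t \<in> sp x" using spectrum_nonempty[OF False x] by blast
      moreover have "poly p t = s" using True by simp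
      ultimately show ?thesis using R s by auto
    next
      case False
      then obtain t where "t \<in> sp x" "poly (p - [:s:]) t = 0" using ginv_peval[OF x False] ng by blast
      thus ?thesis using R s by auto
    qed
  qed
next
  assume n: "norm (peval e p x) \<le> B"
  show "\<forall>s\<in>sp x. \<bar>poly p s\<bar> \<le> B"
  proof (rule ballI, rule ccontr)
    fix s assume s: "s \<in> sp x" and "\<not> \<bar>poly p s\<bar> \<le> B"
    define r where "r = poly p s"
    have r: "\<bar>r\<bar> > B" using \<open>\<not> _\<close> by (simp add: r_def)
    let ?a = "peval e p x"
    have a: "?a \<preceq> B *\<^sub>R e" "- (B *\<^sub>R e) \<preceq> ?a" "?a \<in> S" using norm_le_iff[of ?a B] n B x by auto
    have "ginv x (?a - r *\<^sub>R e)"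
    proof (cases "r > 0")
      case True
      have "ginv x (r *\<^sub>R e - ?a)" by (rule ginv_positive[OF x _ _, of _ "r - B"])
          (use a r True in \<open>auto simp: le_iff algebra_simps intro: gen_closed[OF x] gen_unit peval_in_gen\<close>)
      thus ?thesis using ginv_uminus[OF x] by fastforce
    next
      case False
      show ?thesis by (rule ginv_positive[OF x _ _, of _ "- r - B"])
          (use a r False in \<open>auto simp: le_iff algebra_simps intro: gen_closed[OF x] gen_unit peval_in_gen\<close>)
    qed
    moreover have "?a - r *\<^sub>R e = peval e (p - [:r:]) x" by (simp add: peval_diff peval_const jprod.zero_right)
    moreover have "poly (p - [:r:]) s = 0" by (simp add: r_def)
    then obtain q where q: "p - [:r:] = [:- s, 1:] * q" by (metis dvdE poly_eq_0_iff_dvd)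
    have "peval e (p - [:r:]) x = (x - s *\<^sub>R e) \<cdot> peval e q x"
      unfolding q peval_mult[OF x] using x by (simp add: jprod.zero_right)
    ultimately have "ginv x ((x - s *\<^sub>R e) \<cdot> peval e q x)" by metis
    hence "ginv x (x - s *\<^sub>R e)"
      by (rule ginv_factor[OF x, rotated 2]) (intro gen_closed[OF x] gen_self[OF x] gen_unit peval_in_gen)+
    thus False using s spectrum_iff[OF x] by blast
  qed
qed

lemma spectrum_bounded: "x \<in> S \<Longrightarrow> s \<in> sp x \<Longrightarrow> \<bar>s\<bar> \<le> norm x"
  using norm_peval_iff[of x "norm x" "[:0, 1:]"] peval_id[of x] by auto

text \<open>With \<open>y\<close> the inverse of \<open>x - s e\<close>, one has
  \<open>x - t e = (x - s e)(e - (t - s) y)\<close>, which is invertible for \<open>t\<close> near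
  \<open>s\<close>; so the complement of the spectrum is open.\<close>

lemma compact_spectrum:
  assumes x: "x \<in> S"
  shows "compact (sp x)"
proof -
  have "bounded (sp x)" unfolding bounded_iff using spectrum_bounded[OF x] by auto
  moreover have "open (- sp x)" unfolding open_dist
  proof
    fix s assume "s \<in> - sp x"
    hence g: "ginv x (x - s *\<^sub>R e)" using spectrum_iff[OF x] by simp
    then obtain y where y: "y \<in> gen x" "(x - s *\<^sub>R e) \<cdot> y = e" by (auto simp: ginv_def)
    define \<epsilon> where "\<epsilon> = 1 / (norm y + 1)"
    have "norm y + 1 > 0" using norm_ge_zero[of y] by linarith
    hence \<epsilon>: "\<epsilon> > 0" by (simp add: \<epsilon>_def)
    have "t \<in> - sp x" if t: "dist t s < \<epsilon>" for t
    proof -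
      have yS: "y \<in> S" using gen_in[OF x y(1)] .
      have "norm ((t - s) *\<^sub>R y) < 1"
      proof -
        have "\<bar>t - s\<bar> * norm y \<le> \<bar>t - s\<bar> * (norm y + 1)" by (intro mult_left_mono) auto
        also have "\<dots> < 1" using t \<open>norm y + 1 > 0\<close> unfolding \<epsilon>_def dist_real_def by (simp add: pos_less_divide_eq)
        finally show ?thesis by simp
      qed
      hence "ginv x (e - (t - s) *\<^sub>R y)"
        by (intro ginv_near_unit[OF x]) (auto intro: y gen_closed[OF x]) from ginv_mult[OF x g this]
      have "ginv x ((x - s *\<^sub>R e) \<cdot> (e - (t - s) *\<^sub>R y))" .
      moreover have "(x - s *\<^sub>R e) \<cdot> (e - (t - s) *\<^sub>R y) = x - t *\<^sub>R e"
      proof -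
        have "(x - s *\<^sub>R e) \<cdot> (e - (t - s) *\<^sub>R y) = (x - s *\<^sub>R e) \<cdot> e - (t - s) *\<^sub>R ((x - s *\<^sub>R e) \<cdot> y)"
          by (simp add: jprod.diff_right jprod.scaleR_right)
        also have "\<dots> = x - t *\<^sub>R e" unfolding y(2) using x by (simp add: algebra_simps)
        finally show ?thesis .
      qed
      ultimately show ?thesis using spectrum_iff[OF x] by auto
    qed
    thus "\<exists>\<epsilon>>0. \<forall>t. dist t s < \<epsilon> \<longrightarrow> t \<in> - sp x" using \<epsilon> by blast
  qed
  ultimately show ?thesis by (simp add: compact_eq_bounded_closed closed_def)
qed

section \<open>The continuous functional calculus\<close>

definition unif_approx :: "'a \<Rightarrow> (nat \<Rightarrow> real poly) \<Rightarrow> (real \<Rightarrow> real) \<Rightarrow> bool" where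
  "unif_approx x P g \<longleftrightarrow> uniform_limit (sp x) (\<lambda>n s. poly (P n) s) g sequentially"

lemma unif_approx_exists:
  assumes x: "x \<in> S" and g: "continuous_on (sp x) g"
  shows "\<exists>P. unif_approx x P g"
proof -
  have "\<exists>p. \<forall>s\<in>sp x. \<bar>g s - poly p s\<bar> < 1 / Suc n" for n
  proof -
    obtain h where h: "real_polynomial_function h" "\<And>s. s \<in> sp x \<Longrightarrow> \<bar>g s - h s\<bar> < 1 / Suc n"
      using Stone_Weierstrass_real_polynomial_function[OF compact_spectrum[OF x] g, of "1 / Suc n"] by auto
    then obtain a k where h': "h = (\<lambda>s. \<Sum>i\<le>k. a i * s ^ i)" using real_polynomial_function_iff_sum[of h] by blast
    have "poly (\<Sum>i\<le>k. monom (a i) i) s = h s" for s by (simp add: h' poly_sum poly_monom)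
    thus ?thesis using h(2) by (metis (no_types, lifting))
  qed
  then obtain P where P: "\<And>n s. s \<in> sp x \<Longrightarrow> \<bar>g s - poly (P n) s\<bar> < 1 / Suc n" by metis
  have "uniform_limit (sp x) (\<lambda>n s. poly (P n) s) g sequentially"
  proof (rule uniform_limitI)
    fix \<epsilon> :: real assume "0 < \<epsilon>"
    hence "\<forall>\<^sub>F n in sequentially. 1 / Suc n < \<epsilon>"
      using LIMSEQ_inverse_real_of_nat[unfolded inverse_eq_divide] by (rule order_tendstoD(2)[rotated])
    thus "\<forall>\<^sub>F n in sequentially. \<forall>s\<in>sp x. dist (poly (P n) s) (g s) < \<epsilon>"
    proof (rule eventually_mono, intro ballI)
      fix n s assume n: "1 / real (Suc n) < \<epsilon>" and s: "s \<in> sp x"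
      show "dist (poly (P n) s) (g s) < \<epsilon>" using P[OF s, of n] n by (simp add: dist_real_def abs_minus_commute)
    qed
  qed
  thus ?thesis unfolding unif_approx_def by blast
qed

lemma unif_approxD:
  assumes "unif_approx x P g" "0 < \<epsilon>"
  shows "\<exists>N. \<forall>n\<ge>N. \<forall>s\<in>sp x. \<bar>poly (P n) s - g s\<bar> < \<epsilon>"
  using uniform_limitD[OF assms(1)[unfolded unif_approx_def] assms(2)]
  by (simp add: eventually_sequentially dist_real_def)

lemma unif_approx_close:
  assumes x: "x \<in> S" and P: "unif_approx x P g" and Q: "unif_approx x Q g" and r: "0 < r"
  shows "\<exists>N. \<forall>m\<ge>N. \<forall>n\<ge>N. norm (peval e (P m) x - peval e (Q n) x) < r"
proof -
  obtain N1 where N1: "\<And>n s. n \<ge> N1 \<Longrightarrow> s \<in> sp x \<Longrightarrow> \<bar>poly (P n) s - g s\<bar> < r / 4"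
    using unif_approxD[OF P, of "r / 4"] r by auto
  obtain N2 where N2: "\<And>n s. n \<ge> N2 \<Longrightarrow> s \<in> sp x \<Longrightarrow> \<bar>poly (Q n) s - g s\<bar> < r / 4"
    using unif_approxD[OF Q, of "r / 4"] r by auto
  have "norm (peval e (P m) x - peval e (Q n) x) < r" if mn: "m \<ge> max N1 N2" "n \<ge> max N1 N2" for m n
  proof -
    have "norm (peval e (P m - Q n) x) \<le> r / 2" unfolding norm_peval_iff[OF x less_imp_le[OF half_gt_zero[OF r]]]
    proof
      fix s assume s: "s \<in> sp x"
      show "\<bar>poly (P m - Q n) s\<bar> \<le> r / 2" using N1[OF _ s, of m] N2[OF _ s, of n] mn unfolding poly_diff by linarith
    qed
    thus ?thesis using r by (simp add: peval_diff)
  qed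
  thus ?thesis by blast
qed

lemma unif_approx_unique:
  assumes x: "x \<in> S" and P: "unif_approx x P g" and Q: "unif_approx x Q g"
    and lim: "(\<lambda>n. peval e (P n) x) \<longlonglongrightarrow> a"
  shows "(\<lambda>n. peval e (Q n) x) \<longlonglongrightarrow> a"
proof -
  have "(\<lambda>n. peval e (Q n) x - peval e (P n) x) \<longlonglongrightarrow> 0" using unif_approx_close[OF x Q P] by (intro LIMSEQ_I) (simp, blast)
  from tendsto_add[OF this lim] show ?thesis by simp
qed

lemma unif_approx_convergent: "x \<in> S \<Longrightarrow> unif_approx x P g \<Longrightarrow> convergent (\<lambda>n. peval e (P n) x)"
  by (intro Cauchy_convergent CauchyI unif_approx_close[of x P g P])

text \<open>The chosen approximating sequence does not matter (\<open>fcal_tendsto\<close>), so the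
  laws of the calculus are inherited from polynomials by passing to limits.\<close>

definition fcal :: "'a \<Rightarrow> (real \<Rightarrow> real) \<Rightarrow> 'a" where
  "fcal x g = lim (\<lambda>n. peval e ((SOME P. unif_approx x P g) n) x)"

lemma fcal_tendsto:
  assumes x: "x \<in> S" and P: "unif_approx x P g"
  shows "(\<lambda>n. peval e (P n) x) \<longlonglongrightarrow> fcal x g"
proof -
  have Q: "unif_approx x (SOME P. unif_approx x P g) g" using P by (rule someI[where P = "\<lambda>P. unif_approx x P g"])
  have "(\<lambda>n. peval e ((SOME P. unif_approx x P g) n) x) \<longlonglongrightarrow> fcal x g"
    unfolding fcal_def using unif_approx_convergent[OF x Q] by (simp add: convergent_LIMSEQ_iff)
  thus ?thesis by (rule unif_approx_unique[OF x Q P])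
qed

lemma fcal_poly: "x \<in> S \<Longrightarrow> fcal x (poly p) = peval e p x"
proof -
  assume x: "x \<in> S"
  have "unif_approx x (\<lambda>n. p) (poly p)" by (simp add: unif_approx_def uniform_limit_const)
  from fcal_tendsto[OF x this] show ?thesis by (simp add: LIMSEQ_const_iff)
qed

lemma fcal_add:
  assumes x: "x \<in> S" and "continuous_on (sp x) g" "continuous_on (sp x) h"
  shows "fcal x (\<lambda>s. g s + h s) = fcal x g + fcal x h"
proof -
  obtain P Q where PQ: "unif_approx x P g" "unif_approx x Q h" using unif_approx_exists assms by metis
  have "unif_approx x (\<lambda>n. P n + Q n) (\<lambda>s. g s + h s)"
    using uniform_limit_add[OF PQ[unfolded unif_approx_def]] by (simp add: unif_approx_def)
  from fcal_tendsto[OF x this] tendsto_add[OF fcal_tendsto[OF x PQ(1)] fcal_tendsto[OF x PQ(2)]]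
  show ?thesis by (simp add: peval_add LIMSEQ_unique)
qed

lemma fcal_mult:
  assumes x: "x \<in> S" and g: "continuous_on (sp x) g" and h: "continuous_on (sp x) h"
  shows "fcal x (\<lambda>s. g s * h s) = fcal x g \<cdot> fcal x h"
proof -
  obtain P Q where PQ: "unif_approx x P g" "unif_approx x Q h" using unif_approx_exists assms by metis
  have "bounded (g ` sp x)" "bounded (h ` sp x)"
    using compact_spectrum[OF x] g h compact_continuous_image compact_imp_bounded by blast+
  hence "unif_approx x (\<lambda>n. P n * Q n) (\<lambda>s. g s * h s)"
    using uniform_lim_mult[OF PQ[unfolded unif_approx_def]] by (simp add: unif_approx_def)
  from fcal_tendsto[OF x this] jprod.tendsto[OF fcal_tendsto[OF x PQ(1)] fcal_tendsto[OF x PQ(2)]]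
  show ?thesis by (simp add: peval_mult x LIMSEQ_unique)
qed

lemma fcal_const: "x \<in> S \<Longrightarrow> fcal x (\<lambda>s. c) = c *\<^sub>R e"
proof -
  assume "x \<in> S"
  moreover have "poly [:c:] = (\<lambda>s. c)" by auto
  ultimately show ?thesis using fcal_poly[of x "[:c:]"] by (simp add: jprod.zero_right)
qed

lemma fcal_id: "x \<in> S \<Longrightarrow> fcal x (\<lambda>s. s) = x"
proof -
  assume "x \<in> S"
  moreover have "poly [:0, 1::real:] = (\<lambda>s. s)" by auto
  ultimately show ?thesis using fcal_poly[of x "[:0, 1:]"] by (simp add: jprod.zero_right)
qed

lemma fcal_scaleR:
  assumes x: "x \<in> S" and g: "continuous_on (sp x) g"
  shows "fcal x (\<lambda>s. r * g s) = r *\<^sub>R fcal x g"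
proof -
  obtain P where P: "unif_approx x P g" using unif_approx_exists assms by metis
  have "unif_approx x (\<lambda>n. smult r (P n)) (\<lambda>s. r * g s)"
    using bounded_linear.uniform_limit[OF bounded_linear_mult_right P[unfolded unif_approx_def]]
    by (simp add: unif_approx_def) from fcal_tendsto[OF x this] tendsto_scaleR[OF tendsto_const fcal_tendsto[OF x P]]
  show ?thesis by (simp add: peval_smult LIMSEQ_unique)
qed

lemma fcal_in_gen:
  assumes x: "x \<in> S" and g: "continuous_on (sp x) g"
  shows "fcal x g \<in> gen x"
proof -
  obtain P where P: "unif_approx x P g" using unif_approx_exists assms by metis
  show ?thesis by (rule genI[OF peval_in_gen fcal_tendsto[OF x P]])
qed

lemma fcal_norm:
  assumes x: "x \<in> S" and g: "continuous_on (sp x) g" and B: "0 \<le> B"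
  shows "norm (fcal x g) \<le> B \<longleftrightarrow> (\<forall>s\<in>sp x. \<bar>g s\<bar> \<le> B)"
proof -
  obtain P where P: "unif_approx x P g" using unif_approx_exists assms by metis
  note lim = fcal_tendsto[OF x P]
  show ?thesis
  proof
    assume n: "norm (fcal x g) \<le> B"
    show "\<forall>s\<in>sp x. \<bar>g s\<bar> \<le> B"
    proof (rule ballI, rule field_le_epsilon)
      fix s \<epsilon> :: real assume s: "s \<in> sp x" and \<epsilon>: "0 < \<epsilon>"
      obtain N where N: "\<And>n. n \<ge> N \<Longrightarrow> \<bar>poly (P n) s - g s\<bar> < \<epsilon> / 2" using unif_approxD[OF P, of "\<epsilon> / 2"] s \<epsilon> by auto
      obtain N' where N': "\<And>n. n \<ge> N' \<Longrightarrow> norm (peval e (P n) x - fcal x g) < \<epsilon> / 2"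
        using LIMSEQ_D[OF lim, of "\<epsilon> / 2"] \<epsilon> by auto
      define n where "n = max N N'"
      have "norm (peval e (P n) x) \<le> B + \<epsilon> / 2"
        using N'[of n] n norm_triangle_sub[of "peval e (P n) x" "fcal x g"] by (simp add: n_def)
      hence "\<bar>poly (P n) s\<bar> \<le> B + \<epsilon> / 2" using norm_peval_iff[OF x, of "B + \<epsilon> / 2" "P n"] B \<epsilon> s by simp
      moreover have "\<bar>poly (P n) s - g s\<bar> < \<epsilon> / 2" using N[of n] by (simp add: n_def)
      ultimately show "\<bar>g s\<bar> \<le> B + \<epsilon>" by linarith
    qed
  next
    assume R: "\<forall>s\<in>sp x. \<bar>g s\<bar> \<le> B"
    show "norm (fcal x g) \<le> B"
    proof (rule field_le_epsilon)
      fix \<epsilon> :: real assume \<epsilon>: "0 < \<epsilon>"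
      obtain N where N: "\<And>n s. n \<ge> N \<Longrightarrow> s \<in> sp x \<Longrightarrow> \<bar>poly (P n) s - g s\<bar> < \<epsilon>" using unif_approxD[OF P \<epsilon>] by auto
      have "norm (peval e (P n) x) \<le> B + \<epsilon>" if n: "n \<ge> N" for n
        unfolding norm_peval_iff[OF x add_nonneg_nonneg[OF B less_imp_le[OF \<epsilon>]]]
      proof
        fix s assume s: "s \<in> sp x"
        show "\<bar>poly (P n) s\<bar> \<le> B + \<epsilon>" using N[OF n s] bspec[OF R s] by linarith
      qed
      thus "norm (fcal x g) \<le> B + \<epsilon>" using tendsto_norm[OF lim] by (meson LIMSEQ_le_const2)
    qed
  qed
qed

text \<open>By the isometry on polynomials, a sequence of polynomials in \<open>x\<close> that
  converges in the algebra is uniformly Cauchy on the spectrum; its limit there is the required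
  function.\<close>

lemma fcal_surj:
  assumes x: "x \<in> S" and a: "a \<in> gen x"
  shows "\<exists>g. continuous_on (sp x) g \<and> fcal x g = a"
proof -
  obtain P where P: "(\<lambda>n. peval e (P n) x) \<longlonglongrightarrow> a" using a by (rule genE)
  hence C: "Cauchy (\<lambda>n. peval e (P n) x)" by (rule LIMSEQ_imp_Cauchy)
  have "uniformly_Cauchy_on (sp x) (\<lambda>n s. poly (P n) s)" unfolding uniformly_Cauchy_on_def
  proof (intro allI impI)
    fix \<epsilon> :: real assume \<epsilon>: "0 < \<epsilon>"
    obtain M where M: "\<And>m n. m \<ge> M \<Longrightarrow> n \<ge> M \<Longrightarrow> norm (peval e (P m) x - peval e (P n) x) < \<epsilon> / 2"
      using CauchyD[OF C, of "\<epsilon> / 2"] \<epsilon> by auto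
    have "dist (poly (P m) s) (poly (P n) s) < \<epsilon>" if "s \<in> sp x" "m \<ge> M" "n \<ge> M" for s m n
    proof -
      have "norm (peval e (P m - P n) x) \<le> \<epsilon> / 2" using M[OF that(2,3)] by (simp add: peval_diff)
      hence "\<bar>poly (P m - P n) s\<bar> \<le> \<epsilon> / 2" using norm_peval_iff[OF x, of "\<epsilon> / 2"] \<epsilon> that(1) by simp
      thus ?thesis using \<epsilon> by (simp add: dist_real_def)
    qed
    thus "\<exists>M. \<forall>s\<in>sp x. \<forall>m\<ge>M. \<forall>n\<ge>M. dist (poly (P m) s) (poly (P n) s) < \<epsilon>" by blast
  qed
  then obtain g where g: "uniform_limit (sp x) (\<lambda>n s. poly (P n) s) g sequentially"
    using Cauchy_uniformly_convergent[of "sp x" "\<lambda>n s. poly (P n) s"] by (auto simp: uniformly_convergent_on_def)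
  have "continuous_on (sp x) g"
    by (rule uniform_limit_theorem[OF _ g]) (auto intro!: continuous_intros always_eventually)
  moreover have "fcal x g = a" using fcal_tendsto[OF x, of P g] g P by (auto simp: unif_approx_def intro: LIMSEQ_unique)
  ultimately show ?thesis by blast
qed

lemma is_functional_calculus_fcal:
  assumes x: "x \<in> S"
  shows "is_functional_calculus e x (fcal x)"
proof -
  have "fcal x ` {g. continuous_on (sp x) g} = jb_generated e x"
    unfolding jb_generated_eq[OF x] using fcal_in_gen[OF x] fcal_surj[OF x] by (auto simp: image_iff)
  thus ?thesis unfolding is_functional_calculus_def Let_def
    using fcal_const[OF x, of 1] fcal_id[OF x] fcal_add[OF x] fcal_mult[OF x] fcal_scaleR[OF x] fcal_norm[OF x] by simp
qed

text \<open>The operator \<open>jb_fun_calc\<close> is a definite description, so uniqueness is what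
  identifies it with \<open>fcal\<close>. The algebraic laws fix \<open>\<Phi>\<close> on
  polynomials, and the norm law extends this to their uniform limits.\<close>

lemma functional_calculus_unique:
  assumes x: "x \<in> S" and \<Phi>: "is_functional_calculus e x \<Phi>" and g: "continuous_on (sp x) g"
  shows "\<Phi> g = fcal x g"
proof -
  let ?C = "continuous_on (sp x)"
  have one: "\<Phi> (\<lambda>s. 1) = e" and id: "\<Phi> (\<lambda>s. s) = x"
    and add: "\<And>g h. ?C g \<Longrightarrow> ?C h \<Longrightarrow> \<Phi> (\<lambda>s. g s + h s) = \<Phi> g + \<Phi> h"
    and sc: "\<And>r g. ?C g \<Longrightarrow> \<Phi> (\<lambda>s. r * g s) = r *\<^sub>R \<Phi> g"
    and mul: "\<And>g h. ?C g \<Longrightarrow> ?C h \<Longrightarrow> \<Phi> (\<lambda>s. g s * h s) = \<Phi> g \<cdot> \<Phi> h"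
    and nrm: "\<And>g B. ?C g \<Longrightarrow> 0 \<le> B \<Longrightarrow> norm (\<Phi> g) \<le> B \<longleftrightarrow> (\<forall>s\<in>sp x. \<bar>g s\<bar> \<le> B)"
    using \<Phi> unfolding is_functional_calculus_def Let_def by auto
  have const: "\<Phi> (\<lambda>s. c) = c *\<^sub>R e" for c using sc[of "\<lambda>s. 1" c] one by simp
  have poly: "\<Phi> (poly p) = peval e p x" for p
  proof (induction p)
    case 0
    show ?case using const[of 0] by simp
  next
    case (pCons a p)
    have c: "?C (\<lambda>s. a)" "?C (\<lambda>s. s * poly p s)" "?C (\<lambda>s. s)" "?C (poly p)" by (auto intro!: continuous_intros)
    have eq: "poly (pCons a p) = (\<lambda>s. a + s * poly p s)" by auto
    show ?case unfolding eq add[OF c(1,2)] by (simp add: const mul[OF c(3,4)] id pCons.IH)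
  qed
  obtain P where P: "unif_approx x P g" using unif_approx_exists[OF x g] by blast
  have "(\<lambda>n. peval e (P n) x) \<longlonglongrightarrow> \<Phi> g"
  proof (rule LIMSEQ_I)
    fix r :: real assume r: "0 < r"
    obtain N where N: "\<And>n s. n \<ge> N \<Longrightarrow> s \<in> sp x \<Longrightarrow> \<bar>poly (P n) s - g s\<bar> < r / 2"
      using unif_approxD[OF P, of "r / 2"] r by auto
    have "norm (peval e (P n) x - \<Phi> g) < r" if n: "n \<ge> N" for n
    proof -
      have c: "?C (\<lambda>s. (-1) * g s)" "?C (poly (P n))" "?C (\<lambda>s. poly (P n) s + (-1) * g s)"
        using g by (auto intro!: continuous_intros)
      have "peval e (P n) x - \<Phi> g = \<Phi> (\<lambda>s. poly (P n) s + (-1) * g s)" unfolding add[OF c(2,1)] sc[OF g] poly by simp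
      moreover have "norm \<dots> \<le> r / 2"
      proof (subst nrm[OF c(3)])
        show "\<forall>s\<in>sp x. \<bar>poly (P n) s + - 1 * g s\<bar> \<le> r / 2" using N[OF n] by (auto intro: less_imp_le)
      qed (use r in auto)
      ultimately show ?thesis using r by simp
    qed
    thus "\<exists>N. \<forall>n\<ge>N. norm (peval e (P n) x - \<Phi> g) < r" by blast
  qed
  with fcal_tendsto[OF x P] show ?thesis by (rule LIMSEQ_unique[rotated])
qed

lemma jb_fun_calc_eq:
  assumes x: "x \<in> S" and g: "continuous_on (sp x) g"
  shows "jb_fun_calc e g x = fcal x g" unfolding jb_fun_calc_def
proof (rule the_equality)
  show "\<exists>\<Phi>. is_functional_calculus e x \<Phi> \<and> fcal x g = \<Phi> g" using is_functional_calculus_fcal[OF x] by blast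
  fix y assume "\<exists>\<Phi>. is_functional_calculus e x \<Phi> \<and> y = \<Phi> g"
  thus "y = fcal x g" using functional_calculus_unique[OF x _ g] by blast
qed

end

section \<open>Positivity of the quadratic representation\<close>

context jb_unital
begin

lemma fcal_diff:
  assumes x: "x \<in> S" and g: "continuous_on (sp x) g" and h: "continuous_on (sp x) h"
  shows "fcal x (\<lambda>s. g s - h s) = fcal x g - fcal x h"
  using fcal_add[OF x g, of "\<lambda>s. (-1) * h s"] fcal_scaleR[OF x h, of "-1"] h by (simp add: continuous_on_minus)

lemma fcal_pos:
  assumes x: "x \<in> S" and g: "continuous_on (sp x) g" and pos: "\<And>s. s \<in> sp x \<Longrightarrow> 0 \<le> g s"
  shows "fcal x g \<in> K"
proof (cases "e = 0")
  case True
  thus ?thesis using carrier_trivial[OF True gen_in[OF x fcal_in_gen[OF x g]]] by simp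
next
  case False
  let ?a = "fcal x g"
  have aS: "?a \<in> S" using gen_in[OF x fcal_in_gen[OF x g]] .
  define r where "r = norm ?a + 1"
  have r: "r > 0" "norm ?a \<le> r" unfolding r_def using norm_ge_zero[of ?a] by linarith+
  have le: "\<And>s. s \<in> sp x \<Longrightarrow> \<bar>g s\<bar> \<le> r" using fcal_norm[OF x g, of r] r by auto
  have "fcal x (\<lambda>s. r - g s) = r *\<^sub>R e - ?a" using fcal_diff[OF x _ g, of "\<lambda>s. r"] fcal_const[OF x, of r] by simp
  moreover have "norm (fcal x (\<lambda>s. r - g s)) \<le> r"
  proof (subst fcal_norm[OF x])
    show "continuous_on (sp x) (\<lambda>s. r - g s)" using g by (intro continuous_intros)
    show "\<forall>s\<in>sp x. \<bar>r - g s\<bar> \<le> r" using le pos by (auto simp: abs_le_iff)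
  qed (use r in auto)
  ultimately show ?thesis using K_iff_norm[OF aS r(2,1)] by simp
qed

lemma fcal_K_D:
  assumes x: "x \<in> S" and g: "continuous_on (sp x) g" and K: "fcal x g \<in> K"
    and s: "s \<in> sp x"
  shows "0 \<le> g s"
proof (rule ccontr)
  assume neg: "\<not> 0 \<le> g s"
  define r where "r = norm (fcal x g) + 1"
  have nf: "norm (fcal x g) \<le> r" "r > 0" unfolding r_def using norm_ge_zero[of "fcal x g"] by linarith+
  have "norm (r *\<^sub>R e - fcal x g) \<le> r" using K_iff_norm[OF K_subset[OF K] nf] K by simp
  moreover have cr: "continuous_on (sp x) (\<lambda>s. r - g s)" using g by (intro continuous_intros)
  moreover have "r *\<^sub>R e - fcal x g = fcal x (\<lambda>s. r - g s)"
    using fcal_diff[OF x _ g, of "\<lambda>s. r"] by (simp add: fcal_const x)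
  ultimately have "\<bar>r - g s\<bar> \<le> r" using fcal_norm[OF x cr, of r] nf s by auto
  thus False using neg nf by linarith
qed

lemma fcal_mono:
  assumes x: "x \<in> S" and g: "continuous_on (sp x) g" and h: "continuous_on (sp x) h"
    and le: "\<And>s. s \<in> sp x \<Longrightarrow> g s \<le> h s"
  shows "fcal x g \<preceq> fcal x h" using fcal_pos[OF x, of "\<lambda>s. h s - g s"] fcal_diff[OF x h g] g h le
  by (simp add: le_iff continuous_on_diff)

lemma fcal_cong:
  assumes x: "x \<in> S" and g: "continuous_on (sp x) g" and h: "continuous_on (sp x) h"
    and eq: "\<And>s. s \<in> sp x \<Longrightarrow> g s = h s"
  shows "fcal x g = fcal x h" using fcal_mono[OF x g h] fcal_mono[OF x h g] eq by (intro le_antisym) auto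

lemma spectrum_ge:
  assumes x: "x \<in> S" and c: "c *\<^sub>R e \<preceq> x" and s: "s \<in> sp x"
  shows "c \<le> s"
proof (rule ccontr)
  assume "\<not> c \<le> s"
  moreover have "(c - s) *\<^sub>R e \<preceq> x - s *\<^sub>R e" using c by (simp add: le_iff algebra_simps)
  ultimately have "ginv x (x - s *\<^sub>R e)"
    by (intro ginv_positive[OF x, of _ "c - s"]) (auto intro!: gen_closed[OF x] gen_self x gen_unit)
  with s spectrum_iff[OF x] show False by blast
qed

lemma spectrum_le:
  assumes x: "x \<in> S" and c: "x \<preceq> c *\<^sub>R e" and s: "s \<in> sp x"
  shows "s \<le> c"
proof (rule ccontr)
  assume "\<not> s \<le> c"
  moreover have "(s - c) *\<^sub>R e \<preceq> s *\<^sub>R e - x" using c by (simp add: le_iff algebra_simps)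
  ultimately have "ginv x (s *\<^sub>R e - x)"
    by (intro ginv_positive[OF x, of _ "s - c"]) (auto intro!: gen_closed[OF x] gen_self x gen_unit)
  from ginv_uminus[OF x this] s spectrum_iff[OF x] show False by simp
qed

lemma spectrum_nonneg: "x \<in> K \<Longrightarrow> s \<in> sp x \<Longrightarrow> 0 \<le> s" using spectrum_ge[of x 0 s] K_subset by simp

lemma le_spectrum:
  assumes x: "x \<in> S" and "\<And>s. s \<in> sp x \<Longrightarrow> s \<le> c"
  shows "x \<preceq> c *\<^sub>R e" using fcal_mono[OF x, of "\<lambda>s. s" "\<lambda>s. c"] assms by (simp add: fcal_const fcal_id)

lemma fcal_square: "x \<in> S \<Longrightarrow> fcal x (\<lambda>s. s * s) = x \<cdot> x" using fcal_mult[of x "\<lambda>s. s" "\<lambda>s. s"] by (simp add: fcal_id)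

lemma square_le: "w \<in> K \<Longrightarrow> w \<cdot> w \<preceq> norm w *\<^sub>R w"
proof -
  assume w: "w \<in> K"
  have wS: "w \<in> S" using w K_subset by blast
  have "fcal w (\<lambda>s. s * s) \<preceq> fcal w (\<lambda>s. norm w * s)" by (rule fcal_mono[OF wS])
      (use spectrum_nonneg[OF w] spectrum_le[OF wS le_norm[OF wS order_refl]] in \<open>auto intro!: continuous_intros mult_right_mono\<close>)
  thus ?thesis using fcal_scaleR[OF wS, of "\<lambda>s. s" "norm w"] by (simp add: fcal_square wS fcal_id)
qed

text \<open>Positive and invertible (\<open>spos_iff_ginv\<close>), expressed by a lower bound
  because this form passes to larger elements and to limits of sequences with a common
  bound.\<close>

definition spos :: "'a \<Rightarrow> bool" where
  "spos x \<longleftrightarrow> x \<in> S \<and> (\<exists>\<epsilon>>0. \<epsilon> *\<^sub>R e \<preceq> x)"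

lemma spos_in: "spos x \<Longrightarrow> x \<in> S" by (simp add: spos_def)

lemma spos_K: "spos x \<Longrightarrow> x \<in> K"
proof -
  assume "spos x"
  then obtain \<epsilon> where "\<epsilon> > 0" "\<epsilon> *\<^sub>R e \<preceq> x" by (auto simp: spos_def)
  with K_add[OF K_scaleR[OF unit_in_K, of \<epsilon>], of "x - \<epsilon> *\<^sub>R e"] show ?thesis by (simp add: le_iff)
qed

lemma spos_unit [simp]: "spos e" unfolding spos_def by (auto intro!: exI[of _ 1])

lemma sposI: "x \<in> S \<Longrightarrow> \<epsilon> > 0 \<Longrightarrow> \<epsilon> *\<^sub>R e \<preceq> x \<Longrightarrow> spos x" by (auto simp: spos_def)

lemma spos_mono: "spos x \<Longrightarrow> x \<preceq> y \<Longrightarrow> y \<in> S \<Longrightarrow> spos y" unfolding spos_def using le_trans by blast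

lemma spos_add: "spos x \<Longrightarrow> y \<in> K \<Longrightarrow> spos (x + y)" by (rule spos_mono[of x]) (auto simp: le_iff intro: spos_in K_subset)

lemma spos_scaleR: "spos x \<Longrightarrow> 0 < r \<Longrightarrow> spos (r *\<^sub>R x)"
proof -
  assume x: "spos x" and r: "0 < r"
  then obtain \<epsilon> where \<epsilon>: "\<epsilon> > 0" "\<epsilon> *\<^sub>R e \<preceq> x" by (auto simp: spos_def)
  thus ?thesis using le_scaleR_mono[OF \<epsilon>(2), of r] r spos_in[OF x] by (intro sposI[of _ "r * \<epsilon>"]) auto
qed

lemma spos_near_unit:
  assumes v: "v \<in> S" "norm v < 1"
  shows "spos (e + v)"
proof (rule sposI)
  show "(1 - norm v) *\<^sub>R e \<preceq> e + v" using le_norm'[OF v(1) order_refl] by (simp add: le_iff algebra_simps)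
qed (use v in auto)

lemma spos_spectrum: "spos x \<Longrightarrow> s \<in> sp x \<Longrightarrow> 0 < s" unfolding spos_def using spectrum_ge[of x _ s] by fastforce

lemma spos_iff_ginv: "x \<in> K \<Longrightarrow> spos x \<longleftrightarrow> 0 \<notin> sp x"
proof
  assume x: "x \<in> K" and "0 \<notin> sp x"
  hence "ginv x x" using spectrum_iff[of x 0] K_subset by simp
  thus "spos x" using ginv_bounded_below[of x x] x K_subset unfolding spos_def by blast
qed (use spos_spectrum in blast)

abbreviation jinv :: "'a \<Rightarrow> 'a" where "jinv \<equiv> jb_inverse e"

lemma continuous_inverse_spectrum:
  "spos x \<Longrightarrow> continuous_on (sp x) inverse" using spos_spectrum by (intro continuous_intros) auto

lemma jinv_fcal: "spos x \<Longrightarrow> jinv x = fcal x inverse" unfolding jb_inverse_def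
  by (rule jb_fun_calc_eq) (auto intro: spos_in continuous_inverse_spectrum)

lemma jinv_gen: "spos x \<Longrightarrow> jinv x \<in> gen x" by (simp add: jinv_fcal fcal_in_gen spos_in continuous_inverse_spectrum)

lemma jinv_in: "spos x \<Longrightarrow> jinv x \<in> S" using jinv_gen gen_in spos_in by blast

lemma jinv_right: "spos x \<Longrightarrow> x \<cdot> jinv x = e"
proof -
  assume x: "spos x"
  have xS: "x \<in> S" using x by (rule spos_in)
  have "x \<cdot> jinv x = fcal x (\<lambda>s. s * inverse s)" using fcal_mult[OF xS _ continuous_inverse_spectrum[OF x], of "\<lambda>s. s"]
    by (simp add: jinv_fcal[OF x] fcal_id xS)
  also have "\<dots> = fcal x (\<lambda>s. 1)"
    by (rule fcal_cong[OF xS]) (use spos_spectrum[OF x] in \<open>force intro!: continuous_intros\<close>)+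
  finally show ?thesis using fcal_const[OF xS, of 1] by simp
qed

lemma jinv_spos: "spos x \<Longrightarrow> spos (jinv x)"
proof -
  assume x: "spos x"
  have xS: "x \<in> S" using x by (rule spos_in)
  define r where "r = norm x + 1"
  have r: "r > 0" "x \<preceq> r *\<^sub>R e" using norm_ge_zero[of x] le_norm[OF xS, of r] unfolding r_def by (linarith, simp)
  have "fcal x (\<lambda>s. 1 / r) \<preceq> fcal x inverse"
  proof (rule fcal_mono[OF xS])
    fix s assume "s \<in> sp x"
    hence "s \<le> r" "0 < s" using spectrum_le[OF xS r(2)] spos_spectrum[OF x] by auto
    thus "1 / r \<le> inverse s" using r by (simp add: field_simps)
  qed (use continuous_inverse_spectrum[OF x] in auto)
  thus ?thesis using r jinv_in[OF x] by (intro sposI[of _ "1 / r"]) (auto simp: fcal_const xS jinv_fcal x)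
qed

text \<open>In a Jordan algebra the equation \<open>a \<cdot> b = e\<close> alone does not determine
  \<open>b\<close>; inside an associative subalgebra it does. Inverses are therefore identified by
  exhibiting candidates in \<open>gen x\<close>.\<close>

lemma gen_inverse_unique:
  assumes x: "x \<in> S" and abc: "a \<in> gen x" "b \<in> gen x" "c \<in> gen x" "a \<cdot> b = e" "a \<cdot> c = e"
  shows "b = c"
proof -
  have "(b \<cdot> a) \<cdot> c = b \<cdot> (a \<cdot> c)" by (rule gen_assoc3[OF x abc(2,1,3)])
  thus ?thesis using abc gen_in[OF x] by (simp add: jprod_commute[of b a])
qed

lemma jinv_unique: "spos x \<Longrightarrow> y \<in> gen x \<Longrightarrow> x \<cdot> y = e \<Longrightarrow> jinv x = y"
  by (rule gen_inverse_unique[of x x "jinv x" y]) (simp_all add: spos_in gen_self jinv_gen jinv_right)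

lemma jinv_unit [simp]: "jinv e = e" by (rule jinv_unique) (auto intro: gen_unit)

lemma quad_rep_gen:
  assumes x: "x \<in> S" and ab: "a \<in> gen x" "b \<in> gen x"
  shows "U a b = (a \<cdot> a) \<cdot> b" using gen_assoc3[OF x ab(1) ab(1) ab(2)] by (simp add: quad_rep_def scaleR_2)

text \<open>If \<open>a\<close> is a square \<open>c c\<close>, this is the fundamental formula,
  because \<open>U b\<close> and \<open>U c\<close> commute. In general \<open>a + l e\<close> is a
  square for all large \<open>l\<close>. The terms quadratic in \<open>l\<close> agree, so the
  defect equals \<open>l D\<close> with \<open>D\<close> independent of \<open>l\<close>; two values
  of \<open>l\<close> force \<open>D = 0\<close>.\<close>

lemma gen_quad_rep:
  assumes x: "x \<in> S" and ab: "a \<in> gen x" "b \<in> gen x" and z: "z \<in> S"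
  shows "U a (U b z) = U (a \<cdot> b) z"
proof -
  note S = gen_in[OF x]
  have comm: "q \<cdot> U c w = U c (q \<cdot> w)" if "q \<in> gen x" "c \<in> gen x" "w \<in> S" for q c w
    using gen_assoc[OF x that(1,2)] gen_assoc[OF x that(1) gen_closed(1)[OF x that(2,2)]] that(3) S[OF that(2)]
    by (simp add: quad_rep_def jbilin)
  have sq: "U (c \<cdot> c) (U b z) = U ((c \<cdot> c) \<cdot> b) z" if c: "c \<in> gen x" for c
  proof -
    have bb: "b \<cdot> b \<in> gen x" by (rule gen_closed(1)[OF x ab(2,2)])
    have "U b (U c z) = 2 *\<^sub>R U c (b \<cdot> (b \<cdot> z)) - U c ((b \<cdot> b) \<cdot> z)"
      unfolding quad_rep_def[of b] using comm[OF ab(2) c] comm[OF bb c] z S[OF ab(2)] by simp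
    hence "U b (U c z) = U c (U b z)" by (simp add: quad_rep_def[of b] quad_rep_diff quad_rep_scaleR)
    moreover have "U (c \<cdot> c) y = U c (U c y)" if "y \<in> S" for y using fundamental_formula[of c e y] S[OF c] that by simp
    ultimately show ?thesis using fundamental_formula[of c b z] quad_rep_gen[OF x c ab(2)] z S[OF ab(2)] by simp
  qed
  define y where "y = U b z"
  define D where "D = 2 *\<^sub>R (jtriple (a \<cdot> b) z b - jtriple a y e)"
  have yS: "y \<in> S" using z S[OF ab(2)] by (simp add: y_def)
  have shift: "U a y - U (a \<cdot> b) z = l *\<^sub>R D" if l: "norm a \<le> l" for l
  proof -
    have al: "a + l *\<^sub>R e \<in> gen x" by (intro gen_closed x ab gen_unit)
    have "a + l *\<^sub>R e \<in> K" using le_norm'[OF S[OF ab(1)] l] by (simp add: le_iff)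
    then obtain c where c: "c \<in> gen (a + l *\<^sub>R e)" "c \<cdot> c = a + l *\<^sub>R e" using K_sqrt by blast
    have "U (a + l *\<^sub>R e) y = U (a \<cdot> b + l *\<^sub>R b) z"
      using sq[OF gen_mono[OF x al c(1)]] c(2) S[OF ab(2)] by (simp add: y_def jbilin)
    thus ?thesis unfolding quad_rep_add_left using yS
      by (simp add: quad_rep_scaleR_left y_def[symmetric] D_def jtriple_def jbilin algebra_simps)
  qed
  have "(norm a + 1) *\<^sub>R D = (norm a + 2) *\<^sub>R D" using shift[of "norm a + 1"] shift[of "norm a + 2"] by simp
  hence "D = 0" by simp
  thus ?thesis using shift[of "norm a"] by (simp add: y_def)
qed

lemma quad_rep_jinv: "spos x \<Longrightarrow> z \<in> S \<Longrightarrow> U x (U (jinv x) z) = z"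
  using gen_quad_rep[of x x "jinv x" z] jinv_right[of x] by (simp add: spos_in gen_self jinv_gen)

lemma quad_rep_jinv': "spos x \<Longrightarrow> z \<in> S \<Longrightarrow> U (jinv x) (U x z) = z" using gen_quad_rep[of x "jinv x" x z] jinv_right[of x]
  by (simp add: spos_in gen_self jinv_gen jprod_commute)

lemma quad_rep_self_jinv: "spos x \<Longrightarrow> U x (jinv x) = x"
proof -
  assume x: "spos x"
  have xS: "x \<in> S" using x by (rule spos_in)
  have "U x (jinv x) = x \<cdot> (x \<cdot> jinv x)" using quad_rep_gen[OF xS gen_self[OF xS] jinv_gen[OF x]]
      gen_assoc3[OF xS gen_self[OF xS] gen_self[OF xS] jinv_gen[OF x]] by simp
  thus ?thesis using x xS by (simp add: jinv_right)
qed

lemma quad_rep_inj: "spos x \<Longrightarrow> y \<in> S \<Longrightarrow> z \<in> S \<Longrightarrow> U x y = U x z \<Longrightarrow> y = z" by (metis quad_rep_jinv')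

lemma jinv_jinv: "spos x \<Longrightarrow> jinv (jinv x) = x"
proof -
  assume x: "spos x"
  have xS: "x \<in> S" using x by (rule spos_in)
  show ?thesis by (rule gen_inverse_unique[OF xS, of "jinv x"])
      (use x xS gen_mono[OF xS jinv_gen[OF x]] jinv_gen[OF jinv_spos[OF x]] jinv_gen[OF x] gen_self jinv_right[OF x]
        jinv_right[OF jinv_spos[OF x]] in \<open>auto simp: jprod_commute\<close>)
qed

text \<open>If \<open>0\<close> were a spectral value, a bump function \<open>g\<close> concentrated
  within \<open>\<delta>\<close> of \<open>0\<close> would give an element \<open>g(v)\<close> of
  norm at least \<open>1\<close> whose image under \<open>U v\<close> has norm at most
  \<open>\<delta>^2\<close>.\<close>

lemma spos_of_bounded_below:
  assumes v: "v \<in> K" and C: "\<And>z. z \<in> S \<Longrightarrow> norm z \<le> C * norm (U v z)"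
  shows "spos v"
proof (rule ccontr)
  assume "\<not> spos v"
  hence 0: "0 \<in> sp v" using spos_iff_ginv[OF v] by blast
  have vS: "v \<in> S" using v K_subset by blast
  \<comment> \<open>With these constants
    \<open>C \<delta>^2 \<le> D \<delta>^2 = \<delta> \<le> 1\<close>, so the estimate leaves only
    \<open>\<delta> = 1\<close>, hence \<open>C = 0\<close>, which is absurd.\<close>
  define D where "D = \<bar>C\<bar> + 1"
  define \<delta> where "\<delta> = 1 / D"
  have D: "D \<ge> 1" "C \<le> D" by (auto simp: D_def)
  have \<delta>: "\<delta> > 0" "\<delta> \<le> 1" using D by (auto simp: \<delta>_def)
  define g where "g s = max 0 (1 - \<bar>s\<bar> / \<delta>)" for s
  have gc: "continuous_on (sp v) g" unfolding g_def by (intro continuous_intros) (use \<delta> in auto)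
  have "norm (fcal v g) \<ge> 1" using fcal_norm[OF vS gc, of "norm (fcal v g)"] 0 by (auto simp: g_def)
  moreover have "U v (fcal v g) = fcal v (\<lambda>s. (s * s) * g s)"
    using quad_rep_gen[OF vS gen_self[OF vS] fcal_in_gen[OF vS gc]]
      fcal_mult[OF vS _ gc, of "\<lambda>s. s * s"] fcal_square[OF vS] by (auto simp: continuous_intros)
  moreover have "norm (fcal v (\<lambda>s. (s * s) * g s)) \<le> \<delta> * \<delta>"
  proof (subst fcal_norm[OF vS])
    show "\<forall>s\<in>sp v. \<bar>s * s * g s\<bar> \<le> \<delta> * \<delta>"
    proof
      fix s assume "s \<in> sp v"
      show "\<bar>s * s * g s\<bar> \<le> \<delta> * \<delta>"
      proof (cases "\<bar>s\<bar> \<le> \<delta>")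
        case True
        have "\<bar>s\<bar> * \<bar>s\<bar> \<le> \<delta> * \<delta>" using True by (intro mult_mono) auto
        moreover have "0 \<le> g s" "g s \<le> 1" using \<delta> by (auto simp: g_def)
        ultimately have "(\<bar>s\<bar> * \<bar>s\<bar>) * g s \<le> (\<delta> * \<delta>) * 1" by (intro mult_mono[of "\<bar>s\<bar> * \<bar>s\<bar>" "\<delta> * \<delta>"]) (use \<delta> in auto)
        thus ?thesis using \<open>0 \<le> g s\<close> by (simp add: abs_mult)
      next
        case False
        hence "g s = 0" using \<delta> by (simp add: g_def field_simps)
        thus ?thesis by simp
      qed
    qed
    show "continuous_on (sp v) (\<lambda>s. s * s * g s)" by (intro continuous_intros gc)
  qed (use \<delta> in auto)
  ultimately have "1 \<le> C * norm (U v (fcal v g))" "norm (U v (fcal v g)) \<le> \<delta> * \<delta>"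
    using C[OF gen_in[OF vS fcal_in_gen[OF vS gc]]] by auto
  moreover have "C * norm (U v (fcal v g)) \<le> D * (\<delta> * \<delta>)" using D calculation by (intro mult_mono) auto
  moreover have "D * (\<delta> * \<delta>) = \<delta>" using D by (simp add: \<delta>_def)
  ultimately have "\<delta> = 1" using \<delta> by linarith
  hence "D = 1" using D by (simp add: \<delta>_def)
  hence "C = 0" by (simp add: D_def)
  with \<open>1 \<le> C * norm (U v (fcal v g))\<close> show False by simp
qed

text \<open>The fundamental formula writes \<open>U (U c y)\<close> as \<open>U c\<close>,
  \<open>U y\<close>, \<open>U c\<close> in succession, and each of these has a bounded
  inverse.\<close>

lemma quad_rep_spos_bounded_below:
  assumes c: "spos c" and y: "spos y"
  shows "\<exists>C. \<forall>z\<in>S. norm z \<le> C * norm (U (U c y) z)"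
proof -
  let ?W = "\<lambda>u. U (jinv c) (U (jinv y) (U (jinv c) u))"
  have "bounded_linear ?W" by (rule bounded_linear_compose[OF bounded_linear_quad_rep
          bounded_linear_compose[OF bounded_linear_quad_rep bounded_linear_quad_rep]])
  then obtain C where C: "\<And>u. norm (?W u) \<le> norm u * C" using bounded_linear.bounded by blast
  have "norm z \<le> C * norm (U (U c y) z)" if z: "z \<in> S" for z
  proof -
    have S: "c \<in> S" "y \<in> S" using c y spos_in by auto
    have "?W (U (U c y) z) = z" unfolding fundamental_formula using c y z S by (simp add: quad_rep_jinv')
    thus ?thesis using C[of "U (U c y) z"] by (simp add: mult.commute)
  qed
  thus ?thesis by blast
qed

lemma spos_square: "spos c \<Longrightarrow> spos (c \<cdot> c)"
proof -
  assume c: "spos c"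
  then obtain \<epsilon> where \<epsilon>: "\<epsilon> > 0" "\<epsilon> *\<^sub>R e \<preceq> c" by (auto simp: spos_def)
  have cS: "c \<in> S" using c by (rule spos_in)
  have "fcal c (\<lambda>s. \<epsilon> * \<epsilon>) \<preceq> fcal c (\<lambda>s. s * s)"
  proof (rule fcal_mono[OF cS])
    fix s assume "s \<in> sp c"
    hence "\<epsilon> \<le> s" using spectrum_ge[OF cS \<epsilon>(2)] by blast
    thus "\<epsilon> * \<epsilon> \<le> s * s" using \<epsilon>(1) by (intro mult_mono) auto
  qed (auto intro!: continuous_intros)
  thus ?thesis using \<epsilon> cS by (intro sposI[of _ "\<epsilon> * \<epsilon>"]) (auto simp: fcal_const fcal_square)
qed

text \<open>By the fundamental formula no element of the segment from \<open>c\<^sup>2\<close> to \<open>U\<^sub>c y\<close> is singular,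
  so the segment cannot leave the cone.\<close>

lemma quad_rep_spos_pos:
  assumes c: "spos c" and y: "spos y"
  shows "U c y \<in> K"
proof -
  have S: "c \<in> S" "y \<in> S" using c y spos_in by auto
  define Y where "Y t = (1 - t) *\<^sub>R e + t *\<^sub>R y" for t :: real
  define V where "V t = U c (Y t)" for t
  have YS: "Y t \<in> S" for t using S by (auto simp: Y_def)
  have Ypos: "spos (Y t)" if "0 \<le> t" "t \<le> 1" for t
  proof (cases "t = 1")
    case False
    thus ?thesis unfolding Y_def using that y by (intro spos_add spos_scaleR K_scaleR spos_K) auto
  qed (use y in \<open>simp add: Y_def\<close>)
  have VS: "V t \<in> S" for t using S YS by (auto simp: V_def)
  let ?T = "{t. V t \<in> K} \<inter> {0..1}"
  have Vcont: "continuous_on UNIV V" unfolding V_def Y_def by (intro continuous_intros)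
  have "closed {t. V t \<in> K}" using closed_vimage[OF closed_K Vcont] by (simp add: vimage_def)
  hence "compact ?T" by (intro closed_Int_compact compact_Icc)
  moreover have "0 \<in> ?T" using S by (simp add: V_def Y_def)
  ultimately obtain t where t: "t \<in> ?T" and max: "\<And>u. u \<in> ?T \<Longrightarrow> u \<le> t" using compact_attains_sup[of ?T] by blast
  have "spos (V t)"
  proof -
    obtain C where "\<forall>z\<in>S. norm z \<le> C * norm (U (V t) z)"
      using quad_rep_spos_bounded_below[OF c Ypos, of t] t unfolding V_def by auto
    thus ?thesis using t by (intro spos_of_bounded_below) auto
  qed
  then obtain \<epsilon> where \<epsilon>: "\<epsilon> > 0" "\<epsilon> *\<^sub>R e \<preceq> V t" by (auto simp: spos_def)
  have "t = 1"
  proof (rule ccontr)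
    assume "t \<noteq> 1"
    hence t1: "t < 1" "0 \<le> t" using t by auto
    define D where "D = V 1 - V 0"
    have DS: "D \<in> S" using VS by (simp add: D_def)
    define h where "h = min (1 - t) (\<epsilon> / (norm D + 1))"
    have nD: "norm D + 1 > 0" using norm_ge_zero[of D] by linarith
    have h: "h > 0" "t + h \<le> 1" using t1 \<epsilon> nD by (auto simp: h_def)
    have hD: "norm (h *\<^sub>R D) \<le> \<epsilon>"
    proof -
      have "h * norm D \<le> \<epsilon> / (norm D + 1) * (norm D + 1)" using h \<epsilon> nD by (intro mult_mono) (auto simp: h_def)
      thus ?thesis using h nD by simp
    qed
    have "V (t + h) = V t + h *\<^sub>R D"
      unfolding V_def Y_def D_def by (simp add: quad_rep_add quad_rep_diff quad_rep_scaleR algebra_simps)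
    moreover have "0 \<preceq> V t + h *\<^sub>R D" using le_add_mono[OF \<epsilon>(2) le_norm'[OF scaleR_in[OF DS] hD]] by simp
    ultimately have "t + h \<in> ?T" using h t1 by simp
    with max[of "t + h"] h show False by simp
  qed
  with t show ?thesis by (simp add: V_def Y_def)
qed

lemma quad_rep_spos_K:
  assumes c: "spos c" and y: "y \<in> K"
  shows "U c y \<in> K"
proof (rule K_closed)
  show "U c (y + (1 / real (Suc n)) *\<^sub>R e) \<in> K" for n
    using spos_add[OF spos_scaleR[OF spos_unit, of "1 / real (Suc n)"] y]
    by (intro quad_rep_spos_pos c) (simp add: add.commute)
  have "(\<lambda>n. U c (y + (1 / real (Suc n)) *\<^sub>R e)) \<longlonglongrightarrow> U c (y + 0 *\<^sub>R e)"
    by (intro tendsto_intros LIMSEQ_inverse_real_of_nat[unfolded inverse_eq_divide])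
  thus "(\<lambda>n. U c (y + (1 / real (Suc n)) *\<^sub>R e)) \<longlonglongrightarrow> U c y" by simp
qed

lemma quad_rep_mono_spos: "spos c \<Longrightarrow> x \<preceq> y \<Longrightarrow> U c x \<preceq> U c y"
  using quad_rep_spos_K[of c "y - x"] by (simp add: le_iff quad_rep_diff)

lemma quad_rep_spos_spos:
  assumes c: "spos c" and y: "spos y"
  shows "spos (U c y)"
proof -
  obtain \<epsilon> where \<epsilon>: "\<epsilon> > 0" "\<epsilon> *\<^sub>R e \<preceq> y" using y by (auto simp: spos_def)
  have S: "c \<in> S" "y \<in> S" using c y spos_in by auto
  have "\<epsilon> *\<^sub>R (c \<cdot> c) \<preceq> U c y" using quad_rep_mono_spos[OF c \<epsilon>(2)] S by (simp add: quad_rep_scaleR)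
  thus ?thesis using spos_mono[OF spos_scaleR[OF spos_square[OF c] \<epsilon>(1)]] S by auto
qed

text \<open>By the fundamental formula both sides are sent to \<open>U c y\<close> by the operator
  \<open>U (U c y)\<close>, which is injective.\<close>

lemma jinv_quad_rep:
  assumes c: "spos c" and y: "spos y"
  shows "jinv (U c y) = U (jinv c) (jinv y)"
proof -
  let ?v = "U c y"
  have v: "spos ?v" using c y by (rule quad_rep_spos_spos)
  have S: "c \<in> S" "y \<in> S" "jinv c \<in> S" "jinv y \<in> S" using c y spos_in jinv_in by auto
  have "U ?v (U (jinv c) (jinv y)) = ?v"
    unfolding fundamental_formula using c y S by (simp add: quad_rep_jinv quad_rep_self_jinv)
  thus ?thesis using quad_rep_inj[OF v, of "jinv ?v" "U (jinv c) (jinv y)"] quad_rep_self_jinv[OF v] jinv_in[OF v] S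
    by simp
qed

definition jsq :: "'a \<Rightarrow> 'a" where "jsq x = fcal x sqrt"

lemma jb_sqrt_eq: "x \<in> K \<Longrightarrow> jb_sqrt e x = jsq x" unfolding jb_sqrt_def jsq_def
  by (rule jb_fun_calc_eq) (auto intro: K_subset continuous_on_real_sqrt)

lemma jsq_gen: "x \<in> K \<Longrightarrow> jsq x \<in> gen x"
  unfolding jsq_def by (rule fcal_in_gen) (auto intro: K_subset continuous_on_real_sqrt)

lemma jsq_in: "x \<in> K \<Longrightarrow> jsq x \<in> S" using jsq_gen gen_in K_subset by blast

lemma jsq_square: "x \<in> K \<Longrightarrow> jsq x \<cdot> jsq x = x"
proof -
  assume x: "x \<in> K"
  have xS: "x \<in> S" using x K_subset by blast
  have c: "continuous_on (sp x) sqrt" by (intro continuous_intros)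
  have "jsq x \<cdot> jsq x = fcal x (\<lambda>s. sqrt s * sqrt s)" unfolding jsq_def using fcal_mult[OF xS c c] by simp
  also have "\<dots> = fcal x (\<lambda>s. s)"
    by (rule fcal_cong[OF xS]) (use spectrum_nonneg[OF x] in \<open>auto intro!: continuous_intros\<close>)
  finally show ?thesis by (simp add: fcal_id xS)
qed

lemma jsq_K: "x \<in> K \<Longrightarrow> jsq x \<in> K"
  unfolding jsq_def by (rule fcal_pos) (auto intro: K_subset spectrum_nonneg continuous_on_real_sqrt)

lemma jsq_spos: "spos x \<Longrightarrow> spos (jsq x)"
proof -
  assume x: "spos x"
  then obtain \<epsilon> where \<epsilon>: "\<epsilon> > 0" "\<epsilon> *\<^sub>R e \<preceq> x" by (auto simp: spos_def)
  have xS: "x \<in> S" using x by (rule spos_in)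
  have "fcal x (\<lambda>s. sqrt \<epsilon>) \<preceq> fcal x sqrt"
    by (rule fcal_mono[OF xS]) (use spectrum_ge[OF xS \<epsilon>(2)] in \<open>auto intro!: continuous_intros\<close>)
  thus ?thesis using \<epsilon> xS jsq_in[OF spos_K[OF x]] by (intro sposI[of _ "sqrt \<epsilon>"]) (auto simp: fcal_const jsq_def)
qed

text \<open>The root \<open>jsq (c \<cdot> c)\<close> lies in \<open>gen c\<close>, so it is
  \<open>g(c)\<close> for a continuous \<open>g\<close> with \<open>g(s)^2 = s^2\<close> and
  \<open>g(s) \<ge> 0\<close> on the spectrum of \<open>c\<close>, which forces
  \<open>g(s) = s\<close>.\<close>

lemma sqrt_unique:
  assumes a: "a \<in> K" and b: "b \<in> K" and eq: "a \<cdot> a = b \<cdot> b"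
  shows "a = b"
proof -
  have *: "c = jsq (c \<cdot> c)" if c: "c \<in> K" for c
  proof -
    have cS: "c \<in> S" using c K_subset by blast
    have cc: "c \<cdot> c \<in> K" using cS by simp
    have "c \<cdot> c \<in> gen c" using gen_closed(1)[OF cS gen_self[OF cS] gen_self[OF cS]] .
    from gen_mono[OF cS this jsq_gen[OF cc]] have jg: "jsq (c \<cdot> c) \<in> gen c" .
    then obtain g where g: "continuous_on (sp c) g" "fcal c g = jsq (c \<cdot> c)" using fcal_surj[OF cS] by blast
    have "fcal c (\<lambda>s. s * s - g s * g s) = 0"
    proof -
      have c2: "continuous_on (sp c) (\<lambda>s. s * s)" "continuous_on (sp c) (\<lambda>s. g s * g s)"
        using g by (auto intro!: continuous_intros)
      show ?thesis
        unfolding fcal_diff[OF cS c2] fcal_mult[OF cS g(1) g(1)] fcal_square[OF cS] g(2) jsq_square[OF cc] by simp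
    qed
    moreover have "continuous_on (sp c) (\<lambda>s. s * s - g s * g s)" using g by (intro continuous_intros)
    ultimately have sq: "s * s = g s * g s" if "s \<in> sp c" for s
      using fcal_norm[OF cS, of "\<lambda>s. s * s - g s * g s" 0] that by simp
    have gpos: "0 \<le> g s" if s: "s \<in> sp c" for s by (rule fcal_K_D[OF cS g(1) _ s]) (simp add: g(2) jsq_K[OF cc])
    have "s = g s" if "s \<in> sp c" for s using sq[OF that] gpos[OF that] spectrum_nonneg[OF c that]
      by (metis abs_of_nonneg real_sqrt_mult_self real_sqrt_abs2)
    hence "fcal c (\<lambda>s. s) = fcal c g" by (intro fcal_cong[OF cS _ g(1)]) auto
    thus ?thesis using g(2) by (simp add: fcal_id cS)
  qed
  show ?thesis using *[OF a] *[OF b] eq by metis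
qed

text \<open>For \<open>y = b\<^sup>2\<close> invertible, \<open>U\<^sub>b U\<^sub>a y = U\<^sub>b U\<^sub>a U\<^sub>b e = (U\<^sub>b a)\<^sup>2\<close>.\<close>

theorem quad_rep_K:
  assumes a: "a \<in> S" and y: "y \<in> K"
  shows "U a y \<in> K"
proof -
  have pos: "U a z \<in> K" if z: "spos z" for z
  proof -
    define b where "b = jsq z"
    have b: "spos b" "b \<cdot> b = z" using jsq_spos[OF z] jsq_square[OF spos_K[OF z]] by (auto simp: b_def)
    have S: "b \<in> S" "z \<in> S" using b z spos_in by auto
    have "U b (U a z) = U (U b a) e" unfolding fundamental_formula using S b by simp
    also have "\<dots> \<in> K" using S a by simp
    finally have "U (jinv b) (U b (U a z)) \<in> K" by (rule quad_rep_spos_K[OF jinv_spos[OF b(1)]])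
    thus ?thesis using quad_rep_jinv'[OF b(1), of "U a z"] a S by simp
  qed
  show ?thesis
  proof (rule K_closed)
    show "U a (y + (1 / real (Suc n)) *\<^sub>R e) \<in> K" for n
      using spos_add[OF spos_scaleR[OF spos_unit, of "1 / real (Suc n)"] y] by (intro pos) (simp add: add.commute)
    have "(\<lambda>n. U a (y + (1 / real (Suc n)) *\<^sub>R e)) \<longlonglongrightarrow> U a (y + 0 *\<^sub>R e)"
      by (intro tendsto_intros LIMSEQ_inverse_real_of_nat[unfolded inverse_eq_divide])
    thus "(\<lambda>n. U a (y + (1 / real (Suc n)) *\<^sub>R e)) \<longlonglongrightarrow> U a y" by simp
  qed
qed

lemma quad_rep_mono: "a \<in> S \<Longrightarrow> x \<preceq> y \<Longrightarrow> U a x \<preceq> U a y" using quad_rep_K[of a "y - x"] by (simp add: le_iff quad_rep_diff)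

lemma quad_rep_spos_le_iff:
  assumes c: "spos c" and xy: "x \<in> S" "y \<in> S"
  shows "U c x \<preceq> U c y \<longleftrightarrow> x \<preceq> y" using quad_rep_mono[of "jinv c" "U c x" "U c y"] quad_rep_mono[of c x y]
    quad_rep_jinv'[OF c] xy spos_in[OF c] jinv_in[OF c] by auto

text \<open>Compression by \<open>b\<close>, the inverse root of \<open>y\<close>, takes
  \<open>y\<close> to \<open>e\<close> and reduces the claim to \<open>v = U b x\<close> below
  \<open>e\<close>, where it is a statement about real functions on the spectrum of
  \<open>v\<close>.\<close>

lemma jinv_antimono:
  assumes x: "spos x" and le: "x \<preceq> y" and y: "y \<in> S"
  shows "jinv y \<preceq> jinv x"
proof -
  have yp: "spos y" using spos_mono[OF x le y] .
  define b where "b = jinv (jsq y)"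
  have sq: "spos (jsq y)" "jsq y \<cdot> jsq y = y" using yp jsq_spos jsq_square spos_K by auto
  have b: "spos b" unfolding b_def using sq by (intro jinv_spos)
  have S: "x \<in> S" "y \<in> S" "b \<in> S" "jsq y \<in> S" using x y b sq spos_in by auto
  have "U b y = e" using quad_rep_jinv'[OF sq(1) unit_in] sq S by (simp add: b_def)
  hence le1: "U b x \<preceq> e" using quad_rep_mono[OF S(3) le] by simp
  define v where "v = U b x"
  have v: "spos v" "v \<preceq> e" "v \<in> S" using le1 quad_rep_spos_spos[OF b x] S by (auto simp: v_def)
  have "fcal v (\<lambda>s. 1) \<preceq> fcal v inverse"
  proof (rule fcal_mono[OF v(3) _ continuous_inverse_spectrum[OF v(1)]])
    fix s assume s: "s \<in> sp v"
    have "0 < s" "s \<le> 1" using spos_spectrum[OF v(1) s] spectrum_le[OF v(3) _ s, of 1] v(2) by auto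
    thus "1 \<le> inverse s" by (simp add: one_le_inverse)
  qed auto
  hence "e \<preceq> jinv v" using v by (simp add: jinv_fcal fcal_const)
  also have "jinv v = U (jsq y) (jinv x)" unfolding v_def jinv_quad_rep[OF b x] unfolding b_def jinv_jinv[OF sq(1)] ..
  finally have "U b e \<preceq> U b (U (jsq y) (jinv x))" by (rule quad_rep_mono[OF S(3)])
  also have "U b (U (jsq y) (jinv x)) = jinv x" unfolding b_def by (rule quad_rep_jinv'[OF sq(1) jinv_in[OF x]])
  also have "U b e = jinv y"
  proof -
    have "jinv y = jinv (U (jsq y) e)" using S sq by simp
    also have "\<dots> = U b e" unfolding jinv_quad_rep[OF sq(1) spos_unit] b_def by simp
    finally show ?thesis ..
  qed
  finally show ?thesis .
qed

lemma quad_rep_shift: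
  assumes "a \<in> S" "w \<in> S"
  shows "U (a + \<delta> *\<^sub>R e) w = U a w + (2 * \<delta>) *\<^sub>R (a \<cdot> w) + \<delta>\<^sup>2 *\<^sub>R w" using assms
  by (simp add: quad_rep_add_left quad_rep_scaleR_left jtriple_def jbilin algebra_simps jprod_commute)

text \<open>By hypothesis \<open>U (a + \<delta> e) w = 2 \<delta> (a \<cdot> w) + \<delta>^2
  w\<close>. This is positive for both signs of \<open>\<delta>\<close>, so dividing by
  \<open>\<delta>\<close> and letting it tend to \<open>0\<close> leaves
  \<open>a \<cdot> w = 0\<close>.\<close>

lemma quad_rep_zero_jprod:
  assumes a: "a \<in> S" and w: "w \<in> K" and 0: "U a w = 0"
  shows "a \<cdot> w = 0"
proof -
  have wS: "w \<in> S" using w K_subset by blast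
  have "0 \<preceq> (a \<cdot> w) + \<delta> *\<^sub>R w" "a \<cdot> w \<preceq> 0 + \<delta> *\<^sub>R w" if \<delta>: "\<delta> > 0" for \<delta>
  proof -
    have "U (a + (2 * \<delta>) *\<^sub>R e) w \<in> K" "U (a + (- (2 * \<delta>)) *\<^sub>R e) w \<in> K" using a w by (intro quad_rep_K; simp)+
    hence "(1 / (4 * \<delta>)) *\<^sub>R U (a + (2 * \<delta>) *\<^sub>R e) w \<in> K" "(1 / (4 * \<delta>)) *\<^sub>R U (a + (- (2 * \<delta>)) *\<^sub>R e) w \<in> K"
      using \<delta> by (intro K_scaleR; simp)+
    thus "0 \<preceq> (a \<cdot> w) + \<delta> *\<^sub>R w" "a \<cdot> w \<preceq> 0 + \<delta> *\<^sub>R w" unfolding quad_rep_shift[OF a wS] 0 using \<delta>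
      by (simp_all add: le_iff algebra_simps power2_eq_square)
  qed
  thus ?thesis using le_eps[of 0 "a \<cdot> w" w] le_eps[of "a \<cdot> w" 0 w] by (intro le_antisym) auto
qed

text \<open>Orthogonality of positive elements is symmetric:
  \<open>w \<cdot> w \<preceq> norm w w\<close> passes the hypothesis on to the square of
  \<open>w\<close>, and the vanishing of \<open>a \<cdot> w\<close> and
  \<open>a \<cdot> (w \<cdot> w)\<close> is all that \<open>U w a\<close> involves.\<close>

lemma quad_rep_zero_sym:
  assumes a: "a \<in> K" and w: "w \<in> K" and 0: "U a w = 0"
  shows "U w a = 0" "(a \<cdot> a) \<cdot> w = 0" "a \<cdot> (w \<cdot> w) = 0" "a \<cdot> w = 0"
proof -
  have S: "a \<in> S" "w \<in> S" using a w K_subset by auto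
  show aw: "a \<cdot> w = 0" by (rule quad_rep_zero_jprod[OF S(1) w 0])
  thus "(a \<cdot> a) \<cdot> w = 0" using 0 by (simp add: quad_rep_def jprod.zero_right)
  have "U a (w \<cdot> w) \<preceq> norm w *\<^sub>R U a w" using quad_rep_mono[OF S(1) square_le[OF w]] by (simp add: quad_rep_scaleR)
  hence "U a (w \<cdot> w) = 0" using le_antisym[of "U a (w \<cdot> w)" 0] quad_rep_K[OF S(1), of "w \<cdot> w"] S 0 by simp
  thus aww: "a \<cdot> (w \<cdot> w) = 0" by (rule quad_rep_zero_jprod[OF S(1), rotated]) (use S in simp)
  show "U w a = 0"
    using aw aww by (simp add: quad_rep_def jprod_commute[of w a] jprod_commute[of "w \<cdot> w" a] jprod.zero_right)
qed

end

section \<open>Dual Banach spaces\<close>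

locale dual_rep =
  fixes S :: "'a::real_normed_vector set" and V :: "('a \<Rightarrow> real) set" and n \<Phi>
  assumes S: "subspace S" and V: "banach_function_space V n"
    and bij: "bij_betw \<Phi> S (dual_functionals V n)"
    and \<Phi>_add: "\<And>x y g. x \<in> S \<Longrightarrow> y \<in> S \<Longrightarrow> g \<in> V \<Longrightarrow> \<Phi> (x + y) g = \<Phi> x g + \<Phi> y g"
    and \<Phi>_scaleR: "\<And>r x g. x \<in> S \<Longrightarrow> g \<in> V \<Longrightarrow> \<Phi> (r *\<^sub>R x) g = r * \<Phi> x g"
    and \<Phi>_norm: "\<And>x. x \<in> S \<Longrightarrow> dual_norm V n (\<Phi> x) = norm x"
begin

lemma zero_V: "(\<lambda>b. 0) \<in> V"
  and add_V: "g \<in> V \<Longrightarrow> h \<in> V \<Longrightarrow> (\<lambda>b. g b + h b) \<in> V"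
  and scale_V: "g \<in> V \<Longrightarrow> (\<lambda>b. r * g b) \<in> V"
  and n_nonneg: "g \<in> V \<Longrightarrow> 0 \<le> n g"
  and n_zero_iff: "g \<in> V \<Longrightarrow> n g = 0 \<longleftrightarrow> g = (\<lambda>b. 0)"
  and n_scale: "g \<in> V \<Longrightarrow> n (\<lambda>b. r * g b) = \<bar>r\<bar> * n g" using V unfolding banach_function_space_def by auto

lemma \<Phi>_functional: "x \<in> S \<Longrightarrow> \<Phi> x \<in> dual_functionals V n" using bij by (auto simp: bij_betw_def)

lemma \<Phi>_lin:
  assumes "x \<in> S" "g \<in> V"
  shows "h \<in> V \<Longrightarrow> \<Phi> x (\<lambda>b. g b + h b) = \<Phi> x g + \<Phi> x h" "\<Phi> x (\<lambda>b. r * g b) = r * \<Phi> x g"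
  using \<Phi>_functional[OF assms(1)] assms(2) by (auto simp: dual_functionals_def)

lemma \<Phi>_diff: "x \<in> S \<Longrightarrow> y \<in> S \<Longrightarrow> g \<in> V \<Longrightarrow> \<Phi> (x - y) g = \<Phi> x g - \<Phi> y g"
  using \<Phi>_add[of x "(-1) *\<^sub>R y" g] \<Phi>_scaleR[of y g "-1"] subspace_scale[OF S, of y "-1"]
  by (simp add: subspace_neg[OF S])

lemma bdd_above_functional:
  assumes "x \<in> S"
  shows "bdd_above ((\<lambda>g. \<bar>\<Phi> x g\<bar>) ` {g \<in> V. n g \<le> 1})"
proof -
  obtain C where C: "\<And>g. g \<in> V \<Longrightarrow> \<bar>\<Phi> x g\<bar> \<le> C * n g" using \<Phi>_functional[OF assms] unfolding dual_functionals_def by blast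
  show ?thesis
  proof (rule bdd_aboveI2[where M = "\<bar>C\<bar>"])
    fix g assume g: "g \<in> {g \<in> V. n g \<le> 1}"
    hence "\<bar>\<Phi> x g\<bar> \<le> \<bar>C\<bar> * n g" using C[of g] mult_right_mono[OF abs_ge_self[of C] n_nonneg[of g]] by fastforce
    also have "\<dots> \<le> \<bar>C\<bar> * 1" using g by (intro mult_left_mono) auto
    finally show "\<bar>\<Phi> x g\<bar> \<le> \<bar>C\<bar>" by simp
  qed
qed

lemma \<Phi>_le: "x \<in> S \<Longrightarrow> g \<in> V \<Longrightarrow> \<bar>\<Phi> x g\<bar> \<le> norm x * n g"
proof (cases "n g = 0")
  case True
  assume xg: "x \<in> S" "g \<in> V"
  hence "g = (\<lambda>b. 0 * g b)" using True n_zero_iff by auto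
  hence "\<Phi> x g = 0 * \<Phi> x g" using \<Phi>_lin(2)[OF xg, of 0] by simp
  thus ?thesis using True by simp
next
  case False
  assume xg: "x \<in> S" "g \<in> V"
  hence pos: "n g > 0" using False n_nonneg[of g] by simp
  let ?h = "\<lambda>b. (1 / n g) * g b"
  have h: "?h \<in> V" "n ?h \<le> 1" using xg scale_V[of g "1 / n g"] n_scale[of g "1 / n g"] pos by auto
  have "\<bar>\<Phi> x ?h\<bar> \<le> dual_norm V n (\<Phi> x)"
    unfolding dual_norm_def by (rule cSUP_upper[OF _ bdd_above_functional]) (use h xg in auto)
  also have "\<dots> = norm x" using \<Phi>_norm xg by simp
  also have "\<Phi> x ?h = (1 / n g) * \<Phi> x g" by (rule \<Phi>_lin(2)[OF xg])
  finally show ?thesis using pos by (simp add: abs_mult field_simps)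
qed

lemma norm_le_\<Phi>:
  assumes x: "x \<in> S" and R: "0 \<le> R" and le: "\<And>g. g \<in> V \<Longrightarrow> \<bar>\<Phi> x g\<bar> \<le> R * n g"
  shows "norm x \<le> R"
proof -
  have "dual_norm V n (\<Phi> x) \<le> R" unfolding dual_norm_def
  proof (rule cSUP_least)
    show "{g \<in> V. n g \<le> 1} \<noteq> {}" using zero_V n_zero_iff[OF zero_V] by (auto intro!: exI[of _ "\<lambda>b. 0"])
    fix g assume g: "g \<in> {g \<in> V. n g \<le> 1}"
    thus "\<bar>\<Phi> x g\<bar> \<le> R" using le[of g] mult_left_mono[of "n g" 1 R] R by auto
  qed
  thus ?thesis using \<Phi>_norm[OF x] by simp
qed

lemma \<Phi>_inj: "x \<in> S \<Longrightarrow> y \<in> S \<Longrightarrow> (\<And>g. g \<in> V \<Longrightarrow> \<Phi> x g = \<Phi> y g) \<Longrightarrow> x = y"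
  using norm_le_\<Phi>[of "x - y" 0] subspace_diff[OF S, of x y] \<Phi>_diff[of x y] by auto

text \<open>The Banach--Alaoglu theorem, as a finite intersection property.\<close>

lemma weak_star_compact:
  assumes B: "0 \<le> B" and cl: "\<And>T. T \<in> \<F> \<Longrightarrow> closed T"
    and fip: "\<And>\<G>. finite \<G> \<Longrightarrow> \<G> \<subseteq> \<F> \<Longrightarrow> \<exists>x\<in>S. norm x \<le> B \<and> (\<forall>T\<in>\<G>. \<Phi> x \<in> T)"
  shows "\<exists>x\<in>S. norm x \<le> B \<and> (\<forall>T\<in>\<F>. \<Phi> x \<in> T)"
proof -
  \<comment> \<open>Functionals are extensional: outside \<open>V\<close> they have the value
    \<open>undefined\<close>, so the factors there are singletons.\<close>
  define T where "T g = (if g \<in> V then {- (B * n g)..B * n g} else {undefined})" for g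
  define Q where "Q = PiE UNIV T"
  have "compactin (product_topology (\<lambda>g. euclidean) UNIV) Q"
    unfolding Q_def compactin_PiE by (rule disjI2) (auto simp: T_def)
  hence compQ: "compact Q" by (simp add: euclidean_product_topology)
  define L where "L = {\<Lambda> :: ('a \<Rightarrow> real) \<Rightarrow> real. (\<forall>g\<in>V. \<forall>h\<in>V. \<Lambda> (\<lambda>b. g b + h b) = \<Lambda> g + \<Lambda> h) \<and>
        (\<forall>r. \<forall>g\<in>V. \<Lambda> (\<lambda>b. r * g b) = r * \<Lambda> g)}"
  have "closed L"
  proof -
    have "L = (\<Inter>g\<in>V. \<Inter>h\<in>V. {\<Lambda>. \<Lambda> (\<lambda>b. g b + h b) = \<Lambda> g + \<Lambda> h}) \<inter> (\<Inter>r. \<Inter>g\<in>V. {\<Lambda>. \<Lambda> (\<lambda>b. r * g b) = r * \<Lambda> g})"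
      by (auto simp: L_def)
    moreover have "closed {\<Lambda> :: ('a \<Rightarrow> real) \<Rightarrow> real. \<Lambda> u = \<Lambda> g + \<Lambda> h}" "closed {\<Lambda> :: ('a \<Rightarrow> real) \<Rightarrow> real. \<Lambda> u = r * \<Lambda> g}" for u g h r
      by (intro closed_Collect_eq continuous_intros continuous_on_product_coordinates)+
    ultimately show ?thesis by (auto intro!: closed_Int closed_INT)
  qed
  have \<Phi>Q: "\<Phi> x \<in> Q \<inter> L" if "x \<in> S" "norm x \<le> B" for x
  proof -
    have "\<bar>\<Phi> x g\<bar> \<le> B * n g" if "g \<in> V" for g
      using \<Phi>_le[OF \<open>x \<in> S\<close> that] mult_right_mono[OF \<open>norm x \<le> B\<close> n_nonneg[OF that]] by linarith
    moreover have "\<Phi> x g = undefined" if "g \<notin> V" for g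
      using \<Phi>_functional[OF \<open>x \<in> S\<close>] that by (auto simp: dual_functionals_def extensional_def)
    ultimately have "\<Phi> x \<in> Q" by (auto simp: Q_def T_def abs_le_iff minus_le_iff)
    moreover have "\<Phi> x \<in> L" using \<Phi>_functional[OF \<open>x \<in> S\<close>] by (auto simp: dual_functionals_def L_def)
    ultimately show ?thesis by blast
  qed
  have "compact (Q \<inter> L)" using compQ \<open>closed L\<close> by (rule compact_Int_closed)
  hence "(Q \<inter> L) \<inter> \<Inter>\<F> \<noteq> {}"
  proof (rule compact_imp_fip)
    fix \<G> assume "finite \<G>" "\<G> \<subseteq> \<F>"
    then obtain x where "x \<in> S" "norm x \<le> B" "\<forall>T\<in>\<G>. \<Phi> x \<in> T" using fip by blast
    thus "(Q \<inter> L) \<inter> \<Inter>\<G> \<noteq> {}" using \<Phi>Q by blast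
  qed (rule cl)
  then obtain \<Lambda> where \<Lambda>: "\<Lambda> \<in> Q" "\<Lambda> \<in> L" "\<And>T. T \<in> \<F> \<Longrightarrow> \<Lambda> \<in> T" by blast
  have ext: "\<Lambda> g = undefined" if "g \<notin> V" for g
  proof -
    have "\<Lambda> g \<in> T g" using \<Lambda>(1) by (auto simp: Q_def PiE_def)
    thus ?thesis using that by (simp add: T_def)
  qed
  have bd: "\<bar>\<Lambda> g\<bar> \<le> B * n g" if "g \<in> V" for g
  proof -
    have "\<Lambda> g \<in> T g" using \<Lambda>(1) by (auto simp: Q_def PiE_def)
    thus ?thesis using that by (auto simp: T_def)
  qed
  have "\<Lambda> \<in> dual_functionals V n" unfolding dual_functionals_def
  proof (intro CollectI conjI)
    show "\<Lambda> \<in> extensional V" using ext by (simp add: extensional_def)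
    show "\<exists>C. \<forall>g\<in>V. \<bar>\<Lambda> g\<bar> \<le> C * n g" by (rule exI[of _ B], rule ballI, rule bd)
  qed (rule conjunct1[OF \<Lambda>(2)[unfolded L_def mem_Collect_eq]],
      rule conjunct2[OF \<Lambda>(2)[unfolded L_def mem_Collect_eq]])
  hence "\<Lambda> \<in> \<Phi> ` S" by (simp only: bij_betw_imp_surj_on[OF bij])
  then obtain x where x: "\<Lambda> = \<Phi> x" "x \<in> S" by (rule imageE)
  have "norm x \<le> B" by (rule norm_le_\<Phi>[OF x(2) B]) (rule bd[unfolded x(1)])
  thus ?thesis using \<Lambda>(3)[unfolded x(1)] x(2) by blast
qed

lemma closed_ball_constraint: "closed {\<Lambda> :: ('a \<Rightarrow> real) \<Rightarrow> real. \<forall>g\<in>V. \<bar>\<Lambda> g - c g\<bar> \<le> R * n g}"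
proof -
  have "{\<Lambda> :: ('a \<Rightarrow> real) \<Rightarrow> real. \<forall>g\<in>V. \<bar>\<Lambda> g - c g\<bar> \<le> R * n g} = (\<Inter>g\<in>V. {\<Lambda>. \<bar>\<Lambda> g - c g\<bar> \<le> R * n g})" by auto
  moreover have "closed {\<Lambda> :: ('a \<Rightarrow> real) \<Rightarrow> real. \<bar>\<Lambda> g - c g\<bar> \<le> R * n g}" for g
    by (intro closed_Collect_le continuous_intros continuous_on_product_coordinates)
  ultimately show ?thesis by auto
qed

lemma ball_constraint_iff:
  assumes "x \<in> S" "a \<in> S" "0 \<le> R"
  shows "(\<forall>g\<in>V. \<bar>\<Phi> x g - \<Phi> a g\<bar> \<le> R * n g) \<longleftrightarrow> norm (x - a) \<le> R"
proof
  assume "\<forall>g\<in>V. \<bar>\<Phi> x g - \<Phi> a g\<bar> \<le> R * n g"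
  thus "norm (x - a) \<le> R" by (intro norm_le_\<Phi>) (use assms subspace_diff[OF S] \<Phi>_diff in auto)
next
  assume le: "norm (x - a) \<le> R"
  show "\<forall>g\<in>V. \<bar>\<Phi> x g - \<Phi> a g\<bar> \<le> R * n g"
  proof
    fix g assume g: "g \<in> V"
    have "\<bar>\<Phi> (x - a) g\<bar> \<le> norm (x - a) * n g" using \<Phi>_le[of "x - a" g] subspace_diff[OF S] assms g by auto
    also have "\<dots> \<le> R * n g" using le n_nonneg[OF g] by (rule mult_right_mono)
    finally show "\<bar>\<Phi> x g - \<Phi> a g\<bar> \<le> R * n g" using \<Phi>_diff assms g by simp
  qed
qed

text \<open>Closed balls are weak-star compact. In this purely metric form the predual enters the
  construction of suprema.\<close>

lemma ball_intersection:
  assumes I: "i0 \<in> I" and a: "\<And>i. i \<in> I \<Longrightarrow> a i \<in> S" and R: "\<And>i. i \<in> I \<Longrightarrow> 0 \<le> R i"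
    and fin: "\<And>J. finite J \<Longrightarrow> J \<subseteq> I \<Longrightarrow> \<exists>x\<in>S. \<forall>i\<in>J. norm (x - a i) \<le> R i"
  shows "\<exists>x\<in>S. \<forall>i\<in>I. norm (x - a i) \<le> R i"
proof -
  define T where "T i = {\<Lambda> :: ('a \<Rightarrow> real) \<Rightarrow> real. \<forall>g\<in>V. \<bar>\<Lambda> g - \<Phi> (a i) g\<bar> \<le> R i * n g}" for i
  have iff: "\<Phi> x \<in> T i \<longleftrightarrow> norm (x - a i) \<le> R i" if "x \<in> S" "i \<in> I" for x i
    using ball_constraint_iff[OF that(1) a[OF that(2)] R[OF that(2)]] by (simp add: T_def)
  \<comment> \<open>The single ball with index \<open>i0\<close> bounds the norm of all
    candidates.\<close>
  have "\<exists>x\<in>S. norm x \<le> norm (a i0) + R i0 \<and> (\<forall>Q\<in>T ` I. \<Phi> x \<in> Q)"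
  proof (rule weak_star_compact)
    show "0 \<le> norm (a i0) + R i0" using R[OF I] by simp
    show "closed Q" if "Q \<in> T ` I" for Q using that closed_ball_constraint unfolding T_def by auto
    fix \<G> assume "finite \<G>" "\<G> \<subseteq> T ` I"
    then obtain J where J: "finite J" "J \<subseteq> I" "\<G> = T ` J" by (meson finite_subset_image)
    then obtain x where x: "x \<in> S" "\<forall>i\<in>insert i0 J. norm (x - a i) \<le> R i" using fin[of "insert i0 J"] I by auto
    hence "norm x \<le> norm (a i0) + R i0" using norm_triangle_sub[of x "a i0"] by auto
    thus "\<exists>x\<in>S. norm x \<le> norm (a i0) + R i0 \<and> (\<forall>Q\<in>\<G>. \<Phi> x \<in> Q)" using x J iff by (intro bexI[of _ x]) auto
  qed
  thus ?thesis using iff by auto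
qed

text \<open>An M-summand of a dual space is a dual space. A predual is the uniform closure of the
  functions that the given predual induces on the unit ball of the summand.\<close>

theorem dual_banach_space_summand:
  assumes F: "F \<subseteq> S" "subspace F" and H: "H \<subseteq> S" "subspace H"
    and sum: "\<And>x. x \<in> S \<Longrightarrow> \<exists>y\<in>F. \<exists>z\<in>H. x = y + z"
    and ball: "\<And>y z. y \<in> F \<Longrightarrow> z \<in> H \<Longrightarrow> norm y \<le> 1 \<Longrightarrow> norm z \<le> 1 \<Longrightarrow> norm (y + z) \<le> 1"
    and norm_le: "\<And>y z. y \<in> F \<Longrightarrow> z \<in> H \<Longrightarrow> norm z \<le> norm (y + z)"
  shows "dual_banach_space F"
proof -
  define Y where "Y = {x\<in>F. norm x \<le> 1}"
  define res where "res g x = (if x \<in> Y then \<Phi> x g else 0)" for g x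
  define W where "W = {\<phi>. \<forall>\<epsilon>>0. \<exists>g\<in>V. \<forall>x. \<bar>\<phi> x - res g x\<bar> \<le> \<epsilon>}"
  define nW where "nW \<phi> = (SUP x. \<bar>\<phi> x\<bar>)" for \<phi> :: "'a \<Rightarrow> real"
  have FS: "x \<in> S" if "x \<in> F" for x using that F by blast
  have YF: "x \<in> F" "x \<in> S" "norm x \<le> 1" if "x \<in> Y" for x using that F by (auto simp: Y_def)
  have Y0: "0 \<in> Y" using subspace_0[OF F(2)] by (simp add: Y_def)
  have W_approx: "\<exists>g\<in>V. \<forall>x. \<bar>\<phi> x - res g x\<bar> \<le> \<epsilon>" if "\<phi> \<in> W" "\<epsilon> > 0" for \<phi> \<epsilon> using that unfolding W_def by blast
  have res_le: "\<bar>res g x\<bar> \<le> n g" if g: "g \<in> V" for g x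
    using \<Phi>_le[OF YF(2) g] mult_right_mono[OF YF(3) n_nonneg[OF g]] n_nonneg[OF g] by (fastforce simp: res_def)
  have res_lin: "res (\<lambda>b. g b + h b) = (\<lambda>b. res g b + res h b)" "res (\<lambda>b. r * g b) = (\<lambda>b. r * res g b)"
    if "g \<in> V" "h \<in> V" for g h r using \<Phi>_lin[OF YF(2)] that by (auto simp: res_def)
  have resW: "res g \<in> W" if "g \<in> V" for g using that by (auto simp: W_def intro!: bexI[of _ g])
  have bdd: "bdd_above (range (\<lambda>x. \<bar>\<phi> x\<bar>))" if \<phi>: "\<phi> \<in> W" for \<phi>
  proof -
    obtain g where g: "g \<in> V" "\<And>x. \<bar>\<phi> x - res g x\<bar> \<le> 1" using W_approx[OF \<phi>, of 1] by auto
    have "\<bar>\<phi> x\<bar> \<le> n g + 1" for x using g(2)[of x] res_le[OF g(1), of x] by linarith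
    thus ?thesis by (intro bdd_aboveI2)
  qed
  have le_nW: "\<bar>\<phi> x\<bar> \<le> nW \<phi>" if "\<phi> \<in> W" for \<phi> x unfolding nW_def using bdd[OF that] by (intro cSUP_upper) auto
  have nW_least: "nW \<phi> \<le> B" if "\<And>x. \<bar>\<phi> x\<bar> \<le> B" for \<phi> B unfolding nW_def by (rule cSUP_least) (use that in auto)
  have nW0: "0 \<le> nW \<phi>" if "\<phi> \<in> W" for \<phi> using le_nW[OF that, of 0] by linarith
  have res_n: "nW (res g) \<le> n g" if "g \<in> V" for g by (rule nW_least) (rule res_le[OF that])
  have addW: "(\<lambda>b. \<phi> b + \<psi> b) \<in> W" if \<phi>: "\<phi> \<in> W" and \<psi>: "\<psi> \<in> W" for \<phi> \<psi> unfolding W_def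
  proof (intro CollectI allI impI)
    fix \<epsilon> :: real assume "\<epsilon> > 0"
    then obtain g h where gh: "g \<in> V" "h \<in> V" "\<And>x. \<bar>\<phi> x - res g x\<bar> \<le> \<epsilon> / 2" "\<And>x. \<bar>\<psi> x - res h x\<bar> \<le> \<epsilon> / 2"
      using W_approx[OF \<phi>, of "\<epsilon> / 2"] W_approx[OF \<psi>, of "\<epsilon> / 2"] by auto
    have "\<bar>\<phi> x + \<psi> x - (res g x + res h x)\<bar> \<le> \<epsilon>" for x using gh(3,4)[of x] by linarith
    thus "\<exists>g\<in>V. \<forall>x. \<bar>\<phi> x + \<psi> x - res g x\<bar> \<le> \<epsilon>"
      using gh by (intro bexI[of _ "\<lambda>b. g b + h b"]) (simp_all add: res_lin add_V)
  qed
  have scaleW: "(\<lambda>b. r * \<phi> b) \<in> W" if \<phi>: "\<phi> \<in> W" for r \<phi> unfolding W_def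
  proof (intro CollectI allI impI)
    fix \<epsilon> :: real assume \<epsilon>: "\<epsilon> > 0"
    then obtain g where g: "g \<in> V" "\<And>x. \<bar>\<phi> x - res g x\<bar> \<le> \<epsilon> / (\<bar>r\<bar> + 1)"
      using W_approx[OF \<phi>, of "\<epsilon> / (\<bar>r\<bar> + 1)"] by auto
    have "\<bar>r * \<phi> x - r * res g x\<bar> \<le> \<epsilon>" for x
    proof -
      have "\<bar>r * \<phi> x - r * res g x\<bar> = \<bar>r\<bar> * \<bar>\<phi> x - res g x\<bar>" by (simp add: abs_mult flip: right_diff_distrib)
      also have "\<dots> \<le> (\<bar>r\<bar> + 1) * (\<epsilon> / (\<bar>r\<bar> + 1))" using g(2)[of x] by (intro mult_mono) auto
      finally show ?thesis by simp
    qed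
    thus "\<exists>g\<in>V. \<forall>x. \<bar>r * \<phi> x - res g x\<bar> \<le> \<epsilon>"
      using g(1) by (intro bexI[of _ "\<lambda>b. r * g b"]) (simp_all add: res_lin scale_V)
  qed
  have zeroW: "(\<lambda>b. 0) \<in> W" using scaleW[OF resW[OF zero_V], of 0] by simp
  have complete: "\<exists>\<phi>\<in>W. (\<lambda>k. nW (\<lambda>b. X k b - \<phi> b)) \<longlonglongrightarrow> 0"
    if XW: "\<And>k. X k \<in> W" and C: "\<And>\<epsilon>. \<epsilon> > 0 \<Longrightarrow> \<exists>N. \<forall>k\<ge>N. \<forall>l\<ge>N. nW (\<lambda>b. X k b - X l b) < \<epsilon>" for X :: "nat \<Rightarrow> 'a \<Rightarrow> real"
  proof -
    have diffW: "(\<lambda>b. X k b - X l b) \<in> W" for k l using addW[OF XW[of k] scaleW[OF XW[of l], of "-1"]] by simp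
    have "uniformly_Cauchy_on UNIV X"
      unfolding uniformly_Cauchy_on_def dist_real_def using C le_less_trans[OF le_nW[OF diffW]] by meson
    then obtain \<phi> where \<phi>: "uniform_limit UNIV X \<phi> sequentially"
      using Cauchy_uniformly_convergent unfolding uniformly_convergent_on_def by blast
    have close: "\<exists>N. \<forall>k\<ge>N. \<forall>x. \<bar>X k x - \<phi> x\<bar> < \<epsilon>" if "\<epsilon> > 0" for \<epsilon>
      using uniform_limitD[OF \<phi> that] by (simp add: eventually_sequentially dist_real_def)
    have "\<phi> \<in> W" unfolding W_def
    proof (intro CollectI allI impI)
      fix \<epsilon> :: real assume \<epsilon>: "\<epsilon> > 0"
      obtain N where N: "\<And>x. \<bar>X N x - \<phi> x\<bar> < \<epsilon> / 2" using close[of "\<epsilon> / 2"] \<epsilon> by auto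
      obtain g where g: "g \<in> V" "\<And>x. \<bar>X N x - res g x\<bar> \<le> \<epsilon> / 2" using W_approx[OF XW, of "\<epsilon> / 2" N] \<epsilon> by auto
      have "\<bar>\<phi> x - res g x\<bar> \<le> \<epsilon>" for x using N[of x] g(2)[of x] by linarith
      thus "\<exists>g\<in>V. \<forall>x. \<bar>\<phi> x - res g x\<bar> \<le> \<epsilon>" using g(1) by blast
    qed
    moreover have "(\<lambda>k. nW (\<lambda>b. X k b - \<phi> b)) \<longlonglongrightarrow> 0"
    proof (rule LIMSEQ_I)
      fix r :: real assume r: "0 < r"
      obtain N where N: "\<And>k x. k \<ge> N \<Longrightarrow> \<bar>X k x - \<phi> x\<bar> < r / 2" using close[of "r / 2"] r by auto
      have "norm (nW (\<lambda>b. X k b - \<phi> b) - 0) < r" if k: "k \<ge> N" for k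
      proof -
        have "nW (\<lambda>b. X k b - \<phi> b) \<le> r / 2" by (rule nW_least) (rule less_imp_le[OF N[OF k]])
        moreover have "0 \<le> nW (\<lambda>b. X k b - \<phi> b)" using nW0[OF addW[OF XW[of k] scaleW[OF \<open>\<phi> \<in> W\<close>, of "-1"]]] by simp
        ultimately show ?thesis using r by simp
      qed
      thus "\<exists>N. \<forall>k\<ge>N. norm (nW (\<lambda>b. X k b - \<phi> b) - 0) < r" by blast
    qed
    ultimately show ?thesis by blast
  qed
  have scale_le: "nW (\<lambda>b. r * \<phi> b) \<le> \<bar>r\<bar> * nW \<phi>" if "\<phi> \<in> W" for r \<phi>
    by (rule nW_least) (simp add: abs_mult mult_left_mono le_nW[OF that])
  have bfs: "banach_function_space W nW" unfolding banach_function_space_def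
  proof (intro conjI ballI allI impI)
    fix \<phi> assume \<phi>: "\<phi> \<in> W"
    show "0 \<le> nW \<phi>" using \<phi> by (rule nW0)
    show "nW \<phi> = 0 \<longleftrightarrow> \<phi> = (\<lambda>b. 0)" using le_nW[OF \<phi>] by (force simp: nW_def)
    show "nW (\<lambda>b. \<phi> b + \<psi> b) \<le> nW \<phi> + nW \<psi>" if "\<psi> \<in> W" for \<psi>
      by (rule nW_least) (use le_nW[OF \<phi>] le_nW[OF that] in \<open>fastforce intro: order_trans[OF abs_triangle_ineq] add_mono\<close>)
    show "nW (\<lambda>b. r * \<phi> b) = \<bar>r\<bar> * nW \<phi>" for r
    proof (cases "r = 0")
      case False
      have "nW (\<lambda>b. (1 / r) * (r * \<phi> b)) \<le> \<bar>1 / r\<bar> * nW (\<lambda>b. r * \<phi> b)" by (rule scale_le[OF scaleW[OF \<phi>]])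
      hence "\<bar>r\<bar> * nW \<phi> \<le> nW (\<lambda>b. r * \<phi> b)" using False by (simp add: field_simps)
      thus ?thesis using scale_le[OF \<phi>, of r] by linarith
    qed (simp add: nW_def)
  qed (use zeroW addW scaleW complete in auto)
  \<comment> \<open>Members of \<open>W\<close> carry information on the unit ball of
    \<open>F\<close> only, so \<open>x\<close> is first shrunk into it; the factor
    \<open>norm x + 1\<close> avoids division by zero at \<open>x = 0\<close>.\<close>
  define \<Psi> where "\<Psi> x = (\<lambda>\<phi>\<in>W. (norm x + 1) * \<phi> ((1 / (norm x + 1)) *\<^sub>R x))" for x
  have n1: "norm x + 1 > 0" for x :: 'a using norm_ge_zero[of x] by linarith
  have \<Psi>_approx: "\<bar>\<Psi> x \<phi> - \<Phi> x g\<bar> \<le> (norm x + 1) * \<epsilon>"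
    if x: "x \<in> F" and \<phi>: "\<phi> \<in> W" and g: "g \<in> V" "\<And>y. \<bar>\<phi> y - res g y\<bar> \<le> \<epsilon>" for x \<phi> g \<epsilon>
  proof -
    let ?y = "(1 / (norm x + 1)) *\<^sub>R x"
    have "?y \<in> Y" using subspace_scale[OF F(2) x] n1[of x] by (simp add: Y_def)
    hence "(norm x + 1) * res g ?y = \<Phi> x g" using \<Phi>_scaleR[OF FS[OF x] g(1)] n1[of x] by (simp add: res_def)
    hence "\<Psi> x \<phi> - \<Phi> x g = (norm x + 1) * (\<phi> ?y - res g ?y)" using \<phi> by (simp add: \<Psi>_def right_diff_distrib)
    thus ?thesis using g(2)[of ?y] n1[of x] by (simp add: abs_mult)
  qed
  have \<Psi>_res: "\<Psi> x (res g) = \<Phi> x g" if "x \<in> F" "g \<in> V" for x g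
    using \<Psi>_approx[OF that(1) resW[OF that(2)] that(2), of 0] by simp
  have eq0: "s = t" if "\<And>\<epsilon>. \<epsilon> > 0 \<Longrightarrow> \<bar>s - t\<bar> \<le> c * \<epsilon>" for s t c :: real
  proof (rule ccontr)
    assume "s \<noteq> t"
    hence "\<bar>s - t\<bar> > 0" by simp
    hence "\<bar>s - t\<bar> \<le> c * (\<bar>s - t\<bar> / (\<bar>c\<bar> + 1))" by (intro that) (simp add: add_nonneg_pos)
    also have "\<dots> \<le> \<bar>c\<bar> * (\<bar>s - t\<bar> / (\<bar>c\<bar> + 1))" by (intro mult_right_mono) auto
    finally show False using \<open>\<bar>s - t\<bar> > 0\<close> by (simp add: field_simps)
  qed
  have \<Psi>_add: "\<Psi> (x + y) \<phi> = \<Psi> x \<phi> + \<Psi> y \<phi>" if t: "x \<in> F" "y \<in> F" "\<phi> \<in> W" for x y \<phi>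
  proof (rule eq0)
    fix \<epsilon> :: real assume "\<epsilon> > 0"
    then obtain g where g: "g \<in> V" "\<And>x. \<bar>\<phi> x - res g x\<bar> \<le> \<epsilon>" using W_approx[OF t(3)] by blast
    show "\<bar>\<Psi> (x + y) \<phi> - (\<Psi> x \<phi> + \<Psi> y \<phi>)\<bar> \<le> (norm (x + y) + norm x + norm y + 3) * \<epsilon>"
      using \<Psi>_approx[OF subspace_add[OF F(2) t(1,2)] t(3) g] \<Psi>_approx[OF t(1,3) g] \<Psi>_approx[OF t(2,3) g]
        \<Phi>_add[OF FS[OF t(1)] FS[OF t(2)] g(1)] by (simp add: distrib_right)
  qed
  have \<Psi>_scale: "\<Psi> (r *\<^sub>R x) \<phi> = r * \<Psi> x \<phi>" if t: "x \<in> F" "\<phi> \<in> W" for x r \<phi>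
  proof (rule eq0)
    fix \<epsilon> :: real assume "\<epsilon> > 0"
    then obtain g where g: "g \<in> V" "\<And>x. \<bar>\<phi> x - res g x\<bar> \<le> \<epsilon>" using W_approx[OF t(2)] by blast
    have "\<bar>r * \<Psi> x \<phi> - r * \<Phi> x g\<bar> \<le> \<bar>r\<bar> * ((norm x + 1) * \<epsilon>)"
      unfolding right_diff_distrib[symmetric] abs_mult by (intro mult_left_mono \<Psi>_approx t g) simp
    thus "\<bar>\<Psi> (r *\<^sub>R x) \<phi> - r * \<Psi> x \<phi>\<bar> \<le> (norm (r *\<^sub>R x) + 1 + \<bar>r\<bar> * (norm x + 1)) * \<epsilon>"
      using \<Psi>_approx[OF subspace_scale[OF F(2) t(1), of r] t(2) g] \<Phi>_scaleR[OF FS[OF t(1)] g(1), of r]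
      by (simp add: distrib_right mult.assoc)
  qed
  have \<Psi>_Y: "\<Psi> y \<phi> = \<phi> y" if y: "y \<in> Y" and \<phi>: "\<phi> \<in> W" for y \<phi>
  proof (rule eq0)
    fix \<epsilon> :: real assume "\<epsilon> > 0"
    then obtain g where g: "g \<in> V" "\<And>x. \<bar>\<phi> x - res g x\<bar> \<le> \<epsilon>" using W_approx[OF \<phi>] by blast
    show "\<bar>\<Psi> y \<phi> - \<phi> y\<bar> \<le> (norm y + 2) * \<epsilon>"
      using \<Psi>_approx[OF YF(1)[OF y] \<phi> g] g(2)[of y] y by (simp add: res_def distrib_right)
  qed
  have \<Psi>_le: "\<bar>\<Psi> x \<phi>\<bar> \<le> norm x * nW \<phi>" if x: "x \<in> F" and \<phi>: "\<phi> \<in> W" for x \<phi>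
  proof (cases "x = 0")
    case False
    have y: "(1 / norm x) *\<^sub>R x \<in> Y" using False subspace_scale[OF F(2) x] by (simp add: Y_def)
    have "\<Psi> x \<phi> = norm x * \<phi> ((1 / norm x) *\<^sub>R x)"
      using \<Psi>_scale[OF YF(1)[OF y] \<phi>, of "norm x"] \<Psi>_Y[OF y \<phi>] False by simp
    thus ?thesis using mult_left_mono[OF le_nW[OF \<phi>] norm_ge_zero[of x]] by (simp add: abs_mult)
  qed (use \<Psi>_scale[OF x \<phi>, of 0] in simp)
  have \<Psi>_functional: "\<Psi> x \<in> dual_functionals W nW" if x: "x \<in> F" for x unfolding dual_functionals_def
  proof (intro CollectI conjI)
    show "\<exists>C. \<forall>\<phi>\<in>W. \<bar>\<Psi> x \<phi>\<bar> \<le> C * nW \<phi>" using \<Psi>_le[OF x] by blast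
  qed (use addW scaleW in \<open>auto simp: \<Psi>_def algebra_simps\<close>)
  have \<Psi>_norm: "dual_norm W nW (\<Psi> x) = norm x" if x: "x \<in> F" for x
  proof (rule antisym)
    have ne': "{\<phi>\<in>W. nW \<phi> \<le> 1} \<noteq> {}" using zeroW by (auto simp: nW_def intro!: exI[of _ "\<lambda>b. 0"])
    have le: "\<bar>\<Psi> x \<phi>\<bar> \<le> norm x" if "\<phi> \<in> {\<phi>\<in>W. nW \<phi> \<le> 1}" for \<phi>
      using \<Psi>_le[OF x, of \<phi>] mult_left_mono[of "nW \<phi>" 1 "norm x"] that by auto
    thus "dual_norm W nW (\<Psi> x) \<le> norm x" unfolding dual_norm_def by (rule cSUP_least[OF ne'])
    have bdd: "bdd_above ((\<lambda>\<phi>. \<bar>\<Psi> x \<phi>\<bar>) ` {\<phi>\<in>W. nW \<phi> \<le> 1})" using le by (rule bdd_aboveI2)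
    have "dual_norm V n (\<Phi> x) \<le> dual_norm W nW (\<Psi> x)" unfolding dual_norm_def[of V]
    proof (rule cSUP_least)
      show "{g \<in> V. n g \<le> 1} \<noteq> {}" using zero_V n_zero_iff[OF zero_V] by (auto intro!: exI[of _ "\<lambda>b. 0"])
      fix g assume "g \<in> {g \<in> V. n g \<le> 1}"
      hence rg: "g \<in> V" "res g \<in> {\<phi>\<in>W. nW \<phi> \<le> 1}" using resW res_n[of g] by auto
      show "\<bar>\<Phi> x g\<bar> \<le> dual_norm W nW (\<Psi> x)"
        unfolding dual_norm_def \<Psi>_res[OF x rg(1), symmetric] by (rule cSUP_upper[OF rg(2) bdd])
    qed
    thus "norm x \<le> dual_norm W nW (\<Psi> x)" using \<Phi>_norm[OF FS[OF x]] by simp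
  qed
  have surj: "\<exists>x\<in>F. \<Psi> x = \<Lambda>" if \<Lambda>: "\<Lambda> \<in> dual_functionals W nW" for \<Lambda>
  proof -
    have \<Lambda>_ext: "\<Lambda> \<in> extensional W"
      and \<Lambda>_add: "\<And>\<phi> \<psi>. \<phi> \<in> W \<Longrightarrow> \<psi> \<in> W \<Longrightarrow> \<Lambda> (\<lambda>b. \<phi> b + \<psi> b) = \<Lambda> \<phi> + \<Lambda> \<psi>"
      and \<Lambda>_scale: "\<And>r \<phi>. \<phi> \<in> W \<Longrightarrow> \<Lambda> (\<lambda>b. r * \<phi> b) = r * \<Lambda> \<phi>" using \<Lambda> unfolding dual_functionals_def by blast+
    obtain C' where C': "\<And>\<phi>. \<phi> \<in> W \<Longrightarrow> \<bar>\<Lambda> \<phi>\<bar> \<le> C' * nW \<phi>" using \<Lambda> unfolding dual_functionals_def by blast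
    define C where "C = \<bar>C'\<bar> + 1"
    have C: "C > 0" by (simp add: C_def)
    have Cb: "\<bar>\<Lambda> \<phi>\<bar> \<le> C * nW \<phi>" if "\<phi> \<in> W" for \<phi>
    proof -
      have "C' * nW \<phi> \<le> C * nW \<phi>" using nW0[OF that] by (intro mult_right_mono) (auto simp: C_def)
      thus ?thesis using C'[OF that] by linarith
    qed
    \<comment> \<open>Pulled back along \<open>res\<close>, the functional \<open>\<Lambda>\<close>
      is represented by some \<open>x0\<close> in \<open>S\<close>; it remains to see that
      \<open>x0\<close> has no component in \<open>H\<close>.\<close>
    define \<Lambda>' where "\<Lambda>' = restrict (\<lambda>g. \<Lambda> (res g)) V"
    have "\<Lambda>' \<in> dual_functionals V n" unfolding dual_functionals_def
    proof (intro CollectI conjI)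
      show "\<exists>C. \<forall>g\<in>V. \<bar>\<Lambda>' g\<bar> \<le> C * n g"
      proof (intro exI[of _ C] ballI)
        fix g assume g: "g \<in> V"
        thus "\<bar>\<Lambda>' g\<bar> \<le> C * n g" using order_trans[OF Cb[OF resW[OF g]] mult_left_mono[OF res_n[OF g] less_imp_le[OF C]]]
          by (simp add: \<Lambda>'_def)
      qed
    qed (auto simp: \<Lambda>'_def add_V scale_V res_lin \<Lambda>_add \<Lambda>_scale resW)
    hence "\<Lambda>' \<in> \<Phi> ` S" by (simp only: bij_betw_imp_surj_on[OF bij])
    then obtain x0 where x0': "\<Lambda>' = \<Phi> x0" "x0 \<in> S" by (rule imageE)
    hence x0: "x0 \<in> S" "\<Phi> x0 = \<Lambda>'" by simp_all
    obtain y z where yz: "y \<in> F" "z \<in> H" "x0 = y + z" using sum[OF x0(1)] by blast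
    \<comment> \<open>A unit vector \<open>w\<close> of \<open>H\<close> can be added to the unit
      ball of \<open>F\<close> without leaving the unit ball of \<open>S\<close>, and
      \<open>\<Lambda>\<close> sees only the former. Hence \<open>x0 + C w\<close> still has norm at
      most \<open>C\<close>, although its component in \<open>H\<close> has norm
      \<open>norm z + C\<close>.\<close>
    have "z = 0"
    proof (rule ccontr)
      assume z: "z \<noteq> 0"
      define w where "w = (1 / norm z) *\<^sub>R z"
      have w: "w \<in> H" "norm w = 1" "w \<in> S" using z H yz(2) subspace_scale[OF H(2)] by (auto simp: w_def)
      have le: "\<bar>\<Phi> (x0 + C *\<^sub>R w) g\<bar> \<le> C * n g" if g: "g \<in> V" for g
      proof -
        have *: "\<bar>\<Phi> v g\<bar> + \<bar>\<Phi> w g\<bar> \<le> n g" if v: "v \<in> Y" for v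
        proof -
          have "\<bar>\<Phi> v g + r * \<Phi> w g\<bar> \<le> n g" if r: "\<bar>r\<bar> = 1" for r
          proof -
            have "r *\<^sub>R w \<in> H" "norm (r *\<^sub>R w) \<le> 1" using w r subspace_scale[OF H(2)] by auto
            hence "norm (v + r *\<^sub>R w) \<le> 1" "v + r *\<^sub>R w \<in> S" using ball YF[OF v] H(1) subspace_add[OF S] by auto
            thus ?thesis using \<Phi>_le[of "v + r *\<^sub>R w" g] mult_right_mono[of "norm (v + r *\<^sub>R w)" 1 "n g"] n_nonneg[OF g] g
                \<Phi>_add[OF YF(2)[OF v] subspace_scale[OF S w(3)] g] \<Phi>_scaleR[OF w(3) g] by auto
          qed from this[of 1] this[of "-1"] show ?thesis by simp
        qed
        have "\<bar>res g v\<bar> \<le> n g - \<bar>\<Phi> w g\<bar>" for v using *[of v] *[OF Y0] abs_ge_zero[of "\<Phi> 0 g"] by (auto simp: res_def)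
        hence "nW (res g) \<le> n g - \<bar>\<Phi> w g\<bar>" by (rule nW_least)
        hence "C * nW (res g) \<le> C * (n g - \<bar>\<Phi> w g\<bar>)" using C by simp
        moreover have "\<bar>\<Phi> x0 g\<bar> \<le> C * nW (res g)" using Cb[OF resW[OF g]] g by (simp add: x0(2) \<Lambda>'_def)
        moreover have "\<Phi> (x0 + C *\<^sub>R w) g = \<Phi> x0 g + C * \<Phi> w g"
          using \<Phi>_add[OF x0(1) subspace_scale[OF S w(3)] g] \<Phi>_scaleR[OF w(3) g] by simp
        moreover have "\<bar>C * \<Phi> w g\<bar> = C * \<bar>\<Phi> w g\<bar>" using C by (simp add: abs_mult)
        ultimately show ?thesis by (simp add: right_diff_distrib)
      qed
      have "norm (x0 + C *\<^sub>R w) \<le> C"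
        by (rule norm_le_\<Phi>[OF _ _ le]) (use C x0(1) w(3) subspace_add[OF S] subspace_scale[OF S] in auto)
      moreover have eq: "x0 + C *\<^sub>R w = y + (1 + C / norm z) *\<^sub>R z" by (simp add: yz(3) w_def algebra_simps)
      have "norm ((1 + C / norm z) *\<^sub>R z) \<le> norm (x0 + C *\<^sub>R w)"
        unfolding eq by (rule norm_le[OF yz(1) subspace_scale[OF H(2) yz(2)]])
      moreover have "norm ((1 + C / norm z) *\<^sub>R z) = norm z + C" using z C by (simp add: distrib_right add_pos_pos)
      ultimately show False using z[folded zero_less_norm_iff] by linarith
    qed
    hence x0F: "x0 \<in> F" using yz by simp
    have "\<Psi> x0 \<phi> = \<Lambda> \<phi>" for \<phi>
    proof (cases "\<phi> \<in> W")
      case True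
      show ?thesis
      proof (rule eq0)
        fix \<epsilon> :: real assume "\<epsilon> > 0"
        then obtain g where g: "g \<in> V" "\<And>y. \<bar>\<phi> y - res g y\<bar> \<le> \<epsilon>" using W_approx[OF True] by blast
        have dW: "(\<lambda>b. \<phi> b + (-1) * res g b) \<in> W" by (intro addW scaleW True resW g)
        have "nW (\<lambda>b. \<phi> b + (-1) * res g b) \<le> \<epsilon>" using g(2) by (intro nW_least) simp
        hence "\<bar>\<Lambda> (\<lambda>b. \<phi> b + (-1) * res g b)\<bar> \<le> C * \<epsilon>"
          by (rule order_trans[OF Cb[OF dW] mult_left_mono]) (rule less_imp_le[OF C])
        moreover have "\<Lambda> (\<lambda>b. \<phi> b + (-1) * res g b) = \<Lambda> \<phi> - \<Phi> x0 g"
          using \<Lambda>_add[OF True scaleW[OF resW[OF g(1)], of "-1"]] \<Lambda>_scale[OF resW[OF g(1)], of "-1"] x0 g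
          by (simp add: \<Lambda>'_def)
        ultimately show "\<bar>\<Psi> x0 \<phi> - \<Lambda> \<phi>\<bar> \<le> (norm x0 + 1 + C) * \<epsilon>"
          using \<Psi>_approx[OF x0F True g] by (simp add: distrib_right)
      qed
    qed (use \<Lambda>_ext in \<open>simp add: \<Psi>_def extensional_def\<close>)
    with x0F show ?thesis by blast
  qed
  have "inj_on \<Psi> F"
  proof (rule inj_onI)
    fix x y assume "x \<in> F" "y \<in> F" "\<Psi> x = \<Psi> y"
    thus "x = y" using \<Psi>_res by (intro \<Phi>_inj FS) metis+
  qed
  hence "bij_betw \<Psi> F (dual_functionals W nW)" unfolding bij_betw_def using \<Psi>_functional surj by (auto simp: image_iff)
  thus ?thesis unfolding dual_banach_space_def using bfs \<Psi>_norm \<Psi>_add \<Psi>_scale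
    by (intro exI[of _ W] exI[of _ nW] exI[of _ \<Psi>]) blast
qed

end

lemma dual_banach_space_rep:
  fixes S :: "'a::real_normed_vector set"
  assumes "subspace S" "dual_banach_space S"
  shows "\<exists>V n \<Phi>. dual_rep S V n \<Phi>" using assms(2)[unfolded dual_banach_space_def]
proof (elim exE conjE)
  fix V :: "('a \<Rightarrow> real) set" and n \<Phi>
  assume "banach_function_space V n" "bij_betw \<Phi> S (dual_functionals V n)"
    "\<forall>x\<in>S. \<forall>y\<in>S. \<forall>g\<in>V. \<Phi> (x + y) g = \<Phi> x g + \<Phi> y g"
    "\<forall>r. \<forall>x\<in>S. \<forall>g\<in>V. \<Phi> (r *\<^sub>R x) g = r * \<Phi> x g"
    "\<forall>x\<in>S. dual_norm V n (\<Phi> x) = norm x"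
  hence "dual_rep S V n \<Phi>" using assms(1) by unfold_locales auto
  thus "\<exists>V n \<Phi>. dual_rep S V n \<Phi>" by blast
qed

section \<open>Suprema of bounded directed sets\<close>

locale jbw = jb_unital +
  assumes dual: "dual_banach_space S"
begin

text \<open>An order interval from \<open>d\<close> to \<open>d + 2 \<rho> e\<close> is the ball of
  radius \<open>\<rho>\<close> about \<open>d + \<rho> e\<close>. So lying above the elements of
  \<open>D'\<close> and below all upper bounds can be expressed by balls, and by directedness
  finitely many of them contain an element of \<open>D\<close>.\<close>

lemma directed_sup:
  assumes D: "D \<subseteq> S" "d0 \<in> D" and dir: "\<And>x y. x \<in> D \<Longrightarrow> y \<in> D \<Longrightarrow> \<exists>z\<in>D. x \<preceq> z \<and> y \<preceq> z"
    and b: "b \<in> S" "\<And>d. d \<in> D \<Longrightarrow> d \<preceq> b"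
  shows "\<exists>x\<in>S. (\<forall>d\<in>D. d \<preceq> x) \<and> (\<forall>u\<in>S. (\<forall>d\<in>D. d \<preceq> u) \<longrightarrow> x \<preceq> u)"
proof -
  obtain V n \<Phi> where "dual_rep S V n \<Phi>" using dual_banach_space_rep[OF subspace_carrier dual] by blast
  then interpret R: dual_rep S V n \<Phi> .
  define Up where "Up = {u\<in>S. \<forall>d\<in>D. d \<preceq> u}"
  \<comment> \<open>Above a common element \<open>d0\<close> the lengths of the intervals can be
    chosen large enough to contain the relevant part of \<open>D\<close>:
    \<open>norm (b - d0)\<close> for lower conditions, \<open>norm (u - d0)\<close> for the upper
    bound \<open>u\<close>.\<close>
  define D' where "D' = {d\<in>D. d0 \<preceq> d}"
  define r where "r u = norm (u - d0) / 2" for u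
  have ball: "norm (x - (d + \<rho> *\<^sub>R e)) \<le> \<rho> \<longleftrightarrow> d \<preceq> x \<and> x \<preceq> d + (2 * \<rho>) *\<^sub>R e"
    if "x \<in> S" "d \<in> S" "0 \<le> \<rho>" for x d \<rho> using norm_le_iff[of "x - (d + \<rho> *\<^sub>R e)" \<rho>] that
    by (simp add: le_iff scaleR_left_distrib[of \<rho> \<rho>, symmetric, simplified] algebra_simps)
  define a where "a i = (case i of Inl d \<Rightarrow> d + r b *\<^sub>R e | Inr u \<Rightarrow> (u - (2 * r u) *\<^sub>R e) + r u *\<^sub>R e)" for i :: "'a + 'a"
  define \<rho> where "\<rho> i = (case i of Inl d \<Rightarrow> r b | Inr u \<Rightarrow> r u)" for i :: "'a + 'a"
  have r0: "0 \<le> r u" for u by (simp add: r_def)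
  have DS: "d \<in> S" if "d \<in> D" for d using that D by blast
  have le_r: "u \<preceq> d0 + (2 * r u) *\<^sub>R e" if "u \<in> S" for u
    using le_norm[of "u - d0" "norm (u - d0)"] that DS[OF D(2)] by (simp add: le_iff r_def algebra_simps)
  have "\<exists>x\<in>S. \<forall>i\<in>D' <+> Up. norm (x - a i) \<le> \<rho> i"
  proof (rule R.ball_intersection)
    show "Inl d0 \<in> D' <+> Up" using D by (auto simp: D'_def)
    show "a i \<in> S" if "i \<in> D' <+> Up" for i using that DS by (auto simp: a_def D'_def Up_def)
    show "0 \<le> \<rho> i" for i using r0 by (auto simp: \<rho>_def split: sum.split)
    fix J assume J: "finite J" "J \<subseteq> D' <+> Up"
    have "\<exists>z\<in>D. d0 \<preceq> z \<and> (\<forall>d\<in>E. d \<preceq> z)" if "finite E" "E \<subseteq> D" for E using that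
    proof (induction E rule: finite_induct)
      case empty
      thus ?case using D by auto
    next
      case (insert d E)
      then obtain z where "z \<in> D" "d0 \<preceq> z" "\<forall>d\<in>E. d \<preceq> z" by auto
      moreover obtain z' where "z' \<in> D" "z \<preceq> z'" "d \<preceq> z'" using dir[of z d] calculation insert by auto
      ultimately show ?case using le_trans by (metis insert_iff)
    qed
    moreover have "finite {d. Inl d \<in> J}" using J(1) by (rule finite_vimageI[of J Inl, unfolded vimage_def]) auto
    moreover have "{d. Inl d \<in> J} \<subseteq> D" using J(2) by (auto simp: D'_def)
    ultimately have "\<exists>z\<in>D. d0 \<preceq> z \<and> (\<forall>d\<in>{d. Inl d \<in> J}. d \<preceq> z)" by blast
    then obtain z where z: "z \<in> D" "d0 \<preceq> z" "\<And>d. Inl d \<in> J \<Longrightarrow> d \<preceq> z" by auto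
    have zS: "z \<in> S" using DS z by blast
    have "norm (z - a i) \<le> \<rho> i" if i: "i \<in> J" for i
    proof (cases i)
      case (Inl d)
      hence d: "d \<in> D" "d0 \<preceq> d" "d \<preceq> z" using i J z by (auto simp: D'_def)
      have "z \<preceq> d0 + (2 * r b) *\<^sub>R e" using b(2)[OF z(1)] le_r[OF b(1)] le_trans by blast
      also have "d0 + (2 * r b) *\<^sub>R e \<preceq> d + (2 * r b) *\<^sub>R e" using d(2) le_add_mono by blast
      finally show ?thesis unfolding Inl a_def \<rho>_def sum.case using ball[OF zS DS[OF d(1)] r0[of b]] d by blast
    next
      case (Inr u)
      hence u: "u \<in> S" "z \<preceq> u" using i J z by (auto simp: Up_def)
      have "u - (2 * r u) *\<^sub>R e \<preceq> d0" using le_r[OF u(1)] by (simp add: le_iff algebra_simps)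
      hence "u - (2 * r u) *\<^sub>R e \<preceq> z" using z(2) le_trans by blast
      moreover have "u - (2 * r u) *\<^sub>R e \<in> S" using u by auto
      ultimately show ?thesis
        unfolding Inr a_def \<rho>_def sum.case using ball[OF zS, of "u - (2 * r u) *\<^sub>R e" "r u"] r0[of u] u by simp
    qed
    thus "\<exists>x\<in>S. \<forall>i\<in>J. norm (x - a i) \<le> \<rho> i" using zS by blast
  qed
  then obtain x where x: "x \<in> S" "\<And>i. i \<in> D' <+> Up \<Longrightarrow> norm (x - a i) \<le> \<rho> i" by blast
  have lower: "d \<preceq> x" if "d \<in> D'" for d
    using x(2)[of "Inl d"] ball[OF x(1), of d "r b"] that r0[of b] DS by (auto simp: a_def \<rho>_def D'_def)
  have "d \<preceq> x" if d: "d \<in> D" for d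
  proof -
    obtain z where "z \<in> D" "d \<preceq> z" "d0 \<preceq> z" using dir[OF d D(2)] by blast
    thus ?thesis using lower[of z] le_trans by (auto simp: D'_def)
  qed
  moreover have "x \<preceq> u" if u: "u \<in> S" "\<forall>d\<in>D. d \<preceq> u" for u
    using x(2)[of "Inr u"] ball[OF x(1), of "u - (2 * r u) *\<^sub>R e" "r u"] r0[of u] u by (auto simp: a_def \<rho>_def Up_def)
  ultimately show ?thesis using x(1) by blast
qed

end

section \<open>Projections and atoms\<close>

lemma tendsto_add_inverse_scaleR:
  fixes y z :: "'a::real_normed_vector"
  shows "(\<lambda>n. y + (1 / real (Suc n)) *\<^sub>R z) \<longlonglongrightarrow> y"
proof -
  have "(\<lambda>n. y + (1 / real (Suc n)) *\<^sub>R z) \<longlonglongrightarrow> y + 0 *\<^sub>R z"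
    by (intro tendsto_intros LIMSEQ_inverse_real_of_nat[unfolded inverse_eq_divide])
  thus ?thesis by simp
qed

context jb_unital
begin

lemma jinv_scaleR:
  assumes x: "spos x" and r: "0 < r"
  shows "jinv (r *\<^sub>R x) = (1 / r) *\<^sub>R jinv x"
proof -
  have xS: "x \<in> S" using x by (rule spos_in)
  have rx: "r *\<^sub>R x \<in> gen x" by (intro gen_closed gen_self xS)
  show ?thesis
  proof (rule gen_inverse_unique[OF xS rx])
    show "jinv (r *\<^sub>R x) \<in> gen x" by (rule gen_mono[OF xS rx jinv_gen[OF spos_scaleR[OF x r]]])
    show "(1 / r) *\<^sub>R jinv x \<in> gen x" by (intro gen_closed xS jinv_gen x)
    show "(r *\<^sub>R x) \<cdot> jinv (r *\<^sub>R x) = e" by (rule jinv_right[OF spos_scaleR[OF x r]])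
    show "(r *\<^sub>R x) \<cdot> ((1 / r) *\<^sub>R jinv x) = e" using r by (simp add: jbilin jinv_right[OF x])
  qed
qed

abbreviation proj :: "'a \<Rightarrow> bool" where "proj p \<equiv> jb_projection S p"

lemma proj_in: "proj p \<Longrightarrow> p \<in> S" and proj_idem: "proj p \<Longrightarrow> p \<cdot> p = p" by (auto simp: jb_projection_def)

lemma proj_K: "proj p \<Longrightarrow> p \<in> K" using square_in_K[of p] by (simp add: proj_in proj_idem)

lemma proj_compl: "proj p \<Longrightarrow> proj (e - p)" by (simp add: jb_projection_def jbilin)

lemma proj_compl_jprod: "proj p \<Longrightarrow> (e - p) \<cdot> p = 0" "proj p \<Longrightarrow> p \<cdot> (e - p) = 0"
  by (simp_all add: jbilin proj_in proj_idem)

lemma proj_le_unit: "proj p \<Longrightarrow> p \<preceq> e" using proj_K[OF proj_compl] by (simp add: le_iff)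

lemma proj_zero [simp]: "proj 0" and proj_unit [simp]: "proj e" by (simp_all add: jb_projection_def jprod.zero_left)

lemma norm_proj: "proj p \<Longrightarrow> p \<noteq> 0 \<Longrightarrow> norm p = 1" using norm_jsquare[of p] by (simp add: proj_idem power2_eq_square)

lemma quad_rep_proj_proj: "proj p \<Longrightarrow> U p p = p" by (simp add: quad_rep_def proj_idem scaleR_2)

lemma quad_rep_proj_unit: "proj p \<Longrightarrow> U p e = p" by (simp add: proj_in proj_idem)

text \<open>For multiplication \<open>L\<close> by an idempotent the Jordan identity gives the
  Peirce equation \<open>2 L^3 - 3 L^2 + L = 0\<close>, that is,
  \<open>L (2 L^2 - L) = 2 L^2 - L\<close>.\<close>

lemma jprod_quad_rep_proj:
  assumes p: "proj p" and x: "x \<in> S"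
  shows "p \<cdot> U p x = U p x"
proof -
  define u v w where "u = p \<cdot> x" and "v = p \<cdot> u" and "w = p \<cdot> v"
  have "v + v + v = u + w + w" using jordan_linearized[of p p x p]
    by (simp add: u_def v_def w_def proj_idem[OF p] jprod_commute[of x p] jprod_commute[of "p \<cdot> x" p] add.assoc)
  hence "w + w - v = v + v - u" by (simp add: algebra_simps)
  thus ?thesis
    by (simp add: quad_rep_def proj_idem[OF p] u_def[symmetric] v_def[symmetric] w_def[symmetric] jbilin scaleR_2)
qed

lemma quad_rep_proj_iff:
  assumes p: "proj p" and x: "x \<in> S"
  shows "U p x = x \<longleftrightarrow> p \<cdot> x = x" using jprod_quad_rep_proj[OF p x] proj_idem[OF p] by (auto simp: quad_rep_def scaleR_2)

lemma quad_rep_proj_zero: "proj p \<Longrightarrow> p \<cdot> x = 0 \<Longrightarrow> U p x = 0" by (simp add: quad_rep_def proj_idem jprod.zero_right)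

text \<open>In the polarised identity with two arguments \<open>p\<close> and one \<open>x\<close>
  the remaining terms cancel if \<open>x\<close> lies in the Peirce 1-space or the Peirce 0-space of
  \<open>p\<close>.\<close>

lemma proj_opcomm:
  assumes p: "proj p" and x: "x \<in> S" "p \<cdot> x = x \<or> p \<cdot> x = 0" and z: "z \<in> S"
  shows "p \<cdot> (x \<cdot> z) = x \<cdot> (p \<cdot> z)"
proof -
  have l: "p \<cdot> (x \<cdot> z) + (p \<cdot> x) \<cdot> (p \<cdot> z) + (p \<cdot> x) \<cdot> (p \<cdot> z)
      = x \<cdot> (p \<cdot> z) + p \<cdot> ((p \<cdot> x) \<cdot> z) + p \<cdot> ((p \<cdot> x) \<cdot> z)"
    using jordan_linearized[of p p x z] proj_idem[OF p] by (simp add: jprod_commute[of x p]) from x(2) show ?thesis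
  proof
    assume "p \<cdot> x = x"
    with l show ?thesis by (simp add: add.assoc)
  next
    assume "p \<cdot> x = 0"
    with l show ?thesis by (simp add: jprod.zero_left jprod.zero_right)
  qed
qed

lemma proj_face_jprod:
  assumes "proj p" "x \<in> S" "y \<in> S" "p \<cdot> x = x" "p \<cdot> y = y"
  shows "p \<cdot> (x \<cdot> y) = x \<cdot> y" using proj_opcomm[of p x y] assms by simp

lemma proj_orth_jprod:
  assumes "proj p" "x \<in> S" "y \<in> S" "p \<cdot> x = 0" "p \<cdot> y = 0"
  shows "p \<cdot> (x \<cdot> y) = 0" using proj_opcomm[of p x y] assms by (simp add: jprod.zero_right)

lemma jprod_compl_zero: "proj p \<Longrightarrow> x \<in> S \<Longrightarrow> (e - p) \<cdot> x = 0 \<longleftrightarrow> p \<cdot> x = x" by (auto simp: jbilin)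

text \<open>Compression by \<open>e - p\<close> annihilates \<open>p\<close>, hence also the
  positive \<open>x\<close> below a multiple of it.\<close>

lemma le_proj_face:
  assumes p: "proj p" and x: "x \<in> K" "x \<preceq> r *\<^sub>R p"
  shows "p \<cdot> x = x" "U p x = x"
proof -
  have S: "p \<in> S" "x \<in> S" "e - p \<in> S" using p x K_subset proj_in by auto
  have "U (e - p) x \<preceq> r *\<^sub>R U (e - p) p" using quad_rep_mono[OF S(3) x(2)] by (simp add: quad_rep_scaleR)
  also have "U (e - p) p = 0" by (rule quad_rep_proj_zero[OF proj_compl[OF p]]) (rule proj_compl_jprod(1)[OF p])
  finally have "U (e - p) x = 0" using quad_rep_K[OF S(3) x(1)] le_antisym[of "U (e - p) x" 0] by simp
  hence "(e - p) \<cdot> x = 0" by (rule quad_rep_zero_jprod[OF S(3) x(1)])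
  thus "p \<cdot> x = x" using jprod_compl_zero[OF p S(2)] by blast
  thus "U p x = x" using quad_rep_proj_iff[OF p S(2)] by blast
qed

lemma face_le_proj:
  assumes p: "proj p" and x: "x \<in> S" "p \<cdot> x = x"
  shows "x \<preceq> norm x *\<^sub>R p"
proof -
  have "U p x \<preceq> U p (norm x *\<^sub>R e)" using quad_rep_mono[OF proj_in[OF p] le_norm[OF x(1) order_refl]] .
  thus ?thesis using quad_rep_proj_iff[OF p x(1)] x(2) by (simp add: quad_rep_scaleR quad_rep_proj_unit[OF p])
qed

lemma face_le_proj_unit:
  assumes p: "proj p" and x: "x \<in> S" "p \<cdot> x = x" "x \<preceq> e"
  shows "x \<preceq> p"
  using quad_rep_mono[OF proj_in[OF p] x(3)] quad_rep_proj_iff[OF p x(1)] x(2) by (simp add: quad_rep_proj_unit[OF p])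

lemma proj_diff:
  assumes "proj p" "proj q" "q \<cdot> p = p"
  shows "proj (q - p)" using assms by (simp add: jb_projection_def jbilin jprod_commute[of p q])

lemma proj_le_iff: "proj p \<Longrightarrow> proj q \<Longrightarrow> p \<preceq> q \<longleftrightarrow> q \<cdot> p = p"
proof
  assume pq: "proj p" "proj q"
  { assume "p \<preceq> q"
    thus "q \<cdot> p = p" using le_proj_face(1)[OF pq(2) proj_K[OF pq(1)], of 1] by simp }
  { assume "q \<cdot> p = p"
    thus "p \<preceq> q" using proj_K[OF proj_diff[OF pq]] by (simp add: le_iff) }
qed

lemma proj_add: "proj p \<Longrightarrow> proj q \<Longrightarrow> p \<cdot> q = 0 \<Longrightarrow> proj (p + q)"
  by (simp add: jb_projection_def jbilin jprod_commute[of q p])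

lemma proj_orth_le: "proj p \<Longrightarrow> proj q \<Longrightarrow> p \<cdot> q = 0 \<longleftrightarrow> p \<preceq> e - q"
  using proj_le_iff[of p "e - q"] proj_compl[of q] proj_in[of p] by (auto simp: jbilin jprod_commute[of q p])

lemma gen_proj_mem:
  assumes "proj p"
  shows "a *\<^sub>R p + b *\<^sub>R (e - p) \<in> gen p" using proj_in[OF assms] by (intro gen_closed gen_self gen_unit)

lemma proj_comb_mult:
  assumes "proj p"
  shows "(a *\<^sub>R p + b *\<^sub>R (e - p)) \<cdot> (c *\<^sub>R p + d *\<^sub>R (e - p)) = (a * c) *\<^sub>R p + (b * d) *\<^sub>R (e - p)"
  unfolding jprod.add_left jprod.add_right jprod.scaleR_left jprod.scaleR_right
    proj_compl_jprod[OF assms] proj_idem[OF assms] proj_idem[OF proj_compl[OF assms]] by (simp add: mult.commute)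

lemma quad_rep_proj_comb:
  assumes p: "proj p"
  shows "U (a *\<^sub>R p + b *\<^sub>R (e - p)) (c *\<^sub>R p + d *\<^sub>R (e - p)) = (a * a * c) *\<^sub>R p + (b * b * d) *\<^sub>R (e - p)"
  using quad_rep_gen[OF proj_in[OF p] gen_proj_mem[OF p] gen_proj_mem[OF p]] by (simp add: proj_comb_mult[OF p])

lemma proj_comb_spos:
  assumes p: "proj p" and "0 < a" "0 < b"
  shows "spos (a *\<^sub>R p + b *\<^sub>R (e - p))"
proof (rule sposI)
  have "a *\<^sub>R p + b *\<^sub>R (e - p) - min a b *\<^sub>R e = (a - min a b) *\<^sub>R p + (b - min a b) *\<^sub>R (e - p)"
    by (simp add: algebra_simps)
  thus "min a b *\<^sub>R e \<preceq> a *\<^sub>R p + b *\<^sub>R (e - p)"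
    unfolding le_iff using proj_K[OF p] proj_K[OF proj_compl[OF p]] by (auto intro!: K_add K_scaleR)
qed (use assms proj_in[OF p] in auto)

lemma jinv_proj_comb:
  assumes p: "proj p" and "0 < a" "0 < b"
  shows "jinv (a *\<^sub>R p + b *\<^sub>R (e - p)) = (1 / a) *\<^sub>R p + (1 / b) *\<^sub>R (e - p)"
proof -
  let ?a = "a *\<^sub>R p + b *\<^sub>R (e - p)"
  have s: "spos ?a" using assms by (rule proj_comb_spos)
  have pS: "p \<in> S" using p by (rule proj_in)
  show ?thesis
  proof (rule gen_inverse_unique[OF pS gen_proj_mem[OF p]])
    show "jinv ?a \<in> gen p" by (rule gen_mono[OF pS gen_proj_mem[OF p] jinv_gen[OF s]])
    show "?a \<cdot> ((1 / a) *\<^sub>R p + (1 / b) *\<^sub>R (e - p)) = e" unfolding proj_comb_mult[OF p] using assms by simp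
  qed (use jinv_right[OF s] gen_proj_mem[OF p] in auto)
qed

definition is_lub :: "'a set \<Rightarrow> 'a \<Rightarrow> bool" where
  "is_lub X r \<longleftrightarrow> r \<in> S \<and> (\<forall>a\<in>X. a \<preceq> r) \<and> (\<forall>u\<in>S. (\<forall>a\<in>X. a \<preceq> u) \<longrightarrow> r \<preceq> u)"

text \<open>The hypothesis makes each \<open>a\<close> orthogonal to \<open>e - r\<close>, so
  \<open>a = U r a \<preceq> r \<cdot> r\<close> and therefore
  \<open>r \<preceq> r \<cdot> r\<close>. The reverse inequality holds because the norm of
  \<open>r\<close> is at most \<open>1\<close>.\<close>

lemma lub_proj:
  assumes X: "X \<noteq> {}" "\<And>a. a \<in> X \<Longrightarrow> a \<in> K \<and> a \<preceq> e" and r: "is_lub X r"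
    and z: "\<And>a. a \<in> X \<Longrightarrow> U a (e - r) = 0"
  shows "proj r"
proof -
  have rS: "r \<in> S" using r by (simp add: is_lub_def)
  have re: "r \<preceq> e" using r X by (auto simp: is_lub_def)
  obtain a0 where "a0 \<in> X" using X by blast
  hence "0 \<preceq> a0" "a0 \<preceq> r" using X r by (auto simp: is_lub_def)
  hence rK: "r \<in> K" using le_trans[of 0 a0 r] by simp
  have wK: "e - r \<in> K" using re by (simp add: le_iff)
  have "a \<preceq> r \<cdot> r" if a: "a \<in> X" for a
  proof -
    have aK: "a \<in> K" "a \<preceq> e" "a \<in> S" using X(2)[OF a] K_subset by auto
    note z0 = quad_rep_zero_sym[OF aK(1) wK z[OF a]]
    have 1: "a \<cdot> r = a" using z0(4) aK(3) by (simp add: jbilin)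
    have "r \<cdot> r = e - 2 *\<^sub>R (e - r) + (e - r) \<cdot> (e - r)" using rS by (simp add: jbilin scaleR_2 algebra_simps)
    hence 2: "a \<cdot> (r \<cdot> r) = a" using z0(3,4) aK(3) by (simp add: jprod.add_right jprod.diff_right jprod.scaleR_right)
    have "U r a = a" using 1 2 by (simp add: quad_rep_def jprod_commute[of r a] jprod_commute[of "r \<cdot> r" a] scaleR_2)
    thus ?thesis using quad_rep_mono[OF rS aK(2)] rS by simp
  qed
  hence "r \<preceq> r \<cdot> r" using r rS by (auto simp: is_lub_def)
  moreover have "r \<cdot> r \<preceq> r"
  proof -
    have "norm r \<le> 1" using norm_mono[OF rK re unit_in] norm_unit_le by linarith
    hence "norm r *\<^sub>R r \<preceq> 1 *\<^sub>R r" by (rule le_scaleR_left[OF rK])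
    thus ?thesis using square_le[OF rK] le_trans by simp
  qed
  ultimately show ?thesis using le_antisym rS by (auto simp: jb_projection_def)
qed

end

section \<open>Spectral projections and range projections\<close>

context jbw
begin

lemma lub_exists:
  assumes "D \<subseteq> S" "D \<noteq> {}" "\<And>x y. x \<in> D \<Longrightarrow> y \<in> D \<Longrightarrow> \<exists>z\<in>D. x \<preceq> z \<and> y \<preceq> z"
    and "b \<in> S" "\<And>d. d \<in> D \<Longrightarrow> d \<preceq> b"
  shows "\<exists>x. is_lub D x"
proof -
  obtain d0 where "d0 \<in> D" using assms(2) by blast
  from directed_sup[OF assms(1) this assms(3-5)] show ?thesis unfolding is_lub_def by blast
qed

text \<open>For positive \<open>n\<close> this is zero up to \<open>c + 1/n\<close> and one from
  \<open>c + 2/n\<close> on: a continuous approximation from below to the indicator function of the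
  half-line beyond \<open>c\<close>, such that each ramp is supported where a later one equals
  \<open>1\<close>.\<close>

definition ramp :: "real \<Rightarrow> nat \<Rightarrow> real \<Rightarrow> real" where
  "ramp c n s = min 1 (max 0 (real n * (s - c) - 1))"

lemma ramp_cont [continuous_intros]: "continuous_on A (ramp c n)" unfolding ramp_def by (intro continuous_intros)

lemma ramp_bounds: "0 \<le> ramp c n s" "ramp c n s \<le> 1" by (auto simp: ramp_def)

lemma ramp_mono: "m \<le> n \<Longrightarrow> ramp c m s \<le> ramp c n s"
proof (cases "s \<le> c")
  case True
  hence "real k * (s - c) \<le> 0" for k by (simp add: mult_nonneg_nonpos)
  hence "max 0 (real k * (s - c) - 1) = 0" for k by (intro max_absorb1) (simp add: order_trans[of _ 0])
  hence "ramp c k s = 0" for k by (simp add: ramp_def)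
  thus ?thesis by simp
next
  case False
  assume "m \<le> n"
  hence "real m * (s - c) \<le> real n * (s - c)" using False by (intro mult_right_mono) auto
  thus ?thesis by (auto simp: ramp_def)
qed

lemma ramp_eq_1: "ramp c n s \<noteq> 0 \<Longrightarrow> ramp c (2 * n) s = 1" by (auto simp: ramp_def split: if_splits)

lemma ramp_zero_le: "(\<And>n. ramp c n s = 0) \<Longrightarrow> s \<le> c"
proof (rule ccontr)
  assume z: "\<And>n. ramp c n s = 0" and "\<not> s \<le> c"
  hence d: "s - c > 0" by simp
  obtain n where "2 / (s - c) < real n" using reals_Archimedean2 by blast
  hence "real n * (s - c) > 2" using d by (simp add: pos_divide_less_eq)
  hence "ramp c n s = 1" by (simp add: ramp_def)
  with z show False by simp
qed

lemma spectral_lub: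
  assumes x: "x \<in> S"
  shows "\<exists>r. is_lub (range (\<lambda>n. fcal x (ramp c n))) r"
proof (rule lub_exists)
  have le: "fcal x (ramp c m) \<preceq> fcal x (ramp c n)" if "m \<le> n" for m n
    using that by (intro fcal_mono[OF x ramp_cont ramp_cont] ramp_mono)
  show "\<exists>z\<in>range (\<lambda>n. fcal x (ramp c n)). u \<preceq> z \<and> v \<preceq> z"
    if u: "u \<in> range (\<lambda>n. fcal x (ramp c n))" and v: "v \<in> range (\<lambda>n. fcal x (ramp c n))" for u v
  proof -
    obtain m n where mn: "u = fcal x (ramp c m)" "v = fcal x (ramp c n)" using u v by blast
    show ?thesis unfolding mn by (rule bexI[of _ "fcal x (ramp c (max m n))"]) (auto intro: le)
  qed
  show "d \<preceq> e" if dr: "d \<in> range (\<lambda>n. fcal x (ramp c n))" for d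
  proof -
    obtain n where d: "d = fcal x (ramp c n)" using dr by blast
    show ?thesis
      unfolding d using fcal_mono[OF x ramp_cont[of _ c n], of "\<lambda>s. 1"] ramp_bounds fcal_const[OF x, of 1] by simp
  qed
qed (use x gen_in[OF x fcal_in_gen[OF x ramp_cont]] in auto)

text \<open>The spectral projection of \<open>x\<close> belonging to the open half-line beyond
  \<open>c\<close>; for \<open>c = 0\<close> and positive \<open>x\<close> it is the range
  projection.\<close>

definition spr :: "real \<Rightarrow> 'a \<Rightarrow> 'a" where
  "spr c x = (SOME r. is_lub (range (\<lambda>n. fcal x (ramp c n))) r)"

lemma spr_lub: "x \<in> S \<Longrightarrow> is_lub (range (\<lambda>n. fcal x (ramp c n))) (spr c x)"
  unfolding spr_def using spectral_lub by (rule someI_ex)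

lemma ramp_in: "x \<in> S \<Longrightarrow> fcal x (ramp c n) \<in> S" by (rule gen_in[OF _ fcal_in_gen[OF _ ramp_cont]])

lemma ramp_K: "x \<in> S \<Longrightarrow> fcal x (ramp c n) \<in> K" by (rule fcal_pos[OF _ ramp_cont ramp_bounds(1)])

lemma ramp_le_unit: "x \<in> S \<Longrightarrow> fcal x (ramp c n) \<preceq> e"
  using fcal_mono[OF _ ramp_cont[of _ c n], of x "\<lambda>s. 1"] ramp_bounds fcal_const[of x 1] by simp

lemma ramp_le_spr: "x \<in> S \<Longrightarrow> fcal x (ramp c n) \<preceq> spr c x" using spr_lub[of x c] by (auto simp: is_lub_def)

lemma spr_least: "x \<in> S \<Longrightarrow> u \<in> S \<Longrightarrow> (\<And>n. fcal x (ramp c n) \<preceq> u) \<Longrightarrow> spr c x \<preceq> u"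
  using spr_lub[of x c] by (auto simp: is_lub_def)

lemma fcal_quad_rep:
  assumes x: "x \<in> S" and g: "continuous_on (sp x) g" and h: "continuous_on (sp x) h"
  shows "U (fcal x g) (fcal x h) = fcal x (\<lambda>s. g s * g s * h s)"
  using quad_rep_gen[OF x fcal_in_gen[OF x g] fcal_in_gen[OF x h]]
    fcal_mult[OF x g g] fcal_mult[OF x _ h, of "\<lambda>s. g s * g s"] g by (simp add: continuous_on_mult)

text \<open>By \<open>ramp_eq_1\<close> the functions \<open>ramp c n\<close> and
  \<open>1 - ramp c (2 n)\<close> are orthogonal, so \<open>ramp c n\<close> at \<open>x\<close> is
  orthogonal to \<open>e - spr c x\<close>, as \<open>lub_proj\<close> demands.\<close>

lemma proj_spr: "x \<in> S \<Longrightarrow> proj (spr c x)"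
proof (rule lub_proj[OF _ _ spr_lub])
  assume x: "x \<in> S"
  fix a assume "a \<in> range (\<lambda>n. fcal x (ramp c n))"
  then obtain n where a: "a = fcal x (ramp c n)" by blast
  show "a \<in> K \<and> a \<preceq> e" using ramp_K ramp_le_unit x by (simp add: a)
  have "U a (e - spr c x) \<preceq> U a (e - fcal x (ramp c (2 * n)))"
    by (rule quad_rep_mono) (use ramp_in x ramp_le_spr[OF x, of c "2 * n"] in \<open>auto simp: a le_iff\<close>)
  also have "e - fcal x (ramp c (2 * n)) = fcal x (\<lambda>s. 1 - ramp c (2 * n) s)"
    using fcal_diff[OF x _ ramp_cont, of "\<lambda>s. 1"] fcal_const[OF x, of 1] by simp
  also have "U a \<dots> = fcal x (\<lambda>s. ramp c n s * ramp c n s * (1 - ramp c (2 * n) s))"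
    unfolding a by (rule fcal_quad_rep[OF x ramp_cont]) (intro continuous_intros)
  also have "(\<lambda>s. ramp c n s * ramp c n s * (1 - ramp c (2 * n) s)) = (\<lambda>s. 0)" using ramp_eq_1 by fastforce
  also have "fcal x (\<lambda>s. 0) = 0" using fcal_const[OF x, of 0] by simp
  finally have "U a (e - spr c x) \<preceq> 0" .
  moreover have "e - spr c x \<in> K" using spr_least[OF x unit_in ramp_le_unit[OF x]] by (simp add: le_iff)
  ultimately show "U a (e - spr c x) = 0"
    using quad_rep_K[of a "e - spr c x"] ramp_in[OF x] le_antisym[of _ 0] by (simp add: a)
qed auto

lemma spr_scale_le: "x \<in> K \<Longrightarrow> 0 < c \<Longrightarrow> c *\<^sub>R spr c x \<preceq> x"
proof -
  assume x: "x \<in> K" and c: "0 < c"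
  have xS: "x \<in> S" using x K_subset by blast
  have "fcal x (ramp c n) \<preceq> (1 / c) *\<^sub>R x" for n
  proof -
    have "fcal x (ramp c n) \<preceq> fcal x (\<lambda>s. (1 / c) * s)"
    proof (rule fcal_mono[OF xS ramp_cont])
      fix s assume s: "s \<in> sp x"
      show "ramp c n s \<le> 1 / c * s"
      proof (cases "s \<le> c")
        case True
        hence "real n * (s - c) \<le> 0" by (simp add: mult_nonneg_nonpos)
        hence "ramp c n s = 0" by (simp add: ramp_def)
        thus ?thesis using spectrum_nonneg[OF x s] c by simp
      next
        case False
        hence "1 \<le> 1 / c * s" using c by simp
        thus ?thesis using ramp_bounds(2)[of c n s] by linarith
      qed
    qed (intro continuous_intros)
    thus ?thesis using fcal_scaleR[OF xS, of "\<lambda>s. s" "1 / c"] fcal_id[OF xS] by simp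
  qed
  hence "spr c x \<preceq> (1 / c) *\<^sub>R x" by (intro spr_least xS) (use xS in auto)
  from le_scaleR_mono[OF this, of c] c show ?thesis by simp
qed

lemma spr_zero: "x \<in> S \<Longrightarrow> spr c x = 0 \<Longrightarrow> x \<preceq> c *\<^sub>R e"
proof (rule le_spectrum)
  assume x: "x \<in> S" and z: "spr c x = 0"
  fix s assume s: "s \<in> sp x"
  have "ramp c n s = 0" for n
  proof -
    have "fcal x (ramp c n) = 0"
      using ramp_le_spr[OF x, of c n] ramp_K[OF x, of c n] le_antisym[of _ 0] by (simp add: z)
    hence "\<bar>ramp c n s\<bar> \<le> 0" using fcal_norm[OF x ramp_cont, of 0 c n] s by auto
    thus ?thesis by simp
  qed
  thus "s \<le> c" by (rule ramp_zero_le)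
qed

lemma positive_dominates_proj:
  assumes x: "x \<in> K" "x \<noteq> 0"
  shows "\<exists>q \<epsilon>. proj q \<and> q \<noteq> 0 \<and> 0 < \<epsilon> \<and> \<epsilon> *\<^sub>R q \<preceq> x"
proof -
  have xS: "x \<in> S" using x K_subset by blast
  define c where "c = norm x / 2"
  have c: "0 < c" "c < norm x" using x by (auto simp: c_def)
  have "spr c x \<noteq> 0"
  proof
    assume "spr c x = 0"
    hence "x \<preceq> c *\<^sub>R e" by (rule spr_zero[OF xS])
    hence "norm x \<le> norm (c *\<^sub>R e)" by (intro norm_mono x) auto
    also have "\<dots> \<le> c" using c norm_unit_le by simp
    finally show False using c by simp
  qed
  thus ?thesis using proj_spr[OF xS, of c] spr_scale_le[OF x(1) c(1)] c(1) by blast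
qed

text \<open>Split \<open>y = u - v\<close> into positive and negative part. A projection with a
  positive multiple below \<open>v\<close> is orthogonal to \<open>u\<close>, so compression by it
  sees only \<open>- v\<close>.\<close>

lemma nonpositive_dominates_proj:
  assumes y: "y \<in> S" "y \<notin> K"
  shows "\<exists>q \<epsilon>. proj q \<and> q \<noteq> 0 \<and> 0 < \<epsilon> \<and> U q y \<preceq> - (\<epsilon> *\<^sub>R q)"
proof -
  define u where "u = fcal y (\<lambda>s. max 0 s)"
  define v where "v = fcal y (\<lambda>s. max 0 (- s))"
  have c: "continuous_on A (\<lambda>s::real. max 0 s)" "continuous_on A (\<lambda>s::real. max 0 (- s))" for A
    by (intro continuous_intros)+
  have uK: "u \<in> K" and vK: "v \<in> K" unfolding u_def v_def by (auto intro!: fcal_pos y c)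
  have yuv: "y = u - v"
  proof -
    have "(\<lambda>s::real. max 0 s - max 0 (- s)) = (\<lambda>s. s)" by auto
    thus ?thesis unfolding u_def v_def using fcal_diff[OF y(1) c] fcal_id[OF y(1)] by simp
  qed
  have "v \<noteq> 0" using yuv y uK by auto
  then obtain q \<epsilon> where q: "proj q" "q \<noteq> 0" "0 < \<epsilon>" "\<epsilon> *\<^sub>R q \<preceq> v" using positive_dominates_proj[OF vK] by blast
  have S: "u \<in> S" "v \<in> S" "q \<in> S" using uK vK K_subset q proj_in by auto
  have "U u v = 0"
  proof -
    have "(\<lambda>s::real. max 0 s * max 0 s * max 0 (- s)) = (\<lambda>s. 0)" by (auto simp: max_def)
    thus ?thesis unfolding u_def v_def using fcal_quad_rep[OF y(1) c] fcal_const[OF y(1), of 0] by simp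
  qed
  hence "\<epsilon> *\<^sub>R U u q \<preceq> 0" using quad_rep_mono[OF S(1) q(4)] by (simp add: quad_rep_scaleR)
  hence "U u q \<preceq> 0" using le_scaleR_mono[of "\<epsilon> *\<^sub>R U u q" 0 "1 / \<epsilon>"] q(3) by simp
  hence "U u q = 0" using quad_rep_K[OF S(1) proj_K[OF q(1)]] le_antisym[of _ 0] by simp
  hence "U q u = 0" by (rule quad_rep_zero_sym(1)[OF uK proj_K[OF q(1)]])
  hence "U q y = - U q v" unfolding yuv by (simp add: quad_rep_diff)
  moreover have "\<epsilon> *\<^sub>R q \<preceq> U q v"
    using quad_rep_mono[OF S(3) q(4)] by (simp add: quad_rep_scaleR quad_rep_proj_proj[OF q(1)])
  ultimately have "U q y \<preceq> - (\<epsilon> *\<^sub>R q)" by (simp add: le_iff)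
  with q show ?thesis by blast
qed

abbreviation rng :: "'a \<Rightarrow> 'a" where "rng x \<equiv> spr 0 x"

text \<open>On nonnegative reals \<open>s^2 (1 - ramp 0 m s)\<close> is at most
  \<open>(2/m)^2\<close>, so \<open>U x (e - rng x)\<close> is below every positive multiple of
  \<open>e\<close> and vanishes.\<close>

lemma rng_jprod:
  assumes x: "x \<in> K"
  shows "rng x \<cdot> x = x" "x \<preceq> norm x *\<^sub>R rng x"
proof -
  have xS: "x \<in> S" using x K_subset by blast
  have r: "proj (rng x)" by (rule proj_spr[OF xS])
  have wK: "e - rng x \<in> K" using proj_K[OF proj_compl[OF r]] .
  have "U x (e - rng x) \<preceq> (0 + (1 / real (Suc n)) *\<^sub>R e)" for n
  proof -
    obtain m where m: "4 * real (Suc n) < real m" using reals_Archimedean2 by blast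
    have "m > 0" using m by (metis less_trans of_nat_0_less_iff zero_less_mult_iff zero_less_numeral of_nat_0_less_iff zero_less_Suc)
    have "U x (e - rng x) \<preceq> U x (e - fcal x (ramp 0 m))"
      by (rule quad_rep_mono[OF xS]) (use ramp_le_spr[OF xS, of 0 m] in \<open>auto simp: le_iff\<close>)
    also have "U x (e - fcal x (ramp 0 m)) = fcal x (\<lambda>s. s * s * (1 - ramp 0 m s))"
      using fcal_quad_rep[OF xS, of "\<lambda>s. s" "\<lambda>s. 1 - ramp 0 m s"] fcal_diff[OF xS _ ramp_cont, of "\<lambda>s. 1" 0 m]
        fcal_const[OF xS, of 1] fcal_id[OF xS] by (simp add: continuous_on_diff ramp_cont)
    also have "\<dots> \<preceq> fcal x (\<lambda>s. 1 / real (Suc n))"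
    proof (rule fcal_mono[OF xS])
      fix s assume "s \<in> sp x"
      hence s: "0 \<le> s" by (rule spectrum_nonneg[OF x])
      show "s * s * (1 - ramp 0 m s) \<le> 1 / real (Suc n)"
      proof (cases "real m * s \<ge> 2")
        case True
        hence "ramp 0 m s = 1" by (simp add: ramp_def)
        thus ?thesis by simp
      next
        case False
        hence s2: "s \<le> 2 / real m" using \<open>m > 0\<close> by (simp add: field_simps)
        have "s * s * (1 - ramp 0 m s) \<le> s * s * 1" using ramp_bounds[of 0 m s] by (intro mult_left_mono) auto
        also have "s * s * 1 \<le> (2 / real m) * (2 / real m)"  unfolding mult_1_right using s s2 by (intro mult_mono) auto
        also have "\<dots> \<le> 4 / real m" using \<open>m > 0\<close> by (simp add: field_simps)
        also have "\<dots> \<le> 1 / real (Suc n)" using m \<open>m > 0\<close> by (simp add: field_simps)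
        finally show ?thesis .
      qed
    qed (intro continuous_intros)+
    finally show ?thesis by (simp add: fcal_const[OF xS])
  qed
  hence "U x (e - rng x) \<preceq> 0" by (rule le_limit[OF _ tendsto_const tendsto_add_inverse_scaleR])
  hence "U x (e - rng x) = 0" using quad_rep_K[OF xS wK] le_antisym[of _ 0] by simp
  hence "x \<cdot> (e - rng x) = 0" by (rule quad_rep_zero_jprod[OF xS wK])
  thus 1: "rng x \<cdot> x = x" using xS by (simp add: jbilin jprod_commute)
  show "x \<preceq> norm x *\<^sub>R rng x" by (rule face_le_proj[OF r xS 1])
qed

lemma rng_le:
  assumes x: "x \<in> K" and q: "proj q" "q \<cdot> x = x"
  shows "rng x \<preceq> q"
proof (rule spr_least)
  show xS: "x \<in> S" using x K_subset by blast
  show "q \<in> S" using q proj_in by blast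
  fix n
  let ?a = "fcal x (ramp 0 n)"
  have "?a \<preceq> fcal x (\<lambda>s. real n * s)"
  proof (rule fcal_mono[OF xS ramp_cont])
    fix s assume "s \<in> sp x"
    hence "0 \<le> real n * s" using spectrum_nonneg[OF x] by simp
    thus "ramp 0 n s \<le> real n * s" by (simp add: ramp_def)
  qed (intro continuous_intros)
  also have "\<dots> = real n *\<^sub>R x" using fcal_scaleR[OF xS, of "\<lambda>s. s"] fcal_id[OF xS] by simp
  also have "\<dots> \<preceq> real n *\<^sub>R (norm x *\<^sub>R q)" by (rule le_scaleR_mono[OF face_le_proj[OF q(1) xS q(2)]]) simp
  finally have "?a \<preceq> (real n * norm x) *\<^sub>R q" by simp
  hence "q \<cdot> ?a = ?a" by (rule le_proj_face(1)[OF q(1) ramp_K[OF xS]])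
  thus "?a \<preceq> q" by (intro face_le_proj_unit[OF q(1)] ramp_in xS ramp_le_unit)
qed

lemma rng_orth:
  assumes x: "x \<in> K" and q: "proj q" "q \<cdot> x = 0"
  shows "q \<cdot> rng x = 0"
proof -
  have xS: "x \<in> S" using x K_subset by blast
  have "rng x \<preceq> e - q" by (rule rng_le[OF x proj_compl[OF q(1)]]) (use q xS in \<open>simp add: jbilin\<close>)
  thus ?thesis using proj_orth_le[OF proj_spr[OF xS] q(1)] by (simp add: jprod_commute)
qed

lemma rng_mono:
  assumes "x \<in> K" "y \<in> K" "x \<preceq> y"
  shows "rng x \<preceq> rng y"
proof (rule rng_le[OF assms(1)])
  show r: "proj (rng y)" using proj_spr assms K_subset by blast
  have "x \<preceq> norm y *\<^sub>R rng y" using le_trans[OF assms(3) rng_jprod(2)[OF assms(2)]] .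
  thus "rng y \<cdot> x = x" by (rule le_proj_face(1)[OF r assms(1)])
qed

lemma proj_le_rng_compl:
  assumes x: "x \<in> S" "x \<preceq> e" and p: "proj p" "p \<preceq> x"
  shows "rng (e - x) \<cdot> p = 0"
proof -
  have w: "e - x \<in> K" "e - x \<in> S" using x by (auto simp: le_iff)
  have "e - x \<preceq> 1 *\<^sub>R (e - p)" using p(2) by (simp add: le_iff)
  hence "(e - p) \<cdot> (e - x) = e - x" by (rule le_proj_face(1)[OF proj_compl[OF p(1)] w(1)])
  hence "p \<cdot> (e - x) = 0" using w proj_in[OF p(1)] by (simp add: jprod.diff_left)
  thus ?thesis using rng_orth[OF w(1) p(1)] by (simp add: jprod_commute)
qed

text \<open>Together with \<open>proj_le_rng_compl\<close> this shows that an \<open>x\<close> in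
  the unit interval above several projections is above their join, even if \<open>x\<close> is not a
  projection: what is orthogonal to \<open>rng (e - x)\<close> has its range below
  \<open>e - rng (e - x) \<preceq> x\<close>.\<close>

lemma rng_le_upper:
  assumes x: "x \<in> S" "x \<preceq> e" and y: "y \<in> K" "rng (e - x) \<cdot> y = 0" and xK: "x \<in> K"
  shows "rng y \<preceq> x"
proof -
  define w where "w = e - x"
  have w: "w \<in> K" "w \<in> S" "w \<preceq> e" using x xK by (auto simp: w_def le_iff)
  have r: "proj (rng w)" by (rule proj_spr[OF w(2)])
  have "rng w \<cdot> rng y = 0" using rng_orth[OF y(1) r] y(2) by (simp add: w_def)
  hence "rng y \<preceq> e - rng w"
    using proj_orth_le[OF proj_spr[OF K_subset[OF y(1)], of 0] r] jprod_commute[of "rng y" "rng w"] by simp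
  also have "w \<preceq> rng w" by (rule face_le_proj_unit[OF r w(2) rng_jprod(1)[OF w(1)] w(3)])
  hence "e - rng w \<preceq> x" by (simp add: le_iff w_def algebra_simps)
  finally show ?thesis .
qed

section \<open>Atoms and coefficients at atoms\<close>

abbreviation atom :: "'a \<Rightarrow> bool" where "atom p \<equiv> jb_atom S p"

lemma atom_proj: "atom p \<Longrightarrow> proj p" and atom_nonzero: "atom p \<Longrightarrow> p \<noteq> 0" by (auto simp: jb_atom_def)

lemma atom_minimal: "atom p \<Longrightarrow> proj q \<Longrightarrow> q \<noteq> 0 \<Longrightarrow> q \<preceq> p \<Longrightarrow> q = p" by (auto simp: jb_atom_def)

lemma atom_in: "atom p \<Longrightarrow> p \<in> S" and atom_K: "atom p \<Longrightarrow> p \<in> K" by (auto dest: atom_proj proj_in proj_K)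

lemma norm_atom: "atom p \<Longrightarrow> norm p = 1" by (rule norm_proj[OF atom_proj atom_nonzero])

lemma atom_scale_le: "atom p \<Longrightarrow> a *\<^sub>R p \<preceq> b *\<^sub>R p \<longleftrightarrow> a \<le> b"
proof
  assume p: "atom p" and le: "a *\<^sub>R p \<preceq> b *\<^sub>R p"
  show "a \<le> b"
  proof (rule ccontr)
    assume "\<not> a \<le> b"
    hence "b *\<^sub>R p \<preceq> a *\<^sub>R p" using le_scaleR_left[OF atom_K[OF p], of b a] by simp
    hence "a *\<^sub>R p = b *\<^sub>R p" using le le_antisym by blast
    thus False using atom_nonzero[OF p] \<open>\<not> a \<le> b\<close> by simp
  qed
qed (rule le_scaleR_left[OF atom_K])

text \<open>The spectral projections of \<open>x\<close> for \<open>0 < c < norm x\<close> are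
  nonzero and below \<open>p\<close>, so they all equal \<open>p\<close>, which gives
  \<open>c p \<preceq> x\<close> for all these \<open>c\<close>.\<close>

lemma atom_face_positive:
  assumes p: "atom p" and x: "x \<in> K" "p \<cdot> x = x"
  shows "x = norm x *\<^sub>R p"
proof (cases "x = 0")
  case False
  have pp: "proj p" using p by (rule atom_proj)
  have xS: "x \<in> S" using x K_subset by blast
  have nx: "norm x > 0" using False by simp
  have "c *\<^sub>R p \<preceq> x" if c: "0 < c" "c < norm x" for c
  proof -
    have r: "proj (spr c x)" "c *\<^sub>R spr c x \<preceq> x" using proj_spr[OF xS] spr_scale_le[OF x(1) c(1)] by auto
    have "spr c x \<noteq> 0"
    proof
      assume "spr c x = 0"
      hence "x \<preceq> c *\<^sub>R e" by (rule spr_zero[OF xS])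
      hence "norm x \<le> norm (c *\<^sub>R e)" by (intro norm_mono x) auto
      also have "\<dots> \<le> c" using c norm_unit_le by simp
      finally show False using c by simp
    qed
    have "c *\<^sub>R spr c x \<preceq> norm x *\<^sub>R p" using le_trans[OF r(2) face_le_proj[OF pp xS x(2)]] .
    from le_proj_face(1)[OF pp K_scaleR[OF proj_K[OF r(1)]] this] c
    have "p \<cdot> spr c x = spr c x" by (simp add: jprod.scaleR_right)
    hence "spr c x \<preceq> p" using proj_le_iff[OF r(1) pp] by blast
    hence "spr c x = p" using atom_minimal[OF p r(1) \<open>spr c x \<noteq> 0\<close>] by blast
    thus ?thesis using r(2) by simp
  qed
  hence "norm x *\<^sub>R p \<preceq> x + \<delta> *\<^sub>R p" if \<delta>: "\<delta> > 0" for \<delta>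
  proof (cases "\<delta> < norm x")
    case True
    thus ?thesis using \<open>\<And>c. 0 < c \<Longrightarrow> c < norm x \<Longrightarrow> c *\<^sub>R p \<preceq> x\<close>[of "norm x - \<delta>"] \<delta> by (simp add: le_iff algebra_simps)
  next
    case False
    have "(\<delta> - norm x) *\<^sub>R p \<in> K" using False atom_K[OF p] by (intro K_scaleR) auto
    from K_add[OF x(1) this] show ?thesis by (simp add: le_iff algebra_simps)
  qed
  hence "norm x *\<^sub>R p \<preceq> x" by (rule le_eps)
  thus ?thesis using face_le_proj[OF pp xS x(2)] le_antisym by blast
qed simp

abbreviation \<tau> :: "'a \<Rightarrow> 'a \<Rightarrow> real" where "\<tau> \<equiv> atom_coord"

lemma quad_rep_atom:
  assumes p: "atom p" and x: "x \<in> S"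
  shows "U p x = \<tau> p x *\<^sub>R p"
proof -
  have pp: "proj p" using p by (rule atom_proj)
  \<comment> \<open>The shift by \<open>norm x\<close> makes the element positive, so that
    \<open>atom_face_positive\<close> applies.\<close>
  define y where "y = U p x + norm x *\<^sub>R p"
  have yeq: "y = U p (x + norm x *\<^sub>R e)"
    using quad_rep_proj_unit[OF pp] by (simp add: y_def quad_rep_add quad_rep_scaleR)
  have yK: "y \<in> K" unfolding yeq by (rule quad_rep_K[OF proj_in[OF pp]])
      (use le_norm'[OF x order_refl] in \<open>simp add: le_iff\<close>)
  have "p \<cdot> y = y" unfolding yeq by (rule jprod_quad_rep_proj[OF pp]) (use x in simp)
  hence "y = norm y *\<^sub>R p" by (rule atom_face_positive[OF p yK])
  hence eq: "U p x = (norm y - norm x) *\<^sub>R p" by (simp add: y_def algebra_simps)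
  thus ?thesis unfolding atom_coord_def by (rule theI2) (use eq atom_nonzero[OF p] in auto)
qed

lemma \<tau>_eqI: "atom p \<Longrightarrow> x \<in> S \<Longrightarrow> U p x = r *\<^sub>R p \<Longrightarrow> \<tau> p x = r" using quad_rep_atom[of p x] atom_nonzero[of p] by simp

lemma \<tau>_add: "atom p \<Longrightarrow> x \<in> S \<Longrightarrow> y \<in> S \<Longrightarrow> \<tau> p (x + y) = \<tau> p x + \<tau> p y"
  by (rule \<tau>_eqI) (auto simp: quad_rep_add quad_rep_atom scaleR_left_distrib)

lemma \<tau>_diff: "atom p \<Longrightarrow> x \<in> S \<Longrightarrow> y \<in> S \<Longrightarrow> \<tau> p (x - y) = \<tau> p x - \<tau> p y"
  by (rule \<tau>_eqI) (auto simp: quad_rep_diff quad_rep_atom scaleR_left_diff_distrib)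

lemma \<tau>_scaleR: "atom p \<Longrightarrow> x \<in> S \<Longrightarrow> \<tau> p (r *\<^sub>R x) = r * \<tau> p x" by (rule \<tau>_eqI) (auto simp: quad_rep_scaleR quad_rep_atom)

lemma \<tau>_zero: "atom p \<Longrightarrow> \<tau> p 0 = 0" by (rule \<tau>_eqI) auto

lemma \<tau>_unit: "atom p \<Longrightarrow> \<tau> p e = 1" by (rule \<tau>_eqI) (auto simp: quad_rep_proj_unit[OF atom_proj, simplified])

lemma \<tau>_self: "atom p \<Longrightarrow> \<tau> p p = 1" by (rule \<tau>_eqI) (auto simp: quad_rep_proj_proj[OF atom_proj] atom_in)

lemma \<tau>_mono: "atom p \<Longrightarrow> x \<in> S \<Longrightarrow> y \<in> S \<Longrightarrow> x \<preceq> y \<Longrightarrow> \<tau> p x \<le> \<tau> p y"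
  using quad_rep_mono[OF atom_in, of p x y] by (simp add: quad_rep_atom atom_scale_le)

lemma \<tau>_nonneg: "atom p \<Longrightarrow> x \<in> K \<Longrightarrow> 0 \<le> \<tau> p x" using \<tau>_mono[of p 0 x] K_subset[of x] by (simp add: \<tau>_zero)

lemma \<tau>_zero_iff: "atom p \<Longrightarrow> x \<in> K \<Longrightarrow> \<tau> p x = 0 \<longleftrightarrow> p \<cdot> x = 0"
proof
  assume p: "atom p" and x: "x \<in> K"
  have xS: "x \<in> S" using x K_subset by blast
  { assume "\<tau> p x = 0"
    hence "U p x = 0" using quad_rep_atom[OF p xS] by simp
    thus "p \<cdot> x = 0" by (rule quad_rep_zero_jprod[OF atom_in[OF p] x]) }
  { assume "p \<cdot> x = 0"
    hence "U p x = 0" by (rule quad_rep_proj_zero[OF atom_proj[OF p]])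
    thus "\<tau> p x = 0" using quad_rep_atom[OF p xS] atom_nonzero[OF p] by simp }
qed

text \<open>Evaluating \<open>U (U p q) p\<close> directly and by the fundamental formula gives
  \<open>t^2 = s t\<close> for the two coefficients; if \<open>t = 0\<close>, orthogonality is
  symmetric.\<close>

lemma \<tau>_sym:
  assumes p: "atom p" and q: "atom q"
  shows "\<tau> p q = \<tau> q p"
proof -
  let ?t = "\<tau> p q" and ?s = "\<tau> q p"
  have S: "p \<in> S" "q \<in> S" using p q atom_in by auto
  have "U (U p q) p = ?t\<^sup>2 *\<^sub>R p"
    using quad_rep_atom[OF p S(2)] quad_rep_proj_proj[OF atom_proj[OF p]] by (simp add: quad_rep_scaleR_left)
  moreover have "U (U p q) p = (?s * ?t) *\<^sub>R p" unfolding fundamental_formula quad_rep_proj_proj[OF atom_proj[OF p]]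
    using quad_rep_atom[OF q S(1)] quad_rep_atom[OF p S(2)] by (simp add: quad_rep_scaleR)
  ultimately have t: "?t\<^sup>2 = ?s * ?t" using atom_nonzero[OF p] by simp
  show ?thesis
  proof (cases "?t = 0")
    case True
    hence "p \<cdot> q = 0" using \<tau>_zero_iff[OF p atom_K[OF q]] by simp
    hence "?s = 0" using \<tau>_zero_iff[OF q atom_K[OF p]] by (simp add: jprod_commute)
    thus ?thesis using True by simp
  qed (use t in \<open>simp add: power2_eq_square\<close>)
qed

lemma atom_le_imp_eq: "atom p \<Longrightarrow> atom q \<Longrightarrow> p \<preceq> q \<Longrightarrow> p = q" using atom_minimal[of q p] atom_proj atom_nonzero by blast

lemma \<tau>_le_1: "atom p \<Longrightarrow> atom q \<Longrightarrow> \<tau> p q \<le> 1"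
  using \<tau>_mono[of p q e] proj_le_unit[OF atom_proj, of q] by (simp add: \<tau>_unit atom_in)

lemma \<tau>_lt_1:
  assumes p: "atom p" and q: "atom q" and ne: "p \<noteq> q"
  shows "\<tau> p q < 1"
proof (rule ccontr)
  assume "\<not> \<tau> p q < 1"
  hence "\<tau> p (e - q) = 0" using \<tau>_le_1[OF p q] \<tau>_unit[OF p] \<tau>_diff[OF p unit_in atom_in[OF q]] by simp
  hence "p \<cdot> (e - q) = 0" using \<tau>_zero_iff[OF p proj_K[OF proj_compl[OF atom_proj[OF q]]]] by simp
  hence "q \<cdot> p = p" using atom_in[OF p] by (simp add: jbilin jprod_commute)
  hence "p \<preceq> q" using proj_le_iff atom_proj p q by blast
  thus False using atom_le_imp_eq[OF p q] ne by blast
qed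

lemma atom_interval:
  assumes p: "atom p" and x: "x \<in> K" "x \<preceq> r *\<^sub>R p"
  shows "x = \<tau> p x *\<^sub>R p" using le_proj_face(2)[OF atom_proj[OF p] x] quad_rep_atom[OF p K_subset[OF x(1)]] by simp

text \<open>The estimate comes from compressing with \<open>p + \<delta>(e - p)\<close>.\<close>

lemma \<tau>_less_bound:
  assumes p: "atom p" and x: "x \<in> S" and lt: "\<tau> p x < \<mu>"
  shows "\<exists>k>0. x \<preceq> \<mu> *\<^sub>R p + k *\<^sub>R (e - p)"
proof -
  have pp: "proj p" using p by (rule atom_proj)
  define \<eta> where "\<eta> = \<mu> - \<tau> p x"
  have \<eta>: "\<eta> > 0" using lt by (simp add: \<eta>_def)
  have "(\<lambda>n. U (p + (1 / real (Suc n)) *\<^sub>R (e - p)) x) \<longlonglongrightarrow> U p x"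
    by (intro tendsto_quad_rep tendsto_const tendsto_add_inverse_scaleR) from LIMSEQ_D[OF this \<eta>] obtain n where
    n: "norm (U (p + (1 / real (Suc n)) *\<^sub>R (e - p)) x - U p x) < \<eta>" by blast
  define \<delta> where "\<delta> = 1 / real (Suc n)"
  have \<delta>: "\<delta> > 0" by (simp add: \<delta>_def)
  define a where "a = 1 *\<^sub>R p + \<delta> *\<^sub>R (e - p)"
  define b where "b = 1 *\<^sub>R p + (1 / \<delta>) *\<^sub>R (e - p)"
  have S: "p \<in> S" "a \<in> S" "b \<in> S" using proj_in[OF pp] by (auto simp: a_def b_def)
  have "U a x - U p x \<preceq> \<eta> *\<^sub>R e" using n S x by (intro le_norm) (auto simp: a_def \<delta>_def)
  moreover have "U p x + \<eta> *\<^sub>R e = \<mu> *\<^sub>R p + \<eta> *\<^sub>R (e - p)"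
    unfolding quad_rep_atom[OF p x] by (simp add: \<eta>_def algebra_simps)
  ultimately have "U a x \<preceq> \<mu> *\<^sub>R p + \<eta> *\<^sub>R (e - p)" by (simp add: le_iff algebra_simps)
  hence "U b (U a x) \<preceq> U b (\<mu> *\<^sub>R p + \<eta> *\<^sub>R (e - p))" by (rule quad_rep_mono[OF S(3)])
  moreover have "U b (U a x) = x"
  proof -
    have "b \<cdot> a = e" unfolding a_def b_def proj_comb_mult[OF pp] using \<delta> by simp
    moreover have "a \<in> gen p" "b \<in> gen p" unfolding a_def b_def by (rule gen_proj_mem[OF pp])+
    ultimately show ?thesis using gen_quad_rep[OF S(1), of b a x] x by simp
  qed
  moreover have "U b (\<mu> *\<^sub>R p + \<eta> *\<^sub>R (e - p)) = \<mu> *\<^sub>R p + (1 / \<delta> * (1 / \<delta>) * \<eta>) *\<^sub>R (e - p)"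
    unfolding b_def quad_rep_proj_comb[OF pp] by simp
  ultimately show ?thesis using \<delta> \<eta> by (intro exI[of _ "1 / \<delta> * (1 / \<delta>) * \<eta>"]) auto
qed

lemma \<tau>_bound:
  assumes p: "atom p" and x: "x \<in> S" and le: "x \<preceq> \<mu> *\<^sub>R p + k *\<^sub>R (e - p)"
  shows "\<tau> p x \<le> \<mu>"
proof -
  have pS: "p \<in> S" using p by (rule atom_in)
  have "\<tau> p x \<le> \<tau> p (\<mu> *\<^sub>R p + k *\<^sub>R (e - p))" using le pS x by (intro \<tau>_mono p) auto
  also have "\<dots> = \<mu>" using pS by (simp add: \<tau>_add \<tau>_diff \<tau>_scaleR p \<tau>_self \<tau>_unit)
  finally show ?thesis .
qed

text \<open>Inversion turns the lower bound \<open>l p\<close> of \<open>x\<close> into an upper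
  bound \<open>(1/l) p + k (e - p)\<close> of its inverse, and with \<open>k\<close> at free
  disposal such a bound restricts only the coefficient at \<open>p\<close>
  (\<open>\<tau>_less_bound\<close>, \<open>\<tau>_bound\<close>). Both directions approximate
  \<open>l p\<close> by invertible combinations of \<open>p\<close> and
  \<open>e - p\<close>.\<close>

lemma atom_scale_le_iff:
  assumes x: "spos x" and p: "atom p" and l: "0 \<le> l"
  shows "l *\<^sub>R p \<preceq> x \<longleftrightarrow> l * \<tau> p (jinv x) \<le> 1"
proof
  have xS: "x \<in> S" and jS: "jinv x \<in> S" and pS: "p \<in> S" and pp: "proj p"
    using x spos_in jinv_in p atom_in atom_proj by auto
  have t0: "0 \<le> \<tau> p (jinv x)" by (intro \<tau>_nonneg p spos_K jinv_spos x)
  {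
    assume le: "l *\<^sub>R p \<preceq> x"
    obtain c where c: "c > 0" "c *\<^sub>R e \<preceq> x" using x by (auto simp: spos_def)
    show "l * \<tau> p (jinv x) \<le> 1"
    proof (rule field_le_epsilon)
      fix \<epsilon> :: real assume \<epsilon>: "\<epsilon> > 0"
      define r where "r = 1 + \<epsilon>"
      define d where "d = \<epsilon> * c"
      have d: "d > 0" and r: "r > 0" using \<epsilon> c by (auto simp: d_def r_def)
      have "d *\<^sub>R e \<preceq> \<epsilon> *\<^sub>R x" using le_scaleR_mono[OF c(2), of \<epsilon>] \<epsilon> by (simp add: d_def)
      from le_add_mono[OF le this] have "l *\<^sub>R p + d *\<^sub>R e \<preceq> r *\<^sub>R x" by (simp add: r_def algebra_simps)
      moreover have "l *\<^sub>R p + d *\<^sub>R e = (l + d) *\<^sub>R p + d *\<^sub>R (e - p)" by (simp add: algebra_simps)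
      ultimately have "(l + d) *\<^sub>R p + d *\<^sub>R (e - p) \<preceq> r *\<^sub>R x" by simp
      hence "jinv (r *\<^sub>R x) \<preceq> jinv ((l + d) *\<^sub>R p + d *\<^sub>R (e - p))"
        using l d xS by (intro jinv_antimono proj_comb_spos pp) auto
      hence "(1 / r) *\<^sub>R jinv x \<preceq> (1 / (l + d)) *\<^sub>R p + (1 / d) *\<^sub>R (e - p)"
        using l d by (simp add: jinv_proj_comb[OF pp] jinv_scaleR[OF x r])
      hence "\<tau> p ((1 / r) *\<^sub>R jinv x) \<le> 1 / (l + d)" by (rule \<tau>_bound[OF p scaleR_in[OF jS]])
      hence "\<tau> p (jinv x) / r \<le> 1 / (l + d)" using jS by (simp add: \<tau>_scaleR p)
      hence "\<tau> p (jinv x) * (l + d) \<le> r" using l d r by (simp add: field_simps)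
      moreover have "l * \<tau> p (jinv x) \<le> \<tau> p (jinv x) * (l + d)" using t0 d by (simp add: algebra_simps)
      ultimately show "l * \<tau> p (jinv x) \<le> 1 + \<epsilon>" by (simp add: r_def)
    qed
  }
  {
    assume le: "l * \<tau> p (jinv x) \<le> 1"
    show "l *\<^sub>R p \<preceq> x"
    proof (rule le_eps)
      fix \<delta> :: real assume \<delta>: "\<delta> > 0"
      show "l *\<^sub>R p \<preceq> x + \<delta> *\<^sub>R p"
      proof (cases "l \<le> \<delta>")
        case True
        hence "l *\<^sub>R p \<preceq> \<delta> *\<^sub>R p" by (intro le_scaleR_left atom_K p)
        with le_add_mono[of 0 x "l *\<^sub>R p" "\<delta> *\<^sub>R p"] spos_K[OF x] show ?thesis by simp
      next
        case False
        define m where "m = l - \<delta>"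
        have m: "0 < m" "m < l" using False \<delta> by (auto simp: m_def)
        have "\<tau> p (jinv x) < 1 / m"
        proof (cases "\<tau> p (jinv x) = 0")
          case False
          hence "m * \<tau> p (jinv x) < l * \<tau> p (jinv x)" using m t0 by simp
          thus ?thesis using le m by (simp add: field_simps)
        qed (use m in simp) from \<tau>_less_bound[OF p jS this] obtain k where
          k: "k > 0" "jinv x \<preceq> (1 / m) *\<^sub>R p + k *\<^sub>R (e - p)" by blast
        have "jinv ((1 / m) *\<^sub>R p + k *\<^sub>R (e - p)) \<preceq> jinv (jinv x)"
          using k m pS by (intro jinv_antimono jinv_spos x) auto
        hence "m *\<^sub>R p + (1 / k) *\<^sub>R (e - p) \<preceq> x" using k m by (simp add: jinv_proj_comb[OF pp] jinv_jinv[OF x])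
        moreover have "m *\<^sub>R p \<preceq> m *\<^sub>R p + (1 / k) *\<^sub>R (e - p)"
          using k proj_K[OF proj_compl[OF pp]] by (simp add: le_iff K_scaleR)
        ultimately have "m *\<^sub>R p \<preceq> x" using le_trans by blast
        thus ?thesis by (simp add: m_def le_iff algebra_simps)
      qed
    qed
  }
qed

end

locale jbw_atomic = jbw +
  assumes atomic: "jb_atomic S"
begin

lemma proj_dominates_atom: "proj q \<Longrightarrow> q \<noteq> 0 \<Longrightarrow> \<exists>p. atom p \<and> p \<preceq> q" using atomic unfolding jb_atomic_def by blast

lemma positive_dominates_atom:
  assumes "x \<in> K" "x \<noteq> 0"
  shows "\<exists>p \<epsilon>. atom p \<and> 0 < \<epsilon> \<and> \<epsilon> *\<^sub>R p \<preceq> x"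
proof -
  obtain q \<epsilon> where q: "proj q" "q \<noteq> 0" "0 < \<epsilon>" "\<epsilon> *\<^sub>R q \<preceq> x" using positive_dominates_proj[OF assms] by blast
  obtain p where p: "atom p" "p \<preceq> q" using proj_dominates_atom[OF q(1,2)] by blast
  have "\<epsilon> *\<^sub>R p \<preceq> x" using le_trans[OF le_scaleR_mono[OF p(2), of \<epsilon>] q(4)] q(3) by simp
  thus ?thesis using p q by blast
qed

text \<open>If \<open>y\<close> is not positive, some nonzero projection \<open>q\<close> has
  \<open>U q y \<preceq> - \<epsilon> q\<close>, and every atom below \<open>q\<close> inherits a
  negative coefficient, since compressing by \<open>q\<close> first does not change coefficients at
  such atoms.\<close>

lemma K_iff_\<tau>:
  assumes y: "y \<in> S"
  shows "y \<in> K \<longleftrightarrow> (\<forall>p. atom p \<longrightarrow> 0 \<le> \<tau> p y)"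
proof
  assume a: "\<forall>p. atom p \<longrightarrow> 0 \<le> \<tau> p y"
  show "y \<in> K"
  proof (rule ccontr)
    assume "y \<notin> K"
    then obtain q \<epsilon> where q: "proj q" "q \<noteq> 0" "0 < \<epsilon>" "U q y \<preceq> - (\<epsilon> *\<^sub>R q)"
      using nonpositive_dominates_proj[OF y] by blast
    obtain p where p: "atom p" "p \<preceq> q" using proj_dominates_atom[OF q(1,2)] by blast
    have S: "p \<in> S" "q \<in> S" using p q atom_in proj_in by auto
    have qp: "q \<cdot> p = p" using proj_le_iff[OF atom_proj[OF p(1)] q(1)] p(2) by blast
    have pq: "U q p = p" using quad_rep_proj_iff[OF q(1) S(1)] qp by blast
    have "U p (U q y) = U (U q p) y"
    proof -
      have "U (U q p) y = U q (U p (U q y))" by (rule fundamental_formula)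
      also have "U p (U q y) = \<tau> p (U q y) *\<^sub>R p" using quad_rep_atom[OF p(1)] S y by simp
      also have "U q \<dots> = \<tau> p (U q y) *\<^sub>R p" by (simp add: quad_rep_scaleR pq)
      also have "\<dots> = U p (U q y)" using quad_rep_atom[OF p(1)] S y by simp
      finally show ?thesis ..
    qed
    hence "\<tau> p y *\<^sub>R p = U p (U q y)" using quad_rep_atom[OF p(1) y] by (simp add: pq)
    also have "\<dots> \<preceq> U p (- (\<epsilon> *\<^sub>R q))" by (rule quad_rep_mono[OF S(1) q(4)])
    also have "\<dots> = - \<epsilon> *\<^sub>R U p q" using quad_rep_scaleR[of p "- \<epsilon>" q] by simp
    also have "U p q = p"
      using qp by (simp add: quad_rep_def jprod_commute[of p q] proj_idem[OF atom_proj[OF p(1)]] scaleR_2)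
    finally have "\<tau> p y \<le> - \<epsilon>" using atom_scale_le[OF p(1)] by blast
    thus False using a p(1) q(3) by fastforce
  qed
qed (use \<tau>_nonneg in blast)

lemma le_iff_\<tau>:
  assumes "x \<in> S" "y \<in> S"
  shows "x \<preceq> y \<longleftrightarrow> (\<forall>p. atom p \<longrightarrow> \<tau> p x \<le> \<tau> p y)" using K_iff_\<tau>[of "y - x"] assms by (simp add: le_iff \<tau>_diff)

lemma eq_iff_\<tau>:
  assumes "x \<in> S" "y \<in> S"
  shows "x = y \<longleftrightarrow> (\<forall>p. atom p \<longrightarrow> \<tau> p x = \<tau> p y)"
  using le_iff_\<tau>[OF assms] le_iff_\<tau>[OF assms(2,1)] le_antisym[of x y] by fastforce

lemma max_atom_scale:
  assumes x: "x \<in> K" and p: "atom p"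
  shows "\<exists>l\<ge>0. l *\<^sub>R p \<preceq> x \<and> (\<forall>t. t *\<^sub>R p \<preceq> x \<longrightarrow> t \<le> l)"
proof -
  have xS: "x \<in> S" using x K_subset by blast
  let ?T = "{t. 0 \<le> t \<and> t *\<^sub>R p \<preceq> x}"
  have bd: "t \<le> norm x" if "t *\<^sub>R p \<preceq> x" for t
  proof (cases "0 \<le> t")
    case True
    have "norm (t *\<^sub>R p) \<le> norm x" using True that atom_K[OF p] by (intro norm_mono xS K_scaleR)
    thus ?thesis using True norm_atom[OF p] by simp
  qed (use norm_ge_zero[of x] in linarith)
  have "closed ?T"
  proof -
    have "closed {t. x - t *\<^sub>R p \<in> K}"
      using closed_vimage[OF closed_K, of "\<lambda>t. x - t *\<^sub>R p"] by (simp add: vimage_def continuous_intros)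
    thus ?thesis unfolding le_iff by (intro closed_Collect_conj closed_Collect_le continuous_intros)
  qed
  moreover have "bounded ?T" using bd by (auto simp: bounded_iff intro!: exI[of _ "norm x"])
  ultimately have "compact ?T" by (simp add: compact_eq_bounded_closed)
  moreover have "0 \<in> ?T" using x by simp
  ultimately obtain l where l: "l \<in> ?T" "\<And>t. t \<in> ?T \<Longrightarrow> t \<le> l" using compact_attains_sup[of ?T] by blast
  have "t \<le> l" if "t *\<^sub>R p \<preceq> x" for t using l that by (cases "0 \<le> t") auto
  thus ?thesis using l by blast
qed

text \<open>Subtract the largest multiple of an atom \<open>p\<close> below \<open>x\<close>. An
  atom under the remainder would have multiples comparable with those of \<open>p\<close>, hence
  equal \<open>p\<close>, against maximality. This makes multiples of atoms recognisable by order
  alone.\<close>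

lemma total_interval_atom:
  assumes x: "x \<in> K" "x \<noteq> 0"
    and tot: "\<And>u v. u \<in> K \<Longrightarrow> v \<in> K \<Longrightarrow> u \<preceq> x \<Longrightarrow> v \<preceq> x \<Longrightarrow> u \<preceq> v \<or> v \<preceq> u"
  shows "\<exists>p l. atom p \<and> 0 < l \<and> x = l *\<^sub>R p"
proof -
  obtain p \<epsilon> where p: "atom p" "0 < \<epsilon>" "\<epsilon> *\<^sub>R p \<preceq> x" using positive_dominates_atom[OF x] by blast
  obtain l where l: "0 \<le> l" "l *\<^sub>R p \<preceq> x" "\<And>t. t *\<^sub>R p \<preceq> x \<Longrightarrow> t \<le> l" using max_atom_scale[OF x(1) p(1)] by blast
  have l0: "0 < l" using l(3)[OF p(3)] p(2) by linarith
  have "x - l *\<^sub>R p = 0"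
  proof (rule ccontr)
    assume "x - l *\<^sub>R p \<noteq> 0"
    moreover have yK: "x - l *\<^sub>R p \<in> K" using l(2) by (simp add: le_iff)
    ultimately obtain q \<mu> where q: "atom q" "0 < \<mu>" "\<mu> *\<^sub>R q \<preceq> x - l *\<^sub>R p" using positive_dominates_atom by blast
    have pK: "l *\<^sub>R p \<in> K" using p l by (intro K_scaleR atom_K) auto
    have lq: "\<mu> *\<^sub>R q \<preceq> x" using K_add[of "x - l *\<^sub>R p - \<mu> *\<^sub>R q" "l *\<^sub>R p"] q(3) pK by (simp add: le_iff)
    define m where "m = min \<mu> l"
    have m: "0 < m" "m \<le> \<mu>" "m \<le> l" using q l0 by (auto simp: m_def)
    have "m *\<^sub>R q \<preceq> x" "m *\<^sub>R p \<preceq> x" using le_trans[OF le_scaleR_left[OF atom_K[OF q(1)] m(2)] lq]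
        le_trans[OF le_scaleR_left[OF atom_K[OF p(1)] m(3)] l(2)] by auto
    moreover have "m *\<^sub>R q \<in> K" "m *\<^sub>R p \<in> K"
      using K_scaleR[OF atom_K[OF q(1)], of m] K_scaleR[OF atom_K[OF p(1)], of m] m by auto
    ultimately have "m *\<^sub>R q \<preceq> m *\<^sub>R p \<or> m *\<^sub>R p \<preceq> m *\<^sub>R q" using tot by blast
    hence "q \<preceq> p \<or> p \<preceq> q"
      using le_scaleR_mono[of "m *\<^sub>R q" "m *\<^sub>R p" "1 / m"] le_scaleR_mono[of "m *\<^sub>R p" "m *\<^sub>R q" "1 / m"] m by auto
    hence "q = p" using atom_le_imp_eq p q by blast
    hence "(l + \<mu>) *\<^sub>R p \<preceq> x" using q(3) by (simp add: le_iff algebra_simps)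
    thus False using l(3) q(2) by fastforce
  qed
  thus ?thesis using p l0 by (intro exI[of _ p] exI[of _ l]) auto
qed

text \<open>An invertible \<open>U c\<close> is an order automorphism, so the interval below the
  image of \<open>q\<close> is a segment, and \<open>total_interval_atom\<close> recognises
  it.\<close>

lemma quad_rep_spos_atom:
  assumes c: "spos c" and q: "atom q"
  shows "\<exists>q' m. atom q' \<and> 0 < m \<and> U c q = m *\<^sub>R q'"
proof (rule total_interval_atom)
  have cS: "c \<in> S" "jinv c \<in> S" and qS: "q \<in> S" using c q spos_in jinv_in atom_in by auto
  show xK: "U c q \<in> K" by (rule quad_rep_K[OF cS(1) atom_K[OF q]])
  show "U c q \<noteq> 0" using quad_rep_jinv'[OF c qS] atom_nonzero[OF q] by auto
  fix u v assume uv: "u \<in> K" "v \<in> K" "u \<preceq> U c q" "v \<preceq> U c q"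
  have *: "\<exists>t. w = t *\<^sub>R U c q" if w: "w \<in> K" "w \<preceq> U c q" for w
  proof -
    have wS: "w \<in> S" using w K_subset by blast
    have "U (jinv c) w \<preceq> 1 *\<^sub>R q" using quad_rep_mono[OF cS(2) w(2)] quad_rep_jinv'[OF c qS] by simp
    from atom_interval[OF q quad_rep_K[OF cS(2) w(1)] this] obtain t where "U (jinv c) w = t *\<^sub>R q" by blast
    hence "U c (U (jinv c) w) = t *\<^sub>R U c q" by (simp add: quad_rep_scaleR)
    thus ?thesis using quad_rep_jinv[OF c wS] by auto
  qed
  obtain s t where st: "u = s *\<^sub>R U c q" "v = t *\<^sub>R U c q" using * uv by blast
  show "u \<preceq> v \<or> v \<preceq> u" unfolding st using le_scaleR_left[OF xK, of s t] le_scaleR_left[OF xK, of t s] by linarith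
qed

end

section \<open>Classes of non-orthogonal atoms\<close>

text \<open>Meant for a carrier \<open>A\<close>, which need not have interior points in the whole
  type; the category argument therefore runs inside \<open>A\<close>.\<close>

lemma Baire_closed_union:
  fixes A :: "'a::complete_space set" and F :: "nat \<Rightarrow> 'a set"
  assumes A: "closed A" "A \<noteq> {}" and F: "\<And>n. closed (F n)" and sub: "A \<subseteq> (\<Union>n. F n)"
  shows "\<exists>n x r. x \<in> A \<and> r > 0 \<and> (\<forall>y\<in>A. dist y x < r \<longrightarrow> y \<in> F n)"
proof -
  interpret sb: Submetric UNIV dist A by unfold_locales auto
  have top: "sb.sub.mtopology = top_of_set A" by (simp add: sb.mtopology_submetric)
  have "sb.sub.mcomplete" by (rule sb.closedin_mcomplete_imp_mcomplete) (use A in \<open>auto simp: complete_UNIV\<close>)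
  have "\<exists>n. (top_of_set A) interior_of (A \<inter> F n) \<noteq> {}"
  proof (rule ccontr)
    assume "\<nexists>n. (top_of_set A) interior_of (A \<inter> F n) \<noteq> {}"
    hence "sb.sub.mtopology interior_of \<Union>(range (\<lambda>n. A \<inter> F n)) = {}"
      by (intro sb.sub.metric_Baire_category_alt) (use \<open>sb.sub.mcomplete\<close> F in \<open>auto simp: top closedin_subtopology\<close>)
    moreover have "\<Union>(range (\<lambda>n. A \<inter> F n)) = A" using sub by blast
    ultimately show False using A(2) interior_of_topspace[of "top_of_set A"] by (simp add: top)
  qed
  then obtain n x where "x \<in> (top_of_set A) interior_of (A \<inter> F n)" by blast
  then obtain T where T: "openin (top_of_set A) T" "x \<in> T" "T \<subseteq> A \<inter> F n" unfolding interior_of_def by blast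
  then obtain r where "r > 0" "\<And>y. y \<in> A \<Longrightarrow> dist y x < r \<Longrightarrow> y \<in> T" unfolding openin_euclidean_subtopology_iff by blast
  thus ?thesis using T by blast
qed

context jbw_atomic
begin

definition nonorth :: "'a \<Rightarrow> 'a \<Rightarrow> bool" where
  "nonorth p q \<longleftrightarrow> atom p \<and> atom q \<and> p \<cdot> q \<noteq> 0"

lemma nonorth_sym: "nonorth p q \<Longrightarrow> nonorth q p" by (simp add: nonorth_def jprod_commute)

lemma nonorth_refl: "atom p \<Longrightarrow> nonorth p p" by (simp add: nonorth_def proj_idem[OF atom_proj] atom_nonzero)

definition conn :: "'a \<Rightarrow> 'a \<Rightarrow> bool" where "conn = nonorth\<^sup>*\<^sup>*"

lemma conn_refl [simp]: "conn p p" and conn_trans: "conn p q \<Longrightarrow> conn q r \<Longrightarrow> conn p r"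
  and conn_nonorth: "nonorth p q \<Longrightarrow> conn p q" by (auto simp: conn_def)

lemma conn_sym: "conn p q \<Longrightarrow> conn q p"
  unfolding conn_def by (induction rule: rtranclp.induct) (auto intro: converse_rtranclp_into_rtranclp nonorth_sym)

lemma conn_atom: "conn p q \<Longrightarrow> atom p \<Longrightarrow> atom q"
  unfolding conn_def by (induction rule: rtranclp.induct) (auto simp: nonorth_def)

lemma nonorth_iff_\<tau>: "atom p \<Longrightarrow> atom q \<Longrightarrow> nonorth p q \<longleftrightarrow> 0 < \<tau> p q"
  using \<tau>_zero_iff[of p q] \<tau>_nonneg[of p q] atom_K[of q] by (auto simp: nonorth_def)

lemma quad_rep_add_sub:
  assumes v: "v \<in> S" and y: "y \<in> S"
  shows "U (e + v) y + U (e - v) y = 2 *\<^sub>R (y + U v y)"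
  using quad_rep_unit_add[OF y v] quad_rep_unit_add[OF y minus_in[OF v]]
  by (simp add: quad_rep_minus_left jbilin algebra_simps scaleR_2)

text \<open>Two non-orthogonal atoms are exchanged by a symmetry of the corner they span:
  with \<open>t = \<tau> p q\<close> and \<open>r = p \<or> q\<close> one has \<open>(p + q - r)\<^sup>2 = t r\<close>, which follows from
  \<open>(q - p)\<^sup>2 = (1 - t) r\<close>, both sides acting on \<open>p\<close> and \<open>q\<close> in the same way.\<close>

lemma atom_exchange:
  assumes pq: "nonorth p q"
  shows "\<exists>v\<in>S. norm v \<le> 1 \<and> U v p = q"
proof -
  have p: "atom p" "proj p" "p \<in> S" "p \<in> K" and q: "atom q" "proj q" "q \<in> S" "q \<in> K"
    using pq atom_proj atom_in atom_K by (auto simp: nonorth_def)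
  define t where "t = \<tau> p q"
  have t: "0 < t" using nonorth_iff_\<tau> pq p q by (simp add: t_def)
  define r where "r = rng (p + q)"
  have pqK: "p + q \<in> K" using p q by auto
  have r: "proj r" unfolding r_def by (rule proj_spr) (use p q in auto)
  have rS: "r \<in> S" using r by (rule proj_in)
  have bound: "p + q \<preceq> norm (p + q) *\<^sub>R r" unfolding r_def by (rule rng_jprod(2)[OF pqK])
  have "p \<preceq> p + q" "q \<preceq> p + q" using p q by (auto simp: le_iff)
  hence rp: "r \<cdot> p = p" and rq: "r \<cdot> q = q"
    using le_proj_face(1)[OF r p(4)] le_proj_face(1)[OF r q(4)] le_trans bound by blast+
  define w where "w = p \<cdot> q"
  have wS: "w \<in> S" using p q by (simp add: w_def)
  have rw: "r \<cdot> w = w" unfolding w_def by (rule proj_face_jprod[OF r p(3) q(3) rp rq])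
  have pw: "p \<cdot> w + p \<cdot> w = t *\<^sub>R p + w"
    using quad_rep_atom[OF p(1) q(3)] by (simp add: quad_rep_def proj_idem[OF p(2)] w_def t_def scaleR_2 algebra_simps)
  have qw: "q \<cdot> w + q \<cdot> w = t *\<^sub>R q + w" using quad_rep_atom[OF q(1) p(3)] \<tau>_sym[OF p(1) q(1)]
    by (simp add: quad_rep_def proj_idem[OF q(2)] w_def t_def scaleR_2 algebra_simps jprod_commute[of q p])
  define m where "m = p + q - (w + w) - (1 - t) *\<^sub>R r"
  have mS: "m \<in> S" using p q wS rS by (simp add: m_def)
  have pr: "p \<cdot> r = p" and qr: "q \<cdot> r = q" using rp rq by (simp_all add: jprod_commute)
  have pm: "p \<cdot> m = 0"
  proof -
    have "p \<cdot> m = p + w - (p \<cdot> w + p \<cdot> w) - (1 - t) *\<^sub>R p"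
      by (simp add: m_def jbilin proj_idem[OF p(2)] w_def[symmetric] pr)
    thus ?thesis unfolding pw by (simp add: algebra_simps)
  qed
  have qm: "q \<cdot> m = 0"
  proof -
    have "q \<cdot> m = w + q - (q \<cdot> w + q \<cdot> w) - (1 - t) *\<^sub>R q"
      by (simp add: m_def jbilin proj_idem[OF q(2)] w_def[symmetric] jprod_commute[of q p] qr)
    thus ?thesis unfolding qw by (simp add: algebra_simps)
  qed
  have rm: "r \<cdot> m = m" by (simp add: m_def jbilin rp rq rw proj_idem[OF r])
  \<comment> \<open>The element \<open>m \<cdot> m\<close> belongs to the corner of
    \<open>r\<close>, while its range is orthogonal to \<open>p\<close> and \<open>q\<close> and
    therefore to \<open>r\<close>; so it vanishes.\<close>
  define n where "n = m \<cdot> m"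
  have nK: "n \<in> K" and nS: "n \<in> S" using mS by (auto simp: n_def)
  have rn: "r \<cdot> n = n" unfolding n_def by (rule proj_face_jprod[OF r mS mS rm rm])
  have "p \<cdot> rng n = 0" "q \<cdot> rng n = 0"
    using rng_orth[OF nK p(2)] rng_orth[OF nK q(2)] proj_orth_jprod[OF p(2) mS mS pm pm] proj_orth_jprod[OF q(2) mS mS qm qm]
    by (simp_all add: n_def)
  hence "rng n \<cdot> (p + q) = 0" by (simp add: jprod.add_left jprod_commute[of "rng n"])
  hence "rng n \<cdot> r = 0" unfolding r_def by (rule rng_orth[OF pqK proj_spr[OF nS]])
  hence "U r (rng n) = 0" by (intro quad_rep_proj_zero r) (simp add: jprod_commute)
  moreover have "U r n \<preceq> U r (norm n *\<^sub>R rng n)" by (rule quad_rep_mono[OF rS rng_jprod(2)[OF nK]])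
  moreover have "U r n = n" using quad_rep_proj_iff[OF r nS] rn by blast
  ultimately have "n \<preceq> 0" by (simp add: quad_rep_scaleR)
  hence "n = 0" using nK le_antisym[of n 0] by simp
  hence "m = 0" using norm_jsquare[of m] by (simp add: n_def)
  hence sum: "w + w = p + q - (1 - t) *\<^sub>R r" by (simp add: m_def algebra_simps)
  define b where "b = p + q - r"
  have bS: "b \<in> S" using p q rS by (simp add: b_def)
  have "b \<cdot> b = (w + w) + r - p - q"
    by (simp add: b_def jbilin proj_idem[OF p(2)] proj_idem[OF q(2)] proj_idem[OF r] w_def[symmetric]
        jprod_commute[of q p] pr qr rp rq)
  hence bb: "b \<cdot> b = t *\<^sub>R r" unfolding sum by (simp add: algebra_simps)
  have bp: "b \<cdot> p = w" by (simp add: b_def jbilin proj_idem[OF p(2)] w_def[symmetric] jprod_commute[of q p] rp)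
  have "2 *\<^sub>R (b \<cdot> w) = (p \<cdot> w + p \<cdot> w) + (q \<cdot> w + q \<cdot> w) - (w + w)" by (simp add: b_def jbilin rw scaleR_2)
  also have "\<dots> = t *\<^sub>R p + t *\<^sub>R q" unfolding pw qw by simp
  finally have "U b p = t *\<^sub>R q" by (simp add: quad_rep_def bp bb jprod.scaleR_left rp)
  hence "U ((1 / sqrt t) *\<^sub>R b) p = q" using t by (simp add: quad_rep_scaleR_left power_divide)
  moreover have "norm ((1 / sqrt t) *\<^sub>R b) \<le> 1"
  proof -
    have "(norm b)\<^sup>2 = t * norm r" using norm_jsquare[of b] bb t by simp
    also have "norm r \<le> 1" using norm_mono[OF proj_K[OF r] proj_le_unit[OF r] unit_in] norm_unit_le by linarith
    finally have "(norm b)\<^sup>2 \<le> t" using t by simp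
    hence "norm b \<le> sqrt t" by (rule real_le_rsqrt)
    thus ?thesis using t by simp
  qed
  ultimately show ?thesis using bS by blast
qed

lemma atom_proportional: "atom p \<Longrightarrow> atom q \<Longrightarrow> p = c *\<^sub>R q \<Longrightarrow> p = q"
proof -
  assume p: "atom p" and q: "atom q" and eq: "p = c *\<^sub>R q"
  have "c *\<^sub>R q = (c * c) *\<^sub>R q"
    using proj_idem[OF atom_proj[OF p]] proj_idem[OF atom_proj[OF q]] by (simp add: eq jbilin)
  hence "c = c * c" using atom_nonzero[OF q] by simp
  hence "c = 0 \<or> c = 1" by auto
  thus "p = q" using eq atom_nonzero[OF p] by auto
qed

text \<open>The automorphisms \<open>U (e + s p)\<close> preserve the direction of \<open>p\<close>
  and move \<open>q\<close> inside the corner of the join. Below the sum of two atoms of different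
  classes there is no third one (\<open>atom_le_orth_sum\<close>), so a third atom is what allows
  order isomorphisms to detect connectedness.\<close>

lemma third_atom:
  assumes pq: "nonorth p q" and ne: "p \<noteq> q"
  shows "\<exists>r. atom r \<and> r \<noteq> p \<and> r \<noteq> q \<and> r \<preceq> rng (p + q)"
proof -
  have p: "atom p" "proj p" "p \<in> S" "p \<in> K" and q: "atom q" "proj q" "q \<in> S" "q \<in> K"
    using pq atom_proj atom_in atom_K by (auto simp: nonorth_def)
  define t where "t = \<tau> p q"
  have t: "0 < t" using nonorth_iff_\<tau> pq p q by (simp add: t_def)
  define R where "R = rng (p + q)"
  have pqK: "p + q \<in> K" using p q by auto
  have R: "proj R" unfolding R_def by (rule proj_spr) (use p q in auto)
  have RS: "R \<in> S" using R by (rule proj_in)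
  have bound: "p + q \<preceq> norm (p + q) *\<^sub>R R" unfolding R_def by (rule rng_jprod(2)[OF pqK])
  have "p \<preceq> p + q" "q \<preceq> p + q" using p q by (auto simp: le_iff)
  hence Rp: "R \<cdot> p = p" and Rq: "R \<cdot> q = q"
    using le_proj_face(1)[OF R p(4)] le_proj_face(1)[OF R q(4)] le_trans bound by blast+
  define w where "w = p \<cdot> q"
  have Rw: "R \<cdot> w = w" unfolding w_def by (rule proj_face_jprod[OF R p(3) q(3) Rp Rq])
  have qe: "U (e + s *\<^sub>R p) q = q + (2 * s) *\<^sub>R w + (s\<^sup>2 * t) *\<^sub>R p" for s
    using quad_rep_unit_add[OF q(3) scaleR_in[OF p(3), of s]] quad_rep_atom[OF p(1) q(3)]
    by (simp add: jbilin quad_rep_scaleR_left t_def w_def)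
  have pe: "U (e + s *\<^sub>R p) p = ((1 + s)\<^sup>2) *\<^sub>R p" for s
    using quad_rep_unit_add[OF p(3) scaleR_in[OF p(3), of s]] quad_rep_proj_proj[OF p(2)] proj_idem[OF p(2)]
    by (simp add: jbilin quad_rep_scaleR_left power2_eq_square algebra_simps)
  have sp: "spos (e + s *\<^sub>R p)" if "s > 0" for s using that p by (intro spos_add spos_unit K_scaleR) auto
  have ex: "\<exists>r m. atom r \<and> r \<noteq> p \<and> r \<preceq> R \<and> U (e + s *\<^sub>R p) q = m *\<^sub>R r" if s: "s > 0" for s
  proof -
    obtain r m where r: "atom r" "0 < m" "U (e + s *\<^sub>R p) q = m *\<^sub>R r"
      using quad_rep_spos_atom[OF sp[OF s] q(1)] by blast
    have "R \<cdot> (m *\<^sub>R r) = m *\<^sub>R r" unfolding r(3)[symmetric] qe by (simp add: jbilin Rp Rq Rw)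
    hence "R \<cdot> r = r" using r(2) by (simp add: jbilin)
    hence "r \<preceq> R" using proj_le_iff[OF atom_proj[OF r(1)] R] by blast
    moreover have "r \<noteq> p"
    proof
      assume "r = p"
      hence "U (e + s *\<^sub>R p) q = U (e + s *\<^sub>R p) ((m / (1 + s)\<^sup>2) *\<^sub>R p)" using r(3) s by (simp add: quad_rep_scaleR pe)
      hence "q = (m / (1 + s)\<^sup>2) *\<^sub>R p" by (rule quad_rep_inj[OF sp[OF s] q(3) scaleR_in[OF p(3)]])
      from atom_proportional[OF q(1) p(1) this] show False using ne by simp
    qed
    ultimately show ?thesis using r by blast
  qed
  \<comment> \<open>One value of \<open>s\<close> might lead back to \<open>q\<close>; if
    \<open>s = 1\<close> and \<open>s = 2\<close> both did, eliminating \<open>w\<close> would make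
    \<open>p\<close> a multiple of \<open>q\<close>.\<close>
  obtain r1 m1 where r1: "atom r1" "r1 \<noteq> p" "r1 \<preceq> R" "U (e + 1 *\<^sub>R p) q = m1 *\<^sub>R r1" using ex[of 1] by auto
  obtain r2 m2 where r2: "atom r2" "r2 \<noteq> p" "r2 \<preceq> R" "U (e + 2 *\<^sub>R p) q = m2 *\<^sub>R r2" using ex[of 2] by auto
  have "r1 \<noteq> q \<or> r2 \<noteq> q"
  proof (rule ccontr)
    assume "\<not> (r1 \<noteq> q \<or> r2 \<noteq> q)"
    hence eq: "q + 2 *\<^sub>R w + t *\<^sub>R p = m1 *\<^sub>R q" "q + 4 *\<^sub>R w + (4 * t) *\<^sub>R p = m2 *\<^sub>R q"
      using r1(4) r2(4) qe[of 1] qe[of 2] by simp_all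
    have four: "4 *\<^sub>R x = x + x + x + x" for x :: 'a
    proof -
      have "4 *\<^sub>R x = (1 + 1 + 1 + 1) *\<^sub>R x" by simp
      thus ?thesis by (simp only: scaleR_left_distrib scaleR_one)
    qed
    have "(2 * t) *\<^sub>R p = 2 *\<^sub>R (t *\<^sub>R p)" "(4 * t) *\<^sub>R p = 4 *\<^sub>R (t *\<^sub>R p)" by simp_all
    hence "(2 * t) *\<^sub>R p = (q + 4 *\<^sub>R w + (4 * t) *\<^sub>R p) - 2 *\<^sub>R (q + 2 *\<^sub>R w + t *\<^sub>R p) + q"
      by (simp only: four scaleR_2) simp
    also have "\<dots> = (m2 - 2 * m1 + 1) *\<^sub>R q" unfolding eq by (simp add: algebra_simps)
    finally have "(1 / (2 * t)) *\<^sub>R ((2 * t) *\<^sub>R p) = (1 / (2 * t)) *\<^sub>R ((m2 - 2 * m1 + 1) *\<^sub>R q)" by simp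
    hence "p = ((m2 - 2 * m1 + 1) / (2 * t)) *\<^sub>R q" using t by simp
    from atom_proportional[OF p(1) q(1) this] show False using ne by simp
  qed
  thus ?thesis using r1 r2 unfolding R_def by blast
qed

text \<open>An atom meeting both \<open>p\<close> and \<open>q\<close> would connect them; so
  \<open>r\<close> is orthogonal to one of them and therefore below the other.\<close>

lemma atom_le_orth_sum:
  assumes pq: "atom p" "atom q" "\<not> conn p q" and r: "atom r" "r \<preceq> p + q"
  shows "r = p \<or> r = q"
proof -
  have orth: "p \<cdot> q = 0" using pq conn_nonorth by (auto simp: nonorth_def)
  have P: "proj (p + q)" using proj_add[OF atom_proj[OF pq(1)] atom_proj[OF pq(2)] orth] .
  have rr: "(p + q) \<cdot> r = r" using proj_le_iff[OF atom_proj[OF r(1)] P] r(2) by blast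
  have *: "r = a" if "atom a" "atom b" "a \<cdot> r + b \<cdot> r = r" "b \<cdot> r = 0" for a b
  proof -
    have "r \<preceq> a" using that proj_le_iff[OF atom_proj[OF r(1)] atom_proj[OF that(1)]] by simp
    thus ?thesis using atom_le_imp_eq[OF r(1) that(1)] by blast
  qed
  have "p \<cdot> r = 0 \<or> q \<cdot> r = 0"
  proof (rule ccontr)
    assume "\<not> ?thesis"
    hence "nonorth p r" "nonorth q r" using pq r by (auto simp: nonorth_def)
    thus False using pq(3) conn_nonorth conn_trans conn_sym by blast
  qed
  thus ?thesis using *[of p q] *[of q p] pq rr by (auto simp: jprod.add_left add.commute)
qed

lemma nonorth_limit:
  assumes q: "\<And>n. atom (q n)" and lim: "q \<longlonglongrightarrow> p" and pr: "nonorth p r"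
  shows "\<forall>\<^sub>F n in sequentially. nonorth (q n) r"
proof -
  have "(\<lambda>n. q n \<cdot> r) \<longlonglongrightarrow> p \<cdot> r" by (intro jprod.tendsto lim tendsto_const)
  moreover have "p \<cdot> r \<noteq> 0" using pr by (simp add: nonorth_def)
  ultimately have "\<forall>\<^sub>F n in sequentially. q n \<cdot> r \<noteq> 0" by (rule tendsto_imp_eventually_ne)
  thus ?thesis by eventually_elim (use q pr in \<open>auto simp: nonorth_def\<close>)
qed

text \<open>The automorphisms \<open>U (e + v n)\<close> move \<open>q\<close> to multiples of
  atoms. Atoms have norm \<open>1\<close>, so the factors tend to \<open>1\<close> and can be
  divided out.\<close>

lemma atom_path:
  assumes q: "atom q" and v: "\<And>n. v n \<in> S" "\<And>n. norm (v n) < 1" "v \<longlonglongrightarrow> 0"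
  shows "\<exists>a m. (\<forall>n. atom (a n) \<and> 0 < m n \<and> U (e + v n) q = m n *\<^sub>R a n) \<and> a \<longlonglongrightarrow> q"
proof -
  have "\<exists>a m. atom a \<and> 0 < m \<and> U (e + v n) q = m *\<^sub>R a" for n
    by (rule quad_rep_spos_atom[OF spos_near_unit[OF v(1,2)] q])
  then obtain a m where a: "\<And>n. atom (a n)" "\<And>n. 0 < m n" "\<And>n. U (e + v n) q = m n *\<^sub>R a n" by metis
  have "(\<lambda>n. U (e + v n) q) \<longlonglongrightarrow> U (e + 0) q" by (intro tendsto_intros v(3))
  hence ma: "(\<lambda>n. m n *\<^sub>R a n) \<longlonglongrightarrow> q" using a(3) atom_in[OF q] by simp
  have "m \<longlonglongrightarrow> 1" using tendsto_norm[OF ma] a(2) by (simp add: norm_atom[OF a(1)] norm_atom[OF q] abs_of_pos)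
  hence "(\<lambda>n. inverse (m n) *\<^sub>R (m n *\<^sub>R a n)) \<longlonglongrightarrow> inverse 1 *\<^sub>R q" by (intro tendsto_intros ma) auto
  moreover have "inverse (m n) *\<^sub>R (m n *\<^sub>R a n) = a n" for n using a(2)[of n] by simp
  ultimately have "a \<longlonglongrightarrow> q" by simp
  thus ?thesis using a by blast
qed

text \<open>A small motion of an atom \<open>q\<close> towards a non-orthogonal atom \<open>q'\<close> leaves the orthogonal
  complement of any atom to which \<open>q'\<close> is non-orthogonal.\<close>

lemma approx_nonorth_step:
  assumes q0: "nonorth q' q0" and q: "nonorth q' q"
  shows "\<exists>a. (\<forall>n. nonorth (a n) q0) \<and> a \<longlonglongrightarrow> q"
proof -
  have at: "atom q" "atom q'" "atom q0" using q0 q by (auto simp: nonorth_def)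
  have S: "q \<in> S" "q' \<in> S" "q0 \<in> S" using at atom_in by auto
  \<comment> \<open>Starting at \<open>1/2\<close> keeps \<open>e + \<delta> q'\<close> and
    \<open>e - \<delta> q'\<close> invertible for every \<open>n\<close>.\<close>
  define \<delta> where "\<delta> n = 1 / real (Suc (Suc n))" for n
  have \<delta>: "0 < \<delta> n" "\<delta> n < 1" for n by (simp_all add: \<delta>_def)
  have \<delta>0: "\<delta> \<longlonglongrightarrow> 0" using LIMSEQ_Suc[OF LIMSEQ_inverse_real_of_nat] by (simp add: \<delta>_def[abs_def] inverse_eq_divide)
  have lim: "(\<lambda>n. \<delta> n *\<^sub>R q') \<longlonglongrightarrow> 0" "(\<lambda>n. - (\<delta> n *\<^sub>R q')) \<longlonglongrightarrow> 0"
    using tendsto_scaleR[OF \<delta>0 tendsto_const[of q']] tendsto_minus by force+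
  have n1: "norm (\<delta> n *\<^sub>R q') < 1" for n using \<delta>[of n] norm_atom[OF at(2)] by simp
  obtain a1 m1 where a1: "\<And>n. atom (a1 n) \<and> 0 < m1 n \<and> U (e + \<delta> n *\<^sub>R q') q = m1 n *\<^sub>R a1 n" "a1 \<longlonglongrightarrow> q"
    using atom_path[OF at(1) _ n1 lim(1)] S by blast
  obtain a2 m2 where a2: "\<And>n. atom (a2 n) \<and> 0 < m2 n \<and> U (e + - (\<delta> n *\<^sub>R q')) q = m2 n *\<^sub>R a2 n" "a2 \<longlonglongrightarrow> q"
    using atom_path[OF at(1) _ _ lim(2)] n1 S by (metis minus_in norm_minus_cancel scaleR_in)
  \<comment> \<open>A single path may stay orthogonal to \<open>q0\<close>. In the sum of the two
    paths the linear terms in \<open>\<delta>\<close> cancel, and the quadratic one has a positive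
    coefficient at \<open>q0\<close>.\<close>
  have or: "nonorth (a1 n) q0 \<or> nonorth (a2 n) q0" for n
  proof -
    have eq: "m1 n *\<^sub>R a1 n + m2 n *\<^sub>R a2 n = 2 *\<^sub>R (q + ((\<delta> n)\<^sup>2 * \<tau> q' q) *\<^sub>R q')"
      using quad_rep_add_sub[of "\<delta> n *\<^sub>R q'" q] a1(1)[of n] a2(1)[of n] S quad_rep_atom[OF at(2) S(1)]
      by (simp add: quad_rep_scaleR_left)
    have aS: "a1 n \<in> S" "a2 n \<in> S" using a1(1)[of n] a2(1)[of n] atom_in by auto
    have "\<tau> q0 (m1 n *\<^sub>R a1 n + m2 n *\<^sub>R a2 n) = \<tau> q0 (2 *\<^sub>R (q + ((\<delta> n)\<^sup>2 * \<tau> q' q) *\<^sub>R q'))" by (simp only: eq)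
    hence "m1 n * \<tau> q0 (a1 n) + m2 n * \<tau> q0 (a2 n) = 2 * (\<tau> q0 q + (\<delta> n)\<^sup>2 * \<tau> q' q * \<tau> q0 q')"
      using aS S by (simp add: \<tau>_add \<tau>_scaleR at)
    moreover have "0 < (\<delta> n)\<^sup>2 * \<tau> q' q * \<tau> q0 q'" using nonorth_iff_\<tau> at q nonorth_sym[OF q0] \<delta>(1)[of n] by simp
    moreover have "0 \<le> \<tau> q0 q" by (intro \<tau>_nonneg at atom_K)
    ultimately have "\<tau> q0 (a1 n) \<noteq> 0 \<or> \<tau> q0 (a2 n) \<noteq> 0" by auto
    thus ?thesis
      using \<tau>_nonneg[OF at(3) atom_K] a1(1) a2(1) nonorth_iff_\<tau>[OF at(3)] nonorth_sym by (metis order_le_less)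
  qed
  define a where "a n = (if nonorth (a1 n) q0 then a1 n else a2 n)" for n
  have g: "(\<lambda>n. norm (a1 n - q) + norm (a2 n - q)) \<longlonglongrightarrow> 0"
    using tendsto_add[OF tendsto_norm_zero[OF LIM_zero[OF a1(2)]] tendsto_norm_zero[OF LIM_zero[OF a2(2)]]] by simp
  have "(\<lambda>n. a n - q) \<longlonglongrightarrow> 0" by (rule Lim_null_comparison[OF always_eventually g]) (simp add: a_def)
  hence "a \<longlonglongrightarrow> q" by (rule LIM_zero_cancel)
  thus ?thesis using or by (intro exI[of _ a]) (auto simp: a_def)
qed

text \<open>Non-orthogonality to a given atom is an open condition. So an atom close to
  \<open>q'\<close> and non-orthogonal to \<open>q0\<close> is still non-orthogonal to the next atom
  \<open>q\<close> of the chain, and \<open>approx_nonorth_step\<close> applies with it in place of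
  \<open>q'\<close>.\<close>

lemma nonorth_dense:
  assumes "conn q0 q" "atom q0"
  shows "\<exists>a. (\<forall>n. nonorth (a n) q0) \<and> a \<longlonglongrightarrow> q" using assms unfolding conn_def
proof (induction rule: rtranclp_induct)
  case base
  show ?case using nonorth_refl[OF base] by (intro exI[of _ "\<lambda>_. q0"]) simp
next
  case (step q' q)
  then obtain a where a: "\<And>n. nonorth (a n) q0" "a \<longlonglongrightarrow> q'" by blast
  have "atom (a n)" for n using a(1)[of n] by (simp add: nonorth_def)
  hence "\<forall>\<^sub>F n in sequentially. nonorth (a n) q" using nonorth_limit a(2) step(2) by blast
  then obtain n where "nonorth (a n) q" using eventually_happens sequentially_bot by blast
  thus ?case by (rule approx_nonorth_step[OF a(1)])
qed

text \<open>The quantities \<open>U\<^sub>v q\<close> are bounded by multiples of \<open>w\<close>, uniformly for \<open>v\<close> in some ball by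
  Baire's theorem; the parallelogram identity for \<open>U\<close> moves the ball to the origin.\<close>

lemma quad_rep_uniform_bound:
  assumes q: "atom q" and w: "w \<in> K" and bd: "\<And>q. atom q \<Longrightarrow> \<exists>k. q \<preceq> k *\<^sub>R w"
  shows "\<exists>C>0. \<forall>v\<in>S. norm v \<le> 1 \<longrightarrow> U v q \<preceq> C *\<^sub>R w"
proof -
  have qS: "q \<in> S" and qK: "q \<in> K" using q atom_in atom_K by auto
  have par: "U (x + h) q + U (x - h) q = 2 *\<^sub>R U x q + 2 *\<^sub>R U h q" for x h
    using quad_rep_add_left[of x h q] quad_rep_add_left[of x "- h" q]
    by (simp add: quad_rep_minus_left jtriple_def jbilin scaleR_2)
  have two: "2 *\<^sub>R U h q \<preceq> U (x + h) q + U (x - h) q" if "x \<in> S" for x h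
    using K_scaleR[OF quad_rep_K[OF that qK], of 2] by (simp add: par le_iff)
  have ex: "\<exists>n. U v q \<preceq> real n *\<^sub>R w" if v: "v \<in> S" for v
  proof -
    \<comment> \<open>The image of an atom is controlled by atoms only for positive invertible
      elements, so \<open>v\<close> is shifted by \<open>l e\<close> and recovered through
      \<open>par\<close>.\<close>
    define l where "l = norm v + 1"
    have l: "l > 0" unfolding l_def using norm_ge_zero[of v] by linarith
    have "norm ((1 / l) *\<^sub>R v) < 1" using l by (simp add: l_def)
    hence "spos (l *\<^sub>R (e + (1 / l) *\<^sub>R v))" using v l by (intro spos_scaleR spos_near_unit) auto
    hence "spos (v + l *\<^sub>R e)" using l by (simp add: scaleR_add_right add.commute)
    from quad_rep_spos_atom[OF this q] obtain p m where p: "atom p" "0 < m" "U (v + l *\<^sub>R e) q = m *\<^sub>R p" by blast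
    obtain k1 k2 where k: "p \<preceq> k1 *\<^sub>R w" "q \<preceq> k2 *\<^sub>R w" using bd[OF p(1)] bd[OF q] by blast
    have "U (v + l *\<^sub>R e - l *\<^sub>R e) q \<preceq> 2 *\<^sub>R U (v + l *\<^sub>R e) q + 2 *\<^sub>R U (l *\<^sub>R e) q"
      unfolding par[symmetric] using quad_rep_K[of "v + l *\<^sub>R e + l *\<^sub>R e" q] qK v by (simp add: le_iff)
    hence "U v q \<preceq> 2 *\<^sub>R U (v + l *\<^sub>R e) q + 2 *\<^sub>R U (l *\<^sub>R e) q" by simp
    also have "\<dots> = (2 * m) *\<^sub>R p + (2 * l\<^sup>2) *\<^sub>R q" using p(3) qS by (simp add: quad_rep_scaleR_left)
    also have "\<dots> \<preceq> (2 * m) *\<^sub>R (k1 *\<^sub>R w) + (2 * l\<^sup>2) *\<^sub>R (k2 *\<^sub>R w)"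
      using p(2) k by (intro le_add_mono le_scaleR_mono) auto
    also have "\<dots> = (2 * m * k1 + 2 * l\<^sup>2 * k2) *\<^sub>R w" by (simp add: scaleR_add_left)
    finally have 1: "U v q \<preceq> (2 * m * k1 + 2 * l\<^sup>2 * k2) *\<^sub>R w" .
    obtain n where "2 * m * k1 + 2 * l\<^sup>2 * k2 \<le> real n" using real_arch_simple by blast
    thus ?thesis using le_trans[OF 1 le_scaleR_left[OF w]] by blast
  qed
  have "closed {v. U v q \<preceq> real n *\<^sub>R w}" for n
    unfolding le_iff using closed_vimage[OF closed_K, of "\<lambda>v. real n *\<^sub>R w - U v q"]
    by (simp add: vimage_def continuous_intros)
  moreover have "S \<subseteq> (\<Union>n. {v. U v q \<preceq> real n *\<^sub>R w})" using ex by blast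
  moreover have "S \<noteq> {}" using unit_in by blast
  ultimately obtain k x r where x: "x \<in> S" "0 < r" and near: "\<And>v. v \<in> S \<Longrightarrow> dist v x < r \<Longrightarrow> U v q \<preceq> real k *\<^sub>R w"
    using Baire_closed_union[of S "\<lambda>n. {v. U v q \<preceq> real n *\<^sub>R w}"] closed_carrier by blast
  define d where "d = r / 2"
  have d: "0 < d" "d < r" using x(2) by (auto simp: d_def)
  define C where "C = real k / d\<^sup>2 + 1"
  have C: "C > 0" by (simp add: C_def add_nonneg_pos)
  have "U v q \<preceq> C *\<^sub>R w" if v: "v \<in> S" "norm v \<le> 1" for v
  proof -
    have "d * norm v \<le> d * 1" using v(2) d by (intro mult_left_mono) auto
    moreover have "norm (d *\<^sub>R v) = d * norm v" using d by simp
    ultimately have "norm (d *\<^sub>R v) < r" using d by linarith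
    hence "U (x + d *\<^sub>R v) q + U (x - d *\<^sub>R v) q \<preceq> real k *\<^sub>R w + real k *\<^sub>R w"
      using x v by (intro le_add_mono near) (auto simp: dist_norm)
    from le_trans[OF two[OF x(1)] this] have "2 *\<^sub>R U (d *\<^sub>R v) q \<preceq> 2 *\<^sub>R (real k *\<^sub>R w)" by (simp only: scaleR_2)
    from le_scaleR_mono[OF this, of "1 / 2"] have "d\<^sup>2 *\<^sub>R U v q \<preceq> real k *\<^sub>R w" by (simp add: quad_rep_scaleR_left)
    from le_scaleR_mono[OF this, of "1 / d\<^sup>2"] d have "U v q \<preceq> (real k / d\<^sup>2) *\<^sub>R w" by simp
    also have "\<dots> \<preceq> C *\<^sub>R w" by (rule le_scaleR_left[OF w]) (simp add: C_def)
    finally show ?thesis .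
  qed
  thus ?thesis using C by blast
qed

text \<open>Every atom non-orthogonal to \<open>a\<close> is \<open>U v a\<close> for some
  \<open>v\<close> in the unit ball (\<open>atom_exchange\<close>), and these atoms are dense in the
  class of \<open>a\<close>.\<close>

lemma class_uniform_bound:
  assumes a: "atom a" and w: "w \<in> K" and bd: "\<And>q. atom q \<Longrightarrow> \<exists>k. q \<preceq> k *\<^sub>R w"
  shows "\<exists>C>0. \<forall>q. conn a q \<longrightarrow> q \<preceq> C *\<^sub>R w"
proof -
  obtain C where C: "C > 0" "\<And>v. v \<in> S \<Longrightarrow> norm v \<le> 1 \<Longrightarrow> U v a \<preceq> C *\<^sub>R w" using quad_rep_uniform_bound[OF a w bd] by blast
  have "q \<preceq> C *\<^sub>R w" if q: "conn a q" for q
  proof -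
    obtain u where u: "\<And>n. nonorth (u n) a" "u \<longlonglongrightarrow> q" using nonorth_dense[OF q a] by blast
    have "u n \<preceq> C *\<^sub>R w" for n using atom_exchange[OF nonorth_sym[OF u(1)[of n]]] C(2) by metis
    thus ?thesis by (rule le_limit[OF _ u(2) tendsto_const])
  qed
  thus ?thesis using C(1) by blast
qed

text \<open>An element that dominates a multiple of every atom need not be invertible in general,
  but it is if there are finitely many classes.\<close>

lemma spos_of_atom_bounds:
  assumes A: "finite A" "\<And>a. a \<in> A \<Longrightarrow> atom a" "\<And>q. atom q \<Longrightarrow> \<exists>a\<in>A. conn a q"
    and w: "w \<in> K" and bd: "\<And>q. atom q \<Longrightarrow> \<exists>k. q \<preceq> k *\<^sub>R w"
  shows "spos w"
proof -
  have wS: "w \<in> S" using w K_subset by blast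
  have "\<exists>C>0. \<forall>q. conn a q \<longrightarrow> q \<preceq> C *\<^sub>R w" if "a \<in> A" for a by (rule class_uniform_bound[OF A(2)[OF that] w bd])
  then obtain C where C: "\<And>a. a \<in> A \<Longrightarrow> C a > 0" "\<And>a q. a \<in> A \<Longrightarrow> conn a q \<Longrightarrow> q \<preceq> C a *\<^sub>R w" by metis
  define B where "B = (\<Sum>a\<in>A. C a) + 1"
  have "0 \<le> (\<Sum>a\<in>A. C a)" by (intro sum_nonneg less_imp_le C(1))
  hence B: "B > 0" by (simp add: B_def)
  have CB: "C a \<le> B" if "a \<in> A" for a
  proof -
    have "C a \<le> (\<Sum>a\<in>A. C a)" by (rule member_le_sum[OF that _ A(1)]) (use C(1) in \<open>auto intro: less_imp_le\<close>)
    thus ?thesis by (simp add: B_def)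
  qed
  have "1 / B \<le> \<tau> q w" if q: "atom q" for q
  proof -
    obtain a where a: "a \<in> A" "conn a q" using A(3)[OF q] by blast
    have "q \<preceq> B *\<^sub>R w" using le_trans[OF C(2)[OF a] le_scaleR_left[OF w CB[OF a(1)]]] .
    hence "\<tau> q q \<le> \<tau> q (B *\<^sub>R w)" by (rule \<tau>_mono[OF q atom_in[OF q] scaleR_in[OF wS]])
    thus ?thesis using B wS by (simp add: \<tau>_self q \<tau>_scaleR field_simps)
  qed
  hence "(1 / B) *\<^sub>R e \<preceq> w" using wS le_iff_\<tau>[of "(1 / B) *\<^sub>R e" w] by (simp add: \<tau>_scaleR \<tau>_unit)
  thus ?thesis using B wS by (intro sposI[of _ "1 / B"]) auto
qed

end

section \<open>The maps of the order interval\<close>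

context jb_unital
begin

lemma jinv_upper:
  assumes x: "x \<in> S" and \<epsilon>: "0 < \<epsilon>" "\<epsilon> *\<^sub>R e \<preceq> x"
  shows "jinv x \<preceq> (1 / \<epsilon>) *\<^sub>R e"
  using jinv_antimono[OF spos_scaleR[OF spos_unit \<epsilon>(1)] \<epsilon>(2) x] jinv_scaleR[OF spos_unit \<epsilon>(1)] by simp

text \<open>The comparison is made multiplicative: the difference \<open>x - y\<close> is below
  \<open>\<delta> y\<close>, so \<open>x \<preceq> (1 + \<delta>) y\<close>, and this inequality can
  be inverted although \<open>x\<close> and \<open>y\<close> need not commute.\<close>

lemma jinv_Lipschitz_aux:
  assumes x: "x \<in> S" "\<epsilon> *\<^sub>R e \<preceq> x" and y: "y \<in> S" "\<epsilon> *\<^sub>R e \<preceq> y" and \<epsilon>: "0 < \<epsilon>"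
  shows "jinv y - jinv x \<preceq> (norm (x - y) / \<epsilon>\<^sup>2) *\<^sub>R e"
proof -
  have sx: "spos x" and sy: "spos y" using x y \<epsilon> by (auto intro: sposI)
  define \<delta> where "\<delta> = norm (x - y) / \<epsilon>"
  have \<delta>: "0 \<le> \<delta>" using \<epsilon> by (simp add: \<delta>_def)
  have "x - y \<preceq> norm (x - y) *\<^sub>R e" using x y by (intro le_norm) auto
  also have "norm (x - y) *\<^sub>R e = \<delta> *\<^sub>R (\<epsilon> *\<^sub>R e)" using \<epsilon> by (simp add: \<delta>_def)
  also have "\<dots> \<preceq> \<delta> *\<^sub>R y" using y \<delta> by (intro le_scaleR_mono)
  finally have "x \<preceq> (1 + \<delta>) *\<^sub>R y" by (simp add: le_iff algebra_simps)
  hence "jinv ((1 + \<delta>) *\<^sub>R y) \<preceq> jinv x" using y by (intro jinv_antimono sx) auto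
  hence "(1 / (1 + \<delta>)) *\<^sub>R jinv y \<preceq> jinv x" using \<delta> by (simp add: jinv_scaleR[OF sy])
  from le_scaleR_mono[OF this, of "1 + \<delta>"] \<delta> have "jinv y \<preceq> (1 + \<delta>) *\<^sub>R jinv x" by simp
  hence "jinv y - jinv x \<preceq> \<delta> *\<^sub>R jinv x" by (simp add: le_iff algebra_simps)
  also have "\<dots> \<preceq> \<delta> *\<^sub>R ((1 / \<epsilon>) *\<^sub>R e)" by (intro le_scaleR_mono jinv_upper x \<epsilon> \<delta>)
  finally show ?thesis by (simp add: \<delta>_def power2_eq_square)
qed

lemma jinv_Lipschitz:
  assumes x: "x \<in> S" "\<epsilon> *\<^sub>R e \<preceq> x" and y: "y \<in> S" "\<epsilon> *\<^sub>R e \<preceq> y" and \<epsilon>: "0 < \<epsilon>"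
  shows "norm (jinv y - jinv x) \<le> norm (x - y) / \<epsilon>\<^sup>2"
proof -
  have S: "jinv x \<in> S" "jinv y \<in> S" using x y \<epsilon> by (auto intro!: jinv_in sposI)
  have 1: "jinv y - jinv x \<preceq> (norm (x - y) / \<epsilon>\<^sup>2) *\<^sub>R e" by (rule jinv_Lipschitz_aux[OF x y \<epsilon>])
  have "jinv x - jinv y \<preceq> (norm (x - y) / \<epsilon>\<^sup>2) *\<^sub>R e"
    using jinv_Lipschitz_aux[OF y x \<epsilon>] by (simp add: norm_minus_commute)
  hence 2: "- ((norm (x - y) / \<epsilon>\<^sup>2) *\<^sub>R e) \<preceq> jinv y - jinv x" by (simp add: le_iff algebra_simps)
  show ?thesis by (subst norm_le_iff) (use 1 2 S in auto)
qed

lemma tendsto_jinv: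
  assumes f: "\<And>n. f n \<in> S" "\<And>n. \<epsilon> *\<^sub>R e \<preceq> f n" and \<epsilon>: "0 < \<epsilon>" and lim: "f \<longlonglongrightarrow> x"
  shows "(\<lambda>n. jinv (f n)) \<longlonglongrightarrow> jinv x"
proof -
  have x: "x \<in> S" using closed_sequentially[OF closed_carrier _ lim] f by blast
  have xl: "\<epsilon> *\<^sub>R e \<preceq> x" by (rule le_limit[OF f(2) tendsto_const lim])
  have "(\<lambda>n. norm (x - f n) / \<epsilon>\<^sup>2) \<longlonglongrightarrow> norm (x - x) / \<epsilon>\<^sup>2"
    by (rule tendsto_divide[OF tendsto_norm[OF tendsto_diff[OF tendsto_const lim]] tendsto_const]) (use \<epsilon> in simp)
  hence lim0: "(\<lambda>n. norm (x - f n) / \<epsilon>\<^sup>2) \<longlonglongrightarrow> 0" by simp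
  have "(\<lambda>n. jinv (f n) - jinv x) \<longlonglongrightarrow> 0"
    by (rule Lim_null_comparison[OF always_eventually lim0]) (rule allI, rule jinv_Lipschitz[OF x xl f \<epsilon>])
  thus ?thesis by (rule LIM_zero_cancel)
qed

lemma cone_interior_spos:
  assumes z: "spos z"
  shows "z \<in> jb_cone_interior S"
proof -
  obtain \<epsilon> where \<epsilon>: "\<epsilon> > 0" "\<epsilon> *\<^sub>R e \<preceq> z" using z by (auto simp: spos_def)
  have zS: "z \<in> S" using z by (rule spos_in)
  have "S \<inter> ball z \<epsilon> \<subseteq> K"
  proof
    fix y assume y: "y \<in> S \<inter> ball z \<epsilon>"
    hence "- (\<epsilon> *\<^sub>R e) \<preceq> y - z" using zS by (intro le_norm') (auto simp: dist_norm norm_minus_commute)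
    from le_add_mono[OF \<epsilon>(2) this] show "y \<in> K" by simp
  qed
  moreover have "openin (top_of_set S) (S \<inter> ball z \<epsilon>)" by (simp add: openin_open_Int)
  moreover have "z \<in> S \<inter> ball z \<epsilon>" using zS \<epsilon> by simp
  ultimately show ?thesis unfolding jb_cone_interior_def interior_of_def by blast
qed

text \<open>Inside the associative \<open>gen x\<close> the product is \<open>U (jsq a) b\<close>,
  so it inherits invertibility from \<open>b\<close>.\<close>

lemma gen_mult_spos:
  assumes x: "x \<in> S" and a: "a \<in> gen x" "spos a" and b: "b \<in> gen x" "spos b"
  shows "spos (a \<cdot> b)" "jinv (a \<cdot> b) = jinv a \<cdot> jinv b"
proof -
  have aK: "a \<in> K" using a(2) by (rule spos_K)
  have "jsq a \<in> gen x" by (rule gen_mono[OF x a(1) jsq_gen[OF aK]])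
  hence "U (jsq a) b = a \<cdot> b" using quad_rep_gen[OF x _ b(1)] jsq_square[OF aK] by simp
  thus s: "spos (a \<cdot> b)" using quad_rep_spos_spos[OF jsq_spos[OF a(2)] b(2)] by simp
  have ja: "jinv a \<in> gen x" and jb: "jinv b \<in> gen x"
    using gen_mono[OF x a(1) jinv_gen[OF a(2)]] gen_mono[OF x b(1) jinv_gen[OF b(2)]] .
  have ab: "a \<cdot> b \<in> gen x" by (rule gen_closed(1)[OF x a(1) b(1)])
  show "jinv (a \<cdot> b) = jinv a \<cdot> jinv b"
  proof (rule gen_inverse_unique[OF x ab])
    show "jinv (a \<cdot> b) \<in> gen x" by (rule gen_mono[OF x ab jinv_gen[OF s]])
    show "jinv a \<cdot> jinv b \<in> gen x" by (rule gen_closed(1)[OF x ja jb])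
    show "(a \<cdot> b) \<cdot> jinv (a \<cdot> b) = e" by (rule jinv_right[OF s])
    have "(a \<cdot> b) \<cdot> (jinv a \<cdot> jinv b) = jinv a \<cdot> (jinv b \<cdot> (a \<cdot> b))"
      using gen_assoc[OF x ab ja jinv_in[OF b(2)]] by (simp add: jprod_commute[of "a \<cdot> b" "jinv b"])
    also have "jinv b \<cdot> (a \<cdot> b) = a" using gen_assoc[OF x jb a(1) spos_in[OF b(2)]] jinv_right[OF b(2)] spos_in[OF a(2)]
      by (simp add: jprod_commute[of "jinv b" b] jprod_commute[of a e])
    finally show "(a \<cdot> b) \<cdot> (jinv a \<cdot> jinv b) = e" using jinv_right[OF a(2)] by (simp add: jprod_commute[of "jinv a" a])
  qed
qed

lemma one_minus_jinv:
  assumes b: "spos b"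
  shows "e - jinv (e + b) = jinv (e + jinv b)"
proof -
  have bS: "b \<in> S" using b by (rule spos_in)
  have s: "spos (e + b)" by (intro spos_add spos_unit spos_K b)
  have jS: "jinv b \<in> S" "jinv (e + b) \<in> S" using jinv_in[OF b] jinv_in[OF s] .
  have "e + jinv b = jinv b \<cdot> (e + b)"
    using jS bS jinv_right[OF b] by (simp add: jprod.add_right jprod_commute[of "jinv b"])
  moreover have "jinv (jinv b \<cdot> (e + b)) = b \<cdot> jinv (e + b)"
    using gen_mult_spos(2)[OF bS jinv_gen[OF b] jinv_spos[OF b] _ s] gen_closed(2)[OF bS gen_unit gen_self[OF bS]]
    by (simp add: jinv_jinv[OF b])
  moreover have "jinv (e + b) + b \<cdot> jinv (e + b) = e" using jinv_right[OF s] jS by (simp add: jprod.add_left)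
  ultimately show ?thesis by (metis add_diff_cancel_left')
qed

text \<open>For scalars, \<open>(1/y) / (t/y + 1 - t) = 1 / (t + (1 - t) y)\<close>. Thus
  \<open>jb_phi e t\<close> is an affine map fixing \<open>e\<close>, conjugated by
  inversion.\<close>

lemma jb_phi_jinv:
  assumes y: "y \<in> S" "e \<preceq> y" and t: "t < 1"
  shows "jb_phi e t (jinv y) = jinv (t *\<^sub>R e + (1 - t) *\<^sub>R y)"
proof -
  define b where "b = t *\<^sub>R e + (1 - t) *\<^sub>R y"
  have sy: "spos y" by (rule spos_mono[OF spos_unit y(2,1)])
  have jS: "jinv y \<in> S" using jinv_in[OF sy] .
  have "(1 - t) *\<^sub>R (y - e) \<in> K" using y(2) t by (intro K_scaleR) (auto simp: le_iff)
  moreover have "b - e = (1 - t) *\<^sub>R (y - e)" by (simp add: b_def algebra_simps)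
  ultimately have sb: "spos b" using y(1) by (intro spos_mono[OF spos_unit]) (auto simp: le_iff b_def)
  have bg: "b \<in> gen y" unfolding b_def by (intro gen_closed y(1) gen_unit gen_self)
  have "t *\<^sub>R jinv y + (1 - t) *\<^sub>R e = jinv y \<cdot> b"
    using jS jinv_right[OF sy] by (simp add: b_def jbilin jprod_commute[of "jinv y"])
  hence "jb_phi e t (jinv y) = jinv y \<cdot> (y \<cdot> jinv b)"
    using gen_mult_spos(2)[OF y(1) jinv_gen[OF sy] jinv_spos[OF sy] bg sb] by (simp add: jb_phi_def jinv_jinv[OF sy])
  also have "\<dots> = jinv b \<cdot> (y \<cdot> jinv y)"
    using gen_assoc[OF y(1) jinv_gen[OF sy] gen_mono[OF y(1) bg jinv_gen[OF sb]] y(1)]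
    by (simp add: jprod_commute[of y])
  finally show ?thesis using jinv_right[OF sy] jinv_in[OF sb] by (simp add: jprod_commute[of _ e] b_def)
qed

text \<open>The parameters \<open>t\<close> and \<open>z\<close> belonging to \<open>w\<close>: \<open>w\<^sup>2 \<le> (1 - t)/2\<close> and
  \<open>z\<^sup>2 = w\<^sup>2 ((1 - t) - w\<^sup>2)\<^sup>-\<^sup>1\<close>.\<close>

lemma interval_map_parameters:
  assumes w: "spos w" and t0: "2 * (norm w)\<^sup>2 \<le> 1 - t" and t: "t < 1"
  shows "\<exists>z. spos z \<and> (\<forall>a. spos a \<longrightarrow> a \<preceq> e \<longrightarrow>
    interval_map e t z a = jinv (e + U w (jinv a - e)))"
proof -
  have wS: "w \<in> S" using w by (rule spos_in)
  define T where "T = 1 - t"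
  have T: "T > 0" using t by (simp add: T_def)
  define a0 where "a0 = T *\<^sub>R e - w \<cdot> w"
  have ww: "w \<cdot> w \<in> gen w" by (rule gen_closed(1)[OF wS gen_self[OF wS] gen_self[OF wS]])
  have a0g: "a0 \<in> gen w" unfolding a0_def by (intro gen_closed wS ww gen_unit)
  have a0: "spos a0"
  proof (rule sposI)
    have "w \<cdot> w \<preceq> (T / 2) *\<^sub>R e" using wS t0 by (intro le_norm) (auto simp: T_def norm_jsquare)
    hence "(T / 2) *\<^sub>R e - w \<cdot> w \<in> K" by (simp add: le_iff)
    moreover have "T *\<^sub>R e - (T / 2) *\<^sub>R e = (T / 2) *\<^sub>R e" by (simp flip: scaleR_diff_left)
    ultimately show "(T / 2) *\<^sub>R e \<preceq> a0" by (simp add: le_iff a0_def algebra_simps)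
  qed (use wS T in \<open>auto simp: a0_def\<close>)
  define R where "R = jinv a0"
  define r where "r = jsq R"
  have R: "spos R" "R \<in> gen w" unfolding R_def using jinv_spos[OF a0] gen_mono[OF wS a0g jinv_gen[OF a0]] .
  have r: "spos r" "r \<in> gen w" "r \<cdot> r = R"
    unfolding r_def using jsq_spos[OF R(1)] gen_mono[OF wS R(2) jsq_gen[OF spos_K[OF R(1)]]] jsq_square[OF spos_K[OF R(1)]] .
  have S: "R \<in> S" "r \<in> S" "a0 \<in> S" "jinv r \<in> S" using R r a0 spos_in jinv_in by auto
  \<comment> \<open>Multiplying \<open>w w + a0 = T e\<close> by \<open>R\<close>, the inverse of
    \<open>a0\<close>, gives \<open>z z + e = T R\<close>, so \<open>v\<close> is its positive
    root.\<close>
  define z where "z = w \<cdot> r"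
  define v where "v = sqrt T *\<^sub>R r"
  have z: "spos z" "z \<in> gen w"
    unfolding z_def using gen_mult_spos(1)[OF wS gen_self[OF wS] w r(2,1)] gen_closed(1)[OF wS gen_self[OF wS] r(2)] .
  have v: "spos v" unfolding v_def using T by (intro spos_scaleR r) simp
  have zS: "z \<in> S" and vS: "v \<in> S" using z v spos_in by auto
  have vv: "v \<cdot> v = z \<cdot> z + e"
  proof -
    have "z \<cdot> z = w \<cdot> (z \<cdot> r)" using gen_assoc[OF wS z(2) gen_self[OF wS] S(2)] by (simp only: z_def)
    also have "z \<cdot> r = w \<cdot> R" unfolding z_def gen_assoc3[OF wS gen_self[OF wS] r(2,2)] r(3) ..
    also have "w \<cdot> (w \<cdot> R) = (w \<cdot> w) \<cdot> R" by (rule gen_assoc3[OF wS gen_self[OF wS] gen_self[OF wS] R(2), symmetric])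
    finally have "z \<cdot> z = (w \<cdot> w) \<cdot> R" .
    moreover have "e = a0 \<cdot> R" using jinv_right[OF a0] by (simp add: R_def)
    ultimately have "z \<cdot> z + e = (w \<cdot> w + a0) \<cdot> R" by (simp add: jprod.add_left)
    also have "\<dots> = T *\<^sub>R R" using S(1) by (simp add: a0_def jbilin)
    finally show ?thesis using T r(3) by (simp add: v_def jbilin)
  qed
  have zzK: "z \<cdot> z + e \<in> K" using zS by auto
  have sq: "jb_sqrt e (z \<cdot> z + e) = v"
    unfolding jb_sqrt_eq[OF zzK] by (rule sqrt_unique[OF jsq_K[OF zzK] spos_K[OF v]]) (simp add: jsq_square[OF zzK] vv)
  have jv: "jinv v = (1 / sqrt T) *\<^sub>R jinv r" unfolding v_def using T by (intro jinv_scaleR r) simp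
  have jrg: "jinv r \<in> gen w" by (rule gen_mono[OF wS r(2) jinv_gen[OF r(1)]])
  have jvz: "jinv v \<cdot> z = (1 / sqrt T) *\<^sub>R w" using gen_assoc[OF wS jrg gen_self[OF wS] S(2)] jinv_right[OF r(1)] wS
    by (simp add: jv z_def jprod.scaleR_left jprod_commute[of "jinv r" r] jprod_commute[of w e])
  have jvjv: "jinv v \<cdot> jinv v = e - (1 / T) *\<^sub>R (w \<cdot> w)"
  proof -
    have "jinv r \<cdot> jinv r = a0" using gen_mult_spos(2)[OF wS r(2,1) r(2,1)] r(3) jinv_jinv[OF a0] by (simp add: R_def)
    thus ?thesis using T by (simp add: jv jbilin a0_def scaleR_diff_right)
  qed
  have "interval_map e t z a = jinv (e + U w (jinv a - e))" if a: "spos a" "a \<preceq> e" for a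
  proof -
    have aS: "a \<in> S" "jinv a \<in> S" using a spos_in jinv_in by auto
    define b where "b = U (jinv z) a"
    have b: "spos b" unfolding b_def by (rule quad_rep_spos_spos[OF jinv_spos[OF z(1)] a(1)])
    have jb: "jinv b = U z (jinv a)" unfolding b_def jinv_quad_rep[OF jinv_spos[OF z(1)] a(1)] jinv_jinv[OF z(1)] ..
    have ejb: "spos (e + jinv b)" by (intro spos_add spos_unit spos_K jinv_spos b)
    define y where "y = U (jinv v) (e + jinv b)"
    have y: "spos y" unfolding y_def by (rule quad_rep_spos_spos[OF jinv_spos[OF v] ejb])
    have qw: "U (jinv v) (U z x) = (1 / T) *\<^sub>R U w x" if "x \<in> S" for x
      using gen_quad_rep[OF wS gen_closed(5)[OF wS jrg] z(2) that, of "1 / sqrt T"] T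
      unfolding jv[symmetric] jvz by (simp add: quad_rep_scaleR_left power_divide)
    have yeq: "y = e + (1 / T) *\<^sub>R U w (jinv a - e)"
    proof -
      have "y = jinv v \<cdot> jinv v + (1 / T) *\<^sub>R U w (jinv a)"
        unfolding y_def jb quad_rep_add qw[OF aS(2)] using jinv_in[OF v] by simp
      thus ?thesis unfolding jvjv using wS by (simp add: quad_rep_diff algebra_simps)
    qed
    have "e \<preceq> jinv a" using jinv_antimono[OF a unit_in] by simp
    hence "U w (jinv a - e) \<in> K" using quad_rep_K[OF wS] by (simp add: le_iff)
    hence ey: "e \<preceq> y" unfolding yeq le_iff using T by (simp add: K_scaleR)
    have "interval_map e t z a = jb_phi e t (U v (e - jinv (e + b)))" by (simp add: interval_map_def sq b_def)
    also have "e - jinv (e + b) = jinv (e + jinv b)" by (rule one_minus_jinv[OF b])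
    also have "U v (jinv (e + jinv b)) = jinv y"
      unfolding y_def jinv_quad_rep[OF jinv_spos[OF v] ejb] jinv_jinv[OF v] ..
    also have "jb_phi e t (jinv y) = jinv (t *\<^sub>R e + (1 - t) *\<^sub>R y)" by (rule jb_phi_jinv[OF spos_in[OF y] ey t])
    also have "t *\<^sub>R e + (1 - t) *\<^sub>R y = e + U w (jinv a - e)" unfolding yeq T_def using t by (simp add: algebra_simps)
    finally show ?thesis .
  qed
  thus ?thesis using z(1) by blast
qed

text \<open>The limit may be singular, but every inverse in the formula is taken of an element with
  a lower bound common to the whole sequence, so \<open>tendsto_jinv\<close> applies each
  time.\<close>

lemma tendsto_interval_map:
  assumes z: "spos z" and t: "t < 1" and a: "\<And>n. a n \<in> K" "\<And>n. a n \<preceq> e" and lim: "a \<longlonglongrightarrow> x"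
  shows "(\<lambda>n. interval_map e t z (a n)) \<longlonglongrightarrow> interval_map e t z x"
proof -
  have zS: "z \<in> S" and jzS: "jinv z \<in> S" using z spos_in jinv_in by auto
  have aS: "a n \<in> S" for n using a K_subset by blast
  define v where "v = jb_sqrt e (z \<cdot> z + e)"
  have zzK: "z \<cdot> z + e \<in> K" using zS by auto
  have vS: "v \<in> S" and vv: "v \<cdot> v = z \<cdot> z + e"
    unfolding v_def jb_sqrt_eq[OF zzK] using jsq_in[OF zzK] jsq_square[OF zzK] by auto
  define b where "b y = e + U (jinv z) y" for y
  have bS: "b (a n) \<in> S" for n using aS jzS by (simp add: b_def)
  have be: "1 *\<^sub>R e \<preceq> b (a n)" for n using quad_rep_K[OF jzS a(1)] by (simp add: b_def le_iff)
  have jb: "(\<lambda>n. jinv (b (a n))) \<longlonglongrightarrow> jinv (b x)"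
    by (rule tendsto_jinv[OF bS be]) (auto simp: b_def intro!: tendsto_intros lim)
  define c where "c y = U v (e - jinv (b y))" for y
  have cl: "(\<lambda>n. c (a n)) \<longlonglongrightarrow> c x" unfolding c_def by (intro tendsto_intros jb)
  have sb: "spos (b (a n))" for n by (rule sposI[OF bS _ be]) simp
  have c0: "c (a n) \<in> K" for n
  proof -
    have "jinv (b (a n)) \<preceq> e" using jinv_upper[OF bS _ be] by simp
    thus ?thesis unfolding c_def by (intro quad_rep_K vS) (simp add: le_iff)
  qed
  \<comment> \<open>The bound is the value at \<open>a n = e\<close>, since \<open>U v\<close> maps
    the inverse of \<open>z z + e = v v\<close> to \<open>e\<close>.\<close>
  have c1: "c (a n) \<preceq> e" for n
  proof -
    define zi where "zi = jinv z \<cdot> jinv z"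
    have zi: "spos zi" unfolding zi_def by (rule spos_square[OF jinv_spos[OF z]])
    have "b (a n) \<preceq> e + zi" using quad_rep_mono[OF jzS a(2), of n] jzS by (simp add: b_def le_iff zi_def)
    hence "jinv (e + zi) \<preceq> jinv (b (a n))" using spos_in[OF zi] by (intro jinv_antimono sb) auto
    hence "c (a n) \<preceq> U v (e - jinv (e + zi))" unfolding c_def by (intro quad_rep_mono vS) (simp add: le_iff)
    also have "e - jinv (e + zi) = jinv (e + jinv zi)" by (rule one_minus_jinv[OF zi])
    also have "jinv zi = z \<cdot> z"
    proof -
      have "zi = U (jinv z) e" using jzS by (simp add: zi_def)
      hence "jinv zi = U (jinv (jinv z)) (jinv e)" using jinv_quad_rep[OF jinv_spos[OF z] spos_unit] by simp
      thus ?thesis using zS by (simp add: jinv_jinv[OF z])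
    qed
    also have "U v (jinv (e + z \<cdot> z)) = e"
    proof -
      have eq: "e + z \<cdot> z = v \<cdot> v" using vv by (simp add: add.commute)
      have sv: "spos (v \<cdot> v)" unfolding eq[symmetric] using zS by (intro spos_add spos_unit) auto
      have vg: "v \<cdot> v \<in> gen v" using gen_closed(1)[OF vS gen_self[OF vS] gen_self[OF vS]] .
      have "jinv (v \<cdot> v) \<in> gen v" by (rule gen_mono[OF vS vg jinv_gen[OF sv]])
      hence "U v (jinv (v \<cdot> v)) = (v \<cdot> v) \<cdot> jinv (v \<cdot> v)" by (rule quad_rep_gen[OF vS gen_self[OF vS]])
      thus ?thesis unfolding eq using jinv_right[OF sv] by simp
    qed
    finally show ?thesis .
  qed
  have cS: "c (a n) \<in> S" for n using c0 K_subset by blast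
  \<comment> \<open>For \<open>t \<ge> 0\<close> the denominator is smallest where
    \<open>c = 0\<close>, with value \<open>1 - t\<close>; for negative \<open>t\<close> it is
    smallest where \<open>c = e\<close>, with value \<open>1\<close>.\<close>
  define m where "m = min 1 (1 - t)"
  have m: "m > 0" using t by (simp add: m_def)
  have low: "m *\<^sub>R e \<preceq> t *\<^sub>R c (a n) + (1 - t) *\<^sub>R e" for n
  proof (cases "0 \<le> t")
    case True
    hence "t *\<^sub>R c (a n) \<in> K" using c0 by auto
    hence "(1 - t) *\<^sub>R e \<preceq> t *\<^sub>R c (a n) + (1 - t) *\<^sub>R e" by (simp add: le_iff)
    moreover have "m *\<^sub>R e \<preceq> (1 - t) *\<^sub>R e" by (rule le_scaleR_left) (auto simp: m_def)
    ultimately show ?thesis using le_trans by blast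
  next
    case False
    have "(- t) *\<^sub>R c (a n) \<preceq> (- t) *\<^sub>R e" using False c1 by (intro le_scaleR_mono) auto
    hence "1 *\<^sub>R e \<preceq> t *\<^sub>R c (a n) + (1 - t) *\<^sub>R e" by (simp add: le_iff algebra_simps)
    moreover have "m *\<^sub>R e \<preceq> 1 *\<^sub>R e" by (rule le_scaleR_left) (auto simp: m_def)
    ultimately show ?thesis using le_trans by blast
  qed
  have "(\<lambda>n. jinv (t *\<^sub>R c (a n) + (1 - t) *\<^sub>R e)) \<longlonglongrightarrow> jinv (t *\<^sub>R c x + (1 - t) *\<^sub>R e)"
    by (rule tendsto_jinv[OF _ low m]) (use cS in \<open>auto intro!: tendsto_intros cl\<close>)
  hence "(\<lambda>n. jb_phi e t (c (a n))) \<longlonglongrightarrow> jb_phi e t (c x)" unfolding jb_phi_def by (intro jprod.tendsto cl)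
  thus ?thesis by (simp add: interval_map_def c_def b_def v_def)
qed

end

section \<open>A functional equation\<close>

text \<open>Monotonicity replaces continuity: \<open>n v\<close> lies between consecutive integers,
  which bounds \<open>n\<close> times the deviation from linearity by a constant.\<close>

lemma additive_mono_linear:
  fixes H :: "real \<Rightarrow> real"
  assumes add: "\<And>u v. 0 \<le> u \<Longrightarrow> 0 \<le> v \<Longrightarrow> H (u + v) = H u + H v"
    and mono: "\<And>u v. 0 \<le> u \<Longrightarrow> u \<le> v \<Longrightarrow> H u \<le> H v" and v: "0 \<le> v"
  shows "H v = v * H 1"
proof -
  have H0: "H 0 = 0" using add[of 0 0] by simp
  have mult: "H (real n * x) = real n * H x" if x: "0 \<le> x" for n x
  proof (induction n)
    case (Suc n)
    have "H (x + real n * x) = H x + H (real n * x)" by (rule add) (use x in auto)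
    thus ?case using Suc by (simp add: algebra_simps)
  qed (simp add: H0)
  have H1: "0 \<le> H 1" using mono[of 0 1] H0 by simp
  have le: "\<bar>H v - v * H 1\<bar> * real n \<le> H 1" for n :: nat
  proof -
    define m where "m = nat \<lfloor>real n * v\<rfloor>"
    have m: "real m \<le> real n * v" "real n * v \<le> real m + 1" using v by (auto simp: m_def)
    have "real m * H 1 \<le> real n * H v" using mono[OF _ m(1)] mult[of 1 m] mult[OF v, of n] by simp
    moreover have "real n * H v \<le> (real m + 1) * H 1"
      using mono[OF _ m(2)] mult[of 1 "Suc m"] mult[OF v, of n] v by (simp add: add.commute)
    moreover have "real m * H 1 \<le> real n * v * H 1" "real n * v * H 1 \<le> (real m + 1) * H 1"
      using m H1 by (auto intro: mult_right_mono)
    ultimately have "\<bar>real n * H v - real n * v * H 1\<bar> \<le> H 1" by (simp add: algebra_simps abs_le_iff)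
    moreover have "real n * H v - real n * v * H 1 = real n * (H v - v * H 1)" by (simp add: algebra_simps)
    ultimately show ?thesis by (simp add: abs_mult mult.commute)
  qed
  show ?thesis
  proof (rule ccontr)
    assume "H v \<noteq> v * H 1"
    hence pos: "\<bar>H v - v * H 1\<bar> > 0" by simp
    obtain n where "H 1 / \<bar>H v - v * H 1\<bar> < real n" using reals_Archimedean2 by blast
    hence "H 1 < real n * \<bar>H v - v * H 1\<bar>" using pos by (simp add: pos_divide_less_eq)
    thus False using le[of n] by (simp add: mult.commute)
  qed
qed

text \<open>The relations express that translates of \<open>h\<close> and \<open>k\<close> are affine images of each other under
  the scalings by \<open>c\<close> and \<open>c'\<close>. Translation invariance leaves only exponentials and
  affine functions; invariance under the proper scaling by \<open>c c'\<close> excludes the former.\<close>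

lemma affine_functional_equation:
  fixes h k :: "real \<Rightarrow> real"
  assumes c: "0 < c" "c < 1" "0 < c'" "c' < 1"
    and h1: "h 1 = 1" and k1: "k 1 = 1"
    and hmono: "\<And>a b. 1 \<le> a \<Longrightarrow> a < b \<Longrightarrow> h a < h b"
    and A1: "\<And>a. 1 \<le> a \<Longrightarrow> \<exists>\<rho>. \<forall>s\<ge>0. h (a + c * s) - h a = \<rho> * (k (1 + s) - 1)"
    and A2: "\<And>a. 1 \<le> a \<Longrightarrow> \<exists>\<rho>. \<forall>s\<ge>0. k (a + c' * s) - k a = \<rho> * (h (1 + s) - 1)"
  shows "\<exists>\<alpha>>0. \<forall>s\<ge>1. h s = 1 + \<alpha> * (s - 1)"
proof -
  define H where "H v = h (1 + v) - 1" for v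
  define L where "L v = k (1 + v) - 1" for v
  have H0: "H 0 = 0" by (simp add: H_def h1)
  have Hmono: "H u < H v" if "0 \<le> u" "u < v" for u v using hmono[of "1 + u" "1 + v"] that by (simp add: H_def)
  have "\<exists>\<rho>. \<forall>s\<ge>0. H (w + c * s) - H w = \<rho> * L s" if "0 \<le> w" for w
    using A1[of "1 + w"] that by (simp add: H_def L_def add.assoc)
  then obtain \<rho> where \<rho>: "\<And>w s. 0 \<le> w \<Longrightarrow> 0 \<le> s \<Longrightarrow> H (w + c * s) - H w = \<rho> w * L s" by metis
  have HL: "H (c * s) = \<rho> 0 * L s" if "0 \<le> s" for s using \<rho>[of 0 s] that H0 by simp
  have r0: "\<rho> 0 \<noteq> 0"
  proof
    assume "\<rho> 0 = 0"
    hence "H c = 0" using HL[of 1] by simp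
    thus False using Hmono[of 0 c] c H0 by simp
  qed
  define \<beta> where "\<beta> w = \<rho> w / \<rho> 0" for w
  have step: "H (w + v) = H w + \<beta> w * H v" if "0 \<le> w" "0 \<le> v" for w v
  proof -
    have "H (w + c * (v / c)) - H w = \<rho> w * L (v / c)" using that c by (intro \<rho>) auto
    moreover have "H (c * (v / c)) = \<rho> 0 * L (v / c)" using that c by (intro HL) auto
    ultimately show ?thesis using c r0 by (simp add: \<beta>_def)
  qed
  have H1: "H 1 > 0" using Hmono[of 0 1] H0 by simp
  define q where "q = (\<beta> 1 - 1) / H 1"
  \<comment> \<open>Exchanging \<open>w\<close> and \<open>1\<close> in \<open>step\<close>
    determines \<open>\<beta>\<close> as an affine function of \<open>H\<close>.\<close>
  have \<beta>: "\<beta> w = 1 + q * H w" if "0 \<le> w" for w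
  proof -
    have "H w + \<beta> w * H 1 = H 1 + \<beta> 1 * H w" using step[OF that, of 1] step[of 1 w] that by (simp add: add.commute)
    hence "\<beta> w * H 1 = H 1 + (\<beta> 1 - 1) * H w" by (simp add: algebra_simps)
    thus ?thesis using H1 by (simp add: q_def field_simps)
  qed
  have quad: "H (w + v) = H w + H v + q * H w * H v" if "0 \<le> w" "0 \<le> v" for w v
    using step[OF that] \<beta>[OF that(1)] by (simp add: algebra_simps)
  obtain \<rho>' where \<rho>': "\<And>s. 0 \<le> s \<Longrightarrow> L (c' * s) = \<rho>' * H s" using A2[of 1] k1 by (auto simp: H_def L_def)
  define \<theta> where "\<theta> = \<rho> 0 * \<rho>'"
  have scale: "H (c * c' * s) = \<theta> * H s" if "0 \<le> s" for s
    using HL[of "c' * s"] \<rho>'[OF that] that c by (simp add: \<theta>_def mult.assoc)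
  have cc: "0 < c * c'" "c * c' < 1" using c mult_strict_mono[of c 1 c' 1] by auto
  have "0 < H (c * c')" using Hmono[of 0 "c * c'"] cc H0 by simp
  hence \<theta>0: "0 < \<theta>" using scale[of 1] H1 by (simp add: zero_less_mult_iff)
  have "H (c * c') < H 1" using Hmono[of "c * c'" 1] cc by simp
  hence \<theta>1: "\<theta> < 1" using scale[of 1] H1 by simp
  \<comment> \<open>Computed by scaling and by the addition formula, \<open>H (2 c c')\<close> takes
    two forms that differ by \<open>q \<theta> H(1)^2 (1 - \<theta>)\<close>.\<close>
  have "\<theta> * H (1 + 1) = H (c * c' * 1 + c * c' * 1)" using scale[of "1 + 1"] by (simp add: algebra_simps)
  also have "\<dots> = \<theta> * H 1 + \<theta> * H 1 + q * (\<theta> * H 1) * (\<theta> * H 1)" using quad[of "c * c'" "c * c'"] scale[of 1] cc by simp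
  finally have "\<theta> * (H 1 + H 1 + q * H 1 * H 1) = \<theta> * H 1 + \<theta> * H 1 + q * (\<theta> * H 1) * (\<theta> * H 1)"
    using quad[of 1 1] by simp
  hence "q * (\<theta> * H 1 * H 1 * (1 - \<theta>)) = 0" by (simp add: algebra_simps)
  moreover have "\<theta> * H 1 * H 1 * (1 - \<theta>) \<noteq> 0" using \<theta>0 \<theta>1 H1 by simp
  ultimately have "q = 0" by simp
  hence "H v = v * H 1" if "0 \<le> v" for v using quad Hmono that by (intro additive_mono_linear) (auto simp: le_less)
  hence "h s = 1 + H 1 * (s - 1)" if "1 \<le> s" for s
    using that by (metis H_def add.commute diff_add_cancel diff_ge_0_iff_ge mult.commute)
  thus ?thesis using H1 by blast
qed

section \<open>Order isomorphisms of the unit intervals\<close>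

locale interval_iso = F: jbw_atomic S e + G: jbw_atomic T u
  for S :: "'a::jb_algebra set" and e and T :: "'b::jb_algebra set" and u +
  fixes f :: "'a \<Rightarrow> 'b"
  assumes iso: "order_isomorphism (jb_interval S 0 e) (jb_le S) (jb_interval T 0 u) (jb_le T) f"
begin

notation G.le (infix "\<sqsubseteq>" 50)

definition I :: "'a set" where "I = {x \<in> F.K. x \<preceq> e}"
definition I' :: "'b set" where "I' = {x \<in> G.K. x \<sqsubseteq> u}"

lemma I_eq: "I = jb_interval S 0 e" and I'_eq: "I' = jb_interval T 0 u"
  using F.K_subset G.K_subset by (auto simp: I_def I'_def jb_interval_def)

lemma bij_f: "bij_betw f I I'" using iso by (simp add: order_isomorphism_def I_eq I'_eq)

lemma f_le_iff: "x \<in> I \<Longrightarrow> y \<in> I \<Longrightarrow> f x \<sqsubseteq> f y \<longleftrightarrow> x \<preceq> y" using iso by (simp add: order_isomorphism_def I_eq)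

lemma f_in: "x \<in> I \<Longrightarrow> f x \<in> I'" using bij_f by (auto simp: bij_betw_def)

lemma f_surj: "y \<in> I' \<Longrightarrow> \<exists>x\<in>I. f x = y" using bij_f by (metis bij_betw_imp_surj_on imageE)

lemma I_D: "x \<in> I \<Longrightarrow> x \<in> F.K" "x \<in> I \<Longrightarrow> x \<preceq> e" "x \<in> I \<Longrightarrow> x \<in> S" by (auto simp: I_def F.K_subset)

lemma I'_D: "x \<in> I' \<Longrightarrow> x \<in> G.K" "x \<in> I' \<Longrightarrow> x \<sqsubseteq> u" "x \<in> I' \<Longrightarrow> x \<in> T" by (auto simp: I'_def G.K_subset)

lemma inverse: "interval_iso T u S e (inv_into I f)"
proof -
  have bij: "bij_betw (inv_into I f) I' I" using bij_f by (rule bij_betw_inv_into)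
  have "x \<sqsubseteq> y \<longleftrightarrow> inv_into I f x \<preceq> inv_into I f y" if "x \<in> I'" "y \<in> I'" for x y
  proof -
    obtain a b where "a \<in> I" "f a = x" "b \<in> I" "f b = y" using f_surj \<open>x \<in> I'\<close> \<open>y \<in> I'\<close> by metis
    thus ?thesis using f_le_iff[of a b] bij_f by (auto simp: bij_betw_def inv_into_f_f)
  qed
  thus ?thesis using bij by unfold_locales (simp add: order_isomorphism_def I_eq I'_eq)
qed

lemma inv_f: "x \<in> I \<Longrightarrow> inv_into I f (f x) = x" using bij_f by (simp add: bij_betw_def inv_into_f_f)

lemma zero_I: "0 \<in> I" and unit_I: "e \<in> I" and zero_I': "0 \<in> I'" and unit_I': "u \<in> I'"
  using F.proj_le_unit[OF F.proj_zero] G.proj_le_unit[OF G.proj_zero] by (auto simp: I_def I'_def)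

lemma f_zero: "f 0 = 0"
proof -
  obtain x where x: "x \<in> I" "f x = 0" using f_surj[OF zero_I'] by blast
  have "f 0 \<sqsubseteq> f x" using f_le_iff[OF zero_I x(1)] I_D(1)[OF x(1)] by simp
  moreover have "0 \<sqsubseteq> f 0" using I'_D(1)[OF f_in[OF zero_I]] by simp
  ultimately show ?thesis using x(2) G.le_antisym by metis
qed

lemma f_inj: "x \<in> I \<Longrightarrow> y \<in> I \<Longrightarrow> f x = f y \<longleftrightarrow> x = y" using bij_f by (auto simp: bij_betw_def inj_on_def)

lemma f_nonzero: "x \<in> I \<Longrightarrow> x \<noteq> 0 \<Longrightarrow> f x \<noteq> 0" using f_inj[of x 0] zero_I f_zero by auto

lemma I_down: "y \<in> I \<Longrightarrow> x \<in> F.K \<Longrightarrow> x \<preceq> y \<Longrightarrow> x \<in> I" unfolding I_def using F.le_trans by blast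

lemma I'_down: "y \<in> I' \<Longrightarrow> x \<in> G.K \<Longrightarrow> x \<sqsubseteq> y \<Longrightarrow> x \<in> I'" unfolding I'_def using G.le_trans by blast

lemma proj_I: "F.proj p \<Longrightarrow> p \<in> I" and proj_I': "G.proj q \<Longrightarrow> q \<in> I'"
  by (auto simp: I_def I'_def F.proj_K F.proj_le_unit G.proj_K G.proj_le_unit)

lemma atom_I: "F.atom p \<Longrightarrow> 0 \<le> l \<Longrightarrow> l \<le> 1 \<Longrightarrow> l *\<^sub>R p \<in> I" using F.le_scaleR_left[OF F.atom_K, of p l 1]
  by (intro I_down[OF proj_I[OF F.atom_proj]]) (auto intro: F.K_scaleR F.atom_K)

text \<open>The interval below \<open>l p\<close> is totally ordered, and \<open>f\<close>
  transports this property, by which \<open>total_interval_atom\<close> recognises multiples of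
  atoms.\<close>

lemma atom_scale_image:
  assumes p: "F.atom p" and l: "0 < l" "l \<le> 1"
  shows "\<exists>q m. G.atom q \<and> 0 < m \<and> f (l *\<^sub>R p) = m *\<^sub>R q"
proof (rule G.total_interval_atom)
  have lI: "l *\<^sub>R p \<in> I" by (rule atom_I) (use p l in auto)
  show "f (l *\<^sub>R p) \<in> G.K" using I'_D(1)[OF f_in[OF lI]] .
  show "f (l *\<^sub>R p) \<noteq> 0" using f_nonzero[OF lI] l F.atom_nonzero[OF p] by simp
  fix v w assume v: "v \<in> G.K" "v \<sqsubseteq> f (l *\<^sub>R p)" and w: "w \<in> G.K" "w \<sqsubseteq> f (l *\<^sub>R p)"
  have vI: "v \<in> I'" and wI: "w \<in> I'" using I'_down[OF f_in[OF lI]] v w by auto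
  obtain a b where ab: "a \<in> I" "f a = v" "b \<in> I" "f b = w" using f_surj[OF vI] f_surj[OF wI] by blast
  have le: "a \<preceq> l *\<^sub>R p" "b \<preceq> l *\<^sub>R p" using f_le_iff[OF ab(1) lI] f_le_iff[OF ab(3) lI] ab v w by auto
  obtain s t where "a = s *\<^sub>R p" "b = t *\<^sub>R p"
    using F.atom_interval[OF p I_D(1)[OF ab(1)] le(1)] F.atom_interval[OF p I_D(1)[OF ab(3)] le(2)] by blast
  hence "a \<preceq> b \<or> b \<preceq> a" using F.atom_scale_le[OF p, of s t] F.atom_scale_le[OF p, of t s] by auto
  thus "v \<sqsubseteq> w \<or> w \<sqsubseteq> v" using f_le_iff ab by blast
qed

text \<open>The image of \<open>p\<close> is at most an atom \<open>q\<close>, and the preimage of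
  \<open>q\<close> is likewise at most an atom. As this preimage lies above \<open>p\<close>, that
  atom is \<open>p\<close>, whence \<open>q \<sqsubseteq> f p\<close>.\<close>

lemma atom_image:
  assumes p: "F.atom p"
  shows "G.atom (f p)"
proof -
  obtain q m where q: "G.atom q" "0 < m" "f p = m *\<^sub>R q" using atom_scale_image[OF p, of 1] by auto
  have pI: "p \<in> I" using proj_I[OF F.atom_proj[OF p]] .
  have "f p \<in> G.K" "f p \<sqsubseteq> u" using I'_D[OF f_in[OF pI]] by auto
  hence "norm (f p) \<le> norm u" by (rule G.norm_mono) simp
  hence "norm (m *\<^sub>R q) \<le> norm u" by (simp only: q(3))
  hence m1: "m \<le> 1" using G.norm_atom[OF q(1)] G.norm_unit_le q(2) by simp
  have qI: "q \<in> I'" using proj_I'[OF G.atom_proj[OF q(1)]] .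
  have le1: "f p \<sqsubseteq> q" using q(3) G.atom_scale_le[OF q(1), of m 1] m1 by simp
  obtain a where a: "a \<in> I" "f a = q" using f_surj[OF qI] by blast
  obtain p' m' where p': "F.atom p'" "0 < m'" "a = m' *\<^sub>R p'"
    using interval_iso.atom_scale_image[OF inverse q(1), of 1] inv_f[OF a(1)] a(2) by auto
  have "p \<preceq> m' *\<^sub>R p'" using f_le_iff[OF pI a(1)] a(2) le1 p'(3) by simp
  hence "p = F.\<tau> p' p *\<^sub>R p'" by (rule F.atom_interval[OF p'(1) F.atom_K[OF p]])
  hence pp': "p = p'" by (rule F.atom_proportional[OF p p'(1)])
  have "norm a \<le> norm e" by (rule F.norm_mono[OF I_D(1,2)[OF a(1)] F.unit_in])
  hence "norm (m' *\<^sub>R p') \<le> norm e" by (simp only: p'(3))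
  hence "m' \<le> 1" using F.norm_atom[OF p'(1)] F.norm_unit_le p'(2) by simp
  hence "a \<preceq> p" using F.atom_scale_le[OF p, of m' 1] p'(3) pp' by simp
  hence "q \<sqsubseteq> f p" using f_le_iff[OF a(1) pI] a(2) by simp
  hence "f p = q" using le1 G.le_antisym by blast
  thus ?thesis using q(1) by simp
qed

lemma bij_atoms: "bij_betw f {p. F.atom p} {q. G.atom q}"
proof (rule bij_betw_imageI)
  have sub: "{p. F.atom p} \<subseteq> I" using proj_I F.atom_proj by blast
  show "inj_on f {p. F.atom p}" by (rule inj_on_subset[OF _ sub]) (use bij_f in \<open>simp add: bij_betw_def\<close>)
  show "f ` {p. F.atom p} = {q. G.atom q}"
  proof
    show "{q. G.atom q} \<subseteq> f ` {p. F.atom p}"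
    proof
      fix q assume "q \<in> {q. G.atom q}"
      hence q: "G.atom q" by simp
      obtain a where a: "a \<in> I" "f a = q" using f_surj[OF proj_I'[OF G.atom_proj[OF q]]] by blast
      have "F.atom a" using interval_iso.atom_image[OF inverse q] inv_f[OF a(1)] a(2) by simp
      thus "q \<in> f ` {p. F.atom p}" using a(2) by blast
    qed
  qed (use atom_image in blast)
qed

lemma atom_preimage: "G.atom q \<Longrightarrow> \<exists>p. F.atom p \<and> q = f p" using bij_atoms by (auto simp: bij_betw_def)

definition fp :: "'a \<Rightarrow> real \<Rightarrow> real" where
  "fp p l = G.\<tau> (f p) (f (l *\<^sub>R p))"

lemma f_atom_scale:
  assumes p: "F.atom p" and l: "0 \<le> l" "l \<le> 1"
  shows "f (l *\<^sub>R p) = fp p l *\<^sub>R f p"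
proof -
  have "l *\<^sub>R p \<preceq> p" using F.atom_scale_le[OF p, of l 1] l by simp
  hence "f (l *\<^sub>R p) \<sqsubseteq> 1 *\<^sub>R f p" using f_le_iff atom_I[OF p l] proj_I[OF F.atom_proj[OF p]] by simp
  thus ?thesis unfolding fp_def by (rule G.atom_interval[OF atom_image[OF p] I'_D(1)[OF f_in[OF atom_I[OF p l]]]])
qed

lemma fp_le_iff: "F.atom p \<Longrightarrow> 0 \<le> l \<Longrightarrow> l \<le> 1 \<Longrightarrow> 0 \<le> m \<Longrightarrow> m \<le> 1 \<Longrightarrow> fp p l \<le> fp p m \<longleftrightarrow> l \<le> m"
  using f_le_iff[OF atom_I atom_I, of p l p m] F.atom_scale_le[of p l m]
    G.atom_scale_le[OF atom_image, of p "fp p l" "fp p m"] by (simp add: f_atom_scale)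

lemma fp_0: "F.atom p \<Longrightarrow> fp p 0 = 0" and fp_1: "F.atom p \<Longrightarrow> fp p 1 = 1"
  using atom_image[of p] by (simp_all add: fp_def f_zero G.\<tau>_zero G.\<tau>_self)

lemma fp_surj:
  assumes p: "F.atom p" and m: "0 \<le> m" "m \<le> 1"
  shows "\<exists>l. 0 \<le> l \<and> l \<le> 1 \<and> fp p l = m"
proof -
  have q: "G.atom (f p)" using p by (rule atom_image)
  have le: "m *\<^sub>R f p \<sqsubseteq> f p" using G.atom_scale_le[OF q, of m 1] m by simp
  have "m *\<^sub>R f p \<in> I'" by (rule I'_down[OF proj_I'[OF G.atom_proj[OF q]] G.K_scaleR[OF G.atom_K[OF q] m(1)] le])
  then obtain x where x: "x \<in> I" "f x = m *\<^sub>R f p" using f_surj by blast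
  have "x \<preceq> 1 *\<^sub>R p" using f_le_iff[OF x(1) proj_I[OF F.atom_proj[OF p]]] x(2) le by simp
  hence xeq: "x = F.\<tau> p x *\<^sub>R p" by (rule F.atom_interval[OF p I_D(1)[OF x(1)]])
  have 0: "0 \<le> F.\<tau> p x" by (rule F.\<tau>_nonneg[OF p I_D(1)[OF x(1)]])
  have 1: "F.\<tau> p x \<le> 1" using F.\<tau>_mono[OF p I_D(3)[OF x(1)] F.unit_in I_D(2)[OF x(1)]] F.\<tau>_unit[OF p] by simp
  have "fp p (F.\<tau> p x) = m" unfolding fp_def using xeq x(2) G.\<tau>_scaleR[OF q G.atom_in[OF q]] G.\<tau>_self[OF q] by simp
  thus ?thesis using 0 1 by blast
qed

lemma fp_order_isomorphism:
  assumes p: "F.atom p"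
  shows "order_isomorphism {0..1} (\<le>) {0..1} (\<le>) (fp p)" unfolding order_isomorphism_def
proof
  show "bij_betw (fp p) {0..1} {0..1}"
  proof (rule bij_betw_imageI)
    show "inj_on (fp p) {0..1}" by (rule inj_onI) (metis atLeastAtMost_iff fp_le_iff[OF p] order.refl order.antisym)
    have "fp p l \<in> {0..1}" if "l \<in> {0..1}" for l
      using fp_le_iff[OF p, of 0 l] fp_le_iff[OF p, of l 1] fp_0[OF p] fp_1[OF p] that by auto
    moreover have "m \<in> fp p ` {0..1}" if "m \<in> {0..1}" for m using fp_surj[OF p, of m] that by force
    ultimately show "fp p ` {0..1} = {0..1}" by blast
  qed
qed (use fp_le_iff[OF p] in auto)

end

text \<open>The hypothesis is the conclusion of \<open>spos_of_atom_bounds\<close>; it holds if \<open>S\<close> is a finite direct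
  sum of factors.\<close>

locale jbw_atomic_fin = jbw_atomic +
  assumes spos_if_bounds: "w \<in> K \<Longrightarrow> (\<And>q. atom q \<Longrightarrow> \<exists>k. q \<preceq> k *\<^sub>R w) \<Longrightarrow> spos w"
begin

text \<open>Invertibility in terms of multiples of atoms, hence of order alone; in this form
  \<open>f\<close> preserves it.\<close>

lemma spos_iff_atoms: "w \<in> K \<Longrightarrow> spos w \<longleftrightarrow> (\<forall>q. atom q \<longrightarrow> (\<exists>l. 0 < l \<and> l \<le> 1 \<and> l *\<^sub>R q \<preceq> w))"
proof
  assume w: "w \<in> K" "spos w"
  then obtain \<epsilon> where \<epsilon>: "0 < \<epsilon>" "\<epsilon> *\<^sub>R e \<preceq> w" by (auto simp: spos_def)
  have "min \<epsilon> 1 *\<^sub>R q \<preceq> w" if q: "atom q" for q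
  proof -
    have "min \<epsilon> 1 *\<^sub>R q \<preceq> \<epsilon> *\<^sub>R q" by (rule le_scaleR_left[OF atom_K[OF q]]) simp
    also have "\<epsilon> *\<^sub>R q \<preceq> \<epsilon> *\<^sub>R e" using \<epsilon> proj_le_unit[OF atom_proj[OF q]] by (intro le_scaleR_mono) auto
    also note \<epsilon>(2)
    finally show ?thesis .
  qed
  thus "\<forall>q. atom q \<longrightarrow> (\<exists>l. 0 < l \<and> l \<le> 1 \<and> l *\<^sub>R q \<preceq> w)" using \<epsilon>(1) by (intro allI impI exI[of _ "min \<epsilon> 1"]) auto
next
  assume w: "w \<in> K" and l: "\<forall>q. atom q \<longrightarrow> (\<exists>l. 0 < l \<and> l \<le> 1 \<and> l *\<^sub>R q \<preceq> w)"
  show "spos w"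
  proof (rule spos_if_bounds[OF w])
    fix q assume "atom q"
    then obtain l where l: "0 < l" "l *\<^sub>R q \<preceq> w" using l by blast
    have "q \<preceq> (1 / l) *\<^sub>R w" using le_scaleR_mono[OF l(2), of "1 / l"] l(1) by simp
    thus "\<exists>k. q \<preceq> k *\<^sub>R w" by blast
  qed
qed

end

locale interval_iso_fin = interval_iso S e T u f + F: jbw_atomic_fin S e + G: jbw_atomic_fin T u
  for S :: "'a::jb_algebra set" and e and T :: "'b::jb_algebra set" and u and f
begin

lemma inverse_fin: "interval_iso_fin T u S e (inv_into I f)"
  by (intro interval_iso_fin.intro inverse F.jbw_atomic_fin_axioms G.jbw_atomic_fin_axioms)

lemma spos_f_aux:
  assumes x: "x \<in> I" "F.spos x"
  shows "G.spos (f x)"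
proof -
  have fK: "f x \<in> G.K" using I'_D(1)[OF f_in[OF x(1)]] .
  have "\<exists>l. 0 < l \<and> l \<le> 1 \<and> l *\<^sub>R q \<sqsubseteq> f x" if "G.atom q" for q
  proof -
    obtain p where p: "F.atom p" "q = f p" using atom_preimage[OF \<open>G.atom q\<close>] by blast
    obtain l where l: "0 < l" "l \<le> 1" "l *\<^sub>R p \<preceq> x" using F.spos_iff_atoms[OF I_D(1)[OF x(1)]] x(2) p(1) by blast
    have "fp p l *\<^sub>R q \<sqsubseteq> f x" using f_le_iff[OF atom_I x(1), of p l] f_atom_scale[OF p(1), of l] l p by simp
    moreover have "0 < fp p l" "fp p l \<le> 1"
      using fp_le_iff[OF p(1), of l 0] fp_le_iff[OF p(1), of l 1] fp_0[OF p(1)] fp_1[OF p(1)] l by auto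
    ultimately show ?thesis by blast
  qed
  thus ?thesis using G.spos_iff_atoms[OF fK] by blast
qed

lemma spos_f: "x \<in> I \<Longrightarrow> G.spos (f x) \<longleftrightarrow> F.spos x"
  using spos_f_aux[of x] interval_iso_fin.spos_f_aux[OF inverse_fin, of "f x"] inv_f[of x] f_in[of x]
  by (auto simp: interval_iso.I_def[OF inverse] I'_def)

end

context jb_unital
begin

lemma jinv_le_iff: "spos x \<Longrightarrow> spos y \<Longrightarrow> jinv x \<preceq> jinv y \<longleftrightarrow> y \<preceq> x"
  using jinv_antimono[of y x] jinv_antimono[of "jinv x" "jinv y"] spos_in jinv_spos jinv_in jinv_jinv by metis

lemma spos_ge_unit: "y \<in> S \<Longrightarrow> e \<preceq> y \<Longrightarrow> spos y" using spos_mono[OF spos_unit] by blast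

lemma jinv_le_unit: "y \<in> S \<Longrightarrow> e \<preceq> y \<Longrightarrow> jinv y \<preceq> e" using jinv_antimono[OF spos_unit, of y] by simp

lemma unit_le_jinv: "spos x \<Longrightarrow> x \<preceq> e \<Longrightarrow> e \<preceq> jinv x" using jinv_antimono[of x e] by simp

text \<open>The square is the second order term of the resolvent \<open>(e - s x)\<^sup>-\<^sup>1\<close>.\<close>

lemma resolvent_square:
  assumes x: "x \<in> S"
  shows "(\<lambda>n. (real (Suc n))\<^sup>2 *\<^sub>R (jinv (e - (1 / real (Suc n)) *\<^sub>R x) - e - (1 / real (Suc n)) *\<^sub>R x)) \<longlonglongrightarrow> x \<cdot> x"
proof -
  obtain N :: nat where N: "norm x \<le> real N / 2" using real_arch_simple[of "2 * norm x"] by (auto simp: field_simps)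
  define s where "s n = 1 / real (Suc (n + N))" for n
  define y where "y n = e - s n *\<^sub>R x" for n
  have s0: "s n > 0" for n by (simp add: s_def)
  have yS: "y n \<in> S" for n using x by (simp add: y_def)
  have yl: "(1/2) *\<^sub>R e \<preceq> y n" for n
  proof -
    have "norm (s n *\<^sub>R x) \<le> 1 / 2" using N by (simp add: s_def field_simps)
    from le_norm[OF _ this] x have "s n *\<^sub>R x \<preceq> (1/2) *\<^sub>R e" by simp
    hence "(1/2) *\<^sub>R e - s n *\<^sub>R x \<in> K" by (simp add: le_iff)
    moreover have "y n - (1/2) *\<^sub>R e = (1/2) *\<^sub>R e - s n *\<^sub>R x" using scaleR_half_double[of e] by (simp add: y_def algebra_simps)
    ultimately show ?thesis by (simp add: le_iff)
  qed
  have sy: "spos (y n)" for n by (rule sposI[OF yS _ yl]) simp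
  have slim: "s \<longlonglongrightarrow> 0"
    using LIMSEQ_ignore_initial_segment[OF LIMSEQ_inverse_real_of_nat, of N] by (simp add: s_def[abs_def] inverse_eq_divide)
  have "y \<longlonglongrightarrow> e - 0 *\<^sub>R x" unfolding y_def by (intro tendsto_intros slim)
  hence ylim: "y \<longlonglongrightarrow> e" by simp
  have jlim: "(\<lambda>n. jinv (y n)) \<longlonglongrightarrow> e" using tendsto_jinv[OF yS yl _ ylim] by simp
  have eq: "(1 / s n)\<^sup>2 *\<^sub>R (jinv (y n) - e - s n *\<^sub>R x) = x \<cdot> (x \<cdot> jinv (y n))" for n
  proof -
    define R where "R = jinv (y n)"
    have RS: "R \<in> S" using jinv_in[OF sy] by (simp add: R_def)
    have "(e - s n *\<^sub>R x) \<cdot> R = e" using jinv_right[OF sy, of n] by (simp add: R_def y_def)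
    hence R1: "R = e + s n *\<^sub>R (x \<cdot> R)" using RS by (simp add: jbilin algebra_simps)
    have "x \<cdot> R = x + s n *\<^sub>R (x \<cdot> (x \<cdot> R))" by (subst (1) R1) (use x in \<open>simp add: jbilin\<close>)
    hence "s n *\<^sub>R (x \<cdot> R) = s n *\<^sub>R x + (s n)\<^sup>2 *\<^sub>R (x \<cdot> (x \<cdot> R))"
      by (metis scaleR_add_right scaleR_scaleR power2_eq_square)
    hence "R - e - s n *\<^sub>R x = (s n)\<^sup>2 *\<^sub>R (x \<cdot> (x \<cdot> R))" using R1 by (simp add: algebra_simps)
    thus ?thesis using s0[of n] by (simp add: R_def power_divide)
  qed
  have "(\<lambda>n. x \<cdot> (x \<cdot> jinv (y n))) \<longlonglongrightarrow> x \<cdot> (x \<cdot> e)" by (intro jprod.tendsto tendsto_const jlim)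
  hence "(\<lambda>n. (1 / s n)\<^sup>2 *\<^sub>R (jinv (y n) - e - s n *\<^sub>R x)) \<longlonglongrightarrow> x \<cdot> x" unfolding eq using x by simp
  hence "(\<lambda>n. (real (Suc (n + N)))\<^sup>2 *\<^sub>R (jinv (e - (1 / real (Suc (n + N))) *\<^sub>R x) - e - (1 / real (Suc (n + N))) *\<^sub>R x)) \<longlonglongrightarrow> x \<cdot> x"
    unfolding y_def s_def by (simp only: divide_divide_eq_right mult_1 div_by_1)
  thus ?thesis by (rule LIMSEQ_offset)
qed

end

section \<open>The isomorphism conjugated by inversion\<close>

context interval_iso_fin
begin

text \<open>The reciprocal of the coefficient of the inverse of \<open>x\<close> at \<open>p\<close>
  is the largest \<open>l\<close> with \<open>l p \<preceq> x\<close>; this is an order-theoretic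
  quantity, which \<open>f\<close> transports through \<open>fp p\<close>.\<close>

lemma scale_image:
  assumes x: "x \<in> I" "F.spos x" and p: "F.atom p"
  shows "G.\<tau> (f p) (G.jinv (f x)) = 1 / fp p (1 / F.\<tau> p (F.jinv x))"
proof -
  have q: "G.atom (f p)" using p by (rule atom_image)
  have fx: "f x \<in> I'" "G.spos (f x)" using f_in spos_f x by auto
  define a where "a = F.\<tau> p (F.jinv x)"
  define b where "b = G.\<tau> (f p) (G.jinv (f x))"
  have a1: "1 \<le> a"
    unfolding a_def using F.\<tau>_mono[OF p F.unit_in F.jinv_in[OF x(2)] F.unit_le_jinv[OF x(2) I_D(2)[OF x(1)]]] F.\<tau>_unit[OF p] by simp
  have b1: "1 \<le> b"
    unfolding b_def using G.\<tau>_mono[OF q G.unit_in G.jinv_in[OF fx(2)] G.unit_le_jinv[OF fx(2) I'_D(2)[OF fx(1)]]] G.\<tau>_unit[OF q] by simp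
  have le: "l *\<^sub>R p \<preceq> x \<longleftrightarrow> l \<le> 1 / a" if "0 \<le> l" for l
    using F.atom_scale_le_iff[OF x(2) p that] a1 by (simp add: a_def[symmetric] pos_le_divide_eq)
  have le': "m *\<^sub>R f p \<sqsubseteq> f x \<longleftrightarrow> m \<le> 1 / b" if "0 \<le> m" for m
    using G.atom_scale_le_iff[OF fx(2) q that] b1 by (simp add: b_def[symmetric] pos_le_divide_eq)
  have la: "0 \<le> 1 / a" "1 / a \<le> 1" and lb: "0 \<le> 1 / b" "1 / b \<le> 1" using a1 b1 by auto
  obtain l where l: "0 \<le> l" "l \<le> 1" "fp p l = 1 / b" using fp_surj[OF p lb] by blast
  have "fp p l *\<^sub>R f p \<sqsubseteq> f x" using le'[OF lb(1)] l(3) by simp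
  hence "l \<le> 1 / a" using f_le_iff[OF atom_I[OF p l(1,2)] x(1)] f_atom_scale[OF p l(1,2)] le[OF l(1)] by simp
  hence 1: "1 / b \<le> fp p (1 / a)" using fp_le_iff[OF p l(1,2) la] l(3) by simp
  have "(1 / a) *\<^sub>R p \<preceq> x" using le[OF la(1)] by simp
  hence "fp p (1 / a) *\<^sub>R f p \<sqsubseteq> f x" using f_le_iff[OF atom_I[OF p la] x(1)] f_atom_scale[OF p la] by simp
  moreover have "0 \<le> fp p (1 / a)" using 1 lb by linarith
  ultimately have "fp p (1 / a) \<le> 1 / b" using le' by blast
  hence "fp p (1 / a) = 1 / b" using 1 by linarith
  thus ?thesis by (simp add: a_def b_def)
qed

definition g :: "'a \<Rightarrow> 'b" where "g y = G.jinv (f (F.jinv y))"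

definition h :: "'a \<Rightarrow> real \<Rightarrow> real" where "h p s = 1 / fp p (1 / s)"

lemma jinv_I: "y \<in> S \<Longrightarrow> e \<preceq> y \<Longrightarrow> F.jinv y \<in> I \<and> F.spos (F.jinv y)"
  using F.jinv_le_unit F.jinv_spos[OF F.spos_ge_unit] F.spos_K unfolding I_def by blast

lemma f_jinv: "y \<in> S \<Longrightarrow> e \<preceq> y \<Longrightarrow> f (F.jinv y) \<in> I' \<and> G.spos (f (F.jinv y))" using jinv_I f_in spos_f by blast

lemma g_ge: "y \<in> S \<Longrightarrow> e \<preceq> y \<Longrightarrow> u \<sqsubseteq> g y" unfolding g_def using f_jinv I'_D(2) by (intro G.unit_le_jinv) auto

lemma g_in: "y \<in> S \<Longrightarrow> e \<preceq> y \<Longrightarrow> g y \<in> T" unfolding g_def using f_jinv by (intro G.jinv_in) auto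

lemma \<tau>_g: "F.atom p \<Longrightarrow> y \<in> S \<Longrightarrow> e \<preceq> y \<Longrightarrow> G.\<tau> (f p) (g y) = h p (F.\<tau> p y)"
  using scale_image[of "F.jinv y" p] jinv_I[of y] F.jinv_jinv[OF F.spos_ge_unit, of y] by (simp add: g_def h_def)

lemma g_le_iff:
  assumes "y \<in> S" "e \<preceq> y" "y' \<in> S" "e \<preceq> y'"
  shows "g y \<sqsubseteq> g y' \<longleftrightarrow> y \<preceq> y'" unfolding g_def using assms f_jinv jinv_I
  by (simp add: G.jinv_le_iff f_le_iff F.jinv_le_iff F.spos_ge_unit)

lemma g_surj:
  assumes z: "z \<in> T" "u \<sqsubseteq> z"
  shows "\<exists>y. y \<in> S \<and> e \<preceq> y \<and> g y = z"
proof -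
  have sz: "G.spos z" using z by (rule G.spos_ge_unit)
  have "G.jinv z \<in> I'" using G.jinv_le_unit[OF z] G.spos_K[OF G.jinv_spos[OF sz]] by (simp add: I'_def)
  then obtain x where x: "x \<in> I" "f x = G.jinv z" using f_surj by blast
  have sx: "F.spos x" using spos_f[OF x(1)] x(2) G.jinv_spos[OF sz] by simp
  have "g (F.jinv x) = z" by (simp add: g_def F.jinv_jinv[OF sx] x(2) G.jinv_jinv[OF sz])
  thus ?thesis using F.jinv_in[OF sx] F.unit_le_jinv[OF sx I_D(2)[OF x(1)]] by blast
qed

text \<open>The interval below an increment \<open>D s\<close> corresponds to a segment of the line,
  so it is totally ordered and \<open>D s\<close> is a multiple of an atom. Increments for different
  \<open>s\<close> are comparable, hence all belong to the same atom.\<close>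

lemma g_line:
  assumes y: "y \<in> S" "e \<preceq> y" and r: "F.atom r"
  shows "\<exists>r' l. G.atom r' \<and> (\<forall>s\<ge>0. g (y + s *\<^sub>R r) = g y + l s *\<^sub>R r')"
proof -
  have yS: "y + s *\<^sub>R r \<in> S" for s using y F.atom_in[OF r] by simp
  have le: "y + s *\<^sub>R r \<preceq> y + t *\<^sub>R r \<longleftrightarrow> s \<le> t" for s t using F.atom_scale_le[OF r, of s t] by (simp add: F.le_iff)
  have ye: "e \<preceq> y + s *\<^sub>R r" if "0 \<le> s" for s using F.le_trans[OF y(2)] le[of 0 s] that by simp
  define D where "D s = g (y + s *\<^sub>R r) - g y" for s
  have D_mono: "D s \<sqsubseteq> D t \<longleftrightarrow> s \<le> t" if "0 \<le> s" "0 \<le> t" for s t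
    using g_le_iff[OF yS ye yS ye, of s t] that le[of s t] by (simp add: D_def G.le_iff)
  have D0: "D 0 = 0" by (simp add: D_def)
  have DK: "D s \<in> G.K" if "0 \<le> s" for s using D_mono[of 0 s] that D0 by simp
  have atomD: "\<exists>q m. G.atom q \<and> 0 < m \<and> D s = m *\<^sub>R q" if s: "0 < s" for s
  proof (rule G.total_interval_atom)
    show "D s \<in> G.K" using DK s by simp
    show "D s \<noteq> 0" using D_mono[of s 0] s D0 by auto
    have *: "\<exists>t. 0 \<le> t \<and> v = D t" if v: "v \<in> G.K" "v \<sqsubseteq> D s" for v
    proof -
      have vT: "g y + v \<in> T" using g_in[OF y] G.K_subset[OF v(1)] by simp
      have uv: "g y \<sqsubseteq> g y + v" using v(1) by (simp add: G.le_iff)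
      obtain y1 where y1: "y1 \<in> S" "e \<preceq> y1" "g y1 = g y + v" using g_surj[OF vT G.le_trans[OF g_ge[OF y] uv]] by blast
      have 1: "y \<preceq> y1" using g_le_iff[OF y y1(1,2)] y1(3) uv by simp
      have "g y1 \<sqsubseteq> g (y + s *\<^sub>R r)" using v(2) y1(3) by (simp add: D_def G.le_iff algebra_simps)
      hence "y1 \<preceq> y + s *\<^sub>R r" using g_le_iff[OF y1(1,2) yS ye, of s] s by simp
      hence "y1 - y \<preceq> s *\<^sub>R r" by (simp add: F.le_iff algebra_simps)
      hence eq: "y1 - y = F.\<tau> r (y1 - y) *\<^sub>R r" using 1 by (intro F.atom_interval[OF r]) (auto simp: F.le_iff)
      have "0 \<le> F.\<tau> r (y1 - y)" using 1 by (intro F.\<tau>_nonneg r) (simp add: F.le_iff)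
      moreover have "y1 = y + F.\<tau> r (y1 - y) *\<^sub>R r" using eq by (simp add: algebra_simps)
      ultimately show ?thesis using y1(3) by (intro exI[of _ "F.\<tau> r (y1 - y)"]) (simp add: D_def)
    qed
    fix v w assume "v \<in> G.K" "w \<in> G.K" "v \<sqsubseteq> D s" "w \<sqsubseteq> D s"
    then obtain a b where "0 \<le> a" "v = D a" "0 \<le> b" "w = D b" using * by metis
    thus "v \<sqsubseteq> w \<or> w \<sqsubseteq> v" using D_mono[of a b] D_mono[of b a] by auto
  qed
  obtain r' m where r': "G.atom r'" "0 < m" "D 1 = m *\<^sub>R r'" using atomD[of 1] by auto
  have Deq: "D s = G.\<tau> r' (D s) *\<^sub>R r'" if s: "0 \<le> s" for s
  proof (cases "s \<le> 1")
    case True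
    hence "D s \<sqsubseteq> m *\<^sub>R r'" using D_mono[of s 1] s r'(3) by simp
    thus ?thesis by (rule G.atom_interval[OF r'(1) DK[OF s]])
  next
    case False
    then obtain q k where q: "G.atom q" "0 < k" "D s = k *\<^sub>R q" using atomD[of s] by auto
    have "m *\<^sub>R r' \<sqsubseteq> k *\<^sub>R q" using D_mono[of 1 s] False s r'(3) q(3) by simp
    moreover have "m *\<^sub>R r' \<in> G.K" using DK[of 1] r'(3) by simp
    ultimately have "m *\<^sub>R r' = G.\<tau> q (m *\<^sub>R r') *\<^sub>R q" by (intro G.atom_interval[OF q(1)])
    hence "(1 / m) *\<^sub>R (m *\<^sub>R r') = (1 / m) *\<^sub>R (G.\<tau> q (m *\<^sub>R r') *\<^sub>R q)" by simp
    hence "r' = (G.\<tau> q (m *\<^sub>R r') / m) *\<^sub>R q" using r'(2) by simp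
    hence "r' = q" by (rule G.atom_proportional[OF r'(1) q(1)])
    thus ?thesis using q by (simp add: G.\<tau>_scaleR[OF q(1) G.atom_in[OF q(1)]] G.\<tau>_self[OF q(1)])
  qed
  have "g (y + s *\<^sub>R r) = g y + G.\<tau> r' (D s) *\<^sub>R r'" if s: "0 \<le> s" for s
  proof -
    have "g (y + s *\<^sub>R r) = g y + D s" by (simp add: D_def)
    also have "\<dots> = g y + G.\<tau> r' (D s) *\<^sub>R r'" by (rule arg_cong[OF Deq[OF s]])
    finally show ?thesis .
  qed
  hence "G.atom r' \<and> (\<forall>s\<ge>0. g (y + s *\<^sub>R r) = g y + G.\<tau> r' (D s) *\<^sub>R r')" using r'(1) by simp
  thus ?thesis by (intro exI[of _ r'] exI[of _ "\<lambda>s. G.\<tau> r' (D s)"])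
qed

lemma h_1: "F.atom p \<Longrightarrow> h p 1 = 1" by (simp add: h_def fp_1)

lemma h_mono:
  assumes p: "F.atom p" and ab: "1 \<le> a" "a < b"
  shows "h p a < h p b"
proof -
  have "fp p (1 / b) < fp p (1 / a)" using fp_le_iff[OF p, of "1 / a" "1 / b"] ab by (simp add: field_simps not_le[symmetric])
  moreover have "0 < fp p (1 / b)" using fp_le_iff[OF p, of "1 / b" 0] fp_0[OF p] ab by (simp add: not_le[symmetric])
  ultimately show ?thesis unfolding h_def by (intro divide_strict_left_mono) auto
qed

text \<open>Along \<open>y + s p\<close> the values of \<open>g\<close> move in a single direction
  by an unknown function \<open>l s\<close>. The coefficients at \<open>f p\<close> and
  \<open>f q\<close> both change proportionally to it, and eliminating it leaves a relation between
  \<open>h q\<close> and \<open>h p\<close>.\<close>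

lemma h_relation:
  assumes p: "F.atom p" and q: "F.atom q" and c: "F.\<tau> q p < 1" and a: "1 \<le> a"
  shows "\<exists>\<rho>. \<forall>s\<ge>0. h q (a + F.\<tau> q p * s) - h q a = \<rho> * (h p (1 + s) - 1)"
proof -
  have S: "p \<in> S" "q \<in> S" using p q F.atom_in by auto
  have aq: "G.atom (f p)" "G.atom (f q)" using p q by (auto intro: atom_image)
  \<comment> \<open>The factor makes the base point \<open>y = e + w (e - p)\<close> have
    coefficient \<open>1\<close> at \<open>p\<close> and \<open>a\<close> at
    \<open>q\<close>.\<close>
  define w where "w = (a - 1) / (1 - F.\<tau> q p)"
  have w: "0 \<le> w" using a c by (simp add: w_def)
  define y where "y = e + w *\<^sub>R (e - p)"
  have yS: "y \<in> S" using S by (simp add: y_def)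
  have ye: "e \<preceq> y" using F.K_scaleR[OF F.proj_K[OF F.proj_compl[OF F.atom_proj[OF p]]] w] by (simp add: y_def F.le_iff)
  have "F.\<tau> p y = 1" using S by (simp add: y_def F.\<tau>_add F.\<tau>_scaleR F.\<tau>_diff F.\<tau>_unit F.\<tau>_self p)
  moreover have "F.\<tau> q y = a" using S c by (simp add: y_def F.\<tau>_add F.\<tau>_scaleR F.\<tau>_diff F.\<tau>_unit q w_def)
  ultimately have \<tau>: "F.\<tau> p (y + s *\<^sub>R p) = 1 + s" "F.\<tau> q (y + s *\<^sub>R p) = a + F.\<tau> q p * s" for s
    using S yS by (simp_all add: F.\<tau>_add F.\<tau>_scaleR F.\<tau>_self p q)
  have yes: "e \<preceq> y + s *\<^sub>R p" if "0 \<le> s" for s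
    using F.le_add_mono[OF ye, of 0 "s *\<^sub>R p"] F.K_scaleR[OF F.atom_K[OF p] that] by simp
  obtain r' l where r': "G.atom r'" and l: "\<And>s. 0 \<le> s \<Longrightarrow> g (y + s *\<^sub>R p) = g y + l s *\<^sub>R r'"
    using g_line[OF yS ye p] by blast
  have gT: "g y \<in> T" "r' \<in> T" using g_in[OF yS ye] G.atom_in[OF r'] by auto
  have hq: "h q (a + F.\<tau> q p * s) = h q a + l s * G.\<tau> (f q) r'" and hp: "h p (1 + s) = 1 + l s * G.\<tau> (f p) r'" if s: "0 \<le> s" for s
  proof -
    have "h q (a + F.\<tau> q p * s) = G.\<tau> (f q) (g (y + s *\<^sub>R p))" using \<tau>_g[OF q _ yes[OF s]] yS S by (simp add: \<tau>)
    also have "\<dots> = G.\<tau> (f q) (g y) + l s * G.\<tau> (f q) r'" using gT aq by (simp add: l[OF s] G.\<tau>_add G.\<tau>_scaleR)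
    also have "G.\<tau> (f q) (g y) = h q a" using \<tau>_g[OF q yS ye] \<tau>(2)[of 0] by simp
    finally show "h q (a + F.\<tau> q p * s) = h q a + l s * G.\<tau> (f q) r'" .
    have "h p (1 + s) = G.\<tau> (f p) (g (y + s *\<^sub>R p))" using \<tau>_g[OF p _ yes[OF s]] yS S by (simp add: \<tau>)
    also have "\<dots> = G.\<tau> (f p) (g y) + l s * G.\<tau> (f p) r'" using gT aq by (simp add: l[OF s] G.\<tau>_add G.\<tau>_scaleR)
    also have "G.\<tau> (f p) (g y) = 1" using \<tau>_g[OF p yS ye] \<tau>(1)[of 0] h_1[OF p] by simp
    finally show "h p (1 + s) = 1 + l s * G.\<tau> (f p) r'" .
  qed
  have "G.\<tau> (f p) r' \<noteq> 0"
  proof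
    assume "G.\<tau> (f p) r' = 0"
    hence "h p (1 + 1) = 1" using hp[of 1] by simp
    thus False using h_mono[OF p, of 1 2] h_1[OF p] by simp
  qed
  hence "\<forall>s\<ge>0. h q (a + F.\<tau> q p * s) - h q a = (G.\<tau> (f q) r' / G.\<tau> (f p) r') * (h p (1 + s) - 1)" using hq hp by simp
  thus ?thesis by blast
qed

text \<open>Distinct non-orthogonal atoms have coefficients strictly between \<open>0\<close> and
  \<open>1\<close> at each other; these are the scalings of the functional equation.\<close>

lemma h_affine:
  assumes q: "F.nonorth q p" and ne: "p \<noteq> q"
  shows "\<exists>\<alpha>>0. \<forall>s\<ge>1. h q s = 1 + \<alpha> * (s - 1)"
proof (rule affine_functional_equation)
  have p: "F.atom p" and q': "F.atom q" using q by (auto simp: F.nonorth_def)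
  show c: "0 < F.\<tau> q p" "F.\<tau> q p < 1" "0 < F.\<tau> p q" "F.\<tau> p q < 1"
    using F.nonorth_iff_\<tau>[OF q' p] q F.\<tau>_lt_1[OF q' p] ne F.\<tau>_sym[OF p q'] by auto
  show "h q 1 = 1" "h p 1 = 1" using h_1 p q' by auto
  show "h q a < h q b" if "1 \<le> a" "a < b" for a b using h_mono[OF q' that] .
  show "\<exists>\<rho>. \<forall>s\<ge>0. h q (a + F.\<tau> q p * s) - h q a = \<rho> * (h p (1 + s) - 1)" if "1 \<le> a" for a
    by (rule h_relation[OF p q' c(2) that])
  show "\<exists>\<rho>. \<forall>s\<ge>0. h p (a + F.\<tau> p q * s) - h p a = \<rho> * (h q (1 + s) - 1)" if "1 \<le> a" for a
    by (rule h_relation[OF q' p c(4) that])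
qed

end

section \<open>Unital order isomorphisms\<close>

locale unital_order_iso = F: jbw_atomic_fin S e + G: jbw_atomic_fin T u
  for S :: "'a::jb_algebra set" and e and T :: "'b::jb_algebra set" and u +
  fixes J :: "'a \<Rightarrow> 'b"
  assumes bij: "bij_betw J S T"
    and J_add: "x \<in> S \<Longrightarrow> y \<in> S \<Longrightarrow> J (x + y) = J x + J y"
    and J_scaleR: "x \<in> S \<Longrightarrow> J (r *\<^sub>R x) = r *\<^sub>R J x"
    and J_unit: "J e = u" and J_K: "x \<in> S \<Longrightarrow> J x \<in> jb_cone T \<longleftrightarrow> x \<in> jb_cone S"
begin

notation G.le (infix "\<sqsubseteq>" 50)

lemma J_in: "x \<in> S \<Longrightarrow> J x \<in> T" using bij by (auto simp: bij_betw_def)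

lemma J_diff: "x \<in> S \<Longrightarrow> y \<in> S \<Longrightarrow> J (x - y) = J x - J y" using J_add[of x "(-1) *\<^sub>R y"] J_scaleR[of y "-1"] by simp

lemma J_le: "x \<in> S \<Longrightarrow> y \<in> S \<Longrightarrow> J x \<sqsubseteq> J y \<longleftrightarrow> x \<preceq> y" using J_K[of "y - x"] by (simp add: F.le_iff G.le_iff J_diff)

text \<open>Makes the results on interval isomorphisms, above all \<open>scale_image\<close>,
  available for \<open>J\<close> itself.\<close>

lemma iso_fin: "interval_iso_fin S e T u J"
proof (intro interval_iso_fin.intro F.jbw_atomic_fin_axioms G.jbw_atomic_fin_axioms)
  have "bij_betw J (jb_interval S 0 e) (jb_interval T 0 u)"
  proof (rule bij_betw_imageI)
    show "inj_on J (jb_interval S 0 e)" using bij by (auto simp: bij_betw_def jb_interval_def inj_on_def)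
    show "J ` jb_interval S 0 e = jb_interval T 0 u"
    proof
      show "jb_interval T 0 u \<subseteq> J ` jb_interval S 0 e"
      proof
        fix z assume z: "z \<in> jb_interval T 0 u"
        hence "z \<in> J ` S" using bij by (auto simp: bij_betw_def jb_interval_def)
        then obtain x where x: "z = J x" "x \<in> S" by (rule imageE)
        hence "x \<in> jb_interval S 0 e" using z J_K[of x] J_le[of x e] J_unit by (auto simp: jb_interval_def)
        thus "z \<in> J ` jb_interval S 0 e" using x(1) by blast
      qed
    qed (use J_K J_le[of _ e] J_unit J_in in \<open>auto simp: jb_interval_def\<close>)
  qed
  thus "interval_iso S e T u J" by unfold_locales (use J_le in \<open>auto simp: order_isomorphism_def jb_interval_def\<close>)
qed

interpretation iso: interval_iso_fin S e T u J by (rule iso_fin)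

text \<open>The upper bounds of \<open>\<tau>_less_bound\<close> are transported by
  \<open>J\<close>, which gives one inequality; applied to \<open>- x\<close> it gives the
  other.\<close>

lemma \<tau>_J:
  assumes p: "F.atom p" and x: "x \<in> S"
  shows "G.\<tau> (J p) (J x) = F.\<tau> p x"
proof -
  have q: "G.atom (J p)" using iso.atom_image[OF p] .
  have pS: "p \<in> S" using p by (rule F.atom_in)
  have le: "G.\<tau> (J p) (J x) \<le> F.\<tau> p x" if x: "x \<in> S" for x
  proof (rule field_le_epsilon)
    fix \<epsilon> :: real assume "0 < \<epsilon>"
    then obtain k where "x \<preceq> (F.\<tau> p x + \<epsilon>) *\<^sub>R p + k *\<^sub>R (e - p)" using F.\<tau>_less_bound[OF p x, of "F.\<tau> p x + \<epsilon>"] by auto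
    hence "J x \<sqsubseteq> J ((F.\<tau> p x + \<epsilon>) *\<^sub>R p + k *\<^sub>R (e - p))" using J_le x pS by simp
    also have "\<dots> = (F.\<tau> p x + \<epsilon>) *\<^sub>R J p + k *\<^sub>R (u - J p)"
      using pS J_add[of "(F.\<tau> p x + \<epsilon>) *\<^sub>R p" "k *\<^sub>R (e - p)"] J_scaleR[of "e - p" k] J_diff[of e p]
      by (simp add: J_scaleR J_unit)
    finally show "G.\<tau> (J p) (J x) \<le> F.\<tau> p x + \<epsilon>" by (rule G.\<tau>_bound[OF q J_in[OF x]])
  qed
  have "G.\<tau> (J p) (J ((-1) *\<^sub>R x)) \<le> F.\<tau> p ((-1) *\<^sub>R x)" by (rule le) (use x F.scaleR_in in blast)
  hence "F.\<tau> p x \<le> G.\<tau> (J p) (J x)" unfolding J_scaleR[OF x] F.\<tau>_scaleR[OF p x] G.\<tau>_scaleR[OF q J_in[OF x]] by simp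
  thus ?thesis using le[OF x] by simp
qed

text \<open>For linear \<open>J\<close> the functions \<open>iso.fp\<close> are the identity, so by
  \<open>scale_image\<close> and \<open>\<tau>_J\<close> both sides have the same
  coefficients.\<close>

lemma J_jinv_interval:
  assumes x: "F.spos x" "x \<preceq> e"
  shows "J (F.jinv x) = G.jinv (J x)"
proof -
  have xI: "x \<in> iso.I" using x F.spos_K by (simp add: iso.I_def)
  have sJ: "G.spos (J x)" using iso.spos_f[OF xI] x(1) by simp
  have fp: "iso.fp p l = l" if p: "F.atom p" for p l
    using G.\<tau>_scaleR[OF iso.atom_image[OF p] G.atom_in[OF iso.atom_image[OF p]]] G.\<tau>_self[OF iso.atom_image[OF p]]
    by (simp add: iso.fp_def J_scaleR[OF F.atom_in[OF p]])
  show ?thesis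
  proof (subst G.eq_iff_\<tau>)
    show "J (F.jinv x) \<in> T" "G.jinv (J x) \<in> T" using J_in F.jinv_in[OF x(1)] G.jinv_in[OF sJ] by auto
    show "\<forall>q. G.atom q \<longrightarrow> G.\<tau> q (J (F.jinv x)) = G.\<tau> q (G.jinv (J x))"
    proof (intro allI impI)
      fix q assume "G.atom q"
      then obtain p where p: "F.atom p" "q = J p" using iso.atom_preimage by blast
      thus "G.\<tau> q (J (F.jinv x)) = G.\<tau> q (G.jinv (J x))"
        using iso.scale_image[OF xI x(1) p(1)] fp[OF p(1)] \<tau>_J[OF p(1) F.jinv_in[OF x(1)]] by simp
    qed
  qed
qed

lemma spos_J: "F.spos x \<Longrightarrow> G.spos (J x)"
proof -
  assume x: "F.spos x"
  then obtain \<epsilon> where \<epsilon>: "0 < \<epsilon>" "\<epsilon> *\<^sub>R e \<preceq> x" by (auto simp: F.spos_def)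
  hence "\<epsilon> *\<^sub>R u \<sqsubseteq> J x" using J_le[of "\<epsilon> *\<^sub>R e" x] F.spos_in[OF x] by (simp add: J_scaleR J_unit)
  thus ?thesis using \<epsilon>(1) J_in[OF F.spos_in[OF x]] by (intro G.sposI)
qed

lemma J_jinv:
  assumes x: "F.spos x"
  shows "J (F.jinv x) = G.jinv (J x)"
proof -
  have xS: "x \<in> S" using x by (rule F.spos_in)
  define r where "r = 1 / (norm x + 1)"
  have n: "norm x + 1 > 0" using norm_ge_zero[of x] by linarith
  hence r: "0 < r" by (simp add: r_def)
  have "x \<preceq> (norm x + 1) *\<^sub>R e" by (rule F.le_norm[OF xS]) simp
  from F.le_scaleR_mono[OF this, of r] r n have "r *\<^sub>R x \<preceq> e" by (simp add: r_def)
  from J_jinv_interval[OF F.spos_scaleR[OF x r] this] have "(1 / r) *\<^sub>R J (F.jinv x) = (1 / r) *\<^sub>R G.jinv (J x)"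
    by (simp add: F.jinv_scaleR[OF x r] J_scaleR[OF xS] G.jinv_scaleR[OF spos_J[OF x] r] J_scaleR[OF F.jinv_in[OF x]])
  thus ?thesis using r by simp
qed

lemma norm_J:
  assumes x: "x \<in> S"
  shows "norm (J x) \<le> norm x"
proof -
  have 1: "J x \<sqsubseteq> norm x *\<^sub>R u"
    using J_le[OF x, of "norm x *\<^sub>R e"] F.le_norm[OF x order_refl] by (simp add: J_scaleR J_unit)
  have "(- norm x) *\<^sub>R e \<preceq> x" using F.le_norm'[OF x order_refl] by simp
  hence "J ((- norm x) *\<^sub>R e) \<sqsubseteq> J x" using J_le[OF F.scaleR_in[OF F.unit_in] x] by blast
  hence "(- norm x) *\<^sub>R u \<sqsubseteq> J x" by (subst (asm) J_scaleR[OF F.unit_in]) (simp only: J_unit)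
  hence 2: "- (norm x *\<^sub>R u) \<sqsubseteq> J x" by simp
  show ?thesis using G.norm_le_iff[OF J_in[OF x] norm_ge_zero[of x]] 1 2 by simp
qed

lemma J_square:
  assumes x: "x \<in> S"
  shows "J (x \<cdot> x) = J x \<cdot> J x"
proof -
  define a where "a n = (real (Suc n))\<^sup>2 *\<^sub>R (F.jinv (e - (1 / real (Suc n)) *\<^sub>R x) - e - (1 / real (Suc n)) *\<^sub>R x)" for n
  define b where "b n = (real (Suc n))\<^sup>2 *\<^sub>R (G.jinv (u - (1 / real (Suc n)) *\<^sub>R J x) - u - (1 / real (Suc n)) *\<^sub>R J x)" for n
  have a: "a \<longlonglongrightarrow> x \<cdot> x" unfolding a_def by (rule F.resolvent_square[OF x])
  have b: "b \<longlonglongrightarrow> J x \<cdot> J x" unfolding b_def by (rule G.resolvent_square[OF J_in[OF x]])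
  \<comment> \<open>From this index on the subtracted multiple of \<open>x\<close> has norm below
    \<open>1\<close>, so \<open>J_jinv\<close> can be applied to the resolvent.\<close>
  have ab: "J (a n) = b n \<and> a n \<in> S" if n: "n \<ge> nat \<lceil>norm x\<rceil>" for n
  proof -
    define s where "s = 1 / real (Suc n)"
    have s: "norm (- (s *\<^sub>R x)) < 1" using n by (simp add: s_def field_simps)
    have "F.spos (e - s *\<^sub>R x)" using F.spos_near_unit[OF _ s] x by simp
    note sp = this
    have js: "F.jinv (e - s *\<^sub>R x) \<in> S" using F.jinv_in[OF sp] .
    have "J (F.jinv (e - s *\<^sub>R x)) = G.jinv (u - s *\<^sub>R J x)"
      using J_jinv[OF sp] J_diff[of e "s *\<^sub>R x"] x by (simp add: J_unit J_scaleR)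
    hence "J (a n) = b n" unfolding a_def b_def s_def[symmetric] using js x by (simp add: J_scaleR J_diff J_unit)
    thus ?thesis using js x by (simp add: a_def s_def)
  qed
  have "(\<lambda>n. J (a n)) \<longlonglongrightarrow> J (x \<cdot> x)"
  proof (rule LIM_zero_cancel, rule Lim_null_comparison)
    show "\<forall>\<^sub>F n in sequentially. norm (J (a n) - J (x \<cdot> x)) \<le> norm (a n - x \<cdot> x)"
      using eventually_ge_at_top[of "nat \<lceil>norm x\<rceil>"]
    proof eventually_elim
      case (elim n)
      thus ?case using ab[OF elim] x norm_J[of "a n - x \<cdot> x"] J_diff[of "a n" "x \<cdot> x"] by simp
    qed
    show "(\<lambda>n. norm (a n - x \<cdot> x)) \<longlonglongrightarrow> 0" using LIM_zero[OF a] by (rule tendsto_norm_zero)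
  qed
  moreover have "(\<lambda>n. J (a n)) \<longlonglongrightarrow> J x \<cdot> J x"
    using b by (rule Lim_transform_eventually) (use eventually_ge_at_top[of "nat \<lceil>norm x\<rceil>"] ab in \<open>auto elim!: eventually_mono\<close>)
  ultimately show ?thesis by (rule LIMSEQ_unique)
qed

theorem jordan: "jordan_isomorphism S T J"
proof -
  have "J (x \<cdot> y) = J x \<cdot> J y" if xy: "x \<in> S" "y \<in> S" for x y
  proof -
    have sq: "(x + y) \<cdot> (x + y) = x \<cdot> x + y \<cdot> y + 2 *\<^sub>R (x \<cdot> y)"
      by (simp add: jprod.add_left jprod.add_right jprod_commute[of y x] scaleR_2)
    have sq': "(J x + J y) \<cdot> (J x + J y) = J x \<cdot> J x + J y \<cdot> J y + 2 *\<^sub>R (J x \<cdot> J y)"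
      by (simp add: jprod.add_left jprod.add_right jprod_commute[of "J y" "J x"] scaleR_2)
    have "J ((x + y) \<cdot> (x + y)) = (J x + J y) \<cdot> (J x + J y)" using J_square[of "x + y"] xy by (simp add: J_add)
    hence "J (x \<cdot> x) + J (y \<cdot> y) + 2 *\<^sub>R J (x \<cdot> y) = J x \<cdot> J x + J y \<cdot> J y + 2 *\<^sub>R (J x \<cdot> J y)"
      unfolding sq sq' using xy by (simp add: J_add J_scaleR)
    thus ?thesis by (simp add: J_square xy)
  qed
  thus ?thesis unfolding jordan_isomorphism_def using bij J_add J_scaleR by blast
qed

end

section \<open>Linearisation when every atom has a partner\<close>

locale interval_iso_engaged = interval_iso_fin +
  assumes partner: "F.atom p \<Longrightarrow> \<exists>q. F.nonorth p q \<and> q \<noteq> p"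
begin

definition slope :: "'a \<Rightarrow> real" where
  "slope p = (SOME \<alpha>. 0 < \<alpha> \<and> (\<forall>s\<ge>1. h p s = 1 + \<alpha> * (s - 1)))"

lemma slope: "F.atom p \<Longrightarrow> 0 < slope p" "F.atom p \<Longrightarrow> 1 \<le> s \<Longrightarrow> h p s = 1 + slope p * (s - 1)"
proof -
  have *: "0 < slope p \<and> (\<forall>s\<ge>1. h p s = 1 + slope p * (s - 1))" if p: "F.atom p"
  proof -
    obtain q where "F.nonorth p q" "q \<noteq> p" using partner[OF p] by blast
    hence "\<exists>\<alpha>>0. \<forall>s\<ge>1. h p s = 1 + \<alpha> * (s - 1)" by (rule h_affine)
    thus ?thesis unfolding slope_def by (rule someI_ex)
  qed
  show "F.atom p \<Longrightarrow> 0 < slope p" "F.atom p \<Longrightarrow> 1 \<le> s \<Longrightarrow> h p s = 1 + slope p * (s - 1)" using * by auto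
qed

text \<open>The increment of \<open>g\<close> from \<open>e\<close> makes sense only in positive
  directions, so a general \<open>v\<close> is represented as the difference of the positive
  elements \<open>v + norm v e\<close> and \<open>norm v e\<close>.\<close>

definition lin :: "'a \<Rightarrow> 'b" where
  "lin v = g (e + (v + norm v *\<^sub>R e)) - g (e + norm v *\<^sub>R e)"

lemma ge_unit: "v \<in> F.K \<Longrightarrow> e \<preceq> e + v" by (simp add: F.le_iff)

lemma shift_K: "v \<in> S \<Longrightarrow> v + norm v *\<^sub>R e \<in> F.K" using F.le_norm'[of v "norm v"] by (simp add: F.le_iff)

lemma unit_scale_K: "0 \<le> r \<Longrightarrow> r *\<^sub>R e \<in> F.K" and unit_scale_K': "0 \<le> r \<Longrightarrow> r *\<^sub>R u \<in> G.K"
  by (simp_all add: F.K_scaleR G.K_scaleR)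

lemma g_shift: "v \<in> F.K \<Longrightarrow> g (e + v) \<in> T" using g_in[OF _ ge_unit, of v] F.K_subset by simp

lemma \<tau>_g_shift: "F.atom p \<Longrightarrow> v \<in> F.K \<Longrightarrow> G.\<tau> (f p) (g (e + v)) = 1 + slope p * F.\<tau> p v"
  using \<tau>_g[OF _ _ ge_unit, of p v] slope(2)[of p "1 + F.\<tau> p v"] F.K_subset[of v] F.\<tau>_nonneg[of p v]
  by (simp add: F.\<tau>_add F.\<tau>_unit)

lemma lin_in: "v \<in> S \<Longrightarrow> lin v \<in> T" unfolding lin_def by (intro G.diff_in g_shift shift_K unit_scale_K norm_ge_zero)

lemma \<tau>_lin:
  assumes p: "F.atom p" and v: "v \<in> S"
  shows "G.\<tau> (f p) (lin v) = slope p * F.\<tau> p v" unfolding lin_def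
  using G.\<tau>_diff[OF atom_image[OF p] g_shift[OF shift_K[OF v]] g_shift[OF unit_scale_K[OF norm_ge_zero[of v]]]]
    \<tau>_g_shift[OF p shift_K[OF v]] \<tau>_g_shift[OF p unit_scale_K[OF norm_ge_zero[of v]]] F.\<tau>_add[OF p v, of "norm v *\<^sub>R e"]
  by (simp add: algebra_simps)

text \<open>Linearity is read off from coefficients: those of \<open>lin v\<close> at the atoms
  \<open>f p\<close> are linear in \<open>v\<close>, and they determine the element.\<close>

lemma lin_unique:
  assumes "v \<in> S" "w \<in> T" "\<And>p. F.atom p \<Longrightarrow> G.\<tau> (f p) w = slope p * F.\<tau> p v"
  shows "lin v = w"
proof (subst G.eq_iff_\<tau>[OF lin_in[OF assms(1)] assms(2)], intro allI impI)
  fix q assume "G.atom q"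
  then obtain p where "F.atom p" "q = f p" using atom_preimage by blast
  thus "G.\<tau> q (lin v) = G.\<tau> q w" using assms(3) \<tau>_lin[OF _ assms(1)] by simp
qed

lemma lin_add: "x \<in> S \<Longrightarrow> y \<in> S \<Longrightarrow> lin (x + y) = lin x + lin y"
  by (rule lin_unique) (auto simp: lin_in G.\<tau>_add F.\<tau>_add atom_image \<tau>_lin algebra_simps)

lemma lin_scaleR: "x \<in> S \<Longrightarrow> lin (r *\<^sub>R x) = r *\<^sub>R lin x"
  by (rule lin_unique) (auto simp: lin_in G.\<tau>_scaleR F.\<tau>_scaleR atom_image \<tau>_lin)

lemma lin_diff: "x \<in> S \<Longrightarrow> y \<in> S \<Longrightarrow> lin (x - y) = lin x - lin y"
  by (rule lin_unique) (auto simp: lin_in G.\<tau>_diff F.\<tau>_diff atom_image \<tau>_lin algebra_simps)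

lemma g_lin: "v \<in> F.K \<Longrightarrow> g (e + v) = u + lin v" using lin_unique[of v "g (e + v) - u"] g_shift[of v] F.K_subset[of v]
  by (simp add: G.\<tau>_diff atom_image \<tau>_g_shift G.\<tau>_unit)

lemma lin_K: "v \<in> S \<Longrightarrow> lin v \<in> G.K \<longleftrightarrow> v \<in> F.K"
proof -
  assume v: "v \<in> S"
  have "lin v \<in> G.K \<longleftrightarrow> (\<forall>p. F.atom p \<longrightarrow> 0 \<le> slope p * F.\<tau> p v)"
    unfolding G.K_iff_\<tau>[OF lin_in[OF v]] using atom_preimage atom_image \<tau>_lin[OF _ v] by metis
  also have "\<dots> \<longleftrightarrow> v \<in> F.K" unfolding F.K_iff_\<tau>[OF v] using slope(1) by (simp add: zero_le_mult_iff not_le) fastforce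
  finally show ?thesis .
qed

lemma lin_bij: "bij_betw lin S T"
proof (rule bij_betw_imageI)
  show "inj_on lin S"
  proof (rule inj_onI)
    fix x y assume xy: "x \<in> S" "y \<in> S" "lin x = lin y"
    hence "lin (x - y) = 0" "lin (y - x) = 0" by (simp_all add: lin_diff)
    hence "x - y \<in> F.K" "y - x \<in> F.K" using lin_K[of "x - y"] lin_K[of "y - x"] xy by simp_all
    thus "x = y" using F.K_pointed[of "x - y"] by simp
  qed
  have K: "w \<in> lin ` S" if w: "w \<in> G.K" for w
  proof -
    have "u + w \<in> T" "u \<sqsubseteq> u + w" using w G.K_subset[OF w] by (auto simp: G.le_iff)
    then obtain y where y: "y \<in> S" "e \<preceq> y" "g y = u + w" using g_surj by blast
    have "lin (y - e) = w" using g_lin[of "y - e"] y by (simp add: F.le_iff)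
    thus ?thesis using y(1) by (intro image_eqI[of _ _ "y - e"]) auto
  qed
  show "lin ` S = T"
  proof
    show "T \<subseteq> lin ` S"
    proof
      fix w assume w: "w \<in> T"
      have "w + norm w *\<^sub>R u \<in> G.K" using G.le_norm'[OF w order_refl] by (simp add: G.le_iff)
      then obtain x where x: "x \<in> S" "w + norm w *\<^sub>R u = lin x" using K by blast
      obtain y where y: "y \<in> S" "norm w *\<^sub>R u = lin y" using K[OF unit_scale_K'[OF norm_ge_zero[of w]]] by blast
      have "lin (x - y) = w" using lin_diff[OF x(1) y(1)] x(2) y(2) by (metis add_diff_cancel_right')
      thus "w \<in> lin ` S" using x(1) y(1) F.diff_in by blast
    qed
  qed (use lin_in in blast)
qed

text \<open>By surjectivity \<open>u = lin v\<close> for some \<open>v\<close>, and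
  \<open>v \<preceq> n e\<close> gives \<open>u \<preceq> n lin e\<close>.\<close>

lemma spos_lin_unit: "G.spos (lin e)"
proof -
  have "u \<in> lin ` S" using lin_bij by (simp add: bij_betw_def)
  then obtain v where v: "v \<in> S" "u = lin v" by blast
  define n where "n = norm v + 1"
  have n: "0 < n" unfolding n_def using norm_ge_zero[of v] by linarith
  have "v \<preceq> n *\<^sub>R e" by (rule F.le_norm[OF v(1)]) (simp add: n_def)
  hence "lin (n *\<^sub>R e - v) \<in> G.K" using lin_K[of "n *\<^sub>R e - v"] v(1) by (simp add: F.le_iff)
  hence "u \<sqsubseteq> n *\<^sub>R lin e" using v by (simp add: lin_diff lin_scaleR G.le_iff)
  from G.le_scaleR_mono[OF this, of "1 / n"] n have "(1 / n) *\<^sub>R u \<sqsubseteq> lin e" by simp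
  thus ?thesis using n by (intro G.sposI[of _ "1 / n"] lin_in) auto
qed

definition w :: 'b where "w = G.jsq (lin e)"

lemma w_spos: "G.spos w" and w_in: "w \<in> T" and w_square: "w \<cdot> w = lin e"
  using spos_lin_unit by (auto simp: w_def G.jsq_spos G.jsq_in G.spos_K G.jsq_square)

definition J :: "'a \<Rightarrow> 'b" where "J v = U (G.jinv w) (lin v)"

lemma quad_rep_w_J: "v \<in> S \<Longrightarrow> U w (J v) = lin v" unfolding J_def by (rule G.quad_rep_jinv[OF w_spos lin_in])

lemma J_iso: "unital_order_iso S e T u J"
proof (unfold_locales)
  have jw: "G.spos (G.jinv w)" "G.jinv w \<in> T" using G.jinv_spos[OF w_spos] G.jinv_in[OF w_spos] by auto
  show "bij_betw J S T"
  proof (rule bij_betw_imageI)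
    show "inj_on J S"
    proof (rule inj_onI)
      fix x y assume "x \<in> S" "y \<in> S" "J x = J y"
      thus "x = y" using quad_rep_w_J[of x] quad_rep_w_J[of y] lin_bij by (auto simp: bij_betw_def inj_on_def)
    qed
    show "J ` S = T"
    proof
      show "T \<subseteq> J ` S"
      proof
        fix z assume z: "z \<in> T"
        have "U w z \<in> lin ` S" using lin_bij w_in z by (simp add: bij_betw_def)
        then obtain v where v: "v \<in> S" "U w z = lin v" by blast
        hence "J v = z" using G.quad_rep_jinv'[OF w_spos z] by (simp add: J_def)
        thus "z \<in> J ` S" using v(1) by blast
      qed
    qed (use jw lin_in in \<open>auto simp: J_def\<close>)
  qed
  show "J (x + y) = J x + J y" if "x \<in> S" "y \<in> S" for x y using that by (simp add: J_def lin_add quad_rep_add)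
  show "J (r *\<^sub>R x) = r *\<^sub>R J x" if "x \<in> S" for x r using that by (simp add: J_def lin_scaleR quad_rep_scaleR)
  show "J e = u" using G.quad_rep_jinv'[OF w_spos G.unit_in] w_in by (simp add: J_def w_square)
  show "J x \<in> G.K \<longleftrightarrow> x \<in> F.K" if "x \<in> S" for x
    using G.quad_rep_spos_le_iff[OF jw(1) G.zero_in lin_in[OF that]] lin_K[OF that] by (simp add: J_def)
qed

sublocale J: unital_order_iso S e T u J by (rule J_iso)

lemma f_spos:
  assumes x: "x \<in> I" "F.spos x"
  shows "f x = G.jinv (u + U w (G.jinv (J x) - u))"
proof -
  have jx: "F.jinv x \<in> S" "e \<preceq> F.jinv x" using F.jinv_in[OF x(2)] F.unit_le_jinv[OF x(2) I_D(2)[OF x(1)]] by auto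
  have "G.jinv (f x) = g (e + (F.jinv x - e))" by (simp add: g_def F.jinv_jinv[OF x(2)])
  also have "\<dots> = u + lin (F.jinv x - e)" using jx(2) by (intro g_lin) (simp add: F.le_iff)
  also have "lin (F.jinv x - e) = U w (J (F.jinv x - e))" using quad_rep_w_J jx by simp
  also have "J (F.jinv x - e) = G.jinv (J x) - u" using J.J_diff[OF jx(1) F.unit_in] J.J_jinv[OF x(2)] J.J_unit by simp
  finally show ?thesis using G.jinv_jinv[of "f x"] spos_f[OF x(1)] x(2) by simp
qed

theorem f_interval_map:
  shows "\<exists>t<1. \<exists>z. z \<in> jb_cone_interior T \<and> (\<exists>J. jordan_isomorphism S T J \<and>
    (\<forall>x\<in>jb_interval S 0 e. f x = interval_map u t z (J x)))"
proof -
  \<comment> \<open>Any \<open>t\<close> with \<open>2 (norm w)^2 \<le> 1 - t\<close> and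
    \<open>t < 1\<close> would serve; this one is never positive.\<close>
  define t where "t = - (2 * (norm w)\<^sup>2)"
  have t: "t < 1" "2 * (norm w)\<^sup>2 \<le> 1 - t" using zero_le_power2[of "norm w"] unfolding t_def by linarith+
  obtain z where z: "G.spos z" "\<And>a. G.spos a \<Longrightarrow> a \<sqsubseteq> u \<Longrightarrow>
      interval_map u t z a = G.jinv (u + U w (G.jinv a - u))" using G.interval_map_parameters[OF w_spos t(2,1)] by blast
  have sp: "f x = interval_map u t z (J x)" if x: "x \<in> I" "F.spos x" for x
    using f_spos[OF x] z(2)[OF J.spos_J[OF x(2)]] J.J_le[OF I_D(3)[OF x(1)] F.unit_in] I_D(2)[OF x(1)] J.J_unit by simp
  have "f x = interval_map u t z (J x)" if x: "x \<in> I" for x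
  proof -
    define r where "r n = 1 / real (Suc n)" for n
    have r: "0 < r n" "r n \<le> 1" for n by (simp_all add: r_def)
    \<comment> \<open>Invertible elements of the interval that decrease to \<open>x\<close>.\<close>
    define X where "X n = x + r n *\<^sub>R (e - x)" for n
    have exK: "e - x \<in> F.K" using I_D(2)[OF x] by (simp add: F.le_iff)
    have XS: "X n \<in> S" for n using I_D(3)[OF x] by (simp add: X_def)
    have Xmono: "X n \<preceq> X m" if "m \<le> n" for m n
      using F.le_scaleR_left[OF exK, of "r n" "r m"] that by (simp add: X_def F.le_iff r_def frac_le)
    have X0: "x \<preceq> X n" for n using F.K_scaleR[OF exK, of "r n"] r[of n] by (simp add: X_def F.le_iff)
    have Xe: "X n \<preceq> e" for n using Xmono[of 0 n] by (simp add: X_def r_def)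
    have XI: "X n \<in> I" for n using F.K_add[OF I_D(1)[OF x] F.K_scaleR[OF exK, of "r n"]] r[of n] Xe by (simp add: I_def X_def)
    have Xsp: "F.spos (X n)" for n
    proof (rule F.sposI[OF XS r(1)[of n]])
      have "(1 - r n) *\<^sub>R x \<in> F.K" using r(2)[of n] by (intro F.K_scaleR I_D(1)[OF x]) simp
      moreover have "X n - r n *\<^sub>R e = (1 - r n) *\<^sub>R x" by (simp add: X_def algebra_simps)
      ultimately show "r n *\<^sub>R e \<preceq> X n" by (simp add: F.le_iff)
    qed
    have Xlim: "X \<longlonglongrightarrow> x" unfolding X_def r_def by (rule tendsto_add_inverse_scaleR)
    have JK: "J (X n) \<in> G.K" "J (X n) \<sqsubseteq> u" for n
      using J.J_K[OF XS] I_D(1)[OF XI] J.J_le[OF XS F.unit_in] Xe J.J_unit by auto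
    have Jlim: "(\<lambda>n. J (X n)) \<longlonglongrightarrow> J x"
    proof (rule LIM_zero_cancel, rule Lim_null_comparison)
      show "\<forall>\<^sub>F n in sequentially. norm (J (X n) - J x) \<le> norm (X n - x)"
        using J.norm_J[OF F.diff_in[OF XS I_D(3)[OF x]]] J.J_diff[OF XS I_D(3)[OF x]] by simp
      show "(\<lambda>n. norm (X n - x)) \<longlonglongrightarrow> 0" using LIM_zero[OF Xlim] by (rule tendsto_norm_zero)
    qed
    define L where "L = interval_map u t z (J x)"
    have "(\<lambda>n. interval_map u t z (J (X n))) \<longlonglongrightarrow> L" unfolding L_def by (rule G.tendsto_interval_map[OF z(1) t(1) JK Jlim])
    hence fl: "(\<lambda>n. f (X n)) \<longlonglongrightarrow> L" using sp[OF XI Xsp] by simp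
    have fx: "f x \<sqsubseteq> L" by (rule G.le_limit[OF _ tendsto_const fl]) (use f_le_iff[OF x XI] X0 in blast)
    have Lf: "L \<sqsubseteq> f (X n)" for n
    proof (rule G.le_limit[OF _ LIMSEQ_ignore_initial_segment[OF fl, of n] tendsto_const])
      show "f (X (m + n)) \<sqsubseteq> f (X n)" for m using f_le_iff[OF XI XI] Xmono[of n "m + n"] by simp
    qed
    have "L - f x \<in> G.K" using fx by (simp add: G.le_iff)
    from G.K_add[OF this I'_D(1)[OF f_in[OF x]]] have "L \<in> G.K" by simp
    hence "L \<in> I'" using I'_down[OF f_in[OF XI[of 0]] _ Lf[of 0]] by blast
    \<comment> \<open>No continuity of \<open>f\<close> is available. Instead the preimage
      \<open>x'\<close> of the limit \<open>L\<close> lies below every \<open>X n\<close>, hence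
      below \<open>x\<close>.\<close>
    then obtain x' where x': "x' \<in> I" "f x' = L" using f_surj by blast
    have "x' \<preceq> X n" for n using f_le_iff[OF x'(1) XI] Lf x'(2) by simp
    hence "x' \<preceq> x" by (rule F.le_limit[OF _ tendsto_const Xlim])
    hence "L \<sqsubseteq> f x" using f_le_iff[OF x'(1) x] x'(2) by simp
    thus ?thesis using fx G.le_antisym unfolding L_def by blast
  qed
  hence "jordan_isomorphism S T J \<and> (\<forall>x\<in>jb_interval S 0 e. f x = interval_map u t z (J x))"
    using J.jordan by (simp add: I_eq)
  thus ?thesis using t(1) G.cone_interior_spos[OF z(1)] by blast
qed

end

section \<open>Central projections\<close>

context jb_unital
begin

definition central :: "'a \<Rightarrow> bool" where
  "central c \<longleftrightarrow> proj c \<and> c \<in> jb_centre S"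

definition corner :: "'a \<Rightarrow> 'a set" where "corner c = {x \<in> S. c \<cdot> x = x}"

lemma central_proj: "central c \<Longrightarrow> proj c" and central_in: "central c \<Longrightarrow> c \<in> S" by (auto simp: central_def proj_in)

lemma corner_unit: "corner e = S" by (auto simp: corner_def)

lemma central_assoc: "central c \<Longrightarrow> x \<in> S \<Longrightarrow> y \<in> S \<Longrightarrow> c \<cdot> (x \<cdot> y) = x \<cdot> (c \<cdot> y)" by (simp add: central_def jb_centre_def)

lemma central_assoc': "central c \<Longrightarrow> x \<in> S \<Longrightarrow> y \<in> S \<Longrightarrow> c \<cdot> (x \<cdot> y) = (c \<cdot> x) \<cdot> y"
  using central_assoc[of c y x] by (simp add: jprod_commute[of _ y])

lemma central_idem: "central c \<Longrightarrow> x \<in> S \<Longrightarrow> c \<cdot> (c \<cdot> x) = c \<cdot> x"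
  using central_assoc'[of c c x] central_proj[of c] by (simp add: proj_in proj_idem)

lemma central_mult: "central c \<Longrightarrow> x \<in> S \<Longrightarrow> y \<in> S \<Longrightarrow> c \<cdot> (x \<cdot> y) = (c \<cdot> x) \<cdot> (c \<cdot> y)"
  using central_assoc'[of c x "c \<cdot> y"] central_assoc[of c x y] central_idem[of c "x \<cdot> y"] central_proj[of c]
  by (simp add: proj_in)

lemma quad_rep_central: "central c \<Longrightarrow> x \<in> S \<Longrightarrow> U c x = c \<cdot> x"
  by (simp add: quad_rep_def central_idem scaleR_2 proj_idem[OF central_proj])

lemma central_K: "central c \<Longrightarrow> x \<in> K \<Longrightarrow> c \<cdot> x \<in> K"
  using quad_rep_K[of c x] quad_rep_central[of c x] K_subset[of x] central_in[of c] by simp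

lemma central_mono: "central c \<Longrightarrow> x \<in> S \<Longrightarrow> y \<in> S \<Longrightarrow> x \<preceq> y \<Longrightarrow> c \<cdot> x \<preceq> c \<cdot> y"
  using central_K[of c "y - x"] by (simp add: le_iff jbilin)

lemma central_compl: "central c \<Longrightarrow> central (e - c)"
  using proj_compl[of c] by (auto simp: central_def jb_centre_def jbilin)

lemma central_le: "central c \<Longrightarrow> x \<in> K \<Longrightarrow> c \<cdot> x \<preceq> x"
  using central_K[OF central_compl, of c x] K_subset[of x] by (simp add: le_iff jbilin)

lemma central_image: "central c \<Longrightarrow> (\<lambda>x. c \<cdot> x) ` S = corner c"
  unfolding corner_def by (auto simp: central_idem central_in image_iff) (metis)

lemma cornerD: "x \<in> corner c \<Longrightarrow> x \<in> S" "x \<in> corner c \<Longrightarrow> c \<cdot> x = x" by (auto simp: corner_def)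

lemma subspace_corner: "subspace (corner c)" by (rule subspaceI) (auto simp: corner_def jbilin jprod.zero_right)

lemma corner_unital:
  assumes c: "central c"
  shows "jb_unital (corner c) c"
proof
  have "closed {x. c \<cdot> x = x}" by (intro closed_Collect_eq continuous_intros) (simp add: jprod.continuous_on continuous_on_id)
  hence "closed (S \<inter> {x. c \<cdot> x = x})" using closed_carrier by (rule closed_Int[rotated])
  moreover have "corner c = S \<inter> {x. c \<cdot> x = x}" by (auto simp: corner_def)
  ultimately show "jb_subalgebra (corner c)"
    unfolding jb_subalgebra_def using subspace_corner[of c] central_mult[OF c] by (auto simp: corner_def)
  show "is_jb_unit (corner c) c" using central_proj[OF c] by (auto simp: is_jb_unit_def corner_def proj_in proj_idem)
qed

lemma corner_K:
  assumes c: "central c"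
  shows "x \<in> jb_cone (corner c) \<longleftrightarrow> x \<in> K \<and> c \<cdot> x = x"
proof
  assume "x \<in> jb_cone (corner c)"
  then obtain y where y: "x = y \<cdot> y" "y \<in> corner c" by (auto simp: jb_cone_def)
  thus "x \<in> K \<and> c \<cdot> x = x" using central_mult[OF c, of y y] cornerD[of y c] by auto
next
  assume x: "x \<in> K \<and> c \<cdot> x = x"
  then obtain y where y: "x = y \<cdot> y" "y \<in> S" by (auto simp: jb_cone_def)
  hence "x = (c \<cdot> y) \<cdot> (c \<cdot> y)" using x central_mult[OF c] by simp
  moreover have "c \<cdot> y \<in> corner c" using central_image[OF c] y(2) by blast
  ultimately show "x \<in> jb_cone (corner c)" unfolding jb_cone_def by blast
qed

lemma corner_le: "central c \<Longrightarrow> x \<in> corner c \<Longrightarrow> y \<in> corner c \<Longrightarrow> jb_le (corner c) x y \<longleftrightarrow> x \<preceq> y"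
  using corner_K[of c "y - x"] by (auto simp: jb_le_def corner_def jbilin)

lemma le_central_corner: "central c \<Longrightarrow> x \<in> K \<Longrightarrow> x \<preceq> c \<Longrightarrow> x \<in> corner c"
  using le_proj_face(1)[OF central_proj, of c x 1] K_subset[of x] by (simp add: corner_def)

lemma corner_proj: "jb_projection (corner c) p \<longleftrightarrow> proj p \<and> c \<cdot> p = p" by (auto simp: jb_projection_def corner_def)

lemma proj_le_central: "central c \<Longrightarrow> proj p \<Longrightarrow> proj q \<Longrightarrow> p \<preceq> q \<Longrightarrow> c \<cdot> q = q \<Longrightarrow> c \<cdot> p = p"
  using proj_le_iff[of p q] central_assoc'[of c q p] proj_in[of p] proj_in[of q] by auto

lemma corner_atom:
  assumes c: "central c"
  shows "jb_atom (corner c) p \<longleftrightarrow> jb_atom S p \<and> c \<cdot> p = p"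
proof -
  have "proj q \<and> c \<cdot> q = q \<and> jb_le (corner c) q p \<longleftrightarrow> proj q \<and> q \<preceq> p" if p: "proj p" "c \<cdot> p = p" for q
  proof (cases "proj q \<and> c \<cdot> q = q")
    case True
    thus ?thesis using corner_le[OF c, of q p] p proj_in[of p] proj_in[of q] by (auto simp: corner_def)
  next
    case False
    thus ?thesis using proj_le_central[OF c _ p(1) _ p(2), of q] by blast
  qed
  thus ?thesis unfolding jb_atom_def corner_proj by metis
qed

text \<open>The hypothesis says that no \<open>x\<close> has a Peirce 1/2-part; with the two
  remaining parts \<open>c\<close> operator commutes by \<open>proj_opcomm\<close>.\<close>

lemma is_jb_centralI:
  assumes c: "proj c" and x: "\<And>x. x \<in> S \<Longrightarrow> x = U c x + U (e - c) x"
  shows "central c"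
proof -
  have c': "proj (e - c)" by (rule proj_compl[OF c])
  have "c \<cdot> (x \<cdot> z) = x \<cdot> (c \<cdot> z)" if xz: "x \<in> S" "z \<in> S" for x z
  proof -
    have S: "U c x \<in> S" "U (e - c) x \<in> S" using xz proj_in[OF c] by auto
    have 1: "c \<cdot> (U c x \<cdot> z) = U c x \<cdot> (c \<cdot> z)"
      by (rule proj_opcomm[OF c S(1) _ xz(2)]) (simp add: jprod_quad_rep_proj c xz)
    have "(e - c) \<cdot> U (e - c) x = U (e - c) x" by (rule jprod_quad_rep_proj[OF c' xz(1)])
    hence "c \<cdot> U (e - c) x = 0" using S(2) by (simp add: jbilin)
    hence 2: "c \<cdot> (U (e - c) x \<cdot> z) = U (e - c) x \<cdot> (c \<cdot> z)" by (intro proj_opcomm[OF c S(2) _ xz(2)]) simp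
    have "c \<cdot> ((U c x + U (e - c) x) \<cdot> z) = (U c x + U (e - c) x) \<cdot> (c \<cdot> z)"
      using 1 2 by (simp add: jprod.add_left jprod.add_right)
    thus ?thesis using x[OF xz(1)] by simp
  qed
  thus ?thesis using c proj_in[OF c] by (auto simp: central_def jb_centre_def)
qed

end

context jbw
begin

text \<open>The order description of the unit ball shows that \<open>S\<close> is the M-sum of the
  corners of \<open>c\<close> and \<open>e - c\<close>, so \<open>dual_banach_space_summand\<close>
  applies.\<close>

lemma corner_dual:
  assumes c: "central c"
  shows "dual_banach_space (corner c)"
proof -
  obtain V n \<Phi> where "dual_rep S V n \<Phi>" using dual_banach_space_rep[OF subspace_carrier dual] by blast
  then interpret R: dual_rep S V n \<Phi> .
  have cS: "c \<in> S" and cp: "proj c" using c central_in central_proj by auto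
  show ?thesis
  proof (rule R.dual_banach_space_summand)
    note cc = central_compl[OF c]
    show "corner c \<subseteq> S" "corner (e - c) \<subseteq> S" by (auto simp: corner_def)
    show "subspace (corner c)" "subspace (corner (e - c))" by (rule subspace_corner)+
    show "\<exists>y\<in>corner c. \<exists>z\<in>corner (e - c). x = y + z" if x: "x \<in> S" for x
      using central_idem[OF c x] central_idem[OF cc x] x cS
      by (intro bexI[of _ "c \<cdot> x"] bexI[of _ "(e - c) \<cdot> x"]) (auto simp: corner_def jprod.diff_left)
    have n: "norm x \<le> 1 \<longleftrightarrow> - e \<preceq> x \<and> x \<preceq> e" if "x \<in> S" for x using norm_le_iff[OF that, of 1] by simp
    have b: "- d \<preceq> x \<and> x \<preceq> d" if "central d" "x \<in> corner d" "norm x \<le> 1" for d x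
      using central_mono[OF that(1), of x e] central_mono[OF that(1), of "- e" x] that n[of x] central_in[OF that(1)]
      by (auto simp: corner_def jbilin jprod_commute[of d e])
    fix y z assume yz: "y \<in> corner c" "z \<in> corner (e - c)"
    hence S: "y \<in> S" "z \<in> S" by (auto simp: corner_def)
    show "norm (y + z) \<le> 1" if "norm y \<le> 1" "norm z \<le> 1"
      using b[OF c yz(1) that(1)] b[OF cc yz(2) that(2)] le_add_mono[of "- c" y "- (e - c)" z] le_add_mono[of y c z "e - c"]
        n[of "y + z"] S by simp
    have "(e - c) \<cdot> y = 0" "(e - c) \<cdot> z = z" using yz cS by (auto simp: corner_def jprod.diff_left)
    hence "norm z = norm ((e - c) \<cdot> (y + z))" by (simp add: jprod.add_right)
    also have "\<dots> \<le> norm (e - c) * norm (y + z)" by (rule norm_jprod_le)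
    also have "\<dots> \<le> 1 * norm (y + z)" by (rule mult_right_mono) (use norm_proj[OF central_proj[OF cc]] in force)+
    finally show "norm z \<le> norm (y + z)" by simp
  qed
qed

end

context jbw_atomic
begin

lemma corner_jbw_atomic:
  assumes c: "central c"
  shows "jbw_atomic (corner c) c"
proof -
  have "\<exists>p. jb_atom (corner c) p \<and> jb_le (corner c) p q" if q: "proj q" "c \<cdot> q = q" "q \<noteq> 0" for q
  proof -
    obtain p where p: "atom p" "p \<preceq> q" using proj_dominates_atom[OF q(1,3)] by blast
    have "c \<cdot> p = p" by (rule proj_le_central[OF c atom_proj[OF p(1)] q(1) p(2) q(2)])
    hence "jb_atom (corner c) p" "p \<in> corner c" "q \<in> corner c"
      using corner_atom[OF c, of p] p(1) atom_in[OF p(1)] proj_in[OF q(1)] q(2) by (auto simp: corner_def)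
    thus ?thesis using corner_le[OF c, of p q] p(2) by blast
  qed
  hence "jb_atomic (corner c)" by (simp add: jb_atomic_def corner_proj)
  thus ?thesis
    by (intro jbw_atomic.intro jbw.intro jbw_axioms.intro jbw_atomic_axioms.intro corner_unital corner_dual c)
qed

text \<open>Coefficients at atoms below \<open>c\<close> or below \<open>e - c\<close> do not see
  the Peirce 1/2-part. As every atom is of one of these kinds, \<open>x\<close> and
  \<open>U c x + U (e - c) x\<close> have the same coefficients.\<close>

lemma central_if_atoms:
  assumes c: "proj c" and a: "\<And>p. atom p \<Longrightarrow> c \<cdot> p = p \<or> c \<cdot> p = 0"
  shows "central c"
proof (rule is_jb_centralI[OF c])
  fix x assume x: "x \<in> S"
  have *: "\<tau> p (U b x) = \<tau> p x \<and> \<tau> p (U (e - b) x) = 0" if b: "proj b" and p: "atom p" "b \<cdot> p = p" for b p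
  proof -
    have S: "b \<in> S" "p \<in> S" "e - b \<in> S" using proj_in[OF b] atom_in[OF p(1)] by auto
    have bp: "U b p = p" using quad_rep_proj_iff[OF b S(2)] p(2) by blast
    have eq: "\<tau> p y = \<tau> p (U b y)" if y: "y \<in> S" for y
    proof (rule \<tau>_eqI[OF p(1) y])
      have "U p y = U (U b p) y" by (simp add: bp)
      also have "\<dots> = U b (\<tau> p (U b y) *\<^sub>R p)" unfolding fundamental_formula using quad_rep_atom[OF p(1)] S y by simp
      finally show "U p y = \<tau> p (U b y) *\<^sub>R p" by (simp add: quad_rep_scaleR bp)
    qed
    have be: "b \<cdot> (e - b) = 0" using proj_compl_jprod(2)[OF b] .
    have "e - b \<in> gen b" using gen_proj_mem[OF b, of 0 1] by simp
    hence "U b (U (e - b) x) = 0" using gen_quad_rep[OF S(1) gen_self[OF S(1)] _ x, of "e - b"] be by simp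
    thus ?thesis using eq[OF x] eq[of "U (e - b) x"] S x \<tau>_zero[OF p(1)] by simp
  qed
  have cS: "c \<in> S" by (rule proj_in[OF c])
  show "x = U c x + U (e - c) x"
  proof (subst eq_iff_\<tau>)
    show "\<forall>p. atom p \<longrightarrow> \<tau> p x = \<tau> p (U c x + U (e - c) x)"
    proof (intro allI impI)
      fix p assume p: "atom p"
      have "\<tau> p (U c x + U (e - c) x) = \<tau> p (U c x) + \<tau> p (U (e - c) x)" using cS x by (intro \<tau>_add p) auto
      thus "\<tau> p x = \<tau> p (U c x + U (e - c) x)"
        using a[OF p] *[OF c p] *[OF proj_compl[OF c] p] atom_in[OF p] by (auto simp: jbilin)
    qed
  qed (use x cS in auto)
qed

lemma \<tau>_central: "central c \<Longrightarrow> atom p \<Longrightarrow> c \<cdot> p = p \<Longrightarrow> x \<in> S \<Longrightarrow> \<tau> p (c \<cdot> x) = \<tau> p x"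
proof (rule \<tau>_eqI)
  assume c: "central c" and p: "atom p" "c \<cdot> p = p" and x: "x \<in> S"
  have S: "c \<in> S" "p \<in> S" using c p central_in atom_in by auto
  have "c \<cdot> (p \<cdot> x) = p \<cdot> x" using central_assoc'[OF c S(2) x] p(2) by simp
  moreover have "p \<cdot> (c \<cdot> x) = c \<cdot> (p \<cdot> x)" using central_assoc[OF c S(2) x] by simp
  ultimately have "U p (c \<cdot> x) = U p x" by (simp add: quad_rep_def proj_idem[OF atom_proj[OF p(1)]])
  thus "U p (c \<cdot> x) = \<tau> p x *\<^sub>R p" using quad_rep_atom[OF p(1) x] by simp
qed (simp_all add: central_in)

lemma abs_\<tau>_le: "atom p \<Longrightarrow> x \<in> S \<Longrightarrow> \<bar>\<tau> p x\<bar> \<le> norm x"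
  using \<tau>_mono[of p x "norm x *\<^sub>R e"] \<tau>_mono[of p "(- norm x) *\<^sub>R e" x] le_norm[of x "norm x"] le_norm'[of x "norm x"]
    \<tau>_scaleR[of p e "- norm x"] by (simp add: \<tau>_scaleR \<tau>_unit abs_le_iff)

lemma norm_le_iff_\<tau>: "x \<in> S \<Longrightarrow> 0 \<le> B \<Longrightarrow> norm x \<le> B \<longleftrightarrow> (\<forall>p. atom p \<longrightarrow> \<bar>\<tau> p x\<bar> \<le> B)"
proof
  assume x: "x \<in> S" "0 \<le> B" "\<forall>p. atom p \<longrightarrow> \<bar>\<tau> p x\<bar> \<le> B"
  have "(- B) *\<^sub>R e \<preceq> x \<and> x \<preceq> B *\<^sub>R e"
    using x le_iff_\<tau>[of "(- B) *\<^sub>R e" x] le_iff_\<tau>[of x "B *\<^sub>R e"] \<tau>_scaleR[of _ e "- B"] 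
    by (auto simp: \<tau>_scaleR \<tau>_unit abs_le_iff)
  thus "norm x \<le> B" using norm_le_iff[OF x(1,2)] by simp
qed (use abs_\<tau>_le order_trans in blast)

text \<open>The main point is surjectivity: a bounded family is glued as the supremum of finite
  sums. The norm is computed from coefficients at atoms, each of which lies below some
  \<open>c i\<close>.\<close>

theorem direct_sum_corners:
  assumes c: "\<And>i. i \<in> A \<Longrightarrow> central (c i)"
    and orth: "\<And>i j. i \<in> A \<Longrightarrow> j \<in> A \<Longrightarrow> i \<noteq> j \<Longrightarrow> c i \<cdot> c j = 0"
    and cover: "\<And>p. atom p \<Longrightarrow> \<exists>i\<in>A. c i \<cdot> p = p"
  shows "is_direct_sum S A (\<lambda>i. corner (c i)) (\<lambda>i x. c i \<cdot> x)"
proof -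
  have cS: "c i \<in> S" if "i \<in> A" for i using central_in[OF c[OF that]] .
  have cK: "c i \<in> K" if "i \<in> A" for i using proj_K[OF central_proj[OF c[OF that]]] .
  have other: "c j \<cdot> x = (if j = i then x else 0)" if "i \<in> A" "j \<in> A" "x \<in> corner (c i)" for i j x
  proof (cases "j = i")
    case False
    have "c j \<cdot> (c i \<cdot> x) = (c j \<cdot> c i) \<cdot> x" using that by (intro central_assoc' c cS cornerD(1))
    thus ?thesis using cornerD(2)[OF that(3)] orth[OF that(2,1) False] False by (simp add: jprod.zero_left)
  qed (use cornerD(2)[OF that(3)] in simp)
  have in_corner: "c i \<cdot> x \<in> corner (c i)" if "i \<in> A" "x \<in> S" for i x
    using central_image[OF c[OF that(1)]] that(2) by blast
  have norm_c: "norm (c i \<cdot> x) \<le> norm x" if "i \<in> A" for i x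
  proof -
    have "norm (c i) \<le> 1" using norm_proj[OF central_proj[OF c[OF that]]] by (cases "c i = 0") auto
    hence "norm (c i) * norm x \<le> 1 * norm x" by (intro mult_right_mono) auto
    thus ?thesis using norm_jprod_le[of "c i" x] by simp
  qed
  have norm_iff: "norm x \<le> B \<longleftrightarrow> (\<forall>i\<in>A. norm (c i \<cdot> x) \<le> B)" if x: "x \<in> S" "0 \<le> B" for x B
  proof
    assume n: "\<forall>i\<in>A. norm (c i \<cdot> x) \<le> B"
    have "\<bar>\<tau> p x\<bar> \<le> B" if p: "atom p" for p
    proof -
      obtain i where i: "i \<in> A" "c i \<cdot> p = p" using cover[OF p] by blast
      have "\<bar>\<tau> p (c i \<cdot> x)\<bar> \<le> norm (c i \<cdot> x)" using abs_\<tau>_le[OF p] cS[OF i(1)] x(1) by simp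
      thus ?thesis using n i \<tau>_central[OF c[OF i(1)] p i(2) x(1)] by force
    qed
    thus "norm x \<le> B" using norm_le_iff_\<tau>[OF x] by blast
  qed (use norm_c order_trans in blast)
  have surj: "\<exists>x\<in>S. \<forall>i\<in>A. c i \<cdot> x = y i" if y: "\<And>i. i \<in> A \<Longrightarrow> y i \<in> corner (c i)" and b: "bounded (y ` A)" for y
  proof -
    obtain B where B: "0 \<le> B" "\<And>i. i \<in> A \<Longrightarrow> norm (y i) \<le> B" using b by (auto simp: bounded_pos intro: less_imp_le)
    \<comment> \<open>The shift by the common bound makes the summands positive, so that the finite
      sums form an increasing family.\<close>
    define z where "z i = y i + B *\<^sub>R c i" for i
    have zi: "z i \<in> K" "z i \<preceq> (2 * B) *\<^sub>R c i" "z i \<in> corner (c i)" if i: "i \<in> A" for i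
    proof -
      note yi = cornerD[OF y[OF i]] and ci = c[OF i] and ciS = cS[OF i]
      have "- (B *\<^sub>R e) \<preceq> y i" "y i \<preceq> B *\<^sub>R e" using le_norm[OF yi(1) B(2)[OF i]] le_norm'[OF yi(1) B(2)[OF i]] by auto
      hence "c i \<cdot> (- (B *\<^sub>R e)) \<preceq> c i \<cdot> y i" "c i \<cdot> y i \<preceq> c i \<cdot> (B *\<^sub>R e)"
        using yi(1) by (intro central_mono ci; simp)+
      hence *: "- (B *\<^sub>R c i) \<preceq> y i" "y i \<preceq> B *\<^sub>R c i" using yi ciS by (simp_all add: jbilin)
      have "(2 * B) *\<^sub>R c i = B *\<^sub>R c i + B *\<^sub>R c i" by (metis mult_2 scaleR_add_left)
      hence eq: "(2 * B) *\<^sub>R c i - z i = B *\<^sub>R c i - y i" by (simp add: z_def)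
      show "z i \<in> K" using *(1) by (simp add: z_def le_iff)
      show "z i \<preceq> (2 * B) *\<^sub>R c i" using *(2) unfolding le_iff eq .
      show "z i \<in> corner (c i)" using yi ciS proj_idem[OF central_proj[OF ci]] by (simp add: z_def corner_def jbilin)
    qed
    define Z where "Z G = sum z G" for G
    define \<G> where "\<G> = {G. finite G \<and> G \<subseteq> A}"
    have ZK: "Z G \<in> K" if "G \<in> \<G>" for G using that zi(1) unfolding Z_def \<G>_def by (intro K_sum) auto
    have cZ: "c j \<cdot> Z G = (if j \<in> G then z j else 0)" if "G \<in> \<G>" "j \<in> A" for G j
    proof -
      have "c j \<cdot> Z G = (\<Sum>i\<in>G. c j \<cdot> z i)" unfolding Z_def by (rule jprod.sum_right)
      also have "\<dots> = (\<Sum>i\<in>G. if i = j then z i else 0)"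
        using that other[OF _ that(2) zi(3)] by (intro sum.cong) (auto simp: \<G>_def)
      finally show ?thesis using that by (simp add: \<G>_def sum.delta')
    qed
    have Zmono: "Z G \<preceq> Z H" if "G \<subseteq> H" "H \<in> \<G>" for G H
    proof -
      have "Z H - Z G = sum z (H - G)" using that by (auto simp: Z_def \<G>_def sum_diff)
      thus ?thesis using that zi(1) by (auto simp: le_iff \<G>_def intro!: K_sum)
    qed
    have Zle: "Z G \<preceq> (2 * B) *\<^sub>R e" if G: "G \<in> \<G>" for G
    proof (subst le_iff_\<tau>)
      show "\<forall>p. atom p \<longrightarrow> \<tau> p (Z G) \<le> \<tau> p ((2 * B) *\<^sub>R e)"
      proof (intro allI impI)
        fix p assume p: "atom p"
        then obtain i where i: "i \<in> A" "c i \<cdot> p = p" using cover by blast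
        have "c i \<cdot> Z G \<preceq> (2 * B) *\<^sub>R c i"
          using cZ[OF G i(1)] zi(2)[OF i(1)] K_scaleR[OF cK[OF i(1)], of "2 * B"] B(1) by auto
        also have "(2 * B) *\<^sub>R c i \<preceq> (2 * B) *\<^sub>R e" using B(1) proj_le_unit[OF central_proj[OF c[OF i(1)]]] by (intro le_scaleR_mono) auto
        finally have "\<tau> p (c i \<cdot> Z G) \<le> \<tau> p ((2 * B) *\<^sub>R e)"
          using cS[OF i(1)] K_subset[OF ZK[OF G]] by (intro \<tau>_mono p) auto
        thus "\<tau> p (Z G) \<le> \<tau> p ((2 * B) *\<^sub>R e)" using \<tau>_central[OF c[OF i(1)] p i(2)] K_subset[OF ZK[OF G]] by simp
      qed
    qed (use K_subset[OF ZK[OF G]] in auto)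
    obtain x where x: "is_lub (Z ` \<G>) x"
    proof (rule exE[OF lub_exists[of "Z ` \<G>" "(2 * B) *\<^sub>R e"]])
      show "\<exists>v\<in>Z ` \<G>. a \<preceq> v \<and> b \<preceq> v" if ab: "a \<in> Z ` \<G>" "b \<in> Z ` \<G>" for a b
      proof -
        obtain G H where GH: "G \<in> \<G>" "a = Z G" "H \<in> \<G>" "b = Z H" using ab by blast
        have "G \<union> H \<in> \<G>" using GH by (auto simp: \<G>_def)
        thus ?thesis using Zmono[of G "G \<union> H"] Zmono[of H "G \<union> H"] GH by blast
      qed
      show "Z ` \<G> \<subseteq> S" using ZK K_subset by blast
      show "Z ` \<G> \<noteq> {}" by (auto simp: \<G>_def)
    qed (use Zle in auto)
    have xS: "x \<in> S" and ub: "\<And>G. G \<in> \<G> \<Longrightarrow> Z G \<preceq> x" and least: "\<And>v. v \<in> S \<Longrightarrow> (\<And>G. G \<in> \<G> \<Longrightarrow> Z G \<preceq> v) \<Longrightarrow> x \<preceq> v"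
      using x by (auto simp: is_lub_def)
    have "c j \<cdot> (x - B *\<^sub>R e) = y j" if j: "j \<in> A" for j
    proof -
      note cj = c[OF j] and cjS = cS[OF j]
      have zjS: "z j \<in> S" using K_subset zi(1)[OF j] by blast
      have cz: "c j \<cdot> z j = z j" using cornerD(2)[OF zi(3)[OF j]] .
      have "Z {j} \<preceq> x" by (rule ub) (use j in \<open>simp add: \<G>_def\<close>)
      hence 1: "z j \<preceq> c j \<cdot> x" using central_mono[OF cj zjS xS] cz by (simp add: Z_def)
      \<comment> \<open>The right side is again an upper bound of the finite sums, so leastness of
        \<open>x\<close> bounds its component at \<open>j\<close> by \<open>z j\<close>.\<close>
      have "x \<preceq> z j + (e - c j) \<cdot> x"
      proof (rule least)
        fix G assume G: "G \<in> \<G>"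
        have ZS: "Z G \<in> S" using K_subset ZK[OF G] by blast
        have "Z G = c j \<cdot> Z G + (e - c j) \<cdot> Z G" using ZS by (simp add: jbilin)
        moreover have "c j \<cdot> Z G \<preceq> z j" using cZ[OF G j] zi(1)[OF j] by simp
        moreover have "(e - c j) \<cdot> Z G \<preceq> (e - c j) \<cdot> x" by (rule central_mono[OF central_compl[OF cj] ZS xS ub[OF G]])
        ultimately show "Z G \<preceq> z j + (e - c j) \<cdot> x" using le_add_mono by metis
      qed (use zjS cjS xS in auto)
      hence "c j \<cdot> x \<preceq> c j \<cdot> (z j + (e - c j) \<cdot> x)" using zjS cjS xS by (intro central_mono[OF cj]) auto
      also have "\<dots> = z j" using cz central_idem[OF cj xS] xS by (simp add: jbilin)
      finally have "c j \<cdot> x = z j" using 1 le_antisym by blast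
      thus ?thesis using cjS by (simp add: z_def jbilin)
    qed
    thus ?thesis using xS by (intro bexI[of _ "x - B *\<^sub>R e"]) auto
  qed
  have "bij_betw (\<lambda>x. \<lambda>i\<in>A. c i \<cdot> x) S {y \<in> Pi\<^sub>E A (\<lambda>i. corner (c i)). bounded (y ` A)}"
  proof (rule bij_betw_imageI)
    show "inj_on (\<lambda>x. \<lambda>i\<in>A. c i \<cdot> x) S"
    proof (rule inj_onI)
      fix x y assume xy: "x \<in> S" "y \<in> S" "(\<lambda>i\<in>A. c i \<cdot> x) = (\<lambda>i\<in>A. c i \<cdot> y)"
      hence "c i \<cdot> x = c i \<cdot> y" if "i \<in> A" for i using that by (metis restrict_apply')
      hence "norm (x - y) \<le> 0" using norm_iff[of "x - y" 0] xy by (simp add: jbilin)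
      thus "x = y" by simp
    qed
    show "(\<lambda>x. \<lambda>i\<in>A. c i \<cdot> x) ` S = {y \<in> Pi\<^sub>E A (\<lambda>i. corner (c i)). bounded (y ` A)}"
    proof
      have "bounded ((\<lambda>i\<in>A. c i \<cdot> x) ` A)" for x using norm_c by (auto simp: bounded_iff intro!: exI[of _ "norm x"])
      moreover have "(\<lambda>i\<in>A. c i \<cdot> x) \<in> Pi\<^sub>E A (\<lambda>i. corner (c i))" if "x \<in> S" for x
        by (rule restrict_PiE_iff[THEN iffD2]) (use in_corner that in blast)
      ultimately show "(\<lambda>x. \<lambda>i\<in>A. c i \<cdot> x) ` S \<subseteq> {y \<in> Pi\<^sub>E A (\<lambda>i. corner (c i)). bounded (y ` A)}"
        by (intro image_subsetI CollectI conjI)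
      show "{y \<in> Pi\<^sub>E A (\<lambda>i. corner (c i)). bounded (y ` A)} \<subseteq> (\<lambda>x. \<lambda>i\<in>A. c i \<cdot> x) ` S"
      proof
        fix y assume "y \<in> {y \<in> Pi\<^sub>E A (\<lambda>i. corner (c i)). bounded (y ` A)}"
        hence y: "y \<in> Pi\<^sub>E A (\<lambda>i. corner (c i))" "bounded (y ` A)" by auto
        obtain x where x: "x \<in> S" "\<forall>i\<in>A. c i \<cdot> x = y i" using surj[of y] y by blast
        have "(\<lambda>i\<in>A. c i \<cdot> x) = y" using x(2) y(1) by (intro PiE_ext[of _ A "\<lambda>_. UNIV"]) (auto simp: PiE_def)
        thus "y \<in> (\<lambda>x. \<lambda>i\<in>A. c i \<cdot> x) ` S" using x(1) by blast
      qed
    qed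
  qed
  thus ?thesis unfolding is_direct_sum_def
    using other norm_iff central_mult[OF c] jb_unital.subalgebra[OF corner_unital[OF c]]
    by (intro conjI ballI allI impI subsetI) (simp_all add: jprod.add_right jprod.scaleR_right cornerD(1))
qed

end

section \<open>Suprema of sets of atoms and the classes\<close>

context jbw_atomic
begin

lemma asup_exists:
  assumes X: "X \<subseteq> Collect atom"
  shows "\<exists>r. is_lub ((\<lambda>G. rng (\<Sum>G)) ` {G. finite G \<and> G \<subseteq> X}) r"
proof (rule lub_exists)
  let ?\<G> = "{G. finite G \<and> G \<subseteq> X}"
  have K: "\<Sum>G \<in> K" if "G \<in> ?\<G>" for G using that X atom_K by (intro K_sum) auto
  have P: "proj (rng (\<Sum>G))" if "G \<in> ?\<G>" for G using proj_spr K_subset[OF K[OF that]] by blast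
  show "(\<lambda>G. rng (\<Sum>G)) ` ?\<G> \<subseteq> S" using P proj_in by blast
  show "(\<lambda>G. rng (\<Sum>G)) ` ?\<G> \<noteq> {}" by blast
  show "d \<preceq> e" if d: "d \<in> (\<lambda>G. rng (\<Sum>G)) ` ?\<G>" for d using d P proj_le_unit by blast
  fix x y assume "x \<in> (\<lambda>G. rng (\<Sum>G)) ` ?\<G>" "y \<in> (\<lambda>G. rng (\<Sum>G)) ` ?\<G>"
  then obtain G H where GH: "G \<in> ?\<G>" "x = rng (\<Sum>G)" "H \<in> ?\<G>" "y = rng (\<Sum>H)" by blast
  have U: "G \<union> H \<in> ?\<G>" using GH by blast
  have "rng (\<Sum>B) \<preceq> rng (\<Sum>(G \<union> H))" if B: "B \<in> ?\<G>" "B \<subseteq> G \<union> H" for B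
  proof (rule rng_mono[OF K[OF B(1)] K[OF U]])
    have fin: "finite (G \<union> H)" using U by blast
    have "\<Sum>(G \<union> H) - \<Sum>B = \<Sum>(G \<union> H - B)" using B(2) fin sum_diff by metis
    moreover have "\<Sum>(G \<union> H - B) \<in> K" using U by (intro K) blast
    ultimately show "\<Sum>B \<preceq> \<Sum>(G \<union> H)" by (simp add: le_iff)
  qed
  thus "\<exists>z\<in>(\<lambda>G. rng (\<Sum>G)) ` ?\<G>. x \<preceq> z \<and> y \<preceq> z" using GH U by blast
qed (rule unit_in)

text \<open>The join of a set of atoms. Joins of finite subsets are range projections of sums, and
  these form a directed family.\<close>

definition asup :: "'a set \<Rightarrow> 'a" where
  "asup X = (SOME r. is_lub ((\<lambda>G. rng (\<Sum>G)) ` {G. finite G \<and> G \<subseteq> X}) r)"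

lemma asup_lub: "X \<subseteq> Collect atom \<Longrightarrow> is_lub ((\<lambda>G. rng (\<Sum>G)) ` {G. finite G \<and> G \<subseteq> X}) (asup X)"
  unfolding asup_def by (rule someI_ex[OF asup_exists])

lemma asup_rng:
  assumes X: "X \<subseteq> Collect atom" and G: "finite G" "G \<subseteq> X"
  shows "proj (rng (\<Sum>G))" "rng (\<Sum>G) \<preceq> asup X"
proof -
  have "\<Sum>G \<in> K" using G X atom_K by (intro K_sum) auto
  thus "proj (rng (\<Sum>G))" using proj_spr K_subset by blast
  show "rng (\<Sum>G) \<preceq> asup X" using asup_lub[OF X] G unfolding is_lub_def by blast
qed

text \<open>Stated for every \<open>x\<close> of the unit interval rather than for projections,
  because \<open>f_asup\<close> applies it to images and preimages under \<open>f\<close>.\<close>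

lemma asup_least:
  assumes X: "X \<subseteq> Collect atom" and x: "x \<in> K" "x \<preceq> e" and ub: "\<And>p. p \<in> X \<Longrightarrow> p \<preceq> x"
  shows "asup X \<preceq> x"
proof -
  have xS: "x \<in> S" using x(1) by (rule K_subset)
  have "rng (\<Sum>G) \<preceq> x" if G: "finite G" "G \<subseteq> X" for G
  proof (rule rng_le_upper[OF xS x(2) _ _ x(1)])
    show "\<Sum>G \<in> K" using G X atom_K by (intro K_sum) auto
    have "rng (e - x) \<cdot> \<Sum>G = (\<Sum>p\<in>G. rng (e - x) \<cdot> p)" by (rule jprod.sum_right)
    also have "\<dots> = 0"
    proof (rule sum.neutral, rule ballI)
      fix p assume "p \<in> G"
      hence p: "p \<in> X" "atom p" using G X by auto
      show "rng (e - x) \<cdot> p = 0" by (rule proj_le_rng_compl[OF xS x(2) atom_proj[OF p(2)] ub[OF p(1)]])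
    qed
    finally show "rng (e - x) \<cdot> \<Sum>G = 0" .
  qed
  thus ?thesis using asup_lub[OF X] xS unfolding is_lub_def by blast
qed

lemma asup_proj:
  assumes X: "X \<subseteq> Collect atom"
  shows "proj (asup X)"
proof (rule lub_proj[OF _ _ asup_lub[OF X]])
  show "(\<lambda>G. rng (\<Sum>G)) ` {G. finite G \<and> G \<subseteq> X} \<noteq> {}" by blast
  fix a assume "a \<in> (\<lambda>G. rng (\<Sum>G)) ` {G. finite G \<and> G \<subseteq> X}"
  hence a: "proj a" "a \<preceq> asup X" using asup_rng[OF X] by blast+
  thus "a \<in> K \<and> a \<preceq> e" using proj_K proj_le_unit by blast
  have aS: "a \<in> S" using proj_in[OF a(1)] .
  have ae: "asup X \<preceq> e" using X proj_le_unit[OF atom_proj] by (intro asup_least[OF X]) auto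
  have "e - asup X \<preceq> e - a" using a(2) by (simp add: le_iff)
  hence "U a (e - asup X) \<preceq> U a (e - a)" by (rule quad_rep_mono[OF aS])
  also have "U a (e - a) = 0" by (rule quad_rep_proj_zero[OF a(1) proj_compl_jprod(2)[OF a(1)]])
  finally have 1: "U a (e - asup X) \<preceq> 0" .
  have "0 \<preceq> U a (e - asup X)" using quad_rep_K[OF aS, of "e - asup X"] ae by (simp add: le_iff)
  thus "U a (e - asup X) = 0" using 1 le_antisym by blast
qed

lemma asup_upper:
  assumes X: "X \<subseteq> Collect atom" and p: "p \<in> X"
  shows "p \<preceq> asup X"
proof -
  have pa: "atom p" using X p by blast
  have r: "proj (rng p)" "rng p \<preceq> asup X" using asup_rng[OF X, of "{p}"] p by auto
  have "p \<preceq> rng p" using rng_jprod(1)[OF atom_K[OF pa]] proj_le_iff[OF atom_proj[OF pa] r(1)] by blast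
  thus ?thesis using r(2) by (rule le_trans)
qed

lemma asup_orth:
  assumes X: "X \<subseteq> Collect atom" and q: "proj q" and orth: "\<And>p. p \<in> X \<Longrightarrow> p \<cdot> q = 0"
  shows "asup X \<cdot> q = 0"
proof -
  have "asup X \<preceq> e - q"
  proof (rule asup_least[OF X proj_K proj_le_unit])
    show "p \<preceq> e - q" if "p \<in> X" for p
    proof -
      have "proj p" using X that atom_proj by blast
      thus ?thesis using proj_orth_le[OF _ q] orth[OF that] by blast
    qed
  qed (rule proj_compl[OF q])+
  thus ?thesis using proj_orth_le[OF asup_proj[OF X] q] by blast
qed

text \<open>A union of classes; the joins of such sets are central
  (\<open>asup_central\<close>).\<close>

definition saturated :: "'a set \<Rightarrow> bool" where
  "saturated X \<longleftrightarrow> X \<subseteq> Collect atom \<and> (\<forall>p\<in>X. \<forall>q. nonorth p q \<longrightarrow> q \<in> X)"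

lemma asup_atom:
  assumes X: "saturated X" and q: "atom q"
  shows "asup X \<cdot> q = (if q \<in> X then q else 0)"
proof (cases "q \<in> X")
  case True
  have "q \<preceq> asup X" using asup_upper X True by (auto simp: saturated_def)
  thus ?thesis using proj_le_iff[OF atom_proj[OF q] asup_proj] X True by (auto simp: saturated_def)
next
  case False
  have "asup X \<cdot> q = 0"
  proof (rule asup_orth)
    show "X \<subseteq> Collect atom" using X by (simp add: saturated_def)
    show "p \<cdot> q = 0" if "p \<in> X" for p using X that q False by (auto simp: saturated_def nonorth_def)
  qed (rule atom_proj[OF q])
  thus ?thesis using False by simp
qed

lemma asup_central: "saturated X \<Longrightarrow> central (asup X)"
  by (rule central_if_atoms) (auto simp: asup_atom asup_proj saturated_def)

lemma \<tau>_asup: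
  assumes X: "saturated X" and q: "atom q"
  shows "\<tau> q (asup X) = (if q \<in> X then 1 else 0)"
proof (rule \<tau>_eqI[OF q])
  show "asup X \<in> S" using central_in[OF asup_central[OF X]] .
  show "U q (asup X) = (if q \<in> X then 1 else 0) *\<^sub>R q" using asup_atom[OF X q] proj_idem[OF atom_proj[OF q]]
    by (auto simp: quad_rep_def jprod_commute[of q "asup X"] jprod.zero_right scaleR_2)
qed

lemma asup_disjoint:
  assumes X: "saturated X" and Y: "saturated Y" and XY: "X \<inter> Y = {}"
  shows "asup X \<cdot> asup Y = 0"
proof (rule asup_orth)
  show "X \<subseteq> Collect atom" using X by (simp add: saturated_def)
  show "proj (asup Y)" by (rule central_proj[OF asup_central[OF Y]])
  fix p assume "p \<in> X"
  hence "atom p" "p \<notin> Y" using X XY by (auto simp: saturated_def)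
  thus "p \<cdot> asup Y = 0" using asup_atom[OF Y, of p] by (simp add: jprod_commute)
qed

lemma central_atom_cases:
  assumes c: "central c" and q: "atom q"
  shows "c \<cdot> q = q \<or> c \<cdot> q = 0"
proof -
  have "proj (c \<cdot> q)" using central_mult[OF c, of q q] atom_in[OF q] central_in[OF c] proj_idem[OF atom_proj[OF q]]
    by (simp add: jb_projection_def)
  thus ?thesis using atom_minimal[OF q _ _ central_le[OF c atom_K[OF q]]] by blast
qed

lemma central_nonorth:
  assumes c: "central c" and pq: "nonorth p q" and p: "c \<cdot> p = p"
  shows "c \<cdot> q = q"
proof -
  have a: "atom p" "atom q" "p \<cdot> q \<noteq> 0" using pq by (auto simp: nonorth_def)
  have "c \<cdot> (p \<cdot> q) = p \<cdot> q" using central_assoc'[OF c atom_in[OF a(1)] atom_in[OF a(2)]] p by simp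
  hence "p \<cdot> (c \<cdot> q) = p \<cdot> q" using central_assoc[OF c atom_in[OF a(1)] atom_in[OF a(2)]] by simp
  thus ?thesis using central_atom_cases[OF c a(2)] a(3) by (auto simp: jprod.zero_right)
qed

lemma corner_nonorth:
  assumes c: "central c" and pq: "nonorth p q" and p: "c \<cdot> p = p"
  shows "jbw_atomic.nonorth (corner c) p q"
  unfolding jbw_atomic.nonorth_def[OF corner_jbw_atomic[OF c]] corner_atom[OF c]
  using pq p central_nonorth[OF c pq p] by (auto simp: nonorth_def)

lemma corner_conn:
  assumes c: "central c" and p: "c \<cdot> p = p" and pq: "conn p q"
  shows "jbw_atomic.conn (corner c) p q"
proof -
  have "nonorth\<^sup>*\<^sup>* p q" using pq by (simp add: conn_def)
  hence "jbw_atomic.conn (corner c) p q \<and> c \<cdot> q = q"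
  proof (induction rule: rtranclp_induct)
    case base
    show ?case using jbw_atomic.conn_refl[OF corner_jbw_atomic[OF c]] p by blast
  next
    case (step y z)
    have "jbw_atomic.conn (corner c) y z"
      using jbw_atomic.conn_nonorth[OF corner_jbw_atomic[OF c] corner_nonorth[OF c step(2)]] step(3) by blast
    thus ?case using jbw_atomic.conn_trans[OF corner_jbw_atomic[OF c]] central_nonorth[OF c step(2)] step(3) by blast
  qed
  thus ?thesis by blast
qed

text \<open>A central \<open>z\<close> acts on an atom as a scalar. Computing
  \<open>z \<cdot> (p \<cdot> q)\<close> through either factor shows that non-orthogonal atoms have
  the same scalar.\<close>

lemma centre_\<tau>:
  assumes z: "z \<in> jb_centre S"
  shows "atom q \<Longrightarrow> q \<cdot> z = \<tau> q z *\<^sub>R q" and "conn p q \<Longrightarrow> atom p \<Longrightarrow> \<tau> p z = \<tau> q z"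
proof -
  have zS: "z \<in> S" and com: "\<And>y w. y \<in> S \<Longrightarrow> w \<in> S \<Longrightarrow> z \<cdot> (y \<cdot> w) = y \<cdot> (z \<cdot> w)" using z by (auto simp: jb_centre_def)
  have 1: "q \<cdot> z = \<tau> q z *\<^sub>R q" if q: "atom q" for q
  proof -
    have "q \<cdot> (q \<cdot> z) = q \<cdot> z"
      using com[OF atom_in[OF q] atom_in[OF q]] proj_idem[OF atom_proj[OF q]] by (simp add: jprod_commute[of z q])
    hence "U q z = q \<cdot> z" by (simp add: quad_rep_def proj_idem[OF atom_proj[OF q]] scaleR_2)
    thus ?thesis using quad_rep_atom[OF q zS] by simp
  qed
  thus "atom q \<Longrightarrow> q \<cdot> z = \<tau> q z *\<^sub>R q" by blast
  have 2: "\<tau> p z = \<tau> q z" if pq: "nonorth p q" for p q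
  proof -
    have a: "atom p" "atom q" "p \<cdot> q \<noteq> 0" using pq by (auto simp: nonorth_def)
    have "\<tau> q z *\<^sub>R (p \<cdot> q) = z \<cdot> (p \<cdot> q)"
      using com[OF atom_in[OF a(1)] atom_in[OF a(2)]] 1[OF a(2)] by (simp add: jprod_commute[of z q] jprod.scaleR_right)
    also have "\<dots> = \<tau> p z *\<^sub>R (p \<cdot> q)" using com[OF atom_in[OF a(2)] atom_in[OF a(1)]] 1[OF a(1)]
      by (simp add: jprod_commute[of z p] jprod_commute[of q p] jprod.scaleR_right)
    finally show ?thesis using a(3) by simp
  qed
  show "\<tau> p z = \<tau> q z" if "conn p q" "atom p"
    using that(1) unfolding conn_def by (induction rule: rtranclp_induct) (auto dest: 2)
qed

lemma centre_trivial:
  assumes conn: "\<And>p q. atom p \<Longrightarrow> atom q \<Longrightarrow> conn p q"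
  shows "jb_centre S = range (\<lambda>r. r *\<^sub>R e)"
proof
  show "jb_centre S \<subseteq> range (\<lambda>r. r *\<^sub>R e)"
  proof
    fix z assume z: "z \<in> jb_centre S"
    have zS: "z \<in> S" using z by (simp add: jb_centre_def)
    define r where "r = \<tau> (SOME p. atom p) z"
    have "\<tau> q z = r" if q: "atom q" for q
    proof -
      have "atom (SOME p. atom p)" using q by (rule someI)
      thus ?thesis unfolding r_def using centre_\<tau>(2)[OF z conn[OF q] q] by blast
    qed
    hence "z = r *\<^sub>R e" using eq_iff_\<tau>[of z "r *\<^sub>R e"] zS by (simp add: \<tau>_scaleR \<tau>_unit)
    thus "z \<in> range (\<lambda>r. r *\<^sub>R e)" by blast
  qed
qed (auto simp: jb_centre_def jbilin)

lemma saturated_class: "atom p \<Longrightarrow> saturated {q. conn p q}"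
  using conn_atom conn_trans conn_nonorth unfolding saturated_def by blast

abbreviation cc :: "'a \<Rightarrow> 'a" where "cc p \<equiv> asup {q. conn p q}"

text \<open>In each factor the component of a central projection is a multiple of the unit, and the
  projections of different classes are orthogonal. So each factor meets at most one class, while
  each class meets some factor.\<close>

lemma finite_classes:
  assumes "finite_direct_sum_of_factors S"
  shows "\<exists>A. finite A \<and> (\<forall>a\<in>A. atom a) \<and> (\<forall>q. atom q \<longrightarrow> (\<exists>a\<in>A. conn a q))"
proof -
  obtain n :: nat and H \<pi> where "direct_sum_of_factors S {..<n} H \<pi>"
    using assms by (auto simp: finite_direct_sum_of_factors_def)
  hence sum: "is_direct_sum S {..<n} H \<pi>" and fac: "\<And>i. i < n \<Longrightarrow> jbw_factor (H i)"
    by (auto simp: direct_sum_of_factors_def)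
  have sub: "jb_subalgebra (H i)" "H i \<subseteq> S" if "i < n" for i using sum that by (auto simp: is_direct_sum_def)
  have proj_id: "\<pi> i x = x" if "i < n" "x \<in> H i" for i x using sum that by (auto simp: is_direct_sum_def)
  have mult: "\<pi> i (x \<cdot> y) = \<pi> i x \<cdot> \<pi> i y" if "i < n" "x \<in> S" "y \<in> S" for i x y
    using sum that by (auto simp: is_direct_sum_def)
  have "\<forall>x\<in>S. \<forall>B\<ge>0. norm x \<le> B \<longleftrightarrow> (\<forall>i\<in>{..<n}. norm (\<pi> i x) \<le> B)" using sum unfolding is_direct_sum_def by blast
  hence norm: "x = 0 \<longleftrightarrow> (\<forall>i<n. \<pi> i x = 0)" if "x \<in> S" for x
    using that[THEN bspec[rotated], of "\<lambda>x. \<forall>B\<ge>0. norm x \<le> B \<longleftrightarrow> (\<forall>i\<in>{..<n}. norm (\<pi> i x) \<le> B)"]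
    by (metis lessThan_iff norm_le_zero_iff order_refl)
  have pi_in: "\<pi> i x \<in> H i" if "i < n" "x \<in> S" for i x
  proof -
    have "(\<lambda>i\<in>{..<n}. \<pi> i x) \<in> Pi\<^sub>E {..<n} H" using sum that(2) unfolding is_direct_sum_def bij_betw_def by blast
    thus ?thesis using that(1) by (auto simp: PiE_iff)
  qed
  have scalar: "\<exists>r. \<pi> i c = r *\<^sub>R \<pi> i e" if i: "i < n" and c: "central c" for i c
  proof -
    have cS: "c \<in> S" using c by (rule central_in)
    have unit: "is_jb_unit (H i) (\<pi> i e)" unfolding is_jb_unit_def
    proof
      show "\<forall>x\<in>H i. \<pi> i e \<cdot> x = x"
      proof
        fix x assume x: "x \<in> H i"
        hence xS: "x \<in> S" using sub(2)[OF i] by blast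
        thus "\<pi> i e \<cdot> x = x" using mult[OF i unit_in xS] proj_id[OF i x] by simp
      qed
    qed (rule pi_in[OF i unit_in])
    have "jb_unital (H i) (\<pi> i e)" using sub(1)[OF i] unit by (rule jb_unital.intro)
    hence u: "jb_unit (H i) = \<pi> i e" by (rule jb_unital.jb_unit_eq)
    have "\<pi> i c \<cdot> (y \<cdot> w) = y \<cdot> (\<pi> i c \<cdot> w)" if yw: "y \<in> H i" "w \<in> H i" for y w
    proof -
      have S: "y \<in> S" "w \<in> S" using yw sub(2)[OF i] by auto
      have "\<pi> i (c \<cdot> (y \<cdot> w)) = \<pi> i (y \<cdot> (c \<cdot> w))" using central_assoc[OF c S] by simp
      thus ?thesis using S cS by (simp add: mult[OF i] proj_id[OF i] yw)
    qed
    hence "\<pi> i c \<in> jb_centre (H i)" using pi_in[OF i cS] by (simp add: jb_centre_def)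
    thus ?thesis using fac[OF i] u by (auto simp: jbw_factor_def)
  qed
  have c: "central (cc a)" "cc a \<in> S" if "atom a" for a
    using asup_central[OF saturated_class[OF that]] central_in by auto
  define P where "P i a \<longleftrightarrow> atom a \<and> \<pi> i (cc a) \<noteq> 0" for i a
  define A where "A = (\<lambda>i. SOME a. P i a) ` {i. i < n \<and> (\<exists>a. P i a)}"
  have P: "P i (SOME a. P i a)" if "\<exists>a. P i a" for i using that by (rule someI_ex)
  have "\<exists>a\<in>A. conn a q" if q: "atom q" for q
  proof -
    have "cc q \<cdot> q = q" unfolding asup_atom[OF saturated_class[OF q] q] by simp
    hence "cc q \<noteq> 0" using atom_nonzero[OF q] by (auto simp: jprod.zero_left)
    then obtain i where i: "i < n" "\<pi> i (cc q) \<noteq> 0" using norm[OF c(2)[OF q]] by auto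
    define a where "a = (SOME a. P i a)"
    have "\<exists>a. P i a" using i(2) q by (auto simp: P_def)
    hence a: "a \<in> A" "atom a" "\<pi> i (cc a) \<noteq> 0" using P[of i] i(1) by (auto simp: A_def a_def P_def)
    have "conn a q"
    proof (rule ccontr)
      assume not: "\<not> conn a q"
      have "{x. conn a x} \<inter> {x. conn q x} = {}" using not conn_trans conn_sym by blast
      hence "cc a \<cdot> cc q = 0" by (rule asup_disjoint[OF saturated_class[OF a(2)] saturated_class[OF q]])
      moreover obtain r s where rs: "\<pi> i (cc a) = r *\<^sub>R \<pi> i e" "\<pi> i (cc q) = s *\<^sub>R \<pi> i e"
        using scalar[OF i(1)] c(1) a(2) q by metis
      moreover have "\<pi> i 0 = 0" using norm[OF zero_in] i(1) by auto
      ultimately have "(r * s) *\<^sub>R (\<pi> i e \<cdot> \<pi> i e) = 0"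
        using mult[OF i(1) c(2)[OF a(2)] c(2)[OF q]] by (auto simp: jbilin)
      moreover have "\<pi> i e \<cdot> \<pi> i e = \<pi> i e" using mult[OF i(1) unit_in unit_in] by simp
      ultimately show False using a(3) i(2) rs by auto
    qed
    thus ?thesis using a(1) by blast
  qed
  moreover have "finite A" "\<forall>a\<in>A. atom a" using P by (auto simp: A_def P_def)
  ultimately show ?thesis by blast
qed

lemma fin_if_finite_classes:
  assumes "finite A" "\<And>a. a \<in> A \<Longrightarrow> atom a" "\<And>q. atom q \<Longrightarrow> \<exists>a\<in>A. conn a q"
  shows "jbw_atomic_fin S e" by unfold_locales (rule spos_of_atom_bounds[OF assms])

lemma corner_central:
  assumes c: "central c" and d: "central d" "c \<cdot> d = d"
  shows "jb_unital.central (corner c) d" "jb_unital.corner (corner c) d = corner d"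
proof -
  have dS: "d \<in> S" using central_in[OF d(1)] .
  show "jb_unital.central (corner c) d" unfolding jb_unital.central_def[OF corner_unital[OF c]] corner_proj
    using d central_proj[OF d(1)] central_assoc[OF d(1)] dS by (auto simp: jb_centre_def corner_def)
  have *: "c \<cdot> x = x" if "x \<in> S" "d \<cdot> x = x" for x using central_assoc'[OF c dS that(1)] that(2) d(2) by simp
  show "jb_unital.corner (corner c) d = corner d"
    unfolding jb_unital.corner_def[OF corner_unital[OF c]] unfolding corner_def by (intro Collect_cong iffI) (simp_all add: *)
qed

end

section \<open>The engaged part\<close>

context jbw_atomic
begin

definition engaged_atoms :: "'a set" where
  "engaged_atoms = {q. atom q \<and> (\<exists>r. conn q r \<and> r \<noteq> q)}"

lemma engaged_atoms_nonorth: "q \<in> engaged_atoms \<longleftrightarrow> atom q \<and> (\<exists>r. nonorth q r \<and> r \<noteq> q)"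
proof
  assume "q \<in> engaged_atoms"
  then obtain r where q: "atom q" and r: "nonorth\<^sup>*\<^sup>* q r" "r \<noteq> q" by (auto simp: engaged_atoms_def conn_def)
  have "r = q \<or> (\<exists>r. nonorth q r \<and> r \<noteq> q)" using r(1) by (induction rule: rtranclp_induct) auto
  thus "atom q \<and> (\<exists>r. nonorth q r \<and> r \<noteq> q)" using q r(2) by blast
qed (use conn_nonorth in \<open>auto simp: engaged_atoms_def\<close>)

lemma saturated_engaged: "saturated engaged_atoms" unfolding saturated_def
proof (intro conjI ballI allI impI)
  fix p q assume p: "p \<in> engaged_atoms" and pq: "nonorth p q"
  have "atom q" using pq by (simp add: nonorth_def)
  thus "q \<in> engaged_atoms" using p pq nonorth_sym[OF pq] engaged_atoms_nonorth by (cases "p = q") auto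
qed (auto simp: engaged_atoms_def)

text \<open>A central atom has coefficient \<open>1\<close> at every atom of its class by
  \<open>centre_\<tau>\<close>, whereas distinct atoms have coefficients below \<open>1\<close>.
  Conversely, an atom orthogonal to all others satisfies the criterion
  \<open>central_if_atoms\<close>.\<close>

lemma central_atoms_eq: "central_atoms S = Collect atom - engaged_atoms"
proof (intro set_eqI iffI)
  fix q assume "q \<in> central_atoms S"
  hence q: "q \<in> jb_centre S" "atom q" by (auto simp: central_atoms_def)
  have "r = q" if r: "conn q r" for r
  proof -
    have ra: "atom r" using conn_atom[OF r q(2)] .
    have "\<tau> r q = 1" using centre_\<tau>(2)[OF q(1) r q(2)] \<tau>_self[OF q(2)] by simp
    thus ?thesis using \<tau>_lt_1[OF ra q(2)] by fastforce
  qed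
  thus "q \<in> Collect atom - engaged_atoms" using q(2) by (auto simp: engaged_atoms_def)
next
  fix q assume "q \<in> Collect atom - engaged_atoms"
  hence q: "atom q" "\<And>r. nonorth q r \<Longrightarrow> r = q" by (auto simp: engaged_atoms_nonorth)
  have "central q"
  proof (rule central_if_atoms[OF atom_proj[OF q(1)]])
    fix p assume "atom p"
    thus "q \<cdot> p = p \<or> q \<cdot> p = 0" using q(2)[of p] q(1) proj_idem[OF atom_proj[OF q(1)]] by (auto simp: nonorth_def)
  qed
  thus "q \<in> central_atoms S" using q(1) by (simp add: central_atoms_def central_def)
qed

lemma saturated_central: "saturated (central_atoms S)"
proof -
  have "q = p" if "p \<in> central_atoms S" "nonorth p q" for p q
    using that by (auto simp: central_atoms_eq engaged_atoms_nonorth nonorth_def)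
  thus ?thesis by (auto simp: saturated_def central_atoms_eq nonorth_def)
qed

abbreviation eng :: 'a where "eng \<equiv> asup engaged_atoms"

lemma disengaged_projection_eq: "disengaged_projection S = asup (central_atoms S)" unfolding disengaged_projection_def
proof (rule the_equality)
  have X: "central_atoms S \<subseteq> Collect atom" by (auto simp: central_atoms_eq)
  show *: "proj (asup (central_atoms S)) \<and> (\<forall>q\<in>central_atoms S. q \<preceq> asup (central_atoms S)) \<and>
      (\<forall>r. proj r \<and> (\<forall>q\<in>central_atoms S. q \<preceq> r) \<longrightarrow> asup (central_atoms S) \<preceq> r)"
    using asup_proj[OF X] asup_upper[OF X] asup_least[OF X proj_K proj_le_unit] by blast
  fix p assume "proj p \<and> (\<forall>q\<in>central_atoms S. q \<preceq> p) \<and> (\<forall>r. proj r \<and> (\<forall>q\<in>central_atoms S. q \<preceq> r) \<longrightarrow> p \<preceq> r)"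
  thus "p = asup (central_atoms S)" using * by (intro le_antisym) auto
qed

lemma eng_central: "central eng" by (rule asup_central[OF saturated_engaged])

lemma compl_disengaged: "e - disengaged_projection S = eng"
proof -
  have S: "asup (central_atoms S) \<in> S" "eng \<in> S" using asup_central[OF saturated_central] eng_central central_in by auto
  have "\<tau> p (e - asup (central_atoms S)) = \<tau> p eng" if "atom p" for p
    using that S by (simp add: \<tau>_diff \<tau>_unit \<tau>_asup[OF saturated_central] \<tau>_asup[OF saturated_engaged]) (auto simp: central_atoms_eq)
  thus ?thesis unfolding disengaged_projection_eq using eq_iff_\<tau>[of "e - asup (central_atoms S)" eng] S by simp
qed

lemma engaged_component_eq: "x \<in> S \<Longrightarrow> engaged_component S x = eng \<cdot> x"
  unfolding engaged_component_def jb_unit_eq compl_disengaged by (rule quad_rep_central[OF eng_central])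

lemma engaged_part_eq: "engaged_part S = corner eng"
  unfolding engaged_part_def using engaged_component_eq central_image[OF eng_central] by auto

lemma no_central_atoms: "disengaged_part S = {0} \<Longrightarrow> central_atoms S = {}"
proof -
  assume d: "disengaged_part S = {0}"
  define p where "p = asup (central_atoms S)"
  have p: "proj p" using asup_central[OF saturated_central] central_proj by (simp add: p_def)
  have "U p p \<in> disengaged_part S"
    unfolding disengaged_part_def disengaged_projection_eq p_def[symmetric] using proj_in[OF p] by blast
  hence "p = 0" using d quad_rep_proj_proj[OF p] by simp
  hence "asup (central_atoms S) \<cdot> q = 0" for q by (simp add: p_def jprod.zero_left)
  hence "q = 0" if "q \<in> central_atoms S" for q
    using asup_atom[OF saturated_central, of q] that by (auto simp: central_atoms_eq)
  thus ?thesis using atom_nonzero by (auto simp: central_atoms_eq)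
qed

lemma eng_unit: "central_atoms S = {} \<Longrightarrow> eng = e" using eq_iff_\<tau>[of eng e] central_in[OF eng_central]
  by (auto simp: \<tau>_asup[OF saturated_engaged] \<tau>_unit central_atoms_eq)

lemma class_jbw_factor:
  assumes p: "atom p"
  shows "jbw_factor (corner (cc p))"
proof -
  have c: "central (cc p)" by (rule asup_central[OF saturated_class[OF p]])
  have ccp: "cc p \<cdot> p = p" unfolding asup_atom[OF saturated_class[OF p] p] by simp
  have "jb_centre (corner (cc p)) = range (\<lambda>r. r *\<^sub>R cc p)"
  proof (rule jbw_atomic.centre_trivial[OF corner_jbw_atomic[OF c]])
    fix q r assume "jb_atom (corner (cc p)) q" "jb_atom (corner (cc p)) r"
    hence q: "atom q" "cc p \<cdot> q = q" and r: "atom r" "cc p \<cdot> r = r" by (simp_all add: corner_atom[OF c])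
    have "conn p q" "conn p r"
      using asup_atom[OF saturated_class[OF p] q(1)] asup_atom[OF saturated_class[OF p] r(1)] q r atom_nonzero
      by (auto split: if_splits)
    hence "conn q r" using conn_trans conn_sym by blast
    thus "jbw_atomic.conn (corner (cc p)) q r" by (rule corner_conn[OF c q(2)])
  qed
  moreover have "corner (cc p) \<noteq> {0}" using ccp atom_in[OF p] atom_nonzero[OF p] unfolding corner_def by blast
  ultimately show ?thesis unfolding jbw_factor_def jbw_algebra_def jb_unital.jb_unit_eq[OF corner_unital[OF c]]
    using corner_dual[OF c] jb_unital.subalgebra[OF corner_unital[OF c]] by blast
qed

lemma class_fin:
  assumes p: "atom p"
  shows "jbw_atomic_fin (corner (cc p)) (cc p)"
proof -
  have c: "central (cc p)" by (rule asup_central[OF saturated_class[OF p]])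
  have ccp: "cc p \<cdot> p = p" unfolding asup_atom[OF saturated_class[OF p] p] by simp
  show ?thesis
  proof (rule jbw_atomic.fin_if_finite_classes[OF corner_jbw_atomic[OF c], of "{p}"])
    fix q assume "jb_atom (corner (cc p)) q"
    hence q: "atom q" "cc p \<cdot> q = q" by (simp_all add: corner_atom[OF c])
    hence "conn p q" using asup_atom[OF saturated_class[OF p] q(1)] atom_nonzero by (auto split: if_splits)
    thus "\<exists>a\<in>{p}. jbw_atomic.conn (corner (cc p)) a q" using corner_conn[OF c ccp] by blast
  qed (use p ccp corner_atom[OF c] in auto)
qed

lemma cc_eng: "p \<in> engaged_atoms \<Longrightarrow> eng \<cdot> cc p = cc p"
proof -
  assume p: "p \<in> engaged_atoms"
  have pa: "atom p" using p by (simp add: engaged_atoms_def)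
  have "q \<in> engaged_atoms" if "conn p q" for q
    using that p conn_atom[OF that pa] unfolding engaged_atoms_def by (cases "p = q") (auto dest: conn_sym)
  moreover have "q \<preceq> eng" if "q \<in> engaged_atoms" for q
    using asup_upper[OF _ that] saturated_engaged by (simp add: saturated_def)
  moreover have "{q. conn p q} \<subseteq> Collect atom" using saturated_class[OF pa] by (simp add: saturated_def)
  ultimately have "cc p \<preceq> eng"
    by (intro asup_least[OF _ proj_K[OF central_proj[OF eng_central]] proj_le_unit[OF central_proj[OF eng_central]]]) auto
  thus ?thesis using proj_le_iff central_proj eng_central asup_central[OF saturated_class[OF pa]] by blast
qed

lemma is_direct_sum_cong: "is_direct_sum B A H \<pi> \<Longrightarrow> (\<And>i. i \<in> A \<Longrightarrow> H i = H' i) \<Longrightarrow> is_direct_sum B A H' \<pi>"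
  unfolding is_direct_sum_def by (simp cong: PiE_cong)

text \<open>The indexing \<open>c\<close> of the classes is left open so that both algebras can use
  one index set: the identity for the first, \<open>f\<close> for the second.\<close>

lemma engaged_direct_sum:
  assumes inj: "inj_on c A" and c: "c ` A = cc ` engaged_atoms"
  shows "direct_sum_of_factors (engaged_part S) A (\<lambda>i. corner (c i)) (\<lambda>i x. c i \<cdot> x)"
proof -
  have cls: "\<exists>p\<in>engaged_atoms. c i = cc p \<and> atom p" if "i \<in> A" for i using c that unfolding engaged_atoms_def by blast
  have cen: "central (c i)" if "i \<in> A" for i using cls[OF that] asup_central[OF saturated_class] by metis
  have below: "eng \<cdot> c i = c i" if "i \<in> A" for i using cls[OF that] cc_eng by metis
  have "is_direct_sum (corner eng) A (\<lambda>i. jb_unital.corner (corner eng) (c i)) (\<lambda>i x. c i \<cdot> x)"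
  proof (rule jbw_atomic.direct_sum_corners[OF corner_jbw_atomic[OF eng_central]])
    show "jb_unital.central (corner eng) (c i)" if "i \<in> A" for i
      by (rule corner_central(1)[OF eng_central cen[OF that] below[OF that]])
    show "c i \<cdot> c j = 0" if ij: "i \<in> A" "j \<in> A" "i \<noteq> j" for i j
    proof -
      obtain p q where p: "atom p" "c i = cc p" and q: "atom q" "c j = cc q" using cls ij(1,2) by metis
      have "\<not> conn p q"
      proof
        assume pq: "conn p q"
        have "{x. conn p x} = {x. conn q x}" using pq conn_trans conn_sym by blast
        thus False using inj ij p(2) q(2) by (auto simp: inj_on_def)
      qed
      hence "{x. conn p x} \<inter> {x. conn q x} = {}" using conn_trans conn_sym by blast
      thus ?thesis unfolding p(2) q(2) by (rule asup_disjoint[OF saturated_class[OF p(1)] saturated_class[OF q(1)]])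
    qed
    fix q assume "jb_atom (corner eng) q"
    hence q: "atom q" "eng \<cdot> q = q" by (simp_all add: corner_atom[OF eng_central])
    hence "q \<in> engaged_atoms" using asup_atom[OF saturated_engaged q(1)] atom_nonzero by (auto split: if_splits)
    then obtain i where i: "i \<in> A" "c i = cc q" using c by (metis imageE imageI)
    have "c i \<cdot> q = q" unfolding i(2) asup_atom[OF saturated_class[OF q(1)] q(1)] by simp
    thus "\<exists>i\<in>A. c i \<cdot> q = q" using i(1) by blast
  qed
  hence "is_direct_sum (corner eng) A (\<lambda>i. corner (c i)) (\<lambda>i x. c i \<cdot> x)"
    by (rule is_direct_sum_cong) (rule corner_central(2)[OF eng_central cen below])
  moreover have "jbw_factor (corner (c i))" if "i \<in> A" for i using cls[OF that] class_jbw_factor by metis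
  ultimately show ?thesis unfolding direct_sum_of_factors_def engaged_part_eq by blast
qed

lemma corner_partner:
  assumes c: "central c" and q: "jb_atom (corner c) q" "q \<in> engaged_atoms"
  shows "\<exists>r. jbw_atomic.nonorth (corner c) q r \<and> r \<noteq> q"
  using q corner_atom[OF c, of q] corner_nonorth[OF c] engaged_atoms_nonorth[of q] by blast

end

section \<open>The isomorphism on classes, central projections and corners\<close>

context interval_iso
begin

text \<open>If the images were not connected, their sum would be a projection with no third atom
  below it. But the preimage of this sum is above \<open>p\<close> and \<open>q\<close>, hence by
  \<open>rng_le_upper\<close> above their join, which contains a third atom.\<close>

lemma nonorth_image:
  assumes pq: "F.nonorth p q"
  shows "G.conn (f p) (f q)"
proof (cases "p = q")
  case False
  have a: "F.atom p" "F.atom q" using pq by (auto simp: F.nonorth_def)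
  have fa: "G.atom (f p)" "G.atom (f q)" using a atom_image by auto
  have I: "p \<in> I" "q \<in> I" using a proj_I F.atom_proj by auto
  show ?thesis
  proof (rule ccontr)
    assume not: "\<not> G.conn (f p) (f q)"
    hence orth: "f p \<cdot> f q = 0" using fa G.conn_nonorth by (auto simp: G.nonorth_def)
    have s: "f p + f q \<in> I'" by (rule proj_I'[OF G.proj_add[OF G.atom_proj[OF fa(1)] G.atom_proj[OF fa(2)] orth]])
    obtain x where x: "x \<in> I" "f x = f p + f q" using f_surj[OF s] by blast
    have le: "p \<preceq> x" "q \<preceq> x"
      using f_le_iff[OF I(1) x(1)] f_le_iff[OF I(2) x(1)] x(2) G.atom_K[OF fa(1)] G.atom_K[OF fa(2)] by (simp_all add: G.le_iff)
    obtain r where r: "F.atom r" "r \<noteq> p" "r \<noteq> q" "r \<preceq> F.rng (p + q)" using F.third_atom[OF pq False] by blast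
    have "F.rng (p + q) \<preceq> x"
    proof (rule F.rng_le_upper[OF I_D(3)[OF x(1)] I_D(2)[OF x(1)] _ _ I_D(1)[OF x(1)]])
      show "p + q \<in> F.K" using a F.atom_K by blast
      show "F.rng (e - x) \<cdot> (p + q) = 0"
        using F.proj_le_rng_compl[OF I_D(3)[OF x(1)] I_D(2)[OF x(1)] F.atom_proj[OF a(1)] le(1)]
          F.proj_le_rng_compl[OF I_D(3)[OF x(1)] I_D(2)[OF x(1)] F.atom_proj[OF a(2)] le(2)]
        by (simp add: jprod.add_right)
    qed
    hence "r \<preceq> x" using r(4) F.le_trans by blast
    hence "f r \<sqsubseteq> f p + f q" using f_le_iff[OF proj_I[OF F.atom_proj[OF r(1)]] x(1)] x(2) by simp
    hence "f r = f p \<or> f r = f q" by (rule G.atom_le_orth_sum[OF fa not atom_image[OF r(1)]])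
    thus False using f_inj I proj_I[OF F.atom_proj[OF r(1)]] r(2,3) by blast
  qed
qed simp

lemma conn_image: "F.conn p q \<Longrightarrow> G.conn (f p) (f q)"
  unfolding F.conn_def by (induction rule: rtranclp_induct) (auto intro: G.conn_trans nonorth_image)

lemma conn_image_iff: "F.atom p \<Longrightarrow> F.atom q \<Longrightarrow> G.conn (f p) (f q) \<longleftrightarrow> F.conn p q"
  using conn_image[of p q] interval_iso.conn_image[OF inverse, of "f p" "f q"] proj_I F.atom_proj by (auto simp: inv_f)

lemma class_image:
  assumes p: "F.atom p"
  shows "f ` {q. F.conn p q} = {q. G.conn (f p) q}"
proof
  show "f ` {q. F.conn p q} \<subseteq> {q. G.conn (f p) q}" using conn_image by blast
  show "{q. G.conn (f p) q} \<subseteq> f ` {q. F.conn p q}"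
  proof
    fix q assume "q \<in> {q. G.conn (f p) q}"
    hence q: "G.conn (f p) q" by simp
    obtain r where r: "F.atom r" "q = f r" using atom_preimage[OF G.conn_atom[OF q atom_image[OF p]]] by blast
    hence "F.conn p r" using conn_image_iff[OF p r(1)] q by simp
    thus "q \<in> f ` {q. F.conn p q}" using r(2) by blast
  qed
qed

lemma engaged_atom_iff: "F.atom q \<Longrightarrow> f q \<in> G.engaged_atoms \<longleftrightarrow> q \<in> F.engaged_atoms"
proof -
  assume q: "F.atom q"
  have "G.conn (f q) r \<longleftrightarrow> r \<in> f ` {s. F.conn q s}" for r by (simp add: class_image[OF q])
  hence "(\<exists>r. G.conn (f q) r \<and> r \<noteq> f q) \<longleftrightarrow> (\<exists>r. F.conn q r \<and> f r \<noteq> f q)" by auto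
  moreover have "f r \<noteq> f q \<longleftrightarrow> r \<noteq> q" if "F.conn q r" for r
    using f_inj[OF proj_I[OF F.atom_proj[OF F.conn_atom[OF that q]]] proj_I[OF F.atom_proj[OF q]]] by simp
  ultimately have "(\<exists>r. G.conn (f q) r \<and> r \<noteq> f q) \<longleftrightarrow> (\<exists>r. F.conn q r \<and> r \<noteq> q)" by blast
  thus ?thesis using q atom_image[OF q] by (simp add: F.engaged_atoms_def G.engaged_atoms_def)
qed

lemma engaged_atoms_image: "f ` F.engaged_atoms = G.engaged_atoms"
proof (intro set_eqI iffI)
  fix q assume q: "q \<in> G.engaged_atoms"
  then obtain p where "F.atom p" "q = f p" using atom_preimage by (auto simp: G.engaged_atoms_def)
  thus "q \<in> f ` F.engaged_atoms" using q engaged_atom_iff by blast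
next
  fix q assume "q \<in> f ` F.engaged_atoms"
  then obtain p where "p \<in> F.engaged_atoms" "q = f p" by blast
  thus "q \<in> G.engaged_atoms" using engaged_atom_iff[of p] by (auto simp: F.engaged_atoms_def)
qed

lemma bij_central_atoms: "bij_betw f (central_atoms S) (central_atoms T)"
proof -
  have "bij_betw f (Collect F.atom - F.engaged_atoms) (f ` (Collect F.atom - F.engaged_atoms))"
    using bij_atoms by (auto simp: bij_betw_def intro: inj_on_subset)
  moreover have "f ` (Collect F.atom - F.engaged_atoms) = Collect G.atom - G.engaged_atoms"
    using inj_on_image_set_diff[of f "Collect F.atom" "Collect F.atom" F.engaged_atoms] bij_atoms engaged_atoms_image
    by (auto simp: bij_betw_def F.engaged_atoms_def)
  ultimately show ?thesis unfolding F.central_atoms_eq G.central_atoms_eq by simp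
qed

lemma f_asup:
  assumes X: "X \<subseteq> Collect F.atom"
  shows "f (F.asup X) = G.asup (f ` X)"
proof -
  have Y: "f ` X \<subseteq> Collect G.atom" using X atom_image by blast
  have aI: "F.asup X \<in> I" and bI: "G.asup (f ` X) \<in> I'"
    using proj_I[OF F.asup_proj[OF X]] proj_I'[OF G.asup_proj[OF Y]] .
  have XI: "p \<in> I" if "p \<in> X" for p using X that proj_I F.atom_proj by blast
  have 1: "G.asup (f ` X) \<sqsubseteq> f (F.asup X)"
  proof (rule G.asup_least[OF Y I'_D(1,2)[OF f_in[OF aI]]])
    fix q assume "q \<in> f ` X"
    then obtain p where p: "p \<in> X" "q = f p" by blast
    thus "q \<sqsubseteq> f (F.asup X)" using f_le_iff[OF XI[OF p(1)] aI] F.asup_upper[OF X p(1)] by simp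
  qed
  obtain y where y: "y \<in> I" "f y = G.asup (f ` X)" using f_surj[OF bI] by blast
  have "F.asup X \<preceq> y"
  proof (rule F.asup_least[OF X I_D(1,2)[OF y(1)]])
    fix p assume p: "p \<in> X"
    thus "p \<preceq> y" using f_le_iff[OF XI[OF p] y(1)] y(2) G.asup_upper[OF Y, of "f p"] by simp
  qed
  hence "f (F.asup X) \<sqsubseteq> G.asup (f ` X)" using f_le_iff[OF aI y(1)] y(2) by simp
  thus ?thesis using 1 G.le_antisym by blast
qed

lemma f_cc:
  assumes p: "F.atom p"
  shows "f (F.cc p) = G.cc (f p)"
proof -
  have "{q. F.conn p q} \<subseteq> Collect F.atom" using F.saturated_class[OF p] unfolding F.saturated_def by (rule conjunct1)
  from f_asup[OF this] show ?thesis unfolding class_image[OF p] .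
qed

lemma f_eng: "f F.eng = G.eng"
proof -
  have "F.engaged_atoms \<subseteq> Collect F.atom" by (auto simp: F.engaged_atoms_def)
  from f_asup[OF this] show ?thesis unfolding engaged_atoms_image .
qed

lemma central_I: "F.central c \<Longrightarrow> x \<in> I \<Longrightarrow> c \<cdot> x \<in> I \<and> c \<cdot> x \<preceq> x \<and> c \<cdot> x \<preceq> c"
proof -
  assume c: "F.central c" and x: "x \<in> I"
  have "c \<cdot> x \<preceq> c \<cdot> e" by (rule F.central_mono[OF c I_D(3)[OF x] F.unit_in I_D(2)[OF x]])
  thus ?thesis using F.central_le[OF c I_D(1)[OF x]] I_down[OF x F.central_K[OF c I_D(1)[OF x]]] F.central_in[OF c]
    by (simp add: jprod_commute[of c e])
qed

lemma central_I_greatest: "F.central c \<Longrightarrow> x \<in> I \<Longrightarrow> y \<in> I \<Longrightarrow> y \<preceq> x \<Longrightarrow> y \<preceq> c \<Longrightarrow> y \<preceq> c \<cdot> x"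
  using F.central_mono[of c y x] F.le_central_corner[of c y] F.cornerD(2)[of y c] I_D[of x] I_D[of y] by simp

text \<open>In the unit interval \<open>c \<cdot> x\<close> is the infimum of \<open>c\<close> and
  \<open>x\<close> (\<open>central_I\<close>, \<open>central_I_greatest\<close>), a notion of
  order.\<close>

lemma f_jprod_central:
  assumes c: "F.central c" "G.central (f c)" and x: "x \<in> I"
  shows "f (c \<cdot> x) = f c \<cdot> f x"
proof -
  interpret inv: interval_iso T u S e "inv_into I f" by (rule inverse)
  have I'_inv: "inv.I = I'" by (simp add: inv.I_def I'_def)
  have cI: "c \<in> I" using proj_I[OF F.central_proj[OF c(1)]] .
  note a = central_I[OF c(1) x] and b = inv.central_I[OF c(2), unfolded I'_inv, OF f_in[OF x]]
  obtain y where y: "y \<in> I" "f y = f c \<cdot> f x" using f_surj b by blast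
  have "f (c \<cdot> x) \<sqsubseteq> f c \<cdot> f x"
    using a f_le_iff x cI f_in by (intro inv.central_I_greatest[OF c(2), unfolded I'_inv]) auto
  moreover have "y \<preceq> c \<cdot> x"
    using y b f_le_iff[OF y(1) x] f_le_iff[OF y(1) cI] by (intro central_I_greatest[OF c(1) x]) auto
  hence "f c \<cdot> f x \<sqsubseteq> f (c \<cdot> x)" using f_le_iff[OF y(1)] a y(2) by simp
  ultimately show ?thesis using G.le_antisym by blast
qed

lemma central_atom_coord:
  assumes p: "p \<in> central_atoms S" and x: "x \<in> I"
  shows "G.\<tau> (f p) (f x) = fp p (F.\<tau> p x)"
proof -
  have pa: "F.atom p" "F.central p" using p F.atom_proj by (auto simp: central_atoms_def F.central_def)
  have "f p \<in> central_atoms T" using p bij_central_atoms by (auto simp: bij_betw_def)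
  hence qa: "G.atom (f p)" "G.central (f p)" using G.atom_proj by (auto simp: central_atoms_def G.central_def)
  have t: "0 \<le> F.\<tau> p x" "F.\<tau> p x \<le> 1"
    using F.\<tau>_nonneg[OF pa(1) I_D(1)[OF x]] F.\<tau>_mono[OF pa(1) I_D(3)[OF x] F.unit_in I_D(2)[OF x]] F.\<tau>_unit[OF pa(1)] by auto
  have "G.\<tau> (f p) (f x) *\<^sub>R f p = f p \<cdot> f x"
    using G.quad_rep_atom[OF qa(1)] G.quad_rep_central[OF qa(2)] I'_D(3)[OF f_in[OF x]] by simp
  also have "\<dots> = f (p \<cdot> x)" using f_jprod_central[OF pa(2) qa(2) x] by simp
  also have "p \<cdot> x = F.\<tau> p x *\<^sub>R p" using F.quad_rep_atom[OF pa(1)] F.quad_rep_central[OF pa(2)] I_D(3)[OF x] by simp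
  also have "f \<dots> = fp p (F.\<tau> p x) *\<^sub>R f p" by (rule f_atom_scale[OF pa(1) t])
  finally show ?thesis using G.atom_nonzero[OF qa(1)] by simp
qed

lemma corner_interval:
  assumes c: "F.central c"
  shows "jb_interval (F.corner c) 0 c = {x \<in> I. x \<preceq> c}"
proof -
  have "x \<in> jb_interval (F.corner c) 0 c \<longleftrightarrow> x \<in> F.corner c \<and> x \<in> F.K \<and> x \<preceq> c" for x
  proof -
    have cc: "c \<in> F.corner c" "0 \<in> F.corner c"
      using F.central_in[OF c] F.proj_idem[OF F.central_proj[OF c]] by (auto simp: F.corner_def jprod.zero_right)
    show ?thesis unfolding jb_interval_def using F.corner_le[OF c cc(2), of x] F.corner_le[OF c _ cc(1), of x] by auto
  qed
  moreover have "x \<preceq> c \<Longrightarrow> x \<preceq> e" for x using F.le_trans F.proj_le_unit[OF F.central_proj[OF c]] by blast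
  ultimately show ?thesis using F.le_central_corner[OF c] unfolding I_def by blast
qed

lemma corner_iso:
  assumes c: "F.central c" and d: "G.central (f c)"
  shows "interval_iso (F.corner c) c (G.corner (f c)) (f c) f"
proof -
  interpret inv: interval_iso T u S e "inv_into I f" by (rule inverse)
  have I'_inv: "inv.I = I'" by (simp add: inv.I_def I'_def)
  have cI: "c \<in> I" using proj_I[OF F.central_proj[OF c]] .
  let ?A = "{x \<in> I. x \<preceq> c}" and ?B = "{x \<in> I'. x \<sqsubseteq> f c}"
  have bij: "bij_betw f ?A ?B"
  proof (rule bij_betw_imageI)
    show "inj_on f ?A" using bij_f by (auto simp: bij_betw_def inj_on_def)
    show "f ` ?A = ?B"
    proof
      show "f ` ?A \<subseteq> ?B" using f_in f_le_iff cI by auto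
      show "?B \<subseteq> f ` ?A"
      proof
        fix y assume "y \<in> ?B"
        then obtain x where "x \<in> I" "f x = y" "y \<sqsubseteq> f c" using f_surj by blast
        thus "y \<in> f ` ?A" using f_le_iff cI by blast
      qed
    qed
  qed
  have "jb_le (F.corner c) x y \<longleftrightarrow> jb_le (G.corner (f c)) (f x) (f y)" if "x \<in> ?A" "y \<in> ?A" for x y
  proof -
    have S: "x \<in> F.corner c" "y \<in> F.corner c" using that F.le_central_corner[OF c] I_D(1) by auto
    have T: "f x \<in> G.corner (f c)" "f y \<in> G.corner (f c)"
      using that f_le_iff cI I'_D(1)[OF f_in] by (auto intro!: G.le_central_corner[OF d])
    show ?thesis using F.corner_le[OF c S] G.corner_le[OF d T] f_le_iff that by auto
  qed
  hence "order_isomorphism (jb_interval (F.corner c) 0 c) (jb_le (F.corner c))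
      (jb_interval (G.corner (f c)) 0 (f c)) (jb_le (G.corner (f c))) f"
    unfolding order_isomorphism_def corner_interval[OF c] inv.corner_interval[OF d] I'_inv using bij by blast
  thus ?thesis
    by (intro interval_iso.intro interval_iso_axioms.intro F.corner_jbw_atomic[OF c] G.corner_jbw_atomic[OF d])
qed

text \<open>Here \<open>x\<close> ranges over the whole interval and \<open>c \<cdot> x\<close> is
  its component in the corner, as in the final formula.\<close>

definition corner_map where
  "corner_map c t z J \<longleftrightarrow> t < 1 \<and> z \<in> jb_cone_interior (G.corner (f c)) \<and>
    jordan_isomorphism (F.corner c) (G.corner (f c)) J \<and>
    (\<forall>x\<in>I. f c \<cdot> f x = interval_map (f c) t z (J (c \<cdot> x)))"

text \<open>Stated for any central \<open>c\<close> below the engaged projection, so that it serves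
  a single class in (i) and the whole engaged part in (ii).\<close>

lemma corner_interval_map:
  assumes c: "F.central c" and d: "G.central (f c)"
    and fin: "jbw_atomic_fin (F.corner c) c" "jbw_atomic_fin (G.corner (f c)) (f c)"
    and sub: "F.eng \<cdot> c = c"
  shows "\<exists>t z J. corner_map c t z J"
proof -
  have "interval_iso_engaged (F.corner c) c (G.corner (f c)) (f c) f"
  proof (intro interval_iso_engaged.intro interval_iso_fin.intro corner_iso[OF c d] fin interval_iso_engaged_axioms.intro)
    fix p assume p: "jb_atom (F.corner c) p"
    hence pa: "F.atom p" "c \<cdot> p = p" by (simp_all add: F.corner_atom[OF c])
    have "F.eng \<cdot> p = p"
      using F.central_assoc'[OF F.eng_central F.central_in[OF c] F.atom_in[OF pa(1)]] sub pa(2) by simp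
    hence "p \<in> F.engaged_atoms"
      using F.asup_atom[OF F.saturated_engaged pa(1)] F.atom_nonzero[OF pa(1)] by (auto split: if_splits)
    thus "\<exists>q. jbw_atomic.nonorth (F.corner c) p q \<and> q \<noteq> p" by (rule F.corner_partner[OF c p])
  qed from interval_iso_engaged.f_interval_map[OF this] obtain t z J where *: "t < 1"
    "z \<in> jb_cone_interior (G.corner (f c))" "jordan_isomorphism (F.corner c) (G.corner (f c)) J"
    "\<forall>x\<in>jb_interval (F.corner c) 0 c. f x = interval_map (f c) t z (J x)" by blast
  have "f c \<cdot> f x = interval_map (f c) t z (J (c \<cdot> x))" if x: "x \<in> I" for x
  proof -
    have "c \<cdot> x \<in> jb_interval (F.corner c) 0 c" using central_I[OF c x] by (simp add: corner_interval[OF c])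
    thus ?thesis using *(4) f_jprod_central[OF c d x] by simp
  qed
  thus ?thesis unfolding corner_map_def using *(1-3) by blast
qed

lemma class_interval_map:
  assumes i: "i \<in> F.cc ` F.engaged_atoms"
  shows "\<exists>t z J. corner_map i t z J"
proof -
  obtain p where p: "p \<in> F.engaged_atoms" "i = F.cc p" "F.atom p" using i by (auto simp: F.engaged_atoms_def)
  have q: "G.atom (f p)" "f i = G.cc (f p)" using atom_image[OF p(3)] f_cc[OF p(3)] p(2) by auto
  show ?thesis
  proof (rule corner_interval_map)
    show "F.central i" "G.central (f i)"
      unfolding q(2) unfolding p(2) by (rule F.asup_central[OF F.saturated_class[OF p(3)]] G.asup_central[OF G.saturated_class[OF q(1)]])+
    show "jbw_atomic_fin (F.corner i) i" unfolding p(2) by (rule F.class_fin[OF p(3)])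
    show "jbw_atomic_fin (G.corner (f i)) (f i)" unfolding q(2) by (rule G.class_fin[OF q(1)])
    show "F.eng \<cdot> i = i" unfolding p(2) by (rule F.cc_eng[OF p(1)])
  qed
qed

text \<open>Finiteness of the number of classes passes to the second algebra, since \<open>f\<close>
  preserves connectedness and every atom there is an image.\<close>

lemma engaged_interval_map:
  assumes fds: "finite_direct_sum_of_factors (F.corner F.eng)"
  shows "\<exists>t z J. corner_map F.eng t z J"
proof -
  have d: "G.central (f F.eng)" unfolding f_eng by (rule G.eng_central)
  interpret E: interval_iso "F.corner F.eng" F.eng "G.corner (f F.eng)" "f F.eng" f
    by (rule corner_iso[OF F.eng_central d])
  obtain A where A: "finite A" "\<And>a. a \<in> A \<Longrightarrow> E.F.atom a" "\<And>q. E.F.atom q \<Longrightarrow> \<exists>a\<in>A. E.F.conn a q"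
    using E.F.finite_classes[OF fds] by blast
  have 1: "jbw_atomic_fin (F.corner F.eng) F.eng" by (rule E.F.fin_if_finite_classes[OF A])
  have 2: "jbw_atomic_fin (G.corner (f F.eng)) (f F.eng)"
  proof (rule E.G.fin_if_finite_classes)
    show "finite (f ` A)" using A(1) by simp
    show "E.G.atom b" if "b \<in> f ` A" for b using that A(2) E.atom_image by blast
    fix q assume "E.G.atom q"
    then obtain p where p: "E.F.atom p" "q = f p" using E.atom_preimage by blast
    then obtain a where "a \<in> A" "E.F.conn a p" using A(3) by blast
    thus "\<exists>b\<in>f ` A. E.G.conn b q" using E.conn_image p(2) by blast
  qed
  have "F.eng \<cdot> F.eng = F.eng" using F.proj_idem[OF F.central_proj[OF F.eng_central]] .
  from corner_interval_map[OF F.eng_central d 1 2 this] show ?thesis .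
qed

end

theorem theorem4p8:
  fixes M :: "'a::jb_algebra set" and N :: "'b::jb_algebra set"
    and eM :: 'a and eN :: 'b and f :: "'a \<Rightarrow> 'b"
  assumes "jbw_algebra M" and "jb_atomic M" and "is_jb_unit M eM"
    and "jbw_algebra N" and "jb_atomic N" and "is_jb_unit N eN"
    and "order_isomorphism (jb_interval M 0 eM) (jb_le M) (jb_interval N 0 eN) (jb_le N) f"
  shows
    "(\<exists>(I :: 'a set) Mf \<pi> Nf \<rho> (t :: 'a \<Rightarrow> real) z J \<sigma> (fp :: 'a \<Rightarrow> real \<Rightarrow> real).
        direct_sum_of_factors (engaged_part M) I Mf \<pi> \<and>
        direct_sum_of_factors (engaged_part N) I Nf \<rho> \<and>
        (\<forall>i\<in>I. t i < 1 \<and> z i \<in> jb_cone_interior (Nf i) \<and>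
           jordan_isomorphism (Mf i) (Nf i) (J i)) \<and>
        bij_betw \<sigma> (central_atoms M) (central_atoms N) \<and>
        (\<forall>p\<in>central_atoms M. order_isomorphism {0..1} (\<le>) {0..1} (\<le>) (fp p)) \<and>
        (\<forall>x\<in>jb_interval M 0 eM.
           (\<forall>p\<in>central_atoms M. atom_coord (\<sigma> p) (f x) = fp p (atom_coord p x)) \<and>
           (\<forall>i\<in>I. \<rho> i (engaged_component N (f x)) =
              interval_map (jb_unit (Nf i)) (t i) (z i) (J i (\<pi> i (engaged_component M x))))))
     \<and>
     (finite_direct_sum_of_factors (engaged_part M) \<longrightarrow>
      (\<exists>(t :: real) z J \<sigma> (fp :: 'a \<Rightarrow> real \<Rightarrow> real).
        t < 1 \<and> z \<in> jb_cone_interior (engaged_part N) \<and>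
        jordan_isomorphism (engaged_part M) (engaged_part N) J \<and>
        bij_betw \<sigma> (central_atoms M) (central_atoms N) \<and>
        (\<forall>p\<in>central_atoms M. order_isomorphism {0..1} (\<le>) {0..1} (\<le>) (fp p)) \<and>
        (\<forall>x\<in>jb_interval M 0 eM.
           (\<forall>p\<in>central_atoms M. atom_coord (\<sigma> p) (f x) = fp p (atom_coord p x)) \<and>
           engaged_component N (f x) =
             interval_map (jb_unit (engaged_part N)) t z (J (engaged_component M x)))))
     \<and>
     (finite_direct_sum_of_factors (engaged_part M) \<and> disengaged_part M = {0} \<longrightarrow>
      (\<exists>(t :: real) z J.
        t < 1 \<and> z \<in> jb_cone_interior N \<and> jordan_isomorphism M N J \<and>
        (\<forall>x\<in>jb_interval M 0 eM. f x = interval_map eN t z (J x))))"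
proof -
  interpret P: interval_iso M eM N eN f using assms by unfold_locales (auto simp: jbw_algebra_def)
  have unit: "jb_unit (P.G.corner c) = c" if "P.G.central c" for c
    by (rule jb_unital.jb_unit_eq[OF P.G.corner_unital[OF that]])
  have comp: "engaged_component M x = P.F.eng \<cdot> x" "engaged_component N (f x) = P.G.eng \<cdot> f x" if "x \<in> P.I" for x
    using P.F.engaged_component_eq P.G.engaged_component_eq P.I_D(3) P.I'_D(3)[OF P.f_in] that by auto
  have fp: "\<forall>p\<in>central_atoms M. order_isomorphism {0..1} (\<le>) {0..1} (\<le>) (P.fp p)"
    using P.fp_order_isomorphism by (simp add: central_atoms_def)
  \<comment> \<open>The units of the classes of \<open>M\<close> index both direct sums, since
    \<open>f\<close> carries them to the units of the classes of \<open>N\<close>.\<close>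
  let ?I = "P.F.cc ` P.F.engaged_atoms"
  have atoms: "P.F.atom p \<and> P.G.atom (f p) \<and> P.F.central (P.F.cc p) \<and> P.G.central (f (P.F.cc p)) \<and>
      P.F.eng \<cdot> P.F.cc p = P.F.cc p \<and> P.G.eng \<cdot> f (P.F.cc p) = f (P.F.cc p)" if p: "p \<in> P.F.engaged_atoms" for p
  proof -
    have pa: "P.F.atom p" using p by (simp add: P.F.engaged_atoms_def)
    have qa: "P.G.atom (f p)" "f p \<in> P.G.engaged_atoms" using P.atom_image[OF pa] P.engaged_atoms_image p by auto
    show ?thesis unfolding P.f_cc[OF pa]
      using pa qa P.F.asup_central[OF P.F.saturated_class[OF pa]] P.G.asup_central[OF P.G.saturated_class[OF qa(1)]]
        P.F.cc_eng[OF p] P.G.cc_eng[OF qa(2)] by blast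
  qed
  have sumM: "direct_sum_of_factors (engaged_part M) ?I P.F.corner (\<lambda>i x. i \<cdot> x)"
    using P.F.engaged_direct_sum[of "\<lambda>i. i" ?I] by simp
  have inj: "inj_on f ?I"
  proof (rule inj_on_subset)
    show "inj_on f P.I" using P.bij_f by (simp add: bij_betw_def)
    show "?I \<subseteq> P.I" using atoms P.proj_I P.F.central_proj by blast
  qed
  have "f ` ?I = P.G.cc ` (f ` P.F.engaged_atoms)" unfolding image_image using P.f_cc atoms by (intro image_cong) auto
  hence img: "f ` ?I = P.G.cc ` P.G.engaged_atoms" unfolding P.engaged_atoms_image .
  have sumN: "direct_sum_of_factors (engaged_part N) ?I (\<lambda>i. P.G.corner (f i)) (\<lambda>i x. f i \<cdot> x)"
    by (rule P.G.engaged_direct_sum[OF inj img])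
  have "\<forall>i\<in>?I. \<exists>t z J. P.corner_map i t z J" using P.class_interval_map by blast
  then obtain t z J where J: "\<forall>i\<in>?I. P.corner_map i (t i) (z i) (J i)" by metis
  have map: "f i \<cdot> engaged_component N (f x) =
      interval_map (jb_unit (P.G.corner (f i))) (t i) (z i) (J i (i \<cdot> engaged_component M x))"
    if i: "i \<in> ?I" and x: "x \<in> P.I" for i x
  proof -
    obtain p where p: "p \<in> P.F.engaged_atoms" "i = P.F.cc p" using i by blast
    have c: "P.F.central i" "P.F.eng \<cdot> i = i" "P.G.central (f i)" "P.G.eng \<cdot> f i = f i"
      using atoms[OF p(1)] p(2) by auto
    \<comment> \<open>Class projections lie below the engaged projection, so passing to the engaged
      component first changes nothing.\<close>
    have "f i \<cdot> (P.G.eng \<cdot> f x) = f i \<cdot> f x"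
      using P.G.central_assoc'[OF c(3) P.G.central_in[OF P.G.eng_central] P.I'_D(3)[OF P.f_in[OF x]]] c(4)
      by (simp add: jprod_commute[of "f i" P.G.eng])
    moreover have "i \<cdot> (P.F.eng \<cdot> x) = i \<cdot> x"
      using P.F.central_assoc'[OF c(1) P.F.central_in[OF P.F.eng_central] P.I_D(3)[OF x]] c(2)
      by (simp add: jprod_commute[of i P.F.eng])
    ultimately show ?thesis using bspec[OF J i] x by (simp add: P.corner_map_def comp[OF x] unit[OF c(3)])
  qed
  note coord = P.central_atom_coord[unfolded P.I_eq]
  have ii: "\<exists>t z J. t < 1 \<and> z \<in> jb_cone_interior (engaged_part N) \<and>
      jordan_isomorphism (engaged_part M) (engaged_part N) J \<and>
      (\<forall>x\<in>jb_interval M 0 eM. engaged_component N (f x) =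
         interval_map (jb_unit (engaged_part N)) t z (J (engaged_component M x)))"
    if "finite_direct_sum_of_factors (engaged_part M)"
    using P.engaged_interval_map[OF that[unfolded P.F.engaged_part_eq]]
    unfolding P.corner_map_def P.f_eng P.F.engaged_part_eq P.G.engaged_part_eq unit[OF P.G.eng_central] P.I_eq[symmetric]
    by (simp add: comp)
  have iii: "\<exists>t z J. t < 1 \<and> z \<in> jb_cone_interior N \<and> jordan_isomorphism M N J \<and>
      (\<forall>x\<in>jb_interval M 0 eM. f x = interval_map eN t z (J x))"
    if fds: "finite_direct_sum_of_factors (engaged_part M)" and d: "disengaged_part M = {0}"
  proof -
    have M: "central_atoms M = {}" by (rule P.F.no_central_atoms[OF d])
    hence N: "central_atoms N = {}" using P.bij_central_atoms by (simp add: bij_betw_def)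
    have parts: "engaged_part M = M" "engaged_part N = N"
      by (simp_all add: P.F.engaged_part_eq P.G.engaged_part_eq P.F.eng_unit[OF M] P.G.eng_unit[OF N] P.F.corner_unit P.G.corner_unit)
    have "engaged_component M x = x" "engaged_component N (f x) = f x" if "x \<in> jb_interval M 0 eM" for x
      using comp[unfolded P.I_eq, OF that] P.I_D(3)[unfolded P.I_eq, OF that] P.I'_D(3)[OF P.f_in[unfolded P.I_eq, OF that]]
      by (simp_all add: P.F.eng_unit[OF M] P.G.eng_unit[OF N])
    thus ?thesis using ii[OF fds] unfolding parts P.G.jb_unit_eq by simp
  qed
  show ?thesis
  proof (intro conjI impI, goal_cases)
    case 1
    show ?case by (rule exI[of _ ?I], rule exI[of _ P.F.corner], rule exI[of _ "\<lambda>i x. i \<cdot> x"],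
          rule exI[of _ "\<lambda>i. P.G.corner (f i)"], rule exI[of _ "\<lambda>i x. f i \<cdot> x"],
          rule exI[of _ t], rule exI[of _ z], rule exI[of _ J], rule exI[of _ f], rule exI[of _ P.fp],
          intro conjI sumM sumN P.bij_central_atoms fp ballI coord map[unfolded P.I_eq])
        (use J in \<open>auto simp: P.corner_map_def\<close>)
  next
    case 2
    from ii[OF this] show ?case using P.bij_central_atoms fp coord by blast
  qed (use iii in blast)
qed

end
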